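(* Let $H$ be a finite-dimensional Hopf algebra over a field $\Bbbk$. Then: (6) If $J\in H\otimes H$ is a (left or right) twist for $H$, then $\exp_0(H^J)=\exp_0(H)$. (7) $\exp_0(D(H))=\exp_0(H)$, where $D(H)$ denotes the Drinfeld double of $H$.
   Context: Let $(H,m,u,\Delta,\varepsilon)$ be a Hopf algebra over a field $\Bbbk$. For $n\ge 1$ let $m_n:H^{\otimes n}\to H$, $h_1\otimes\cdots\otimes h_n\mapsto h_1\cdots h_n$, and $\Delta_n:H\to H^{\otimes n}$, $h\mapsto\sum h_{(1)}\otimes\cdots\otimes h_{(n)}$. The $n$th Sweedler power is $[n]:=m_n\circ\Delta_n$. Define $\exp_0(H):=\min\{n\ge 1\mid m_n\circ\Delta_n=u\circ\varepsilon\}$, with the convention $\min\varnothing=\infty$; thus equalities of exponents include the case where both sides are $\infty$. A left twist for $H$ is an invertible element $J\in H\otimes H$ satisfying $(J\otimes 1)\cdot(\Delta\otimes\mathrm{id})(J)=(1\otimes J)\cdot(\mathrm{id}\otimes\Delta)(J)$. The twisted Hopf algebra $H^J$ is $(H,m,u,\Delta^J,\varepsilon)$ with the same algebra structure and counit as $H$ and with $\Delta^J(h)=J\Delta(h)J^{-1}$. A right twist for $H$ is an invertible $J\in H\otimes H$ such that $J^{-1}$ is a left twist; in this case $H^J$ has comultiplication $\Delta^J(h)=J^{-1}\Delta(h)J$. *)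

theory Defs
  imports "HOL-Library.Extended_Nat" "HOL-Algebra.AbelCoset" "Jordan_Normal_Form.Missing_VectorSpace"
begin

section \<open>Tensor products\<close>

text \<open>
  Tensor products are free modules modulo the (multi)linearity relations, so a tensor is a coset of
  finitely supported functions on the generators.  The record \<^typ>\<open>('a, 'b) module\<close> extends
  \<^typ>\<open>'b ring\<close>; its fields \<open>mult\<close> and \<open>one\<close> play no role for mere vector spaces and are left
  undefined there.
\<close>

definition free_module :: "('a, 'k) ring_scheme \<Rightarrow> 'x set \<Rightarrow> ('a, 'x \<Rightarrow> 'a) module" where
  "free_module K X =
    \<lparr>carrier = {r. range r \<subseteq> carrier K \<and> finite {x. r x \<noteq> \<zero>\<^bsub>K\<^esub>} \<and> {x. r x \<noteq> \<zero>\<^bsub>K\<^esub>} \<subseteq> X},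
     mult = undefined, one = undefined,
     zero = (\<lambda>x. \<zero>\<^bsub>K\<^esub>), add = (\<lambda>r s x. r x \<oplus>\<^bsub>K\<^esub> s x), smult = (\<lambda>a r x. a \<otimes>\<^bsub>K\<^esub> r x)\<rparr>"

definition free_gen :: "('a, 'k) ring_scheme \<Rightarrow> 'x \<Rightarrow> 'x \<Rightarrow> 'a" where
  "free_gen K x = (\<lambda>y. if y = x then \<one>\<^bsub>K\<^esub> else \<zero>\<^bsub>K\<^esub>)"

definition quot_module :: "('a, 'b, 'm) module_scheme \<Rightarrow> 'b set \<Rightarrow> ('a, 'b set) module" where
  "quot_module M N =
    \<lparr>carrier = a_rcosets\<^bsub>M\<^esub> N, mult = undefined, one = undefined,
     zero = N, add = set_add M, smult = (\<lambda>a X. \<Union>x\<in>X. N +>\<^bsub>M\<^esub> (a \<odot>\<^bsub>M\<^esub> x))\<rparr>"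

text \<open>
  \<open>lift K W \<phi>\<close> is the linear map into \<open>W\<close> that sends the class of a generator \<open>x\<close> to \<open>\<phi> x\<close>.  If the
  linear extension of \<open>\<phi>\<close> to the free module kills the relations, the image of a coset is a singleton.
\<close>

definition lift :: "('a, 'k) ring_scheme \<Rightarrow> ('a, 'w, 'm) module_scheme \<Rightarrow> ('x \<Rightarrow> 'w) \<Rightarrow> ('x \<Rightarrow> 'a) set \<Rightarrow> 'w" where
  "lift K W \<phi> X = the_elem ((\<lambda>r. \<Oplus>\<^bsub>W\<^esub>x\<in>{x. r x \<noteq> \<zero>\<^bsub>K\<^esub>}. r x \<odot>\<^bsub>W\<^esub> \<phi> x) ` X)"

subsection \<open>The tensor product of two spaces\<close>

definition bilinear_relations ::
  "('a, 'k) ring_scheme \<Rightarrow> ('a, 'v, 'm) module_scheme \<Rightarrow> ('a, 'w, 'n) module_scheme \<Rightarrow> ('v \<times> 'w \<Rightarrow> 'a) set" where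
  "bilinear_relations K V W =
    (let F = free_module K (carrier V \<times> carrier W); e = free_gen K in
      {e (v \<oplus>\<^bsub>V\<^esub> v', w) \<ominus>\<^bsub>F\<^esub> (e (v, w) \<oplus>\<^bsub>F\<^esub> e (v', w)) | v v' w.
         v \<in> carrier V \<and> v' \<in> carrier V \<and> w \<in> carrier W} \<union>
      {e (v, w \<oplus>\<^bsub>W\<^esub> w') \<ominus>\<^bsub>F\<^esub> (e (v, w) \<oplus>\<^bsub>F\<^esub> e (v, w')) | v w w'.
         v \<in> carrier V \<and> w \<in> carrier W \<and> w' \<in> carrier W} \<union>
      {e (a \<odot>\<^bsub>V\<^esub> v, w) \<ominus>\<^bsub>F\<^esub> a \<odot>\<^bsub>F\<^esub> e (v, w) | a v w.
         a \<in> carrier K \<and> v \<in> carrier V \<and> w \<in> carrier W} \<union>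
      {e (v, a \<odot>\<^bsub>W\<^esub> w) \<ominus>\<^bsub>F\<^esub> a \<odot>\<^bsub>F\<^esub> e (v, w) | a v w.
         a \<in> carrier K \<and> v \<in> carrier V \<and> w \<in> carrier W})"

definition bilinear_submodule ::
  "('a, 'k) ring_scheme \<Rightarrow> ('a, 'v, 'm) module_scheme \<Rightarrow> ('a, 'w, 'n) module_scheme \<Rightarrow> ('v \<times> 'w \<Rightarrow> 'a) set" where
  "bilinear_submodule K V W =
    module.span K (free_module K (carrier V \<times> carrier W)) (bilinear_relations K V W)"

definition tensor_product ::
  "('a, 'k) ring_scheme \<Rightarrow> ('a, 'v, 'm) module_scheme \<Rightarrow> ('a, 'w, 'n) module_scheme \<Rightarrow>
   ('a, ('v \<times> 'w \<Rightarrow> 'a) set) module" where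
  "tensor_product K V W =
    quot_module (free_module K (carrier V \<times> carrier W)) (bilinear_submodule K V W)"

definition pair_tensor ::
  "('a, 'k) ring_scheme \<Rightarrow> ('a, 'v, 'm) module_scheme \<Rightarrow> ('a, 'w, 'n) module_scheme \<Rightarrow> 'v \<Rightarrow> 'w \<Rightarrow>
   ('v \<times> 'w \<Rightarrow> 'a) set" where
  "pair_tensor K V W v w =
    bilinear_submodule K V W +>\<^bsub>free_module K (carrier V \<times> carrier W)\<^esub> free_gen K (v, w)"

subsection \<open>Tensor powers\<close>

text \<open>The generators of the \<open>n\<close>-th tensor power of \<open>V\<close> are the lists of length \<open>n\<close> over \<open>V\<close>.\<close>

definition vectors :: "nat \<Rightarrow> ('v, 'm) partial_object_scheme \<Rightarrow> 'v list set" where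
  "vectors n V = {xs. length xs = n \<and> set xs \<subseteq> carrier V}"

definition multilinear_relations ::
  "('a, 'k) ring_scheme \<Rightarrow> nat \<Rightarrow> ('a, 'v, 'm) module_scheme \<Rightarrow> ('v list \<Rightarrow> 'a) set" where
  "multilinear_relations K n V =
    (let F = free_module K (vectors n V); e = free_gen K in
      {e (xs[i := v \<oplus>\<^bsub>V\<^esub> w]) \<ominus>\<^bsub>F\<^esub> (e (xs[i := v]) \<oplus>\<^bsub>F\<^esub> e (xs[i := w])) | xs i v w.
         xs \<in> vectors n V \<and> i < n \<and> v \<in> carrier V \<and> w \<in> carrier V} \<union>
      {e (xs[i := a \<odot>\<^bsub>V\<^esub> v]) \<ominus>\<^bsub>F\<^esub> a \<odot>\<^bsub>F\<^esub> e (xs[i := v]) | xs i a v.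
         xs \<in> vectors n V \<and> i < n \<and> a \<in> carrier K \<and> v \<in> carrier V})"

definition multilinear_submodule ::
  "('a, 'k) ring_scheme \<Rightarrow> nat \<Rightarrow> ('a, 'v, 'm) module_scheme \<Rightarrow> ('v list \<Rightarrow> 'a) set" where
  "multilinear_submodule K n V =
    module.span K (free_module K (vectors n V)) (multilinear_relations K n V)"

definition tensor_space ::
  "('a, 'k) ring_scheme \<Rightarrow> nat \<Rightarrow> ('a, 'v, 'm) module_scheme \<Rightarrow> ('a, ('v list \<Rightarrow> 'a) set) module" where
  "tensor_space K n V = quot_module (free_module K (vectors n V)) (multilinear_submodule K n V)"

definition tensor :: "('a, 'k) ring_scheme \<Rightarrow> ('a, 'v, 'm) module_scheme \<Rightarrow> 'v list \<Rightarrow> ('v list \<Rightarrow> 'a) set" where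
  "tensor K V xs =
    multilinear_submodule K (length xs) V +>\<^bsub>free_module K (vectors (length xs) V)\<^esub> free_gen K xs"

text \<open>The tensor power of an algebra, with the factorwise product.\<close>

definition tensor_power ::
  "('a, 'k) ring_scheme \<Rightarrow> nat \<Rightarrow> ('a, 'v, 'm) module_scheme \<Rightarrow> ('a, ('v list \<Rightarrow> 'a) set) module" where
  "tensor_power K n V =
    (tensor_space K n V)
      \<lparr>mult := (\<lambda>X Y. lift K (tensor_space K n V)
                 (\<lambda>xs. lift K (tensor_space K n V) (\<lambda>ys. tensor K V (map2 (\<otimes>\<^bsub>V\<^esub>) xs ys)) Y) X),
       one := tensor K V (replicate n \<one>\<^bsub>V\<^esub>)\<rparr>"

text \<open>The canonical product of the \<open>m\<close>-th and the \<open>n\<close>-th tensor power, by juxtaposition.\<close>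

definition tensor_append ::
  "('a, 'k) ring_scheme \<Rightarrow> ('a, 'v, 'm) module_scheme \<Rightarrow> nat \<Rightarrow> nat \<Rightarrow>
   ('v list \<Rightarrow> 'a) set \<Rightarrow> ('v list \<Rightarrow> 'a) set \<Rightarrow> ('v list \<Rightarrow> 'a) set" where
  "tensor_append K V m n X Y =
    lift K (tensor_space K (m + n) V)
      (\<lambda>xs. lift K (tensor_space K (m + n) V) (\<lambda>ys. tensor K V (xs @ ys)) Y) X"

text \<open>
  For a linear map \<open>f\<close> from \<open>V\<close> to its \<open>m\<close>-th tensor power, \<open>tensor_left K V m f\<close> is
  \<open>f \<otimes> id\<close> and \<open>tensor_right K V m f\<close> is \<open>id \<otimes> f\<close>, both defined on the tensor square.
\<close>

definition tensor_left ::
  "('a, 'k) ring_scheme \<Rightarrow> ('a, 'v, 'm) module_scheme \<Rightarrow> nat \<Rightarrow> ('v \<Rightarrow> ('v list \<Rightarrow> 'a) set) \<Rightarrow>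
   ('v list \<Rightarrow> 'a) set \<Rightarrow> ('v list \<Rightarrow> 'a) set" where
  "tensor_left K V m f =
    lift K (tensor_space K (m + 1) V)
      (\<lambda>xs. tensor_append K V m 1 (f (xs ! 0)) (tensor K V [xs ! 1]))"

definition tensor_right ::
  "('a, 'k) ring_scheme \<Rightarrow> ('a, 'v, 'm) module_scheme \<Rightarrow> nat \<Rightarrow> ('v \<Rightarrow> ('v list \<Rightarrow> 'a) set) \<Rightarrow>
   ('v list \<Rightarrow> 'a) set \<Rightarrow> ('v list \<Rightarrow> 'a) set" where
  "tensor_right K V m f =
    lift K (tensor_space K (1 + m) V)
      (\<lambda>xs. tensor_append K V 1 m (tensor K V [xs ! 0]) (f (xs ! 1)))"

section \<open>Hopf algebras\<close>

record ('a, 'h) hopf = "('a, 'h) module" +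
  comult :: "'h \<Rightarrow> ('h list \<Rightarrow> 'a) set"
  counit :: "'h \<Rightarrow> 'a"

definition scalars :: "('a, 'k) ring_scheme \<Rightarrow> ('a, 'a) module" where
  "scalars K =
    \<lparr>carrier = carrier K, mult = mult K, one = \<one>\<^bsub>K\<^esub>, zero = \<zero>\<^bsub>K\<^esub>, add = add K, smult = mult K\<rparr>"

definition is_antipode :: "('a, 'k) ring_scheme \<Rightarrow> ('a, 'h, 'm) hopf_scheme \<Rightarrow> ('h \<Rightarrow> 'h) \<Rightarrow> bool" where
  "is_antipode K H S \<longleftrightarrow>
    S \<in> module_hom K H H \<and>
    (\<forall>h\<in>carrier H.
      lift K H (\<lambda>xs. S (xs ! 0) \<otimes>\<^bsub>H\<^esub> xs ! 1) (comult H h) = counit H h \<odot>\<^bsub>H\<^esub> \<one>\<^bsub>H\<^esub> \<and>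
      lift K H (\<lambda>xs. xs ! 0 \<otimes>\<^bsub>H\<^esub> S (xs ! 1)) (comult H h) = counit H h \<odot>\<^bsub>H\<^esub> \<one>\<^bsub>H\<^esub>)"

definition antipode :: "('a, 'k) ring_scheme \<Rightarrow> ('a, 'h, 'm) hopf_scheme \<Rightarrow> 'h \<Rightarrow> 'h" where
  "antipode K H = (THE S. is_antipode K H S \<and> S \<in> extensional (carrier H))"

locale hopf_algebra =
  fixes K :: "('a, 'k) ring_scheme" and H :: "('a, 'h, 'm) hopf_scheme"
  assumes vectorspace: "vectorspace K H"
    and ring: "ring H"
    and smult_mult_left:
      "\<lbrakk>a \<in> carrier K; x \<in> carrier H; y \<in> carrier H\<rbrakk> \<Longrightarrow>
        (a \<odot>\<^bsub>H\<^esub> x) \<otimes>\<^bsub>H\<^esub> y = a \<odot>\<^bsub>H\<^esub> (x \<otimes>\<^bsub>H\<^esub> y)"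
    and smult_mult_right:
      "\<lbrakk>a \<in> carrier K; x \<in> carrier H; y \<in> carrier H\<rbrakk> \<Longrightarrow>
        x \<otimes>\<^bsub>H\<^esub> (a \<odot>\<^bsub>H\<^esub> y) = a \<odot>\<^bsub>H\<^esub> (x \<otimes>\<^bsub>H\<^esub> y)"
    and comult_linear: "comult H \<in> module_hom K H (tensor_space K 2 H)"
    and counit_linear: "counit H \<in> module_hom K H (scalars K)"
    and coassoc:
      "h \<in> carrier H \<Longrightarrow>
        tensor_left K H 2 (comult H) (comult H h) = tensor_right K H 2 (comult H) (comult H h)"
    and counit_left:
      "h \<in> carrier H \<Longrightarrow> lift K H (\<lambda>xs. counit H (xs ! 0) \<odot>\<^bsub>H\<^esub> xs ! 1) (comult H h) = h"
    and counit_right: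
      "h \<in> carrier H \<Longrightarrow> lift K H (\<lambda>xs. counit H (xs ! 1) \<odot>\<^bsub>H\<^esub> xs ! 0) (comult H h) = h"
    and comult_ring_hom: "comult H \<in> ring_hom H (tensor_power K 2 H)"
    and counit_ring_hom: "counit H \<in> ring_hom H K"
    and antipode_exists: "\<exists>S. is_antipode K H S"

section \<open>Sweedler powers and the exponent\<close>

definition mult_n :: "('a, 'k) ring_scheme \<Rightarrow> ('a, 'h, 'm) hopf_scheme \<Rightarrow> ('h list \<Rightarrow> 'a) set \<Rightarrow> 'h" where
  "mult_n K H = lift K H (\<lambda>xs. foldr (\<otimes>\<^bsub>H\<^esub>) xs \<one>\<^bsub>H\<^esub>)"

text \<open>Only \<open>n \<ge> 1\<close> matters below; \<open>comult_n K H 0\<close> is the counit.\<close>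

fun comult_n :: "('a, 'k) ring_scheme \<Rightarrow> ('a, 'h, 'm) hopf_scheme \<Rightarrow> nat \<Rightarrow> 'h \<Rightarrow> ('h list \<Rightarrow> 'a) set" where
  "comult_n K H 0 h = counit H h \<odot>\<^bsub>tensor_space K 0 H\<^esub> tensor K H []"
| "comult_n K H (Suc 0) h = tensor K H [h]"
| "comult_n K H (Suc (Suc n)) h = tensor_left K H (Suc n) (comult_n K H (Suc n)) (comult H h)"

definition sweedler_power :: "('a, 'k) ring_scheme \<Rightarrow> ('a, 'h, 'm) hopf_scheme \<Rightarrow> nat \<Rightarrow> 'h \<Rightarrow> 'h" where
  "sweedler_power K H n h = mult_n K H (comult_n K H n h)"

text \<open>The infimum of the empty set in \<^typ>\<open>enat\<close> is \<open>\<infinity>\<close>.\<close>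

definition exp0 :: "('a, 'k) ring_scheme \<Rightarrow> ('a, 'h, 'm) hopf_scheme \<Rightarrow> enat" where
  "exp0 K H =
    Inf (enat ` {n. n \<ge> 1 \<and> (\<forall>h\<in>carrier H. sweedler_power K H n h = counit H h \<odot>\<^bsub>H\<^esub> \<one>\<^bsub>H\<^esub>)})"

section \<open>Twists\<close>

definition left_twist :: "('a, 'k) ring_scheme \<Rightarrow> ('a, 'h, 'm) hopf_scheme \<Rightarrow> ('h list \<Rightarrow> 'a) set \<Rightarrow> bool" where
  "left_twist K H J \<longleftrightarrow>
    J \<in> Units (tensor_power K 2 H) \<and>
    tensor_append K H 2 1 J (tensor K H [\<one>\<^bsub>H\<^esub>]) \<otimes>\<^bsub>tensor_power K 3 H\<^esub> tensor_left K H 2 (comult H) J =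
    tensor_append K H 1 2 (tensor K H [\<one>\<^bsub>H\<^esub>]) J \<otimes>\<^bsub>tensor_power K 3 H\<^esub> tensor_right K H 2 (comult H) J"

definition right_twist :: "('a, 'k) ring_scheme \<Rightarrow> ('a, 'h, 'm) hopf_scheme \<Rightarrow> ('h list \<Rightarrow> 'a) set \<Rightarrow> bool" where
  "right_twist K H J \<longleftrightarrow>
    J \<in> Units (tensor_power K 2 H) \<and> left_twist K H (inv\<^bsub>tensor_power K 2 H\<^esub> J)"

definition left_twisted ::
  "('a, 'k) ring_scheme \<Rightarrow> ('a, 'h, 'm) hopf_scheme \<Rightarrow> ('h list \<Rightarrow> 'a) set \<Rightarrow> ('a, 'h, 'm) hopf_scheme" where
  "left_twisted K H J =
    H\<lparr>comult := (\<lambda>h. J \<otimes>\<^bsub>tensor_power K 2 H\<^esub> comult H h \<otimes>\<^bsub>tensor_power K 2 H\<^esub> inv\<^bsub>tensor_power K 2 H\<^esub> J)\<rparr>"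

definition right_twisted ::
  "('a, 'k) ring_scheme \<Rightarrow> ('a, 'h, 'm) hopf_scheme \<Rightarrow> ('h list \<Rightarrow> 'a) set \<Rightarrow> ('a, 'h, 'm) hopf_scheme" where
  "right_twisted K H J =
    H\<lparr>comult := (\<lambda>h. inv\<^bsub>tensor_power K 2 H\<^esub> J \<otimes>\<^bsub>tensor_power K 2 H\<^esub> comult H h \<otimes>\<^bsub>tensor_power K 2 H\<^esub> J)\<rparr>"

section \<open>The Drinfeld double\<close>

text \<open>
  The dual Hopf algebra of a finite-dimensional \<open>H\<close>: the product is convolution, and the coproduct
  is the transpose of multiplication under the identification of the tensor square of the dual with
  the dual of the tensor square.  Functionals are extensional, so that they are determined by their
  values on \<open>H\<close>.
\<close>

definition dual_algebra :: "('a, 'k) ring_scheme \<Rightarrow> ('a, 'h, 'm) hopf_scheme \<Rightarrow> ('a, 'h \<Rightarrow> 'a) module" where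
  "dual_algebra K H =
    \<lparr>carrier = module_hom K H (scalars K) \<inter> extensional (carrier H),
     mult = (\<lambda>f g. \<lambda>h\<in>carrier H. lift K (scalars K) (\<lambda>xs. f (xs ! 0) \<otimes>\<^bsub>K\<^esub> g (xs ! 1)) (comult H h)),
     one = (\<lambda>h\<in>carrier H. counit H h),
     zero = (\<lambda>h\<in>carrier H. \<zero>\<^bsub>K\<^esub>),
     add = (\<lambda>f g. \<lambda>h\<in>carrier H. f h \<oplus>\<^bsub>K\<^esub> g h),
     smult = (\<lambda>a f. \<lambda>h\<in>carrier H. a \<otimes>\<^bsub>K\<^esub> f h)\<rparr>"

definition dual_hopf :: "('a, 'k) ring_scheme \<Rightarrow> ('a, 'h, 'm) hopf_scheme \<Rightarrow> ('a, 'h \<Rightarrow> 'a) hopf" where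
  "dual_hopf K H =
    module.extend (dual_algebra K H) (hopf.fields
      (\<lambda>f. THE t. t \<in> carrier (tensor_space K 2 (dual_algebra K H)) \<and>
         (\<forall>x\<in>carrier H. \<forall>y\<in>carrier H.
           lift K (scalars K) (\<lambda>fs. (fs ! 0) x \<otimes>\<^bsub>K\<^esub> (fs ! 1) y) t = f (x \<otimes>\<^bsub>H\<^esub> y)))
      (\<lambda>f. f \<one>\<^bsub>H\<^esub>))"

text \<open>
  The Drinfeld double is \<open>H\<^sup>* \<otimes> H\<close> with the tensor product coalgebra structure of the
  co-opposite dual and of \<open>H\<close>, and with product
  \<open>(f \<otimes> h) (g \<otimes> k) = f (h\<^sub>1 \<rightharpoonup> g \<leftharpoonup> S\<^sup>-\<^sup>1 h\<^sub>3) \<otimes> h\<^sub>2 k\<close>,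
  where \<open>(a \<rightharpoonup> g \<leftharpoonup> b) x = g (b x a)\<close>.  The antipode \<open>S\<close> of a finite-dimensional Hopf algebra
  is bijective.
\<close>

definition drinfeld_double ::
  "('a, 'k) ring_scheme \<Rightarrow> ('a, 'h, 'm) hopf_scheme \<Rightarrow> ('a, (('h \<Rightarrow> 'a) \<times> 'h \<Rightarrow> 'a) set) hopf" where
  "drinfeld_double K H =
    (let A = dual_hopf K H;
         D = tensor_product K A H;
         p = pair_tensor K A H;
         Si = inv_into (carrier H) (antipode K H)
     in
      \<lparr>carrier = carrier D,
       mult = (\<lambda>X Y. lift K D (\<lambda>(f, h). lift K D (\<lambda>(g, k).
         lift K D (\<lambda>hs. p (f \<otimes>\<^bsub>A\<^esub> (\<lambda>x\<in>carrier H. g (Si (hs ! 2) \<otimes>\<^bsub>H\<^esub> x \<otimes>\<^bsub>H\<^esub> hs ! 0))) (hs ! 1 \<otimes>\<^bsub>H\<^esub> k))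
           (comult_n K H 3 h)) Y) X),
       one = p \<one>\<^bsub>A\<^esub> \<one>\<^bsub>H\<^esub>,
       zero = \<zero>\<^bsub>D\<^esub>,
       add = add D,
       smult = smult D,
       comult = lift K (tensor_space K 2 D) (\<lambda>(f, h).
         lift K (tensor_space K 2 D) (\<lambda>fs.
           lift K (tensor_space K 2 D) (\<lambda>hs. tensor K D [p (fs ! 1) (hs ! 0), p (fs ! 0) (hs ! 1)])
             (comult H h)) (comult A f)),
       counit = lift K (scalars K) (\<lambda>(f, h). counit A f \<otimes>\<^bsub>K\<^esub> counit H h)\<rparr>)"

end

theory Submission
  imports Defs
begin

text \<open>
  All computations are done in Sweedler notation, as identities between values of linear functionals.

  Twists. Let \<open>\<beta> B (x, y) = B (x\<^sub>1, x\<^sub>2 y)\<close> on bilinear forms \<open>B\<close> on \<open>H\<close>. Since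
  \<open>\<beta>\<^sup>n B (x, y) = B (x\<^sub>1, x\<^sub>2\<^bsup>[n]\<^esup> y)\<close>, the equation \<open>[n] = u \<epsilon>\<close> says that \<open>\<beta>\<^sup>n = id\<close>, and it is already
  implied by the invariance of all \<open>\<epsilon> \<otimes> \<phi>\<close>. An explicit invertible operator built from \<open>J\<close> conjugates
  the \<open>\<beta>\<close> of \<open>H\<^sup>J\<close> to that of \<open>H\<close> and multiplies \<open>\<epsilon> \<otimes> \<phi>\<close> by a unit.

  Double. The coproduct of \<open>D(H)\<close> followed by multiplication on a third element is again an operator
  whose powers compute the Sweedler powers. It is a product of two commuting operators (a shadow of the
  R-matrix), and the \<open>n\<close>-th power of each is the identity when \<open>[n] = u \<epsilon>\<close> on \<open>H\<close>. Conversely, \<open>H\<close> is a Hopf subalgebra of \<open>D(H)\<close>.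
\<close>

text \<open>In general a twist changes the Sweedler powers themselves, so they cannot be compared
  element by element. What conjugation preserves is that an operator has trivial n-th power, and
  this is why [n] = u \<epsilon> is recast as a statement about operators. All operators act on
  multilinear forms, hence are transposes of maps on tensors. The conjugating operator contains the
  inverse antipode, as does the product of the double. Its existence is proved here from a trace
  formula for integrals (\<open>lam\<close>), together with a dimension count. Finite dimension
  enters there, in the dual, and through a basis, which writes every tensor in H \<otimes> H as a
  sum of terms X i \<otimes> e i. For the twist and the double, the recursion of Sweedler powers is
  derived from linearity of product and coproduct alone (\<open>sweedler_struct\<close>). Two
  features blur the formulas: the twist is not normalised, so the unit \<open>gam\<close> appears,
  and embedding a ring without its unit replaces \<epsilon>(1) = 1 by laws such as
  \<open>eps one * f x = f x\<close>.\<close>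

text \<open>Sums over a carrier-based ring are awkward.  The product of all commutative rings with carrier in a
  given type is a type of class \<^class>\<open>comm_ring\<close> into which each of these rings embeds (without its unit).\<close>

typedef ('a, 'k) uring = "{\<phi> :: ('a, 'k) ring_scheme \<Rightarrow> 'a. \<forall>L. if cring L then \<phi> L \<in> carrier L else \<phi> L = undefined}"
  morphisms uring_comp Abs_uring
  by (rule exI[of _ "\<lambda>L. if cring L then \<zero>\<^bsub>L\<^esub> else undefined"]) (auto simp: cring.cring_simprules)

lemma uring_comp_in: "cring L \<Longrightarrow> uring_comp r L \<in> carrier L"
  using uring_comp[of r] by (auto split: if_splits)

lemma uring_eqI:
  assumes "\<And>L. cring L \<Longrightarrow> uring_comp r L = uring_comp s L" shows "r = s"
proof -
  have "uring_comp r L = uring_comp s L" for L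
    using assms[of L] uring_comp[of r] uring_comp[of s] by (cases "cring L") force+
  then show ?thesis by (metis ext uring_comp_inject)
qed

definition mk_uring where
  "mk_uring f = Abs_uring (\<lambda>L. if cring L then f L else undefined)"

lemma uring_comp_mk:
  assumes "\<And>L. cring L \<Longrightarrow> f L \<in> carrier L" "cring L"
  shows "uring_comp (mk_uring f) L = f L"
  unfolding mk_uring_def using assms by (subst Abs_uring_inverse) auto

instantiation uring :: (type, type) comm_ring
begin

definition "0 = mk_uring (\<lambda>L. \<zero>\<^bsub>L\<^esub>)"
definition "r + s = mk_uring (\<lambda>L. uring_comp r L \<oplus>\<^bsub>L\<^esub> uring_comp s L)"
definition "r * s = mk_uring (\<lambda>L. uring_comp r L \<otimes>\<^bsub>L\<^esub> uring_comp s L)"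
definition "- r = mk_uring (\<lambda>L. \<ominus>\<^bsub>L\<^esub> uring_comp r L)"
definition "r - s = mk_uring (\<lambda>L. uring_comp r L \<ominus>\<^bsub>L\<^esub> uring_comp s L)"

lemma uring_comp_ops [simp]:
  assumes "cring L"
  shows "uring_comp 0 L = \<zero>\<^bsub>L\<^esub>"
    "uring_comp (r + s) L = uring_comp r L \<oplus>\<^bsub>L\<^esub> uring_comp s L"
    "uring_comp (r * s) L = uring_comp r L \<otimes>\<^bsub>L\<^esub> uring_comp s L"
    "uring_comp (- r) L = \<ominus>\<^bsub>L\<^esub> uring_comp r L"
    "uring_comp (r - s) L = uring_comp r L \<ominus>\<^bsub>L\<^esub> uring_comp s L"
  unfolding zero_uring_def plus_uring_def times_uring_def uminus_uring_def minus_uring_def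
  using assms by (auto simp: uring_comp_mk uring_comp_in cring.cring_simprules)

instance
  by standard (auto intro!: uring_eqI simp: uring_comp_in cring.cring_simprules)

end

text \<open>All components other than \<open>K\<close> are filled with zeros, so the image of the
  unit of \<open>K\<close> is an idempotent that need not be a unit. This is why the calculus below
  works over a commutative ring without unit.\<close>

definition emb :: "('a, 'k) ring_scheme \<Rightarrow> 'a \<Rightarrow> ('a, 'k) uring" where
  "emb K a = mk_uring (\<lambda>L. if L = K then a else \<zero>\<^bsub>L\<^esub>)"

lemma uring_comp_emb:
  "\<lbrakk>a \<in> carrier K; cring L\<rbrakk> \<Longrightarrow> uring_comp (emb K a) L = (if L = K then a else \<zero>\<^bsub>L\<^esub>)"
  unfolding emb_def by (subst uring_comp_mk) (auto simp: cring.cring_simprules)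

lemma emb_inject: "\<lbrakk>cring K; a \<in> carrier K; b \<in> carrier K; emb K a = emb K b\<rbrakk> \<Longrightarrow> a = b"
  by (metis uring_comp_emb)

lemma emb_ops:
  assumes "cring K" "a \<in> carrier K" "b \<in> carrier K"
  shows "emb K (a \<oplus>\<^bsub>K\<^esub> b) = emb K a + emb K b" "emb K (a \<otimes>\<^bsub>K\<^esub> b) = emb K a * emb K b"
  using assms by (auto intro!: uring_eqI simp: uring_comp_emb cring.cring_simprules)

lemma emb_one: "\<lbrakk>cring K; a \<in> carrier K\<rbrakk> \<Longrightarrow> emb K \<one>\<^bsub>K\<^esub> * emb K a = emb K a"
  using cring.cring_simprules(6,12)[of K] by (simp add: emb_ops(2)[symmetric])

text \<open>The ideal of the idempotent that is the image of the unit of \<open>K\<close>. It is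
  exactly the image of \<open>K\<close> under \<open>emb K\<close>: its elements vanish in every
  component but \<open>K\<close>.\<close>

definition uring_module :: "('a, 'k) ring_scheme \<Rightarrow> ('a, ('a, 'k) uring) module" where
  "uring_module K = \<lparr>carrier = {r. emb K \<one>\<^bsub>K\<^esub> * r = r}, mult = undefined, one = undefined,
     zero = 0, add = (+), smult = (\<lambda>a r. emb K a * r)\<rparr>"

lemma uring_module_simps [simp]:
  "r \<in> carrier (uring_module K) \<longleftrightarrow> emb K \<one>\<^bsub>K\<^esub> * r = r"
  "\<zero>\<^bsub>uring_module K\<^esub> = 0" "r \<oplus>\<^bsub>uring_module K\<^esub> s = r + s" "a \<odot>\<^bsub>uring_module K\<^esub> r = emb K a * r"
  by (simp_all add: uring_module_def)

lemma module_uring: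
  assumes "cring K" shows "module K (uring_module K)"
proof (rule moduleI)
  show "abelian_group (uring_module K)"
  proof (rule abelian_groupI)
    fix x assume "x \<in> carrier (uring_module K)"
    then show "\<exists>y\<in>carrier (uring_module K). y \<oplus>\<^bsub>uring_module K\<^esub> x = \<zero>\<^bsub>uring_module K\<^esub>"
      by (intro bexI[of _ "- x"]) auto
  qed (auto simp: algebra_simps)
  fix a r assume "a \<in> carrier K" "r \<in> carrier (uring_module K)"
  then show "a \<odot>\<^bsub>uring_module K\<^esub> r \<in> carrier (uring_module K)"
    using assms by (simp add: mult.assoc[symmetric] emb_one)
qed (use assms in \<open>auto simp: emb_ops algebra_simps\<close>)

text \<open>Turns sums in the record-based module into type-class sums, on which all the Sweedler
  computations are done.\<close>

lemma finsum_uring: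
  assumes K: "cring K" and "f \<in> A \<rightarrow> carrier (uring_module K)"
  shows "finsum (uring_module K) f A = sum f A"
proof -
  interpret module K "uring_module K" by (rule module_uring[OF K])
  show ?thesis
    using assms(2)
  proof (induction A rule: infinite_finite_induct)
    case (insert x A)
    then have f: "f x \<in> carrier (uring_module K)" "f \<in> A \<rightarrow> carrier (uring_module K)" by auto
    have "finsum (uring_module K) f (insert x A) = f x \<oplus>\<^bsub>uring_module K\<^esub> finsum (uring_module K) f A"
      by (rule M.finsum_insert[OF insert.hyps f(2,1)])
    also have "\<dots> = f x + sum f A" by (simp only: insert.IH[OF f(2)] uring_module_simps)
    finally show ?case using insert.hyps by simp
  next
    case (infinite A)
    from infinite(1) have "finsum (uring_module K) f A = \<zero>\<^bsub>uring_module K\<^esub>" by (rule M.finsum_infinite)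
    with infinite(1) show ?case by simp
  next
    case empty
    have "finsum (uring_module K) f {} = \<zero>\<^bsub>uring_module K\<^esub>" by (rule M.finsum_empty)
    then show ?case by simp
  qed
qed

section \<open>Modules given by generators and relations\<close>

lemma module_homI:
  "\<lbrakk>\<And>x. x \<in> carrier M \<Longrightarrow> f x \<in> carrier N;
    \<And>x y. \<lbrakk>x \<in> carrier M; y \<in> carrier M\<rbrakk> \<Longrightarrow> f (x \<oplus>\<^bsub>M\<^esub> y) = f x \<oplus>\<^bsub>N\<^esub> f y;
    \<And>a x. \<lbrakk>a \<in> carrier K; x \<in> carrier M\<rbrakk> \<Longrightarrow> f (a \<odot>\<^bsub>M\<^esub> x) = a \<odot>\<^bsub>N\<^esub> f x\<rbrakk> \<Longrightarrow> f \<in> module_hom K M N"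
  by (auto simp: module_hom_def)

lemma module_hom_in: "\<lbrakk>f \<in> module_hom K M N; x \<in> carrier M\<rbrakk> \<Longrightarrow> f x \<in> carrier N"
  by (auto simp: module_hom_def)

lemmas module_homD = module_hom_in module_hom_add module_hom_smult

lemma module_hom_comp:
  assumes f: "f \<in> module_hom K M N" and g: "g \<in> module_hom K N P"
  shows "(\<lambda>x. g (f x)) \<in> module_hom K M P"
  by (rule module_homI) (simp_all add: module_homD[OF f] module_homD[OF g])

lemma module_hom_cong:
  assumes "\<And>x. x \<in> carrier M \<Longrightarrow> f x = g x" "module K M"
  shows "f \<in> module_hom K M N \<longleftrightarrow> g \<in> module_hom K M N"
proof -
  interpret module K M by fact
  have "h' \<in> module_hom K M N" if "h \<in> module_hom K M N" "\<And>x. x \<in> carrier M \<Longrightarrow> h x = h' x" for h h'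
    using that(1) by (auto simp: module_hom_def that(2)[symmetric])
  then show ?thesis using assms(1) by metis
qed

lemma module_hom_ident: "(\<lambda>x. x) \<in> module_hom K M M"
  by (auto simp: module_hom_def)

lemma module_hom_plus:
  assumes "module K N" and f: "f \<in> module_hom K M N" and g: "g \<in> module_hom K M N"
  shows "(\<lambda>x. f x \<oplus>\<^bsub>N\<^esub> g x) \<in> module_hom K M N"
proof -
  interpret N: module K N by fact
  show ?thesis
    by (rule module_homI)
      (auto simp: module_homD[OF f] module_homD[OF g] N.smult_r_distr N.M.add.m_ac)
qed

lemma module_hom_scale:
  assumes "module K N" and f: "f \<in> module_hom K M N" and a: "a \<in> carrier K"
  shows "(\<lambda>x. a \<odot>\<^bsub>N\<^esub> f x) \<in> module_hom K M N"
proof -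
  interpret N: module K N by fact
  show ?thesis
    by (rule module_homI)
      (auto simp: module_homD[OF f] N.smult_r_distr N.smult_assoc1[symmetric] a N.R.m_comm)
qed

lemma module_hom_zero:
  assumes "module K M" "module K N" "f \<in> module_hom K M N"
  shows "f \<zero>\<^bsub>M\<^esub> = \<zero>\<^bsub>N\<^esub>"
  using assms by (auto intro!: mod_hom.f0_is_0 simp: mod_hom_def mod_hom_axioms_def)

lemma module_hom_finsum:
  assumes "module K M" "module K N" "f \<in> module_hom K M N" "finite A" "g \<in> A \<rightarrow> carrier M"
  shows "f (finsum M g A) = finsum N (\<lambda>a. f (g a)) A"
proof -
  interpret M: module K M by fact
  interpret N: module K N by fact
  show ?thesis
    using assms(4,5)
  proof (induction A)
    case empty
    show ?case by (simp only: M.M.finsum_empty N.M.finsum_empty module_hom_zero[OF assms(1,2,3)])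
  next
    case (insert x A)
    then have g: "g \<in> A \<rightarrow> carrier M" "g x \<in> carrier M" by auto
    have fg: "(\<lambda>a. f (g a)) \<in> A \<rightarrow> carrier N" "f (g x) \<in> carrier N"
      using g module_hom_in[OF assms(3)] by auto
    have "f (finsum M g (insert x A)) = f (g x \<oplus>\<^bsub>M\<^esub> finsum M g A)"
      by (simp only: M.M.finsum_insert[OF insert.hyps g])
    also have "\<dots> = f (g x) \<oplus>\<^bsub>N\<^esub> f (finsum M g A)"
      by (rule module_hom_add[OF assms(3) g(2) M.M.finsum_closed[OF g(1)]])
    also have "\<dots> = finsum N (\<lambda>a. f (g a)) (insert x A)"
      by (simp only: insert.IH[OF g(1)] N.M.finsum_insert[OF insert.hyps fg])
    finally show ?case .
  qed
qed

subsection \<open>Free modules\<close>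

lemma free_module_carrier:
  "r \<in> carrier (free_module K X) \<longleftrightarrow> (\<forall>x. r x \<in> carrier K) \<and> finite {x. r x \<noteq> \<zero>\<^bsub>K\<^esub>} \<and> {x. r x \<noteq> \<zero>\<^bsub>K\<^esub>} \<subseteq> X"
  by (auto simp: free_module_def)

lemma free_module_simps:
  "\<zero>\<^bsub>free_module K X\<^esub> = (\<lambda>x. \<zero>\<^bsub>K\<^esub>)"
  "r \<oplus>\<^bsub>free_module K X\<^esub> s = (\<lambda>x. r x \<oplus>\<^bsub>K\<^esub> s x)"
  "a \<odot>\<^bsub>free_module K X\<^esub> r = (\<lambda>x. a \<otimes>\<^bsub>K\<^esub> r x)"
  by (simp_all add: free_module_def)

lemma module_free_module:
  assumes "cring K" shows "module K (free_module K X)"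
proof -
  interpret cring K by fact
  have sub: "r \<in> carrier (free_module K X)"
    if "\<And>x. r x \<in> carrier K" "finite A" "A \<subseteq> X" "{x. r x \<noteq> \<zero>\<^bsub>K\<^esub>} \<subseteq> A" for r A
    using that finite_subset by (fastforce simp: free_module_carrier)
  have add: "(\<lambda>x. r x \<oplus>\<^bsub>K\<^esub> s x) \<in> carrier (free_module K X)"
    if "r \<in> carrier (free_module K X)" "s \<in> carrier (free_module K X)" for r s
    using that by (intro sub[of _ "{x. r x \<noteq> \<zero>\<^bsub>K\<^esub>} \<union> {x. s x \<noteq> \<zero>\<^bsub>K\<^esub>}"]) (auto simp: free_module_carrier)
  have scale: "(\<lambda>x. a \<otimes>\<^bsub>K\<^esub> r x) \<in> carrier (free_module K X)"
    if "r \<in> carrier (free_module K X)" "a \<in> carrier K" for r a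
    using that by (intro sub[of _ "{x. r x \<noteq> \<zero>\<^bsub>K\<^esub>}"]) (auto simp: free_module_carrier)
  have neg: "(\<lambda>x. \<ominus>\<^bsub>K\<^esub> r x) \<in> carrier (free_module K X)"
    if "r \<in> carrier (free_module K X)" for r
    using that by (intro sub[of _ "{x. r x \<noteq> \<zero>\<^bsub>K\<^esub>}"]) (auto simp: free_module_carrier)
  have "abelian_group (free_module K X)"
  proof (rule abelian_groupI)
    fix r assume r: "r \<in> carrier (free_module K X)"
    show "\<exists>s\<in>carrier (free_module K X). s \<oplus>\<^bsub>free_module K X\<^esub> r = \<zero>\<^bsub>free_module K X\<^esub>"
      by (rule bexI[OF _ neg[OF r]]) (use r in \<open>auto simp: free_module_simps free_module_carrier l_neg\<close>)
  qed (auto simp: free_module_simps add, auto simp: free_module_carrier a_ac)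
  then show ?thesis
    by (intro moduleI) (auto simp: free_module_simps scale \<open>cring K\<close>,
        auto simp: free_module_carrier l_distr r_distr m_assoc)
qed

lemma free_gen_in:
  assumes "cring K" "x \<in> X" shows "free_gen K x \<in> carrier (free_module K X)"
proof -
  interpret cring K by fact
  have "{y. free_gen K x y \<noteq> \<zero>\<^bsub>K\<^esub>} \<subseteq> {x}" by (auto simp: free_gen_def)
  then show ?thesis using assms(2) finite_subset by (auto simp: free_module_carrier free_gen_def)
qed

text \<open>The map inside \<open>lift\<close>, before passing to cosets: \<open>lift\<close> takes
  the unique value of \<open>lin_ext\<close> on a coset.\<close>

definition lin_ext :: "('a, 'k) ring_scheme \<Rightarrow> ('a, 'w, 'm) module_scheme \<Rightarrow> ('x \<Rightarrow> 'w) \<Rightarrow> ('x \<Rightarrow> 'a) \<Rightarrow> 'w" where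
  "lin_ext K W \<phi> r = (\<Oplus>\<^bsub>W\<^esub>x\<in>{x. r x \<noteq> \<zero>\<^bsub>K\<^esub>}. r x \<odot>\<^bsub>W\<^esub> \<phi> x)"

text \<open>The supports of two functions and of their sum differ; summing over a common finite
  superset makes the three sums comparable.\<close>

lemma lin_ext_superset:
  assumes "module K W" "\<phi> \<in> X \<rightarrow> carrier W" "r \<in> carrier (free_module K X)" "finite A" "{x. r x \<noteq> \<zero>\<^bsub>K\<^esub>} \<subseteq> A" "A \<subseteq> X"
  shows "lin_ext K W \<phi> r = (\<Oplus>\<^bsub>W\<^esub>x\<in>A. r x \<odot>\<^bsub>W\<^esub> \<phi> x)"
proof -
  interpret W: module K W by fact
  show ?thesis
    unfolding lin_ext_def
    using assms by (intro W.M.add.finprod_mono_neutral_cong_left) (auto simp: free_module_carrier Pi_iff intro!: W.smult_l_null)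
qed

lemma lin_ext_hom:
  assumes W: "module K W" and \<phi>: "\<phi> \<in> X \<rightarrow> carrier W"
  shows "lin_ext K W \<phi> \<in> module_hom K (free_module K X) W"
proof -
  interpret W: module K W by fact
  interpret F: module K "free_module K X" by (rule module_free_module[OF W.R.is_cring])
  let ?S = "\<lambda>r. {x. r x \<noteq> \<zero>\<^bsub>K\<^esub>}"
  have S: "finite (?S r)" "?S r \<subseteq> X" "\<And>x. r x \<in> carrier K" if "r \<in> carrier (free_module K X)" for r
    using that by (auto simp: free_module_carrier)
  have cl: "(\<lambda>x. r x \<odot>\<^bsub>W\<^esub> \<phi> x) \<in> A \<rightarrow> carrier W" if "r \<in> carrier (free_module K X)" "A \<subseteq> X" for r A
    using that S(3) \<phi> by (force simp: Pi_iff)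
  show ?thesis
  proof (rule module_homI)
    fix r assume r: "r \<in> carrier (free_module K X)"
    show "lin_ext K W \<phi> r \<in> carrier W"
      unfolding lin_ext_def by (rule W.M.finsum_closed) (use cl[OF r S(2)[OF r]] in auto)
  next
    fix r s assume r: "r \<in> carrier (free_module K X)" and s: "s \<in> carrier (free_module K X)"
    let ?A = "?S r \<union> ?S s"
    have rs: "r \<oplus>\<^bsub>free_module K X\<^esub> s \<in> carrier (free_module K X)" using r s by simp
    have A: "finite ?A" "?A \<subseteq> X" using S r s by auto
    have "lin_ext K W \<phi> (r \<oplus>\<^bsub>free_module K X\<^esub> s) = (\<Oplus>\<^bsub>W\<^esub>x\<in>?A. (r \<oplus>\<^bsub>free_module K X\<^esub> s) x \<odot>\<^bsub>W\<^esub> \<phi> x)"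
      by (rule lin_ext_superset[OF W \<phi> rs A(1) _ A(2)]) (auto simp: free_module_simps)
    also have "\<dots> = (\<Oplus>\<^bsub>W\<^esub>x\<in>?A. (r x \<odot>\<^bsub>W\<^esub> \<phi> x) \<oplus>\<^bsub>W\<^esub> (s x \<odot>\<^bsub>W\<^esub> \<phi> x))"
      by (intro W.M.finsum_cong' refl) (use A(2) \<phi> S(3)[OF r] S(3)[OF s] in \<open>auto simp: free_module_simps W.smult_l_distr Pi_iff\<close>)
    also have "\<dots> = (\<Oplus>\<^bsub>W\<^esub>x\<in>?A. r x \<odot>\<^bsub>W\<^esub> \<phi> x) \<oplus>\<^bsub>W\<^esub> (\<Oplus>\<^bsub>W\<^esub>x\<in>?A. s x \<odot>\<^bsub>W\<^esub> \<phi> x)"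
      by (rule W.M.finsum_addf) (use cl[OF r A(2)] cl[OF s A(2)] in auto)
    also have "\<dots> = lin_ext K W \<phi> r \<oplus>\<^bsub>W\<^esub> lin_ext K W \<phi> s"
      using lin_ext_superset[OF W \<phi> r A(1) _ A(2)] lin_ext_superset[OF W \<phi> s A(1) _ A(2)] by simp
    finally show "lin_ext K W \<phi> (r \<oplus>\<^bsub>free_module K X\<^esub> s) = lin_ext K W \<phi> r \<oplus>\<^bsub>W\<^esub> lin_ext K W \<phi> s" .
  next
    fix a r assume a: "a \<in> carrier K" and r: "r \<in> carrier (free_module K X)"
    let ?A = "?S r"
    have ar: "a \<odot>\<^bsub>free_module K X\<^esub> r \<in> carrier (free_module K X)" using a r by simp
    have "lin_ext K W \<phi> (a \<odot>\<^bsub>free_module K X\<^esub> r) = (\<Oplus>\<^bsub>W\<^esub>x\<in>?A. (a \<odot>\<^bsub>free_module K X\<^esub> r) x \<odot>\<^bsub>W\<^esub> \<phi> x)"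
      by (rule lin_ext_superset[OF W \<phi> ar S(1)[OF r] _ S(2)[OF r]]) (use a in \<open>auto simp: free_module_simps\<close>)
    also have "\<dots> = (\<Oplus>\<^bsub>W\<^esub>x\<in>?A. a \<odot>\<^bsub>W\<^esub> (r x \<odot>\<^bsub>W\<^esub> \<phi> x))"
      by (intro W.M.finsum_cong' refl) (use S(2)[OF r] \<phi> S(3)[OF r] a in \<open>auto simp: free_module_simps W.smult_assoc1 Pi_iff\<close>)
    also have "\<dots> = a \<odot>\<^bsub>W\<^esub> lin_ext K W \<phi> r"
      unfolding lin_ext_def by (rule W.finsum_smult_ldistr[symmetric]) (use S[OF r] a cl[OF r] in auto)
    finally show "lin_ext K W \<phi> (a \<odot>\<^bsub>free_module K X\<^esub> r) = a \<odot>\<^bsub>W\<^esub> lin_ext K W \<phi> r" .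
  qed
qed

lemma lin_ext_gen:
  assumes W: "module K W" and \<phi>: "\<phi> \<in> X \<rightarrow> carrier W" and x: "x \<in> X"
  shows "lin_ext K W \<phi> (free_gen K x) = \<phi> x"
proof -
  interpret W: module K W by fact
  have \<phi>x: "\<phi> x \<in> carrier W" using \<phi> x by auto
  have "lin_ext K W \<phi> (free_gen K x) = (\<Oplus>\<^bsub>W\<^esub>y\<in>{x}. free_gen K x y \<odot>\<^bsub>W\<^esub> \<phi> y)"
    by (rule lin_ext_superset[OF W \<phi> free_gen_in[OF W.R.is_cring x]]) (use x in \<open>auto simp: free_gen_def\<close>)
  also have "\<dots> = (\<Oplus>\<^bsub>W\<^esub>y\<in>{x}. \<phi> y)"
    by (intro W.M.finsum_cong' refl) (auto simp: free_gen_def \<phi>x)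
  also have "\<dots> = \<phi> x" using \<phi>x by (simp add: W.M.finsum_insert[of "{}"])
  finally show ?thesis .
qed

lemma free_module_hom_eqI:
  assumes W: "module K W" and f: "f \<in> module_hom K (free_module K X) W" and g: "g \<in> module_hom K (free_module K X) W"
    and eq: "\<And>x. x \<in> X \<Longrightarrow> f (free_gen K x) = g (free_gen K x)" and r: "r \<in> carrier (free_module K X)"
  shows "f r = g r"
proof -
  interpret W: module K W by fact
  interpret F: module K "free_module K X" by (rule module_free_module[OF W.R.is_cring])
  \<comment> \<open>Induction over a finite set that merely contains the support; the function is
    cleared at one point of the set, whether or not it was zero there.\<close>
  have "finite A \<Longrightarrow> r \<in> carrier (free_module K X) \<Longrightarrow> {x. r x \<noteq> \<zero>\<^bsub>K\<^esub>} \<subseteq> A \<Longrightarrow> A \<subseteq> X \<Longrightarrow> f r = g r" for A r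
  proof (induction A arbitrary: r rule: finite_induct)
    case empty
    then have "r = \<zero>\<^bsub>free_module K X\<^esub>" by (auto simp: free_module_simps)
    then show ?case
      using module_hom_zero[OF F.module_axioms W f] module_hom_zero[OF F.module_axioms W g] by simp
  next
    case (insert x A)
    let ?s = "r(x := \<zero>\<^bsub>K\<^esub>)"
    have rx: "r x \<in> carrier K" and r: "\<And>y. r y \<in> carrier K" using insert.prems(1) by (auto simp: free_module_carrier)
    have s: "?s \<in> carrier (free_module K X)"
      using insert.prems(1) by (auto simp: free_module_carrier elim: rev_finite_subset)
    have gx: "free_gen K x \<in> carrier (free_module K X)"
      using insert.prems(3) by (intro free_gen_in W.R.is_cring) auto
    have rs: "r = r x \<odot>\<^bsub>free_module K X\<^esub> free_gen K x \<oplus>\<^bsub>free_module K X\<^esub> ?s"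
      using r by (auto simp: free_module_simps free_gen_def fun_eq_iff)
    have IH: "f ?s = g ?s" by (rule insert.IH[OF s]) (use insert.prems in auto)
    have "h r = r x \<odot>\<^bsub>W\<^esub> h (free_gen K x) \<oplus>\<^bsub>W\<^esub> h ?s" if h: "h \<in> module_hom K (free_module K X) W" for h
      by (subst rs) (simp only: module_hom_add[OF h F.smult_closed[OF rx gx] s] module_hom_smult[OF h rx gx])
    from this[OF f] this[OF g] show ?case using IH eq[of x] insert.prems(3) by simp
  qed
  from this[of "{x. r x \<noteq> \<zero>\<^bsub>K\<^esub>}"] r show ?thesis by (auto simp: free_module_carrier)
qed

subsection \<open>Quotients\<close>

locale quotient = M: module K M + N: submodule K N M
  for K :: "('a, 'k) ring_scheme" and M :: "('a, 'b, 'm) module_scheme" and N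
begin

definition proj where "proj x = N +>\<^bsub>M\<^esub> x"

lemma abelian_subgroup: "abelian_subgroup N M"
proof (rule abelian_subgroupI3[OF additive_subgroupI M.M.abelian_group_axioms])
  show "subgroup N (add_monoid M)"
  proof
    fix x assume x: "x \<in> N"
    have xM: "x \<in> carrier M" using x N.subset by auto
    \<comment> \<open>A submodule is closed under scalars, so additive inverses come from the scalar
      -1.\<close>
    have "\<ominus>\<^bsub>M\<^esub> x = \<ominus>\<^bsub>K\<^esub> \<one>\<^bsub>K\<^esub> \<odot>\<^bsub>M\<^esub> x" using M.smult_l_minus[OF M.R.one_closed xM] xM by simp
    then have "\<ominus>\<^bsub>M\<^esub> x \<in> N" using x by simp
    then show "inv\<^bsub>add_monoid M\<^esub> x \<in> N" by (simp add: a_inv_def)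
  qed (use N.subset in auto)
qed

sublocale A: abelian_subgroup N M by (rule abelian_subgroup)

lemma proj_eq_iff: "\<lbrakk>x \<in> carrier M; y \<in> carrier M\<rbrakk> \<Longrightarrow> proj x = proj y \<longleftrightarrow> x \<ominus>\<^bsub>M\<^esub> y \<in> N"
  unfolding proj_def a_minus_def
  using A.a_rcos_module[of y x] A.a_repr_independence'[of x y] A.a_rcos_self[of x] by auto

lemma quot_simps:
  "X \<in> carrier (quot_module M N) \<longleftrightarrow> (\<exists>x\<in>carrier M. X = proj x)"
  "\<zero>\<^bsub>quot_module M N\<^esub> = proj \<zero>\<^bsub>M\<^esub>"
  "\<lbrakk>x \<in> carrier M; y \<in> carrier M\<rbrakk> \<Longrightarrow> proj x \<oplus>\<^bsub>quot_module M N\<^esub> proj y = proj (x \<oplus>\<^bsub>M\<^esub> y)"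
  by (auto simp: quot_module_def proj_def A_RCOSETS_def' A.a_rcos_sum A.a_rcos_const)

text \<open>The scalar multiple of a coset is a union over all representatives; they all give the
  same coset, so the union over a nonempty set collapses.\<close>

lemma quot_smult:
  assumes a: "a \<in> carrier K" and x: "x \<in> carrier M"
  shows "a \<odot>\<^bsub>quot_module M N\<^esub> proj x = proj (a \<odot>\<^bsub>M\<^esub> x)"
proof -
  have 1: "proj (a \<odot>\<^bsub>M\<^esub> y) = proj (a \<odot>\<^bsub>M\<^esub> x)" if "y \<in> proj x" for y
  proof -
    have y: "y \<in> carrier M" using that x A.a_elemrcos_carrier unfolding proj_def by blast
    have "y \<ominus>\<^bsub>M\<^esub> x \<in> N" using that A.a_rcos_module[OF x y] by (simp add: proj_def a_minus_def)
    then have "a \<odot>\<^bsub>M\<^esub> (y \<ominus>\<^bsub>M\<^esub> x) \<in> N" using a by simp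
    moreover have "a \<odot>\<^bsub>M\<^esub> (y \<ominus>\<^bsub>M\<^esub> x) = a \<odot>\<^bsub>M\<^esub> y \<ominus>\<^bsub>M\<^esub> a \<odot>\<^bsub>M\<^esub> x"
      using a x y by (simp add: a_minus_def M.smult_r_distr M.smult_r_minus)
    ultimately show ?thesis using a x y by (simp add: proj_eq_iff)
  qed
  have "x \<in> proj x" unfolding proj_def by (rule A.a_rcos_self[OF x])
  then have "proj x \<noteq> {}" by blast
  then have "(\<Union>y\<in>proj x. proj (a \<odot>\<^bsub>M\<^esub> y)) = proj (a \<odot>\<^bsub>M\<^esub> x)" by (rule SUP_eq_const) (rule 1)
  then show ?thesis by (simp add: quot_module_def proj_def)
qed

lemma module_quot: "module K (quot_module M N)"
proof (rule moduleI)
  show "abelian_group (quot_module M N)"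
  proof (rule abelian_groupI)
    fix X assume "X \<in> carrier (quot_module M N)"
    then obtain x where x: "x \<in> carrier M" "X = proj x" by (auto simp: quot_simps)
    show "\<exists>Y\<in>carrier (quot_module M N). Y \<oplus>\<^bsub>quot_module M N\<^esub> X = \<zero>\<^bsub>quot_module M N\<^esub>"
      by (rule bexI[of _ "proj (\<ominus>\<^bsub>M\<^esub> x)"]) (use x in \<open>auto simp: quot_simps M.M.l_neg\<close>)
  qed (auto simp: quot_simps M.M.a_ac)
qed (auto simp: quot_simps quot_smult M.smult_l_distr M.smult_r_distr M.smult_assoc1 M.R.is_cring)

lemma proj_hom: "proj \<in> module_hom K M (quot_module M N)"
  by (rule module_homI) (auto simp: quot_simps quot_smult)

end

subsection \<open>Presentations\<close>

text \<open>Common to tensor powers and to the tensor product of two spaces, which differ only in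
  their generators and relations.\<close>

locale presentation = cring K for K :: "('a, 'k) ring_scheme" +
  fixes X :: "'x set" and Rel :: "('x \<Rightarrow> 'a) set"
  assumes Rel: "Rel \<subseteq> carrier (free_module K X)"
begin

abbreviation "F \<equiv> free_module K X"
abbreviation "N \<equiv> module.span K F Rel"
abbreviation "Q \<equiv> quot_module F N"

definition cls where "cls x = N +>\<^bsub>F\<^esub> free_gen K x"

sublocale F: module K F by (rule module_free_module[OF is_cring])
sublocale quotient K F N
  by (intro quotient.intro F.module_axioms F.span_is_submodule[OF Rel])

lemma cls_in: "x \<in> X \<Longrightarrow> cls x \<in> carrier Q"
  using free_gen_in[OF is_cring, of x X] by (auto simp: quot_simps cls_def proj_def)

lemma hom_eqI:
  assumes W: "module K W" and f: "f \<in> module_hom K Q W" and g: "g \<in> module_hom K Q W"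
    and eq: "\<And>x. x \<in> X \<Longrightarrow> f (cls x) = g (cls x)" and T: "T \<in> carrier Q"
  shows "f T = g T"
proof -
  from T obtain r where r: "r \<in> carrier F" "T = proj r" by (auto simp: quot_simps)
  have "f (proj r) = g (proj r)"
    by (rule free_module_hom_eqI[OF W module_hom_comp[OF proj_hom f] module_hom_comp[OF proj_hom g] _ r(1)])
      (use eq in \<open>simp add: cls_def proj_def\<close>)
  with r show ?thesis by simp
qed

text \<open>The linear extension kills \<open>Rel\<close>, hence its span, hence is constant on each
  coset. So the image taken in \<open>lift\<close> is a singleton, and \<open>the_elem\<close>
  returns its element.\<close>

lemma lift_proj:
  assumes W: "module K W" and \<phi>: "\<phi> \<in> X \<rightarrow> carrier W" and R: "\<And>\<rho>. \<rho> \<in> Rel \<Longrightarrow> lin_ext K W \<phi> \<rho> = \<zero>\<^bsub>W\<^esub>"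
    and r: "r \<in> carrier F"
  shows "lift K W \<phi> (proj r) = lin_ext K W \<phi> r"
proof -
  interpret W: module K W by fact
  interpret E: mod_hom K F W "lin_ext K W \<phi>"
    by (intro mod_hom.intro mod_hom_axioms.intro F.module_axioms W lin_ext_hom[OF W \<phi>])
  have "N \<subseteq> E.ker"
    by (rule F.span_is_subset[OF _ E.ker_is_submodule]) (use R Rel in \<open>auto simp: E.ker_def\<close>)
  have 1: "lin_ext K W \<phi> s = lin_ext K W \<phi> r" if "s \<in> proj r" for s
  proof -
    have s: "s \<in> carrier F" using that r A.a_elemrcos_carrier unfolding proj_def by blast
    have "s \<ominus>\<^bsub>F\<^esub> r \<in> N" using that A.a_rcos_module[OF r s] by (simp add: proj_def a_minus_def)
    with \<open>N \<subseteq> E.ker\<close> have "lin_ext K W \<phi> s \<ominus>\<^bsub>W\<^esub> lin_ext K W \<phi> r = \<zero>\<^bsub>W\<^esub>"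
      using r s by (auto simp: E.ker_def)
    then have "\<ominus>\<^bsub>W\<^esub> (\<ominus>\<^bsub>W\<^esub> lin_ext K W \<phi> r) = lin_ext K W \<phi> s"
      using r s by (intro W.M.minus_equality) (auto simp: a_minus_def)
    then show ?thesis using r by simp
  qed
  have "r \<in> proj r" unfolding proj_def by (rule A.a_rcos_self[OF r])
  then have "lin_ext K W \<phi> ` proj r = {lin_ext K W \<phi> r}"
    by (intro equalityI subsetI) (blast dest: 1, blast)
  then show ?thesis by (simp add: lift_def lin_ext_def[abs_def])
qed

lemma
  assumes W: "module K W" and \<phi>: "\<phi> \<in> X \<rightarrow> carrier W" and R: "\<And>\<rho>. \<rho> \<in> Rel \<Longrightarrow> lin_ext K W \<phi> \<rho> = \<zero>\<^bsub>W\<^esub>"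
  shows lift_hom: "lift K W \<phi> \<in> module_hom K Q W"
    and lift_cls: "\<And>x. x \<in> X \<Longrightarrow> lift K W \<phi> (cls x) = \<phi> x"
proof -
  note E = lin_ext_hom[OF W \<phi>]
  show "lift K W \<phi> \<in> module_hom K Q W"
    by (rule module_homI) (auto simp: quot_simps quot_smult lift_proj[OF W \<phi> R] module_homD[OF E])
  fix x assume x: "x \<in> X"
  show "lift K W \<phi> (cls x) = \<phi> x"
    using lift_proj[OF W \<phi> R free_gen_in[OF is_cring x]] lin_ext_gen[OF W \<phi> x] by (simp add: cls_def proj_def)
qed

lemma cls_relation:
  assumes "x \<in> X" "r \<in> carrier F" "free_gen K x \<ominus>\<^bsub>F\<^esub> r \<in> Rel"
  shows "cls x = proj r"
proof -
  have "free_gen K x \<ominus>\<^bsub>F\<^esub> r \<in> N" using F.in_own_span[OF Rel] assms(3) by auto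
  then have "proj (free_gen K x) = proj r" using proj_eq_iff[OF free_gen_in[OF is_cring assms(1)] assms(2)] by simp
  then show ?thesis by (simp add: cls_def proj_def)
qed

end

section \<open>Tensors\<close>

context presentation
begin

definition good :: "('a, 'w, 'm) module_scheme \<Rightarrow> ('x \<Rightarrow> 'w) \<Rightarrow> bool" where
  "good W \<phi> \<longleftrightarrow> \<phi> \<in> X \<rightarrow> carrier W \<and> (\<forall>\<rho>\<in>Rel. lin_ext K W \<phi> \<rho> = \<zero>\<^bsub>W\<^esub>)"

lemma good_hom: "\<lbrakk>module K W; good W \<phi>\<rbrakk> \<Longrightarrow> lift K W \<phi> \<in> module_hom K Q W"
  using lift_hom[of W \<phi>] by (auto simp: good_def)

lemma good_cls: "\<lbrakk>module K W; good W \<phi>; x \<in> X\<rbrakk> \<Longrightarrow> lift K W \<phi> (cls x) = \<phi> x"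
  using lift_cls[of W \<phi> x] by (auto simp: good_def)

text \<open>Both sides of each linearity law in the parameter are homomorphisms in \<open>T\<close>,
  so it is enough to compare them on generators. This is what makes nested \<open>lift\<close>s
  multilinear.\<close>

lemma lift_param:
  assumes V: "module K V" and W: "module K W" and \<phi>: "\<And>v. v \<in> carrier V \<Longrightarrow> good W (\<phi> v)"
    and h: "\<And>x. x \<in> X \<Longrightarrow> (\<lambda>v. \<phi> v x) \<in> module_hom K V W" and T: "T \<in> carrier Q"
  shows "(\<lambda>v. lift K W (\<phi> v) T) \<in> module_hom K V W"
proof -
  interpret V: module K V by fact
  show ?thesis
  proof (rule module_homI)
    fix v assume v: "v \<in> carrier V"
    show "lift K W (\<phi> v) T \<in> carrier W" by (rule module_hom_in[OF good_hom[OF W \<phi>[OF v]] T])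
  next
    fix v w assume vw: "v \<in> carrier V" "w \<in> carrier V"
    then have vw': "v \<oplus>\<^bsub>V\<^esub> w \<in> carrier V" by simp
    show "lift K W (\<phi> (v \<oplus>\<^bsub>V\<^esub> w)) T = lift K W (\<phi> v) T \<oplus>\<^bsub>W\<^esub> lift K W (\<phi> w) T"
      by (rule hom_eqI[OF W good_hom[OF W \<phi>[OF vw']] module_hom_plus[OF W good_hom[OF W \<phi>[OF vw(1)]] good_hom[OF W \<phi>[OF vw(2)]]] _ T])
        (simp add: good_cls[OF W \<phi>] vw vw' module_hom_add[OF h])
  next
    fix a v assume a: "a \<in> carrier K" and v: "v \<in> carrier V"
    then have av: "a \<odot>\<^bsub>V\<^esub> v \<in> carrier V" by simp
    show "lift K W (\<phi> (a \<odot>\<^bsub>V\<^esub> v)) T = a \<odot>\<^bsub>W\<^esub> lift K W (\<phi> v) T"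
      by (rule hom_eqI[OF W good_hom[OF W \<phi>[OF av]] module_hom_scale[OF W good_hom[OF W \<phi>[OF v]] a] _ T])
        (simp add: good_cls[OF W \<phi>] v av module_hom_smult[OF h] a)
  qed
qed

text \<open>Every relation used for tensors has one of these two shapes: a sum, or a scalar
  multiple, in one argument.\<close>

lemma good_relation:
  assumes W: "module K W" and \<phi>: "\<phi> \<in> X \<rightarrow> carrier W" and x: "x \<in> X"
  shows "\<lbrakk>y \<in> X; z \<in> X; \<phi> x = \<phi> y \<oplus>\<^bsub>W\<^esub> \<phi> z\<rbrakk> \<Longrightarrow> lin_ext K W \<phi> (free_gen K x \<ominus>\<^bsub>F\<^esub> (free_gen K y \<oplus>\<^bsub>F\<^esub> free_gen K z)) = \<zero>\<^bsub>W\<^esub>"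
    and "\<lbrakk>y \<in> X; a \<in> carrier K; \<phi> x = a \<odot>\<^bsub>W\<^esub> \<phi> y\<rbrakk> \<Longrightarrow> lin_ext K W \<phi> (free_gen K x \<ominus>\<^bsub>F\<^esub> (a \<odot>\<^bsub>F\<^esub> free_gen K y)) = \<zero>\<^bsub>W\<^esub>"
proof -
  interpret W: module K W by fact
  interpret E: mod_hom K F W "lin_ext K W \<phi>"
    by (intro mod_hom.intro mod_hom_axioms.intro F.module_axioms W lin_ext_hom[OF W \<phi>])
  note g = free_gen_in[OF is_cring] lin_ext_gen[OF W \<phi>]
  have in': "\<phi> y \<in> carrier W" if "y \<in> X" for y using \<phi> that by auto
  have sub: "w \<ominus>\<^bsub>W\<^esub> w = \<zero>\<^bsub>W\<^esub>" if "w \<in> carrier W" for w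
    using that by (simp add: a_minus_def W.M.r_neg)
  show "lin_ext K W \<phi> (free_gen K x \<ominus>\<^bsub>F\<^esub> (free_gen K y \<oplus>\<^bsub>F\<^esub> free_gen K z)) = \<zero>\<^bsub>W\<^esub>"
    if "y \<in> X" "z \<in> X" "\<phi> x = \<phi> y \<oplus>\<^bsub>W\<^esub> \<phi> z"
    using that x by (simp add: g in' sub)
  show "lin_ext K W \<phi> (free_gen K x \<ominus>\<^bsub>F\<^esub> (a \<odot>\<^bsub>F\<^esub> free_gen K y)) = \<zero>\<^bsub>W\<^esub>"
    if "y \<in> X" "a \<in> carrier K" "\<phi> x = a \<odot>\<^bsub>W\<^esub> \<phi> y"
    using that x by (simp add: g in' sub)
qed

lemma cls_rel:
  assumes x: "x \<in> X"
  shows "\<lbrakk>y \<in> X; z \<in> X; free_gen K x \<ominus>\<^bsub>F\<^esub> (free_gen K y \<oplus>\<^bsub>F\<^esub> free_gen K z) \<in> Rel\<rbrakk> \<Longrightarrow> cls x = cls y \<oplus>\<^bsub>Q\<^esub> cls z"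
    and "\<lbrakk>y \<in> X; a \<in> carrier K; free_gen K x \<ominus>\<^bsub>F\<^esub> (a \<odot>\<^bsub>F\<^esub> free_gen K y) \<in> Rel\<rbrakk> \<Longrightarrow> cls x = a \<odot>\<^bsub>Q\<^esub> cls y"
proof -
  have g: "free_gen K u \<in> carrier F" if "u \<in> X" for u using free_gen_in[OF is_cring that] .
  have c: "cls y = proj (free_gen K y)" for y by (simp add: cls_def proj_def)
  show "cls x = cls y \<oplus>\<^bsub>Q\<^esub> cls z" if "y \<in> X" "z \<in> X" "free_gen K x \<ominus>\<^bsub>F\<^esub> (free_gen K y \<oplus>\<^bsub>F\<^esub> free_gen K z) \<in> Rel"
    using cls_relation[OF x F.M.a_closed[OF g[OF that(1)] g[OF that(2)]] that(3)] quot_simps(3)[OF g[OF that(1)] g[OF that(2)]]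
    by (simp only: c)
  show "cls x = a \<odot>\<^bsub>Q\<^esub> cls y" if "y \<in> X" "a \<in> carrier K" "free_gen K x \<ominus>\<^bsub>F\<^esub> (a \<odot>\<^bsub>F\<^esub> free_gen K y) \<in> Rel"
    using cls_relation[OF x F.smult_closed[OF that(2) g[OF that(1)]] that(3)] quot_smult[OF that(2) g[OF that(1)]]
    by (simp only: c)
qed

end

subsection \<open>Tensor powers\<close>

text \<open>One entry is varied by list update, the same form in which
  \<open>multilinear_relations\<close> writes its generators.\<close>

definition mlin :: "('a, 'k) ring_scheme \<Rightarrow> nat \<Rightarrow> ('a, 'v, 'm) module_scheme \<Rightarrow> ('a, 'w, 'n) module_scheme \<Rightarrow> ('v list \<Rightarrow> 'w) \<Rightarrow> bool" where
  "mlin K n V W \<phi> \<longleftrightarrow> (\<forall>xs\<in>vectors n V. \<phi> xs \<in> carrier W) \<and>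
     (\<forall>xs\<in>vectors n V. \<forall>i<n. (\<lambda>v. \<phi> (xs[i := v])) \<in> module_hom K V W)"

lemma vectors_update: "\<lbrakk>xs \<in> vectors n V; v \<in> carrier V\<rbrakk> \<Longrightarrow> xs[i := v] \<in> vectors n V"
  using set_update_subset_insert[of xs i v] by (auto simp: vectors_def)

lemma vectors_append: "\<lbrakk>xs \<in> vectors m V; ys \<in> vectors n V\<rbrakk> \<Longrightarrow> xs @ ys \<in> vectors (m + n) V"
  by (auto simp: vectors_def)

lemma vectors_nth: "\<lbrakk>xs \<in> vectors n V; i < n\<rbrakk> \<Longrightarrow> xs ! i \<in> carrier V"
  by (auto simp: vectors_def)

lemma vectors_1: "xs \<in> vectors (Suc 0) V \<longleftrightarrow> (\<exists>a\<in>carrier V. xs = [a])"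
  by (auto simp: vectors_def length_Suc_conv)

lemma vectors_2: "xs \<in> vectors 2 V \<longleftrightarrow> (\<exists>a\<in>carrier V. \<exists>b\<in>carrier V. xs = [a, b])"
  by (auto simp: vectors_def numeral_2_eq_2 length_Suc_conv)

lemma vectors_3: "xs \<in> vectors 3 V \<longleftrightarrow> (\<exists>a\<in>carrier V. \<exists>b\<in>carrier V. \<exists>c\<in>carrier V. xs = [a, b, c])"
  by (auto simp: vectors_def numeral_3_eq_3 length_Suc_conv)

lemma mlinD:
  assumes "mlin K n V W \<phi>"
  shows "xs \<in> vectors n V \<Longrightarrow> \<phi> xs \<in> carrier W" "\<lbrakk>xs \<in> vectors n V; i < n\<rbrakk> \<Longrightarrow> (\<lambda>v. \<phi> (xs[i := v])) \<in> module_hom K V W"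
  using assms by (auto simp: mlin_def)

lemma mlin_cong:
  assumes "module K V" and eq: "\<And>xs. xs \<in> vectors n V \<Longrightarrow> \<phi> xs = \<psi> xs" and "mlin K n V W \<phi>"
  shows "mlin K n V W \<psi>"
  unfolding mlin_def
proof (intro conjI ballI allI impI)
  fix xs assume xs: "xs \<in> vectors n V"
  show "\<psi> xs \<in> carrier W" using mlinD(1)[OF assms(3) xs] eq[OF xs] by simp
  fix i assume "i < n"
  have "(\<lambda>v. \<phi> (xs[i := v])) \<in> module_hom K V W \<longleftrightarrow> (\<lambda>v. \<psi> (xs[i := v])) \<in> module_hom K V W"
    by (rule module_hom_cong[OF _ assms(1)]) (simp add: eq vectors_update[OF xs])
  then show "(\<lambda>v. \<psi> (xs[i := v])) \<in> module_hom K V W"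
    using mlinD(2)[OF assms(3) xs \<open>i < n\<close>] by simp
qed

lemma mlin_comp:
  assumes "mlin K n V W \<phi>" and g: "g \<in> module_hom K W W'"
  shows "mlin K n V W' (\<lambda>xs. g (\<phi> xs))"
  unfolding mlin_def using mlinD[OF assms(1)] module_hom_in[OF g] module_hom_comp[OF _ g] by blast

locale tensor_pres = V: module K V for K :: "('a, 'k) ring_scheme" and V :: "('a, 'v, 'm) module_scheme" +
  fixes n :: nat
begin

sublocale presentation K "vectors n V" "multilinear_relations K n V"
proof
  interpret F: module K "free_module K (vectors n V)" by (rule module_free_module[OF V.R.is_cring])
  note g = free_gen_in[OF V.R.is_cring]
  show "multilinear_relations K n V \<subseteq> carrier (free_module K (vectors n V))"
    unfolding multilinear_relations_def Let_def
    by (auto intro!: F.M.minus_closed F.M.a_closed F.smult_closed g vectors_update)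
qed

lemma tensor_space_eq: "tensor_space K n V = Q"
  by (simp add: tensor_space_def multilinear_submodule_def)

lemma tensor_eq:
  assumes "xs \<in> vectors n V" shows "tensor K V xs = cls xs"
proof -
  have "length xs = n" using assms by (simp add: vectors_def)
  then show ?thesis by (simp only: tensor_def multilinear_submodule_def cls_def)
qed

lemma mlin_good:
  assumes W: "module K W" and \<phi>: "mlin K n V W \<phi>"
  shows "good W \<phi>"
proof -
  have \<phi>in: "\<phi> \<in> vectors n V \<rightarrow> carrier W" using mlinD(1)[OF \<phi>] by auto
  have "lin_ext K W \<phi> \<rho> = \<zero>\<^bsub>W\<^esub>" if \<rho>: "\<rho> \<in> multilinear_relations K n V" for \<rho>
    using \<rho> unfolding multilinear_relations_def Let_def
  proof (elim UnE CollectE exE conjE)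
    fix xs i v w assume \<rho>: "\<rho> = free_gen K (xs[i := v \<oplus>\<^bsub>V\<^esub> w]) \<ominus>\<^bsub>F\<^esub> (free_gen K (xs[i := v]) \<oplus>\<^bsub>F\<^esub> free_gen K (xs[i := w]))"
      and xs: "xs \<in> vectors n V" "i < n" "v \<in> carrier V" "w \<in> carrier V"
    show ?thesis
      unfolding \<rho> by (rule good_relation[OF W \<phi>in]) (use xs module_hom_add[OF mlinD(2)[OF \<phi> xs(1,2)] xs(3,4)] in \<open>auto simp: vectors_update\<close>)
  next
    fix xs i a v assume \<rho>: "\<rho> = free_gen K (xs[i := a \<odot>\<^bsub>V\<^esub> v]) \<ominus>\<^bsub>F\<^esub> a \<odot>\<^bsub>F\<^esub> free_gen K (xs[i := v])"
      and xs: "xs \<in> vectors n V" "i < n" "a \<in> carrier K" "v \<in> carrier V"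
    show ?thesis
      unfolding \<rho> by (rule good_relation[OF W \<phi>in]) (use xs module_hom_smult[OF mlinD(2)[OF \<phi> xs(1,2)] xs(3,4)] in \<open>auto simp: vectors_update\<close>)
  qed
  with \<phi>in show ?thesis by (simp add: good_def)
qed

lemma mlin_tensor: "mlin K n V (tensor_space K n V) (tensor K V)"
  unfolding mlin_def
proof (intro conjI ballI allI impI)
  fix xs assume xs: "xs \<in> vectors n V"
  then show "tensor K V xs \<in> carrier (tensor_space K n V)" by (simp add: tensor_space_eq tensor_eq cls_in)
  fix i assume i: "i < n"
  show "(\<lambda>v. tensor K V (xs[i := v])) \<in> module_hom K V (tensor_space K n V)"
    unfolding tensor_space_eq
  proof (rule module_homI)
    fix v w assume vw: "v \<in> carrier V" "w \<in> carrier V"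
    show "tensor K V (xs[i := v]) \<in> carrier Q" using vw by (simp add: tensor_eq cls_in vectors_update[OF xs])
    have "cls (xs[i := v \<oplus>\<^bsub>V\<^esub> w]) = cls (xs[i := v]) \<oplus>\<^bsub>Q\<^esub> cls (xs[i := w])"
      by (rule cls_rel) (use xs i vw in \<open>auto simp: vectors_update multilinear_relations_def Let_def\<close>)
    then show "tensor K V (xs[i := v \<oplus>\<^bsub>V\<^esub> w]) = tensor K V (xs[i := v]) \<oplus>\<^bsub>Q\<^esub> tensor K V (xs[i := w])"
      using vw by (simp add: tensor_eq vectors_update[OF xs])
  next
    fix a v assume av: "a \<in> carrier K" "v \<in> carrier V"
    have "free_gen K (xs[i := a \<odot>\<^bsub>V\<^esub> v]) \<ominus>\<^bsub>F\<^esub> (a \<odot>\<^bsub>F\<^esub> free_gen K (xs[i := v])) \<in> multilinear_relations K n V"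
      unfolding multilinear_relations_def Let_def using xs i av by blast
    then have "cls (xs[i := a \<odot>\<^bsub>V\<^esub> v]) = a \<odot>\<^bsub>Q\<^esub> cls (xs[i := v])"
      by (intro cls_rel(2)) (use xs i av in \<open>auto simp: vectors_update\<close>)
    then show "tensor K V (xs[i := a \<odot>\<^bsub>V\<^esub> v]) = a \<odot>\<^bsub>Q\<^esub> tensor K V (xs[i := v])"
      using av by (simp add: tensor_eq vectors_update[OF xs])
  qed
qed

end

lemma tensor_presI: "module K V \<Longrightarrow> tensor_pres K V"
  by (simp add: tensor_pres_def)

lemma module_tensor_space:
  assumes "module K V" shows "module K (tensor_space K n V)"
proof -
  interpret tensor_pres K V n by (rule tensor_presI[OF assms])
  show ?thesis unfolding tensor_space_eq by (rule module_quot)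
qed

lemma mlin_tensor: "module K V \<Longrightarrow> mlin K n V (tensor_space K n V) (tensor K V)"
  by (rule tensor_pres.mlin_tensor[OF tensor_presI])

lemma tensor_in: "\<lbrakk>module K V; xs \<in> vectors n V\<rbrakk> \<Longrightarrow> tensor K V xs \<in> carrier (tensor_space K n V)"
  using mlinD(1)[OF mlin_tensor] .

lemma
  assumes V: "module K V" and W: "module K W" and \<phi>: "mlin K n V W \<phi>"
  shows lift_tensor_hom: "lift K W \<phi> \<in> module_hom K (tensor_space K n V) W"
    and lift_tensor: "xs \<in> vectors n V \<Longrightarrow> lift K W \<phi> (tensor K V xs) = \<phi> xs"
proof -
  interpret tensor_pres K V n by (rule tensor_presI[OF V])
  show "lift K W \<phi> \<in> module_hom K (tensor_space K n V) W"
    unfolding tensor_space_eq by (rule good_hom[OF W mlin_good[OF W \<phi>]])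
  show "xs \<in> vectors n V \<Longrightarrow> lift K W \<phi> (tensor K V xs) = \<phi> xs"
    by (simp add: tensor_eq good_cls[OF W mlin_good[OF W \<phi>]])
qed

lemmas lift_tensor_in = module_hom_in[OF lift_tensor_hom]

lemma tensor_hom_eqI:
  assumes V: "module K V" and W: "module K W"
    and f: "f \<in> module_hom K (tensor_space K n V) W" and g: "g \<in> module_hom K (tensor_space K n V) W"
    and eq: "\<And>xs. xs \<in> vectors n V \<Longrightarrow> f (tensor K V xs) = g (tensor K V xs)" and T: "T \<in> carrier (tensor_space K n V)"
  shows "f T = g T"
proof -
  interpret tensor_pres K V n by (rule tensor_presI[OF V])
  show ?thesis
    by (rule hom_eqI[OF W f[unfolded tensor_space_eq] g[unfolded tensor_space_eq] _ T[unfolded tensor_space_eq]])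
      (simp add: tensor_eq[symmetric] eq)
qed

lemma lift_tensor_comp:
  assumes V: "module K V" and W: "module K W" and W': "module K W'" and g: "g \<in> module_hom K W W'"
    and \<phi>: "mlin K n V W \<phi>" and T: "T \<in> carrier (tensor_space K n V)"
  shows "g (lift K W \<phi> T) = lift K W' (\<lambda>xs. g (\<phi> xs)) T"
  by (rule tensor_hom_eqI[OF V W' module_hom_comp[OF lift_tensor_hom[OF V W \<phi>] g] lift_tensor_hom[OF V W' mlin_comp[OF \<phi> g]] _ T])
    (simp add: lift_tensor[OF V W \<phi>] lift_tensor[OF V W' mlin_comp[OF \<phi> g]])

lemma lift_tensor_cong:
  assumes V: "module K V" and W: "module K W" and \<phi>: "mlin K n V W \<phi>"
    and eq: "\<And>xs. xs \<in> vectors n V \<Longrightarrow> \<phi> xs = \<psi> xs" and T: "T \<in> carrier (tensor_space K n V)"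
  shows "lift K W \<phi> T = lift K W \<psi> T"
  using eq lift_tensor[OF V W \<phi>] lift_tensor[OF V W mlin_cong[OF V eq \<phi>]]
  by (intro tensor_hom_eqI[OF V W lift_tensor_hom[OF V W \<phi>] lift_tensor_hom[OF V W mlin_cong[OF V eq \<phi>]] _ T]) auto

lemma lift_tensor_param:
  assumes V: "module K V" and U: "module K U" and W: "module K W" and \<phi>: "\<And>v. v \<in> carrier U \<Longrightarrow> mlin K n V W (\<phi> v)"
    and h: "\<And>xs. xs \<in> vectors n V \<Longrightarrow> (\<lambda>v. \<phi> v xs) \<in> module_hom K U W" and T: "T \<in> carrier (tensor_space K n V)"
  shows "(\<lambda>v. lift K W (\<phi> v) T) \<in> module_hom K U W"
proof -
  interpret tensor_pres K V n by (rule tensor_presI[OF V])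
  show ?thesis
    by (rule lift_param[OF U W mlin_good[OF W \<phi>] h T[unfolded tensor_space_eq]]) auto
qed

text \<open>Currying of a multilinear map at position \<open>m\<close>; in the second part the right
  block is contracted with a fixed tensor, which is the outer layer of a nested
  \<open>lift\<close>.\<close>

lemma mlin_append:
  assumes V: "module K V" and W: "module K W" and G: "mlin K (m + n) V W G"
  shows "xs \<in> vectors m V \<Longrightarrow> mlin K n V W (\<lambda>ys. G (xs @ ys))"
    and "Y \<in> carrier (tensor_space K n V) \<Longrightarrow> mlin K m V W (\<lambda>xs. lift K W (\<lambda>ys. G (xs @ ys)) Y)"
proof -
  show 1: "mlin K n V W (\<lambda>ys. G (xs @ ys))" if xs: "xs \<in> vectors m V" for xs
    unfolding mlin_def
  proof (intro conjI ballI allI impI)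
    fix ys i assume ys: "ys \<in> vectors n V" and i: "i < n"
    have "length xs = m" using xs by (simp add: vectors_def)
    then show "(\<lambda>v. G (xs @ ys[i := v])) \<in> module_hom K V W"
      using mlinD(2)[OF G vectors_append[OF xs ys], of "m + i"] i by (simp add: list_update_append)
  qed (auto intro: mlinD(1)[OF G] vectors_append xs)
  assume Y: "Y \<in> carrier (tensor_space K n V)"
  show "mlin K m V W (\<lambda>xs. lift K W (\<lambda>ys. G (xs @ ys)) Y)"
    unfolding mlin_def
  proof (intro conjI ballI allI impI)
    fix xs assume xs: "xs \<in> vectors m V"
    show "lift K W (\<lambda>ys. G (xs @ ys)) Y \<in> carrier W" by (rule lift_tensor_in[OF V W 1[OF xs] Y])
    fix i assume i: "i < m"
    show "(\<lambda>v. lift K W (\<lambda>ys. G (xs[i := v] @ ys)) Y) \<in> module_hom K V W"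
    proof (rule lift_tensor_param[OF V V W 1 _ Y])
      fix ys assume ys: "ys \<in> vectors n V"
      have "length xs = m" using xs by (simp add: vectors_def)
      then show "(\<lambda>v. G (xs[i := v] @ ys)) \<in> module_hom K V W"
        using mlinD(2)[OF G vectors_append[OF xs ys], of i] i by (simp add: list_update_append1)
    qed (rule vectors_update[OF xs])
  qed
qed

lemma
  assumes V: "module K V" and X: "X \<in> carrier (tensor_space K m V)" and Y: "Y \<in> carrier (tensor_space K n V)"
  shows tensor_append_in: "tensor_append K V m n X Y \<in> carrier (tensor_space K (m + n) V)"
    and lift_tensor_append: "\<lbrakk>module K W; mlin K (m + n) V W G\<rbrakk> \<Longrightarrow>
      lift K W G (tensor_append K V m n X Y) = lift K W (\<lambda>xs. lift K W (\<lambda>ys. G (xs @ ys)) Y) X"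
proof -
  note T = module_tensor_space[OF V, of "m + n"] and t = mlin_tensor[OF V, of "m + n"]
  note t1 = mlin_append(1)[OF V T t] and t2 = mlin_append(2)[OF V T t Y]
  show "tensor_append K V m n X Y \<in> carrier (tensor_space K (m + n) V)"
    unfolding tensor_append_def by (rule lift_tensor_in[OF V T t2 X])
  assume W: "module K W" and G: "mlin K (m + n) V W G"
  note g = lift_tensor_hom[OF V W G]
  have "lift K W G (tensor_append K V m n X Y) = lift K W (\<lambda>xs. lift K W G (lift K (tensor_space K (m + n) V) (\<lambda>ys. tensor K V (xs @ ys)) Y)) X"
    unfolding tensor_append_def by (rule lift_tensor_comp[OF V T W g t2 X])
  also have "\<dots> = lift K W (\<lambda>xs. lift K W (\<lambda>ys. G (xs @ ys)) Y) X"
  proof (rule lift_tensor_cong[OF V W mlin_comp[OF t2 g] _ X])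
    fix xs assume xs: "xs \<in> vectors m V"
    have "lift K W G (lift K (tensor_space K (m + n) V) (\<lambda>ys. tensor K V (xs @ ys)) Y) = lift K W (\<lambda>ys. lift K W G (tensor K V (xs @ ys))) Y"
      by (rule lift_tensor_comp[OF V T W g t1[OF xs] Y])
    also have "\<dots> = lift K W (\<lambda>ys. G (xs @ ys)) Y"
      by (rule lift_tensor_cong[OF V W mlin_comp[OF t1[OF xs] g] _ Y]) (simp add: lift_tensor[OF V W G] vectors_append[OF xs])
    finally show "lift K W G (lift K (tensor_space K (m + n) V) (\<lambda>ys. tensor K V (xs @ ys)) Y) = lift K W (\<lambda>ys. G (xs @ ys)) Y" .
  qed
  finally show "lift K W G (tensor_append K V m n X Y) = lift K W (\<lambda>xs. lift K W (\<lambda>ys. G (xs @ ys)) Y) X" .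
qed

lemma tensor_append_hom:
  assumes V: "module K V"
  shows "Y \<in> carrier (tensor_space K n V) \<Longrightarrow> (\<lambda>X. tensor_append K V m n X Y) \<in> module_hom K (tensor_space K m V) (tensor_space K (m + n) V)"
    and "X \<in> carrier (tensor_space K m V) \<Longrightarrow> (\<lambda>Y. tensor_append K V m n X Y) \<in> module_hom K (tensor_space K n V) (tensor_space K (m + n) V)"
proof -
  note T = module_tensor_space[OF V, of "m + n"] and t = mlin_tensor[OF V, of "m + n"]
  note t1 = mlin_append(1)[OF V T t] and t2 = mlin_append(2)[OF V T t]
  show "(\<lambda>X. tensor_append K V m n X Y) \<in> module_hom K (tensor_space K m V) (tensor_space K (m + n) V)"
    if "Y \<in> carrier (tensor_space K n V)"
    unfolding tensor_append_def by (rule lift_tensor_hom[OF V T t2[OF that]])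
  show "(\<lambda>Y. tensor_append K V m n X Y) \<in> module_hom K (tensor_space K n V) (tensor_space K (m + n) V)"
    if X: "X \<in> carrier (tensor_space K m V)"
    unfolding tensor_append_def
    by (rule lift_tensor_param[OF V module_tensor_space[OF V] T t2 lift_tensor_hom[OF V T t1] X])
qed

lemma mlin_3I:
  assumes "\<And>b c. \<lbrakk>b \<in> carrier V; c \<in> carrier V\<rbrakk> \<Longrightarrow> (\<lambda>a. T a b c) \<in> module_hom K V W"
    "\<And>a c. \<lbrakk>a \<in> carrier V; c \<in> carrier V\<rbrakk> \<Longrightarrow> (\<lambda>b. T a b c) \<in> module_hom K V W"
    "\<And>a b. \<lbrakk>a \<in> carrier V; b \<in> carrier V\<rbrakk> \<Longrightarrow> (\<lambda>c. T a b c) \<in> module_hom K V W"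
  shows "mlin K 3 V W (\<lambda>xs. T (xs ! 0) (xs ! 1) (xs ! 2))"
  unfolding mlin_def
proof (intro conjI ballI allI impI)
  fix xs assume "xs \<in> vectors 3 V"
  then obtain a b c where ab: "a \<in> carrier V" "b \<in> carrier V" "c \<in> carrier V" "xs = [a, b, c]" by (auto simp: vectors_3)
  note h = assms(1)[OF ab(2,3)] assms(2)[OF ab(1,3)] assms(3)[OF ab(1,2)]
  show "T (xs ! 0) (xs ! 1) (xs ! 2) \<in> carrier W" using module_hom_in[OF h(1) ab(1)] ab by simp
  fix i :: nat assume "i < 3"
  then consider "i = 0" | "i = 1" | "i = 2" by linarith
  then show "(\<lambda>v. T (xs[i := v] ! 0) (xs[i := v] ! 1) (xs[i := v] ! 2)) \<in> module_hom K V W"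
    using h ab by cases simp_all
qed

definition bi2 :: "('a, 'k) ring_scheme \<Rightarrow> ('a, 'v, 'm) module_scheme \<Rightarrow> ('a, 'w, 'n) module_scheme \<Rightarrow> ('v \<Rightarrow> 'v \<Rightarrow> 'w) \<Rightarrow> bool" where
  "bi2 K V W f \<longleftrightarrow> (\<forall>b\<in>carrier V. (\<lambda>a. f a b) \<in> module_hom K V W) \<and> (\<forall>a\<in>carrier V. (\<lambda>b. f a b) \<in> module_hom K V W)"

lemma bi2_mlin:
  assumes f: "bi2 K V W f" shows "mlin K 2 V W (\<lambda>xs. f (xs ! 0) (xs ! 1))"
  unfolding mlin_def
proof (intro conjI ballI allI impI)
  fix xs assume "xs \<in> vectors 2 V"
  then obtain a b where ab: "a \<in> carrier V" "b \<in> carrier V" "xs = [a, b]" by (auto simp: vectors_2)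
  have h: "(\<lambda>a. f a b) \<in> module_hom K V W" "(\<lambda>b. f a b) \<in> module_hom K V W"
    using f ab by (auto simp: bi2_def)
  show "f (xs ! 0) (xs ! 1) \<in> carrier W" using module_hom_in[OF h(1) ab(1)] ab by simp
  fix i :: nat assume "i < 2"
  then consider "i = 0" | "i = 1" by linarith
  then show "(\<lambda>v. f (xs[i := v] ! 0) (xs[i := v] ! 1)) \<in> module_hom K V W"
    using h ab by cases simp_all
qed

lemma tensor1_hom:
  assumes V: "module K V" shows "(\<lambda>b. tensor K V [b]) \<in> module_hom K V (tensor_space K 1 V)"
proof -
  interpret V: module K V by fact
  show ?thesis
    using mlinD(2)[OF mlin_tensor[OF V], of "[\<zero>\<^bsub>V\<^esub>]" 1 0] by (simp add: vectors_def)
qed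

text \<open>A multilinear map on \<open>f \<otimes> id\<close> or \<open>id \<otimes> f\<close>
  becomes a two-fold \<open>lift\<close>: it is pushed through the outer \<open>lift\<close>, and
  the tensor of length one is then evaluated. Coassociativity and the twist equation are read off
  through these two rules.\<close>

lemma
  assumes V: "module K V" and f: "f \<in> module_hom K V (tensor_space K m V)" and X: "X \<in> carrier (tensor_space K 2 V)"
  shows tensor_left_hom: "tensor_left K V m f \<in> module_hom K (tensor_space K 2 V) (tensor_space K (m + 1) V)"
    and tensor_left_in: "tensor_left K V m f X \<in> carrier (tensor_space K (m + 1) V)"
    and tensor_right_in: "tensor_right K V m f X \<in> carrier (tensor_space K (1 + m) V)"
    and lift_tensor_left: "\<lbrakk>module K W; mlin K (m + 1) V W G\<rbrakk> \<Longrightarrow>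
      lift K W G (tensor_left K V m f X) = lift K W (\<lambda>xs. lift K W (\<lambda>ys. G (ys @ [xs ! 1])) (f (xs ! 0))) X"
    and lift_tensor_right: "\<lbrakk>module K W; mlin K (1 + m) V W G\<rbrakk> \<Longrightarrow>
      lift K W G (tensor_right K V m f X) = lift K W (\<lambda>xs. lift K W (\<lambda>ys. G (xs ! 0 # ys)) (f (xs ! 1))) X"
proof -
  have t: "tensor K V [b] \<in> carrier (tensor_space K 1 V)" if "b \<in> carrier V" for b
    using that by (intro tensor_in V) (auto simp: vectors_1)
  have l: "mlin K 2 V (tensor_space K (m + 1) V) (\<lambda>xs. tensor_append K V m 1 (f (xs ! 0)) (tensor K V [xs ! 1]))"
    by (rule bi2_mlin) (unfold bi2_def, intro conjI ballI module_hom_comp[OF f tensor_append_hom(1)[OF V t]]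
      module_hom_comp[OF tensor1_hom[OF V] tensor_append_hom(2)[OF V module_hom_in[OF f]]])
  have r: "mlin K 2 V (tensor_space K (1 + m) V) (\<lambda>xs. tensor_append K V 1 m (tensor K V [xs ! 0]) (f (xs ! 1)))"
    by (rule bi2_mlin) (unfold bi2_def, intro conjI ballI module_hom_comp[OF f tensor_append_hom(2)[OF V t]]
      module_hom_comp[OF tensor1_hom[OF V] tensor_append_hom(1)[OF V module_hom_in[OF f]]])
  note T = module_tensor_space[OF V]
  show "tensor_left K V m f \<in> module_hom K (tensor_space K 2 V) (tensor_space K (m + 1) V)"
    unfolding tensor_left_def by (rule lift_tensor_hom[OF V T l])
  show "tensor_left K V m f X \<in> carrier (tensor_space K (m + 1) V)"
    unfolding tensor_left_def by (rule lift_tensor_in[OF V T l X])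
  show "tensor_right K V m f X \<in> carrier (tensor_space K (1 + m) V)"
    unfolding tensor_right_def by (rule lift_tensor_in[OF V T r X])
  show "lift K W G (tensor_left K V m f X) = lift K W (\<lambda>xs. lift K W (\<lambda>ys. G (ys @ [xs ! 1])) (f (xs ! 0))) X"
    if W: "module K W" and G: "mlin K (m + 1) V W G"
  proof -
    note g = lift_tensor_hom[OF V W G]
    have "lift K W G (tensor_left K V m f X) = lift K W (\<lambda>xs. lift K W G (tensor_append K V m 1 (f (xs ! 0)) (tensor K V [xs ! 1]))) X"
      unfolding tensor_left_def by (rule lift_tensor_comp[OF V T W g l X])
    also have "\<dots> = lift K W (\<lambda>xs. lift K W (\<lambda>ys. G (ys @ [xs ! 1])) (f (xs ! 0))) X"
    proof (rule lift_tensor_cong[OF V W mlin_comp[OF l g] _ X])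
      fix xs assume xs: "xs \<in> vectors 2 V"
      then have xs': "xs ! 0 \<in> carrier V" "xs ! 1 \<in> carrier V" by (auto simp: vectors_2)
      then have v1: "[xs ! 1] \<in> vectors 1 V" by (simp add: vectors_def)
      note fx = module_hom_in[OF f xs'(1)]
      have "lift K W G (tensor_append K V m 1 (f (xs ! 0)) (tensor K V [xs ! 1]))
        = lift K W (\<lambda>ys. lift K W (\<lambda>zs. G (ys @ zs)) (tensor K V [xs ! 1])) (f (xs ! 0))"
        by (rule lift_tensor_append[OF V fx t[OF xs'(2)] W G])
      also have "\<dots> = lift K W (\<lambda>ys. G (ys @ [xs ! 1])) (f (xs ! 0))"
        by (rule lift_tensor_cong[OF V W mlin_append(2)[OF V W G t[OF xs'(2)]] _ fx])
          (rule lift_tensor[OF V W mlin_append(1)[OF V W G] v1])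
      finally show "lift K W G (tensor_append K V m 1 (f (xs ! 0)) (tensor K V [xs ! 1])) = lift K W (\<lambda>ys. G (ys @ [xs ! 1])) (f (xs ! 0))" .
    qed
    finally show ?thesis .
  qed
  show "lift K W G (tensor_right K V m f X) = lift K W (\<lambda>xs. lift K W (\<lambda>ys. G (xs ! 0 # ys)) (f (xs ! 1))) X"
    if W: "module K W" and G: "mlin K (1 + m) V W G"
  proof -
    note g = lift_tensor_hom[OF V W G]
    have "lift K W G (tensor_right K V m f X) = lift K W (\<lambda>xs. lift K W G (tensor_append K V 1 m (tensor K V [xs ! 0]) (f (xs ! 1)))) X"
      unfolding tensor_right_def by (rule lift_tensor_comp[OF V T W g r X])
    also have "\<dots> = lift K W (\<lambda>xs. lift K W (\<lambda>ys. G (xs ! 0 # ys)) (f (xs ! 1))) X"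
    proof (rule lift_tensor_cong[OF V W mlin_comp[OF r g] _ X])
      fix xs assume xs: "xs \<in> vectors 2 V"
      then have xs': "xs ! 0 \<in> carrier V" "xs ! 1 \<in> carrier V" by (auto simp: vectors_2)
      then have v1: "[xs ! 0] \<in> vectors 1 V" by (simp add: vectors_def)
      note fx = module_hom_in[OF f xs'(2)]
      have "lift K W G (tensor_append K V 1 m (tensor K V [xs ! 0]) (f (xs ! 1)))
        = lift K W (\<lambda>zs. lift K W (\<lambda>ys. G (zs @ ys)) (f (xs ! 1))) (tensor K V [xs ! 0])"
        by (rule lift_tensor_append[OF V t[OF xs'(1)] fx W G])
      also have "\<dots> = lift K W (\<lambda>ys. G (xs ! 0 # ys)) (f (xs ! 1))"
        using lift_tensor[OF V W mlin_append(2)[OF V W G fx] v1] by simp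
      finally show "lift K W G (tensor_append K V 1 m (tensor K V [xs ! 0]) (f (xs ! 1))) = lift K W (\<lambda>ys. G (xs ! 0 # ys)) (f (xs ! 1))" .
    qed
    finally show ?thesis .
  qed
qed

lemma tensor_power_carrier [simp]: "carrier (tensor_power K n V) = carrier (tensor_space K n V)"
  by (simp add: tensor_power_def)

lemma map2_update:
  assumes "length xs = length ys"
  shows "map2 f (xs[i := v]) ys = (map2 f xs ys)[i := f v (ys ! i)]" "map2 f xs (ys[i := v]) = (map2 f xs ys)[i := f (xs ! i) v]"
  using assms by (cases "i < length ys"; auto intro!: nth_equalityI simp: nth_list_update)+

text \<open>The factorwise product is itself a nested \<open>lift\<close>, so a multilinear map of a
  product is the same nested \<open>lift\<close> of its values on entrywise products.\<close>

lemma
  assumes V: "module K V" and m: "bi2 K V V (\<otimes>\<^bsub>V\<^esub>)"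
    and X: "X \<in> carrier (tensor_space K n V)" and Y: "Y \<in> carrier (tensor_space K n V)"
  shows mlin_mult: "\<lbrakk>module K W; mlin K n V W G\<rbrakk> \<Longrightarrow> mlin K n V W (\<lambda>xs. lift K W (\<lambda>ys. G (map2 (\<otimes>\<^bsub>V\<^esub>) xs ys)) Y)"
    and tensor_power_mult_in: "X \<otimes>\<^bsub>tensor_power K n V\<^esub> Y \<in> carrier (tensor_space K n V)"
    and lift_tensor_mult: "\<lbrakk>module K W; mlin K n V W G\<rbrakk> \<Longrightarrow>
      lift K W G (X \<otimes>\<^bsub>tensor_power K n V\<^esub> Y) = lift K W (\<lambda>xs. lift K W (\<lambda>ys. G (map2 (\<otimes>\<^bsub>V\<^esub>) xs ys)) Y) X"
proof -
  let ?m = "(\<otimes>\<^bsub>V\<^esub>)"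
  have m2: "\<And>b. b \<in> carrier V \<Longrightarrow> (\<lambda>a. ?m a b) \<in> module_hom K V V" "\<And>a. a \<in> carrier V \<Longrightarrow> (\<lambda>b. ?m a b) \<in> module_hom K V V"
    using m by (auto simp: bi2_def)
  have vec: "map2 ?m xs ys \<in> vectors n V" if "xs \<in> vectors n V" "ys \<in> vectors n V" for xs ys
  proof -
    have "?m a b \<in> carrier V" if ab: "(a, b) \<in> set (zip xs ys)" for a b
      using set_zip_leftD[OF ab] set_zip_rightD[OF ab] \<open>xs \<in> _\<close> \<open>ys \<in> _\<close>
      by (intro module_hom_in[OF m2(1)]) (auto simp: vectors_def)
    then show ?thesis using that by (auto simp: vectors_def)
  qed
  \<comment> \<open>Generic in the type of \<open>W\<close>, because it is used both for the target
    of \<open>G\<close> and for the tensor power itself.\<close>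
  have 1: "mlin K n V W (\<lambda>ys. G (map2 ?m xs ys))" if W: "module K W" and G: "mlin K n V W G" and xs: "xs \<in> vectors n V" for W :: "('a, 'x, 'y) module_scheme" and G xs
    unfolding mlin_def
  proof (intro conjI ballI allI impI)
    fix ys assume ys: "ys \<in> vectors n V"
    show "G (map2 ?m xs ys) \<in> carrier W" by (rule mlinD(1)[OF G vec[OF xs ys]])
    fix i assume i: "i < n"
    have l: "length xs = length ys" using xs ys by (simp add: vectors_def)
    show "(\<lambda>v. G (map2 ?m xs (ys[i := v]))) \<in> module_hom K V W"
      unfolding map2_update(2)[OF l] by (rule module_hom_comp[OF m2(2)[OF vectors_nth[OF xs i]] mlinD(2)[OF G vec[OF xs ys] i]])
  qed
  have 2: "mlin K n V W (\<lambda>xs. lift K W (\<lambda>ys. G (map2 ?m xs ys)) Y)" if W: "module K W" and G: "mlin K n V W G" for W :: "('a, 'x, 'y) module_scheme" and G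
    unfolding mlin_def
  proof (intro conjI ballI allI impI)
    fix xs assume xs: "xs \<in> vectors n V"
    show "lift K W (\<lambda>ys. G (map2 ?m xs ys)) Y \<in> carrier W" by (rule lift_tensor_in[OF V W 1[OF W G xs] Y])
    fix i assume i: "i < n"
    show "(\<lambda>v. lift K W (\<lambda>ys. G (map2 ?m (xs[i := v]) ys)) Y) \<in> module_hom K V W"
    proof (rule lift_tensor_param[OF V V W 1[OF W G] _ Y])
      fix ys assume ys: "ys \<in> vectors n V"
      have l: "length xs = length ys" using xs ys by (simp add: vectors_def)
      show "(\<lambda>v. G (map2 ?m (xs[i := v]) ys)) \<in> module_hom K V W"
        unfolding map2_update(1)[OF l] by (rule module_hom_comp[OF m2(1)[OF vectors_nth[OF ys i]] mlinD(2)[OF G vec[OF xs ys] i]])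
    qed (rule vectors_update[OF xs])
  qed
  show "\<lbrakk>module K W; mlin K n V W G\<rbrakk> \<Longrightarrow> mlin K n V W (\<lambda>xs. lift K W (\<lambda>ys. G (map2 (\<otimes>\<^bsub>V\<^esub>) xs ys)) Y)"
    by (rule 2)
  note T = module_tensor_space[OF V, of n] and t = mlin_tensor[OF V, of n]
  have e: "X \<otimes>\<^bsub>tensor_power K n V\<^esub> Y = lift K (tensor_space K n V) (\<lambda>xs. lift K (tensor_space K n V) (\<lambda>ys. tensor K V (map2 ?m xs ys)) Y) X"
    by (simp add: tensor_power_def)
  show "X \<otimes>\<^bsub>tensor_power K n V\<^esub> Y \<in> carrier (tensor_space K n V)"
    unfolding e by (rule lift_tensor_in[OF V T 2[OF T t] X])
  assume W: "module K W" and G: "mlin K n V W G"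
  note g = lift_tensor_hom[OF V W G]
  have "lift K W G (X \<otimes>\<^bsub>tensor_power K n V\<^esub> Y) = lift K W (\<lambda>xs. lift K W G (lift K (tensor_space K n V) (\<lambda>ys. tensor K V (map2 ?m xs ys)) Y)) X"
    unfolding e by (rule lift_tensor_comp[OF V T W g 2[OF T t] X])
  also have "\<dots> = lift K W (\<lambda>xs. lift K W (\<lambda>ys. G (map2 ?m xs ys)) Y) X"
  proof (rule lift_tensor_cong[OF V W mlin_comp[OF 2[OF T t] g] _ X])
    fix xs assume xs: "xs \<in> vectors n V"
    have "lift K W G (lift K (tensor_space K n V) (\<lambda>ys. tensor K V (map2 ?m xs ys)) Y) = lift K W (\<lambda>ys. lift K W G (tensor K V (map2 ?m xs ys))) Y"
      by (rule lift_tensor_comp[OF V T W g 1[OF T t xs] Y])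
    also have "\<dots> = lift K W (\<lambda>ys. G (map2 ?m xs ys)) Y"
      by (rule lift_tensor_cong[OF V W mlin_comp[OF 1[OF T t xs] g] _ Y]) (simp add: lift_tensor[OF V W G] vec[OF xs])
    finally show "lift K W G (lift K (tensor_space K n V) (\<lambda>ys. tensor K V (map2 ?m xs ys)) Y) = lift K W (\<lambda>ys. G (map2 ?m xs ys)) Y" .
  qed
  finally show "lift K W G (X \<otimes>\<^bsub>tensor_power K n V\<^esub> Y) = lift K W (\<lambda>xs. lift K W (\<lambda>ys. G (map2 (\<otimes>\<^bsub>V\<^esub>) xs ys)) Y) X" .
qed

section \<open>The Sweedler calculus\<close>

text \<open>The ring has no unit, so a dual basis cannot be stated by Kronecker symbols.
  \<open>c_exp\<close> says instead that each coordinate function obeys the basis expansion.\<close>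

locale lin_frame =
  fixes H :: "'h set" and d :: nat and e :: "nat \<Rightarrow> 'h" and c :: "nat \<Rightarrow> 'h \<Rightarrow> 'r::comm_ring"
  assumes e_in [simp]: "i < d \<Longrightarrow> e i \<in> H"
    and c_exp: "\<lbrakk>x \<in> H; j < d\<rbrakk> \<Longrightarrow> c j x = (\<Sum>i<d. c i x * c j (e i))"
    and c_separates: "\<lbrakk>x \<in> H; y \<in> H; \<forall>i<d. c i x = c i y\<rbrakk> \<Longrightarrow> x = y"
begin

text \<open>\<open>H\<close> is a bare set here, without addition or scalars. Linearity means that
  the coordinate expansion holds; an operator then counts as linear (\<open>lop\<close>) if it pulls
  linear functionals back to linear ones.\<close>

definition lin :: "('h \<Rightarrow> 'r) \<Rightarrow> bool" where
  "lin f \<longleftrightarrow> (\<forall>x\<in>H. f x = (\<Sum>i<d. c i x * f (e i)))"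

definition lop :: "('h \<Rightarrow> 'h) \<Rightarrow> bool" where
  "lop t \<longleftrightarrow> (\<forall>x\<in>H. t x \<in> H) \<and> (\<forall>f. lin f \<longrightarrow> lin (\<lambda>x. f (t x)))"

definition bil :: "('h \<Rightarrow> 'h \<Rightarrow> 'r) \<Rightarrow> bool" where
  "bil F \<longleftrightarrow> (\<forall>b\<in>H. lin (\<lambda>a. F a b)) \<and> (\<forall>a\<in>H. lin (F a))"

definition tri :: "('h \<Rightarrow> 'h \<Rightarrow> 'h \<Rightarrow> 'r) \<Rightarrow> bool" where
  "tri F \<longleftrightarrow> (\<forall>b\<in>H. \<forall>k\<in>H. lin (\<lambda>a. F a b k)) \<and> (\<forall>a\<in>H. bil (F a))"

text \<open>The sum of the tensors \<open>X i \<otimes> e i\<close>, paired with a bilinear form.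
  Each element of the tensor square has this shape, so coproducts and twists are both given by
  families \<open>X\<close>.\<close>

definition tsw :: "(nat \<Rightarrow> 'h) \<Rightarrow> ('h \<Rightarrow> 'h \<Rightarrow> 'r) \<Rightarrow> 'r" where
  "tsw X F = (\<Sum>i<d. F (X i) (e i))"

lemma linD: "\<lbrakk>lin f; x \<in> H\<rbrakk> \<Longrightarrow> f x = (\<Sum>i<d. c i x * f (e i))"
  by (simp add: lin_def)

lemma lin_app: "\<lbrakk>lin f; lop t\<rbrakk> \<Longrightarrow> lin (\<lambda>x. f (t x))"
  by (simp add: lop_def)

lemma lop_in: "\<lbrakk>lop t; x \<in> H\<rbrakk> \<Longrightarrow> t x \<in> H"
  by (simp add: lop_def)

lemma lop_id: "lop (\<lambda>x. x)"
  by (simp add: lop_def)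

lemma lop_comp: "\<lbrakk>lop s; lop t\<rbrakk> \<Longrightarrow> lop (\<lambda>x. s (t x))"
  unfolding lop_def by fastforce

lemma lin_c: "j < d \<Longrightarrow> lin (c j)"
  by (simp add: lin_def c_exp[symmetric])

lemma lin_separates: "\<lbrakk>x \<in> H; y \<in> H; \<And>f. lin f \<Longrightarrow> f x = f y\<rbrakk> \<Longrightarrow> x = y"
  using c_separates lin_c by blast

lemma lin_cong: "(\<And>x. x \<in> H \<Longrightarrow> f x = g x) \<Longrightarrow> lin f \<longleftrightarrow> lin g"
  by (simp add: lin_def)

lemma lin_cmult:
  assumes "lin f" shows "lin (\<lambda>x. k * f x)"
  unfolding lin_def
proof
  fix x assume "x \<in> H"
  from linD[OF assms this] have "k * f x = k * (\<Sum>i<d. c i x * f (e i))" by (rule arg_cong)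
  then show "k * f x = (\<Sum>i<d. c i x * (k * f (e i)))"
    by (simp only: sum_distrib_left mult.left_commute)
qed

lemma lin_multc: "lin f \<Longrightarrow> lin (\<lambda>x. f x * k)"
  using lin_cmult[of f k] by (simp only: mult.commute)

lemma lin_sum:
  assumes "\<And>i. i \<in> I \<Longrightarrow> lin (f i)" shows "lin (\<lambda>x. \<Sum>i\<in>I. f i x)"
  unfolding lin_def
proof
  fix x assume "x \<in> H"
  then have "(\<Sum>i\<in>I. f i x) = (\<Sum>i\<in>I. \<Sum>j<d. c j x * f i (e j))"
    by (intro sum.cong refl linD assms)
  also have "\<dots> = (\<Sum>j<d. c j x * (\<Sum>i\<in>I. f i (e j)))"
    by (simp only: sum_distrib_left) (rule sum.swap)
  finally show "(\<Sum>i\<in>I. f i x) = (\<Sum>j<d. c j x * (\<Sum>i\<in>I. f i (e j)))" .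
qed

lemma lin_tsw:
  "\<lbrakk>\<forall>i<d. X i \<in> H; \<And>a b. \<lbrakk>a \<in> H; b \<in> H\<rbrakk> \<Longrightarrow> lin (\<lambda>x. F x a b)\<rbrakk> \<Longrightarrow> lin (\<lambda>x. tsw X (\<lambda>a b. F x a b))"
  unfolding tsw_def by (rule lin_sum) auto

lemma tsw_cong:
  "\<lbrakk>\<forall>i<d. X i \<in> H; \<And>a b. \<lbrakk>a \<in> H; b \<in> H\<rbrakk> \<Longrightarrow> F a b = G a b\<rbrakk> \<Longrightarrow> tsw X (\<lambda>a b. F a b) = tsw X (\<lambda>a b. G a b)"
  unfolding tsw_def by (rule sum.cong) auto

lemma tsw_swap: "tsw X (\<lambda>a b. tsw Y (\<lambda>p q. F a b p q)) = tsw Y (\<lambda>p q. tsw X (\<lambda>a b. F a b p q))"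
  unfolding tsw_def by (rule sum.swap)

lemma tsw_cmult: "tsw X (\<lambda>a b. k * F a b) = k * tsw X F"
  by (simp add: tsw_def sum_distrib_left)

lemma tsw_multc: "tsw X (\<lambda>a b. F a b * k) = tsw X F * k"
  by (simp add: tsw_def sum_distrib_right)

lemma tsw_sum: "tsw X (\<lambda>a b. \<Sum>j\<in>I. F j a b) = (\<Sum>j\<in>I. tsw X (F j))"
  unfolding tsw_def by (rule sum.swap)

lemma bilI: "\<lbrakk>\<And>b. b \<in> H \<Longrightarrow> lin (\<lambda>a. F a b); \<And>a. a \<in> H \<Longrightarrow> lin (\<lambda>b. F a b)\<rbrakk> \<Longrightarrow> bil (\<lambda>a b. F a b)"
  by (simp add: bil_def)

lemma bilD:
  assumes "bil F"
  shows "\<And>t b. \<lbrakk>lop t; b \<in> H\<rbrakk> \<Longrightarrow> lin (\<lambda>x. F (t x) b)" "\<And>t a. \<lbrakk>lop t; a \<in> H\<rbrakk> \<Longrightarrow> lin (\<lambda>x. F a (t x))"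
  using assms by (auto simp: bil_def intro: lin_app[where f="\<lambda>a. F a _"] lin_app)

lemma triI: "\<lbrakk>\<And>b k. \<lbrakk>b \<in> H; k \<in> H\<rbrakk> \<Longrightarrow> lin (\<lambda>a. F a b k); \<And>a k. \<lbrakk>a \<in> H; k \<in> H\<rbrakk> \<Longrightarrow> lin (\<lambda>b. F a b k);
   \<And>a b. \<lbrakk>a \<in> H; b \<in> H\<rbrakk> \<Longrightarrow> lin (\<lambda>k. F a b k)\<rbrakk> \<Longrightarrow> tri (\<lambda>a b k. F a b k)"
  by (simp add: tri_def bil_def)

lemma triD:
  assumes "tri F"
  shows "\<And>t b k. \<lbrakk>lop t; b \<in> H; k \<in> H\<rbrakk> \<Longrightarrow> lin (\<lambda>x. F (t x) b k)"
    "\<And>t a k. \<lbrakk>lop t; a \<in> H; k \<in> H\<rbrakk> \<Longrightarrow> lin (\<lambda>x. F a (t x) k)"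
    "\<And>t a b. \<lbrakk>lop t; a \<in> H; b \<in> H\<rbrakk> \<Longrightarrow> lin (\<lambda>x. F a b (t x))"
  using assms lin_app[where f="\<lambda>a. F a _ _"] by (auto simp: tri_def intro: bilD)

end

section \<open>The Hopf algebra axioms, paired with linear functionals\<close>

locale hopf_calc = lin_frame H d e c
  for H :: "'h set" and d :: nat and e :: "nat \<Rightarrow> 'h" and c :: "nat \<Rightarrow> 'h \<Rightarrow> 'r::comm_ring" +
  fixes mul :: "'h \<Rightarrow> 'h \<Rightarrow> 'h"  (infixl \<open>\<cdot>\<close> 70) and one :: 'h and S :: "'h \<Rightarrow> 'h"
    and eps :: "'h \<Rightarrow> 'r" and Dl :: "nat \<Rightarrow> 'h \<Rightarrow> 'h"
  assumes one_in [simp]: "one \<in> H"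
    and lop_mult_left: "y \<in> H \<Longrightarrow> lop (\<lambda>x. x \<cdot> y)"
    and lop_mult_right: "y \<in> H \<Longrightarrow> lop (\<lambda>x. y \<cdot> x)"
    and mult_assoc: "\<lbrakk>x \<in> H; y \<in> H; z \<in> H\<rbrakk> \<Longrightarrow> x \<cdot> y \<cdot> z = x \<cdot> (y \<cdot> z)"
    and mult_one_left [simp]: "x \<in> H \<Longrightarrow> one \<cdot> x = x"
    and mult_one_right [simp]: "x \<in> H \<Longrightarrow> x \<cdot> one = x"
    and lop_antipode: "lop S"
    and lop_comult: "i < d \<Longrightarrow> lop (Dl i)"
    and counit_lin: "lin eps"
    and counit_mult: "\<lbrakk>x \<in> H; y \<in> H\<rbrakk> \<Longrightarrow> eps (x \<cdot> y) = eps x * eps y"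
    and counit_one: "\<lbrakk>lin f; x \<in> H\<rbrakk> \<Longrightarrow> eps one * f x = f x"
    and coassoc': "\<lbrakk>tri T; x \<in> H\<rbrakk> \<Longrightarrow>
      (\<Sum>j<d. \<Sum>i<d. T (Dl i (Dl j x)) (e i) (e j)) = (\<Sum>j<d. \<Sum>i<d. T (Dl j x) (Dl i (e j)) (e i))"
    and counit_left': "\<lbrakk>lin f; x \<in> H\<rbrakk> \<Longrightarrow> (\<Sum>i<d. eps (Dl i x) * f (e i)) = f x"
    and counit_right': "\<lbrakk>lin f; x \<in> H\<rbrakk> \<Longrightarrow> (\<Sum>i<d. f (Dl i x) * eps (e i)) = f x"
    and comult_mult': "\<lbrakk>bil F; x \<in> H; y \<in> H\<rbrakk> \<Longrightarrow>
      (\<Sum>i<d. F (Dl i (x \<cdot> y)) (e i)) = (\<Sum>i<d. \<Sum>j<d. F (Dl i x \<cdot> Dl j y) (e i \<cdot> e j))"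
    and comult_one': "bil F \<Longrightarrow> (\<Sum>i<d. F (Dl i one) (e i)) = F one one"
    and antipode_left': "\<lbrakk>lin f; x \<in> H\<rbrakk> \<Longrightarrow> (\<Sum>i<d. f (S (Dl i x) \<cdot> e i)) = eps x * f one"
    and antipode_right': "\<lbrakk>lin f; x \<in> H\<rbrakk> \<Longrightarrow> (\<Sum>i<d. f (Dl i x \<cdot> S (e i))) = eps x * f one"
begin

text \<open>Sweedler notation: \<open>sw x F\<close> is F applied to x_(1) and x_(2), where
  \<open>Dl i x\<close> is the factor of \<Delta>(x) that stands in front of
  \<open>e i\<close>.\<close>

definition sw :: "'h \<Rightarrow> ('h \<Rightarrow> 'h \<Rightarrow> 'r) \<Rightarrow> 'r" where
  "sw x = tsw (\<lambda>i. Dl i x)"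

lemma mul_in [simp]: "\<lbrakk>x \<in> H; y \<in> H\<rbrakk> \<Longrightarrow> x \<cdot> y \<in> H"
  using lop_mult_left lop_in by blast

lemma S_in [simp]: "x \<in> H \<Longrightarrow> S x \<in> H"
  using lop_antipode lop_in by blast

lemma Dl_in [simp]: "\<lbrakk>i < d; x \<in> H\<rbrakk> \<Longrightarrow> Dl i x \<in> H"
  using lop_comult lop_in by blast

lemma sw_cong:
  assumes "x = y" "y \<in> H" "\<And>a b. \<lbrakk>a \<in> H; b \<in> H\<rbrakk> \<Longrightarrow> F a b = G a b"
  shows "sw x (\<lambda>a b. F a b) = sw y (\<lambda>a b. G a b)"
  unfolding sw_def using assms by (auto intro!: tsw_cong)

lemmas sw_cong' = sw_cong[OF refl]

lemma sw_swap: "sw x (\<lambda>a b. sw y (\<lambda>p q. F a b p q)) = sw y (\<lambda>p q. sw x (\<lambda>a b. F a b p q))"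
  unfolding sw_def by (rule tsw_swap)

lemma sw_tsw: "sw x (\<lambda>a b. tsw Y (\<lambda>p q. F a b p q)) = tsw Y (\<lambda>p q. sw x (\<lambda>a b. F a b p q))"
  unfolding sw_def by (rule tsw_swap)

lemma sw_cmult: "sw x (\<lambda>a b. k * F a b) = k * sw x F"
  by (simp add: sw_def tsw_cmult)

lemma sw_multc: "sw x (\<lambda>a b. F a b * k) = sw x F * k"
  by (simp add: sw_def tsw_multc)

lemma sw_sum: "sw x (\<lambda>a b. \<Sum>j\<in>I. F j a b) = (\<Sum>j\<in>I. sw x (F j))"
  by (simp add: sw_def tsw_sum)

lemma lop_mull: "\<lbrakk>lop t; y \<in> H\<rbrakk> \<Longrightarrow> lop (\<lambda>x. t x \<cdot> y)"
  by (rule lop_comp[OF lop_mult_left])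

lemma lop_mulr: "\<lbrakk>lop t; y \<in> H\<rbrakk> \<Longrightarrow> lop (\<lambda>x. y \<cdot> t x)"
  by (rule lop_comp[OF lop_mult_right])

lemma lop_S: "lop t \<Longrightarrow> lop (\<lambda>x. S (t x))"
  by (rule lop_comp[OF lop_antipode])

lemma lin_sw_arg: "\<lbrakk>lop t; \<And>b. b \<in> H \<Longrightarrow> lin (\<lambda>a. F a b)\<rbrakk> \<Longrightarrow> lin (\<lambda>x. sw (t x) (\<lambda>a b. F a b))"
  unfolding sw_def tsw_def
  by (rule lin_sum) (auto intro: lin_app[of "\<lambda>x. F x _"] lop_comp[OF lop_comult])

lemma lin_sw_const: "\<lbrakk>y \<in> H; \<And>a b. \<lbrakk>a \<in> H; b \<in> H\<rbrakk> \<Longrightarrow> lin (\<lambda>x. F x a b)\<rbrakk> \<Longrightarrow> lin (\<lambda>x. sw y (\<lambda>a b. F x a b))"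
  unfolding sw_def by (rule lin_tsw) auto

lemma lin_eps: "lop t \<Longrightarrow> lin (\<lambda>x. eps (t x))"
  by (rule lin_app[OF counit_lin])

lemmas lin_intros = bilI triI lop_id lop_mull lop_mulr lop_S lin_sw_arg lin_sw_const lin_tsw lin_eps lin_cmult lin_multc

lemma coassoc: "\<lbrakk>tri F; x \<in> H\<rbrakk> \<Longrightarrow> sw x (\<lambda>a b. sw a (\<lambda>p q. F p q b)) = sw x (\<lambda>a b. sw b (\<lambda>p q. F a p q))"
  using coassoc'[of F x] by (simp add: sw_def tsw_def)

lemma counit_left: "\<lbrakk>lin f; x \<in> H\<rbrakk> \<Longrightarrow> sw x (\<lambda>a b. eps a * f b) = f x"
  using counit_left'[of f x] by (simp add: sw_def tsw_def)

lemma counit_right: "\<lbrakk>lin f; x \<in> H\<rbrakk> \<Longrightarrow> sw x (\<lambda>a b. eps b * f a) = f x"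
  using counit_right'[of f x] by (simp add: sw_def tsw_def mult.commute)

lemma comult_mult: "\<lbrakk>bil F; x \<in> H; y \<in> H\<rbrakk> \<Longrightarrow> sw (x \<cdot> y) (\<lambda>a b. F a b) = sw x (\<lambda>a b. sw y (\<lambda>p q. F (a \<cdot> p) (b \<cdot> q)))"
  using comult_mult'[of F x y] by (simp add: sw_def tsw_def)

lemma comult_one: "bil F \<Longrightarrow> sw one (\<lambda>a b. F a b) = F one one"
  using comult_one'[of F] by (simp add: sw_def tsw_def)

lemma antipode_left: "\<lbrakk>lin f; x \<in> H\<rbrakk> \<Longrightarrow> sw x (\<lambda>a b. f (S a \<cdot> b)) = eps x * f one"
  using antipode_left'[of f x] by (simp add: sw_def tsw_def)

lemma antipode_right: "\<lbrakk>lin f; x \<in> H\<rbrakk> \<Longrightarrow> sw x (\<lambda>a b. f (a \<cdot> S b)) = eps x * f one"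
  using antipode_right'[of f x] by (simp add: sw_def tsw_def)

text \<open>In a right-nested Sweedler expression a factor that collapses to a counit can sit before the last leg.\<close>

lemma collapse_head:
  assumes m: "\<And>f y. \<lbrakk>lin f; y \<in> H\<rbrakk> \<Longrightarrow> sw y (\<lambda>a b. f (m a b)) = eps y * f one"
    and m_lop: "\<And>b. b \<in> H \<Longrightarrow> lop (\<lambda>a. m a b)" "\<And>a. a \<in> H \<Longrightarrow> lop (m a)"
    and G: "bil G" and x: "x \<in> H"
  shows "sw x (\<lambda>a r. sw r (\<lambda>b t. G (m a b) t)) = G one x"
proof -
  have "sw x (\<lambda>a r. sw r (\<lambda>b t. G (m a b) t)) = sw x (\<lambda>r t. sw r (\<lambda>a b. G (m a b) t))"
    by (rule coassoc[symmetric]) (auto intro!: triI bilD[OF G] m_lop x lop_id lop_in[OF m_lop(2)])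
  also have "\<dots> = sw x (\<lambda>r t. eps r * G one t)"
    by (rule sw_cong') (auto intro!: m x bilD[OF G] lop_id)
  also have "\<dots> = G one x"
    by (rule counit_left) (auto intro!: x bilD[OF G] lop_id)
  finally show ?thesis .
qed

lemma collapse_tail:
  assumes m: "\<And>f y. \<lbrakk>lin f; y \<in> H\<rbrakk> \<Longrightarrow> sw y (\<lambda>a b. f (m a b)) = eps y * f one"
    and G: "bil G" and x: "x \<in> H"
  shows "sw x (\<lambda>t r. sw r (\<lambda>a b. G t (m a b))) = G x one"
proof -
  have "sw x (\<lambda>t r. sw r (\<lambda>a b. G t (m a b))) = sw x (\<lambda>t r. eps r * G t one)"
    by (rule sw_cong') (auto intro!: m x bilD[OF G] lop_id)
  also have "\<dots> = G x one"
    by (rule counit_right) (auto intro!: x bilD[OF G] lop_id)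
  finally show ?thesis .
qed

lemmas antipode_left_head = collapse_head[of "\<lambda>a b. S a \<cdot> b", OF antipode_left lop_mull[OF lop_antipode] lop_mult_right[OF S_in]]
lemmas antipode_right_head = collapse_head[of "\<lambda>a b. a \<cdot> S b", OF antipode_right lop_mult_left[OF S_in] lop_mulr[OF lop_antipode]]
lemmas antipode_left_tail = collapse_tail[of "\<lambda>a b. S a \<cdot> b", OF antipode_left]
lemmas antipode_right_tail = collapse_tail[of "\<lambda>a b. a \<cdot> S b", OF antipode_right]

section \<open>The antipode reverses products and coproducts\<close>

lemma antipode_one:
  assumes f: "lin f" shows "f (S one) = f one"
proof -
  have "f (S one) = f (S one \<cdot> one)" by simp
  also have "\<dots> = sw one (\<lambda>a b. f (S a \<cdot> b))"
    by (rule comult_one[symmetric]) (auto intro!: lin_intros lin_app[OF f])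
  also have "\<dots> = f one"
    by (simp add: antipode_left f counit_one)
  finally show ?thesis .
qed

lemma counit_antipode:
  assumes x: "x \<in> H" shows "eps (S x) = eps x"
proof -
  have "eps x = eps one * eps x" by (simp add: counit_one x counit_lin)
  also have "\<dots> = sw x (\<lambda>a b. eps (S a \<cdot> b))" by (simp add: antipode_left counit_lin x mult.commute)
  also have "\<dots> = sw x (\<lambda>a b. eps b * eps (S a))"
    by (rule sw_cong') (auto simp: x counit_mult mult.commute)
  also have "\<dots> = eps (S x)" by (rule counit_right) (auto intro!: lin_intros x)
  finally show ?thesis by simp
qed

text \<open>Both sides are convolution inverses of the multiplication H \<otimes> H \<rightarrow> H.
  \<open>?E\<close> is the convolution product of three maps, namely S of the product, the product,
  and the reversed product of antipodes; it collapses from either end.\<close>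

lemma antipode_mult:
  assumes f: "lin f" and x: "x \<in> H" and y: "y \<in> H"
  shows "f (S (x \<cdot> y)) = f (S y \<cdot> S x)"
proof -
  note [simp] = x y
  note L = lin_intros lin_app[OF f]
  let ?E = "sw x (\<lambda>x1 xr. sw xr (\<lambda>x2 x3. sw y (\<lambda>y1 yr. sw yr (\<lambda>y2 y3. f (S (x1 \<cdot> y1) \<cdot> (x2 \<cdot> (y2 \<cdot> S y3 \<cdot> S x3)))))))"
  have "?E = sw x (\<lambda>x1 xr. sw xr (\<lambda>x2 x3. f (S (x1 \<cdot> y) \<cdot> (x2 \<cdot> (one \<cdot> S x3)))))"
    by (intro sw_cong' antipode_right_tail[where G = "\<lambda>y1 u. f (S (_ \<cdot> y1) \<cdot> (_ \<cdot> (u \<cdot> S _)))"]) (auto intro!: L)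
  also have "\<dots> = sw x (\<lambda>x1 xr. sw xr (\<lambda>x2 x3. f (S (x1 \<cdot> y) \<cdot> (x2 \<cdot> S x3))))"
    by (intro sw_cong') (auto simp: x)
  also have "\<dots> = f (S (x \<cdot> y) \<cdot> one)"
    by (rule antipode_right_tail) (auto intro!: L)
  finally have 1: "?E = f (S (x \<cdot> y))" by (simp add: x y)
  have "?E = sw x (\<lambda>x1 xr. sw xr (\<lambda>x2 x3. sw y (\<lambda>y1 yr. sw yr (\<lambda>y2 y3. f (S (x1 \<cdot> y1) \<cdot> (x2 \<cdot> y2) \<cdot> (S y3 \<cdot> S x3))))))"
    by (intro sw_cong') (auto simp: x y mult_assoc)
  also have "\<dots> = sw x (\<lambda>r x3. sw r (\<lambda>x1 x2. sw y (\<lambda>y1 yr. sw yr (\<lambda>y2 y3. f (S (x1 \<cdot> y1) \<cdot> (x2 \<cdot> y2) \<cdot> (S y3 \<cdot> S x3))))))"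
    by (rule coassoc[symmetric]) (auto intro!: L)
  also have "\<dots> = sw x (\<lambda>r x3. sw r (\<lambda>x1 x2. sw y (\<lambda>s y3. sw s (\<lambda>y1 y2. f (S (x1 \<cdot> y1) \<cdot> (x2 \<cdot> y2) \<cdot> (S y3 \<cdot> S x3))))))"
    by (intro sw_cong' coassoc[symmetric]) (auto intro!: L)
  also have "\<dots> = sw x (\<lambda>r x3. sw y (\<lambda>s y3. sw r (\<lambda>x1 x2. sw s (\<lambda>y1 y2. f (S (x1 \<cdot> y1) \<cdot> (x2 \<cdot> y2) \<cdot> (S y3 \<cdot> S x3))))))"
    by (intro sw_cong' sw_swap x)
  also have "\<dots> = sw x (\<lambda>r x3. sw y (\<lambda>s y3. sw (r \<cdot> s) (\<lambda>a b. f (S a \<cdot> b \<cdot> (S y3 \<cdot> S x3)))))"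
    by (intro sw_cong' comult_mult[symmetric]) (auto intro!: L)
  also have "\<dots> = sw x (\<lambda>r x3. sw y (\<lambda>s y3. eps (r \<cdot> s) * f (one \<cdot> (S y3 \<cdot> S x3))))"
    by (intro sw_cong' antipode_left) (auto intro!: L)
  also have "\<dots> = sw x (\<lambda>r x3. eps r * sw y (\<lambda>s y3. eps s * f (S y3 \<cdot> S x3)))"
    by (simp add: sw_cmult[symmetric]) (intro sw_cong', auto simp: x y counit_mult mult.assoc)
  also have "\<dots> = sw x (\<lambda>r x3. eps r * f (S y \<cdot> S x3))"
    by (intro sw_cong' arg_cong[where f="\<lambda>u. _ * u"] counit_left) (auto intro!: L)
  also have "\<dots> = f (S y \<cdot> S x)"
    by (rule counit_left) (auto intro!: L)
  finally show ?thesis using 1 by simp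
qed

text \<open>The same uniqueness argument, now for convolution inverses of \<Delta> among maps from H
  to H \<otimes> H. In \<open>?E\<close> the legs \<open>q\<close> and \<open>t\<close> enter
  crosswise, which is what exchanges the two factors.\<close>

lemma antipode_comult:
  assumes F: "bil F" and x: "x \<in> H"
  shows "sw (S x) (\<lambda>a b. F a b) = sw x (\<lambda>a b. F (S b) (S a))"
proof -
  note [simp] = x
  note L = lin_intros bilD[OF F]
  let ?E = "sw x (\<lambda>a r. sw r (\<lambda>b r. sw r (\<lambda>p r. sw r (\<lambda>q t. sw (S a) (\<lambda>s s'. F (s \<cdot> (b \<cdot> S t)) (s' \<cdot> (p \<cdot> S q)))))))"
  have "?E = sw x (\<lambda>a r. sw r (\<lambda>b r. sw (S a) (\<lambda>s s'. F (s \<cdot> (b \<cdot> S r)) (s' \<cdot> one))))"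
    by (intro sw_cong' antipode_right_head) (auto intro!: L)
  also have "\<dots> = sw (S x) (\<lambda>s s'. F (s \<cdot> one) (s' \<cdot> one))"
    by (rule antipode_right_tail) (auto intro!: L)
  also have "\<dots> = sw (S x) (\<lambda>s s'. F s s')"
    by (intro sw_cong') (auto simp: x)
  finally have 1: "?E = sw (S x) (\<lambda>s s'. F s s')" .
  have "?E = sw x (\<lambda>a r. sw r (\<lambda>b r. sw r (\<lambda>p r. sw r (\<lambda>q t. sw (S a) (\<lambda>s s'. F (s \<cdot> b \<cdot> S t) (s' \<cdot> p \<cdot> S q))))))"
    by (intro sw_cong') (auto simp: x mult_assoc)
  also have "\<dots> = sw x (\<lambda>a r. sw r (\<lambda>u r. sw u (\<lambda>b p. sw r (\<lambda>q t. sw (S a) (\<lambda>s s'. F (s \<cdot> b \<cdot> S t) (s' \<cdot> p \<cdot> S q))))))"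
    by (intro sw_cong' coassoc[symmetric]) (auto intro!: L)
  also have "\<dots> = sw x (\<lambda>w r. sw w (\<lambda>a u. sw u (\<lambda>b p. sw r (\<lambda>q t. sw (S a) (\<lambda>s s'. F (s \<cdot> b \<cdot> S t) (s' \<cdot> p \<cdot> S q))))))"
    by (rule coassoc[symmetric]) (auto intro!: L)
  also have "\<dots> = sw x (\<lambda>w r. sw r (\<lambda>q t. sw w (\<lambda>a u. sw (S a) (\<lambda>s s'. sw u (\<lambda>b p. F (s \<cdot> b \<cdot> S t) (s' \<cdot> p \<cdot> S q))))))"
    by (subst (2) sw_swap, subst (3) sw_swap, subst (2) sw_swap, rule refl)
  also have "\<dots> = sw x (\<lambda>w r. sw r (\<lambda>q t. sw w (\<lambda>a u. sw (S a \<cdot> u) (\<lambda>y z. F (y \<cdot> S t) (z \<cdot> S q)))))"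
    by (intro sw_cong' comult_mult[symmetric]) (auto intro!: L)
  also have "\<dots> = sw x (\<lambda>w r. sw r (\<lambda>q t. eps w * sw one (\<lambda>y z. F (y \<cdot> S t) (z \<cdot> S q))))"
    by (intro sw_cong' antipode_left) (auto intro!: L)
  also have "\<dots> = sw x (\<lambda>w r. sw r (\<lambda>q t. eps w * F (one \<cdot> S t) (one \<cdot> S q)))"
    by (intro sw_cong' arg_cong[where f="\<lambda>u. _ * u"] comult_one) (auto intro!: L)
  also have "\<dots> = sw x (\<lambda>w r. eps w * sw r (\<lambda>q t. F (S t) (S q)))"
    by (simp add: sw_cmult[symmetric]) (intro sw_cong', auto simp: x)
  also have "\<dots> = sw x (\<lambda>q t. F (S t) (S q))"
    by (rule counit_left) (auto intro!: L)
  finally show ?thesis using 1 by simp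
qed

section \<open>Integrals as traces, and injectivity of the antipode\<close>

lemma lin_expand: "\<lbrakk>lin g; x \<in> H\<rbrakk> \<Longrightarrow> (\<Sum>i<d. c i x * g (e i)) = g x"
  by (simp add: linD[symmetric])

lemma lin_expand2:
  assumes G: "bil G" and x: "x \<in> H" and y: "y \<in> H"
  shows "(\<Sum>i<d. c i x * (\<Sum>j<d. c j y * G (e i) (e j))) = G x y"
proof -
  have "(\<Sum>i<d. c i x * (\<Sum>j<d. c j y * G (e i) (e j))) = (\<Sum>i<d. c i x * G (e i) y)"
    by (intro sum.cong refl arg_cong[where f="\<lambda>u. _ * u"] lin_expand y) (auto intro!: bilD[OF G] lop_id)
  also have "\<dots> = G x y"
    by (intro lin_expand x) (auto intro!: bilD[OF G] lop_id y)
  finally show ?thesis .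
qed

text \<open>The trace of the operator that sends y to z_(1) f(z_(2)), where z = x S(S(y)); the trace
  is formed by the coordinates \<open>c i\<close> against the basis vectors \<open>e i\<close>. Such
  traces are a classical source of integrals on a finite-dimensional Hopf algebra.\<close>

definition lam :: "('h \<Rightarrow> 'r) \<Rightarrow> 'h \<Rightarrow> 'r" where
  "lam f x = (\<Sum>i<d. sw x (\<lambda>x1 x2. sw (S (S (e i))) (\<lambda>u1 u2. c i (x1 \<cdot> u1) * f (x2 \<cdot> u2))))"

lemma lin_lam: "lin f \<Longrightarrow> lin (lam f)"
  unfolding lam_def by (rule lin_sum) (auto intro!: lin_intros lin_app[OF lin_c] lin_app[of f])

lemma lam_mult:
  assumes f: "lin f" and x: "x \<in> H"
  shows "lam f x = (\<Sum>i<d. sw (x \<cdot> S (S (e i))) (\<lambda>r1 r2. c i r1 * f r2))"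
  unfolding lam_def
  by (intro sum.cong refl comult_mult[symmetric]) (auto intro!: lin_intros lin_app[OF lin_c] lin_app[OF f] simp: x)

text \<open>Cyclicity of the trace moves a leg of the argument next to its own antipode, where the
  two cancel. So \<open>lam f\<close> is an integral whatever \<open>f\<close> is: applying it to
  the second factor of \<Delta>(x) gives its value at x times 1.\<close>

lemma lam_integral:
  assumes f: "lin f" and g: "lin g" and x: "x \<in> H"
  shows "sw x (\<lambda>x1 x2. g x1 * lam f x2) = g one * lam f x"
proof -
  note [simp] = x
  note L = lin_intros lin_app[OF f] lin_app[OF g] lin_app[OF lin_c]
  have g1: "g (y \<cdot> S one) = g y" if "y \<in> H" for y
    using that by (subst antipode_one[of "\<lambda>t. g (y \<cdot> t)"]) (auto intro!: L)
  \<comment> \<open>The unit is inserted as a leg of \<open>z\<close> times the antipode of the next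
    one. Since S reverses products and coproducts, the inserted factor becomes the missing leg of
    S(S(z2)), and all three legs of x S(S(z2)) appear together.\<close>
  have 1: "sw x (\<lambda>x0 x'. g x0 * sw x' (\<lambda>x1 x2. sw (S (S z)) (\<lambda>u1 u2. c i (x1 \<cdot> u1) * f (x2 \<cdot> u2))))
     = sw z (\<lambda>z1 z2. sw (x \<cdot> S (S z2)) (\<lambda>r0 r'. sw r' (\<lambda>r1 r2. c i r1 * (g (r0 \<cdot> S z1) * f r2))))"
    (is "?l = ?r") if [simp]: "i < d" "z \<in> H" for i z
  proof -
    have "?l = sw x (\<lambda>x0 x'. sw x' (\<lambda>x1 x2. sw (S (S z)) (\<lambda>u1 u2. g (x0 \<cdot> S one) * (c i (x1 \<cdot> u1) * f (x2 \<cdot> u2)))))"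
      by (simp add: sw_cmult[symmetric]) (intro sw_cong', auto simp: g1)
    also have "\<dots> = sw x (\<lambda>x0 x'. sw x' (\<lambda>x1 x2. sw z (\<lambda>z1 r. sw r (\<lambda>p q. sw (S (S q)) (\<lambda>u1 u2. g (x0 \<cdot> S (z1 \<cdot> S p)) * (c i (x1 \<cdot> u1) * f (x2 \<cdot> u2)))))))"
      by (intro sw_cong' antipode_right_head[symmetric]) (auto intro!: L)
    also have "\<dots> = sw x (\<lambda>x0 x'. sw x' (\<lambda>x1 x2. sw z (\<lambda>z1 r. sw r (\<lambda>p q. sw (S (S q)) (\<lambda>u1 u2. g (x0 \<cdot> S (S p) \<cdot> S z1) * (c i (x1 \<cdot> u1) * f (x2 \<cdot> u2)))))))"
      by (intro sw_cong') (auto simp: antipode_mult[OF lin_app[OF g lop_mult_right]] mult_assoc)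
    also have "\<dots> = sw x (\<lambda>x0 x'. sw x' (\<lambda>x1 x2. sw z (\<lambda>z1 z2. sw (S z2) (\<lambda>p q. sw (S p) (\<lambda>u1 u2. g (x0 \<cdot> S q \<cdot> S z1) * (c i (x1 \<cdot> u1) * f (x2 \<cdot> u2)))))))"
      by (intro sw_cong' antipode_comult[symmetric]) (auto intro!: L)
    also have "\<dots> = sw x (\<lambda>x0 x'. sw x' (\<lambda>x1 x2. sw z (\<lambda>z1 z2. sw (S (S z2)) (\<lambda>p q. sw q (\<lambda>u1 u2. g (x0 \<cdot> p \<cdot> S z1) * (c i (x1 \<cdot> u1) * f (x2 \<cdot> u2)))))))"
      by (intro sw_cong' antipode_comult[symmetric]) (auto intro!: L)
    also have "\<dots> = sw z (\<lambda>z1 z2. sw x (\<lambda>x0 x'. sw (S (S z2)) (\<lambda>p q. sw x' (\<lambda>x1 x2. sw q (\<lambda>u1 u2. c i (x1 \<cdot> u1) * (g (x0 \<cdot> p \<cdot> S z1) * f (x2 \<cdot> u2)))))))"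
      by (subst (2) sw_swap, subst (1) sw_swap, subst (3) sw_swap, simp add: ac_simps)
    also have "\<dots> = sw z (\<lambda>z1 z2. sw x (\<lambda>x0 x'. sw (S (S z2)) (\<lambda>p q. sw (x' \<cdot> q) (\<lambda>r1 r2. c i r1 * (g (x0 \<cdot> p \<cdot> S z1) * f r2)))))"
      by (intro sw_cong' comult_mult[symmetric]) (auto intro!: L)
    also have "\<dots> = ?r"
      by (intro sw_cong' comult_mult[symmetric]) (auto intro!: L)
    finally show ?thesis .
  qed
  have "sw x (\<lambda>x1 x2. g x1 * lam f x2) = (\<Sum>i<d. sw x (\<lambda>x0 x'. g x0 * sw x' (\<lambda>x1 x2. sw (S (S (e i))) (\<lambda>u1 u2. c i (x1 \<cdot> u1) * f (x2 \<cdot> u2)))))"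
    by (simp add: lam_def sum_distrib_left sw_sum)
  also have "\<dots> = (\<Sum>i<d. sw (e i) (\<lambda>z1 z2. sw (x \<cdot> S (S z2)) (\<lambda>r0 r'. sw r' (\<lambda>r1 r2. c i r1 * (g (r0 \<cdot> S z1) * f r2)))))"
    by (intro sum.cong refl 1) auto
  \<comment> \<open>Cyclicity of the trace: \<open>z2\<close> is expanded in the basis with index
    \<open>k\<close>, and the old index \<open>i\<close> is then summed out, which puts
    \<open>r1\<close> in place of \<open>e i\<close>.\<close>
  also have "\<dots> = (\<Sum>i<d. sw (e i) (\<lambda>z1 z2. \<Sum>k<d. c k z2 * sw (x \<cdot> S (S (e k))) (\<lambda>r0 r'. sw r' (\<lambda>r1 r2. c i r1 * (g (r0 \<cdot> S z1) * f r2)))))"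
    by (intro sum.cong refl sw_cong' lin_expand[symmetric]) (auto intro!: L)
  also have "\<dots> = (\<Sum>i<d. \<Sum>k<d. sw (e i) (\<lambda>z1 z2. sw (x \<cdot> S (S (e k))) (\<lambda>r0 r'. sw r' (\<lambda>r1 r2. c i r1 * (c k z2 * (g (r0 \<cdot> S z1) * f r2))))))"
    by (simp add: sw_sum sw_cmult[symmetric] ac_simps)
  also have "\<dots> = (\<Sum>k<d. \<Sum>i<d. sw (x \<cdot> S (S (e k))) (\<lambda>r0 r'. sw r' (\<lambda>r1 r2. c i r1 * sw (e i) (\<lambda>z1 z2. c k z2 * (g (r0 \<cdot> S z1) * f r2)))))"
    by (subst sum.swap, intro sum.cong refl, subst sw_swap, intro sw_cong', simp, simp, subst sw_swap, simp add: sw_cmult)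
  also have "\<dots> = (\<Sum>k<d. sw (x \<cdot> S (S (e k))) (\<lambda>r0 r'. sw r' (\<lambda>r1 r2. \<Sum>i<d. c i r1 * sw (e i) (\<lambda>z1 z2. c k z2 * (g (r0 \<cdot> S z1) * f r2)))))"
    by (simp only: sw_sum)
  also have "\<dots> = (\<Sum>k<d. sw (x \<cdot> S (S (e k))) (\<lambda>r0 r'. sw r' (\<lambda>r1 r2. sw r1 (\<lambda>z1 z2. c k z2 * (g (r0 \<cdot> S z1) * f r2)))))"
    by (intro sum.cong refl sw_cong' lin_expand) (auto intro!: L)
  also have "\<dots> = (\<Sum>k<d. sw (x \<cdot> S (S (e k))) (\<lambda>r0 r'. sw r' (\<lambda>z1 s. sw s (\<lambda>z2 r2. c k z2 * (g (r0 \<cdot> S z1) * f r2)))))"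
    by (intro sum.cong refl sw_cong' coassoc) (auto intro!: L)
  also have "\<dots> = (\<Sum>k<d. sw (x \<cdot> S (S (e k))) (\<lambda>z2 r2. c k z2 * (g one * f r2)))"
    by (intro sum.cong refl antipode_right_head) (auto intro!: L)
  also have "\<dots> = g one * lam f x"
    by (simp add: lam_mult f sum_distrib_left sw_cmult[symmetric] ac_simps)
  finally show ?thesis .
qed

text \<open>The integrals together recover every functional, so they cannot all vanish. The
  antipodes combine to x S(S(e i) e j), and contracting both indices with two adjacent legs p, q
  gives S(p) q, to which the antipode axiom applies.\<close>

lemma lam_sum:
  assumes f: "lin f" and x: "x \<in> H"
  shows "(\<Sum>j<d. lam (\<lambda>v. sw v (\<lambda>v1 v2. c j v1 * f v2)) (x \<cdot> S (e j))) = f x"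
proof -
  note [simp] = x
  note L = lin_intros lin_app[OF f] lin_app[OF lin_c]
  \<comment> \<open>What is left once the first two legs have been written as legs of a basis vector
    \<open>e k\<close>. It is linear in \<open>w\<close>, so the antipode axiom can be applied
    inside it.\<close>
  define Y where "Y k w = sw (x \<cdot> S w) (\<lambda>t' t3. c k t' * f t3)" for k w
  have Y: "lin (Y k)" if "k < d" for k unfolding Y_def using that by (auto intro!: L)
  have 1: "sw (x \<cdot> S (e j) \<cdot> S (S (e i))) (\<lambda>t1 t'. c i t1 * sw t' (\<lambda>t2 t3. c j t2 * f t3))
     = (\<Sum>k<d. sw (e k) (\<lambda>p q. c i p * (c j q * Y k (S (e i) \<cdot> e j))))" (is "?l = ?r")
    if [simp]: "i < d" "j < d" for i j
  proof -
    have "?l = sw (x \<cdot> (S (e j) \<cdot> S (S (e i)))) (\<lambda>t1 t'. c i t1 * sw t' (\<lambda>t2 t3. c j t2 * f t3))"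
      by (simp add: mult_assoc)
    also have "\<dots> = sw (x \<cdot> S (S (e i) \<cdot> e j)) (\<lambda>t1 t'. sw t' (\<lambda>t2 t3. c i t1 * c j t2 * f t3))"
      by (subst antipode_mult[of "\<lambda>w. sw (x \<cdot> w) (\<lambda>t1 t'. c i t1 * sw t' (\<lambda>t2 t3. c j t2 * f t3))", symmetric])
        (auto intro!: L simp: sw_cmult[symmetric] mult.assoc)
    also have "\<dots> = sw (x \<cdot> S (S (e i) \<cdot> e j)) (\<lambda>t' t3. sw t' (\<lambda>t1 t2. c i t1 * c j t2 * f t3))"
      by (rule coassoc[symmetric]) (auto intro!: L)
    also have "\<dots> = sw (x \<cdot> S (S (e i) \<cdot> e j)) (\<lambda>t' t3. \<Sum>k<d. c k t' * sw (e k) (\<lambda>t1 t2. c i t1 * c j t2 * f t3))"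
      by (intro sw_cong' lin_expand[symmetric]) (auto intro!: L)
    also have "\<dots> = ?r"
      by (simp add: sw_sum Y_def sw_cmult[symmetric] ac_simps) (subst sw_swap, rule refl)
    finally show ?thesis .
  qed
  have "(\<Sum>j<d. lam (\<lambda>v. sw v (\<lambda>v1 v2. c j v1 * f v2)) (x \<cdot> S (e j)))
    = (\<Sum>j<d. \<Sum>i<d. sw (x \<cdot> S (e j) \<cdot> S (S (e i))) (\<lambda>t1 t'. c i t1 * sw t' (\<lambda>t2 t3. c j t2 * f t3)))"
    by (intro sum.cong refl lam_mult) (auto intro!: L)
  also have "\<dots> = (\<Sum>j<d. \<Sum>i<d. \<Sum>k<d. sw (e k) (\<lambda>p q. c i p * (c j q * Y k (S (e i) \<cdot> e j))))"
    by (intro sum.cong refl 1) auto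
  also have "\<dots> = (\<Sum>k<d. sw (e k) (\<lambda>p q. \<Sum>i<d. c i p * (\<Sum>j<d. c j q * Y k (S (e i) \<cdot> e j))))"
    by (subst sum.swap, subst (2) sum.swap, subst sum.swap) (simp add: sw_sum sum_distrib_left)
  also have "\<dots> = (\<Sum>k<d. sw (e k) (\<lambda>p q. Y k (S p \<cdot> q)))"
    by (intro sum.cong refl sw_cong' lin_expand2) (auto intro!: L lin_app[OF Y])
  also have "\<dots> = (\<Sum>k<d. eps (e k) * Y k one)"
    by (intro sum.cong refl antipode_left) (auto intro: Y)
  also have "\<dots> = sw (x \<cdot> S one) (\<lambda>t' t3. \<Sum>k<d. c k t' * (eps (e k) * f t3))"
    by (simp add: Y_def sw_sum sw_cmult[symmetric] ac_simps)
  also have "\<dots> = sw (x \<cdot> S one) (\<lambda>t' t3. eps t' * f t3)"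
    by (intro sw_cong' lin_expand) (auto intro!: L)
  also have "\<dots> = sw (x \<cdot> one) (\<lambda>t' t3. eps t' * f t3)"
    by (rule antipode_one[of "\<lambda>w. sw (x \<cdot> w) (\<lambda>t' t3. eps t' * f t3)"]) (auto intro!: L)
  also have "\<dots> = f x"
    by (simp add: counit_left f)
  finally show ?thesis .
qed

text \<open>By the integral property, lam f(x S(h_(1))) g(h_(2)) can be rewritten with S applied to
  all of h, so it vanishes when S(h) does. A further antipode cancellation gives lam f(x) g(h) = 0
  for all f and x, and by \<open>lam_sum\<close> the integrals are rich enough to conclude g(h) =
  0.\<close>

lemma antipode_injective:
  assumes h: "h \<in> H" and Sh: "\<And>g. lin g \<Longrightarrow> g (S h) = 0" and g: "lin g"
  shows "g h = 0"
proof -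
  note [simp] = h
  have 1: "sw h (\<lambda>h1 h2. lam f (x \<cdot> S h1) * g h2) = 0" if f: "lin f" and g: "lin g" and [simp]: "x \<in> H" for f g x
  proof -
    note L = lin_intros lin_app[OF lin_lam[OF f]] lin_app[OF g]
    have "sw h (\<lambda>h1 h2. lam f (x \<cdot> S h1) * g h2) = sw h (\<lambda>h1 h2. sw (x \<cdot> S h1) (\<lambda>y1 y2. g (y1 \<cdot> h2) * lam f y2))"
      by (intro sw_cong') (auto simp: lam_integral[OF f lin_app[OF g lop_mult_left]] mult.commute)
    also have "\<dots> = sw h (\<lambda>h1 h2. sw x (\<lambda>x1 x2. sw (S h1) (\<lambda>p q. g (x1 \<cdot> p \<cdot> h2) * lam f (x2 \<cdot> q))))"
      by (intro sw_cong' comult_mult) (auto intro!: L)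
    also have "\<dots> = sw h (\<lambda>h1 h2. sw x (\<lambda>x1 x2. sw h1 (\<lambda>p q. g (x1 \<cdot> S q \<cdot> h2) * lam f (x2 \<cdot> S p))))"
      by (intro sw_cong' antipode_comult) (auto intro!: L)
    also have "\<dots> = sw h (\<lambda>h1 h2. sw x (\<lambda>x1 x2. sw h1 (\<lambda>p q. g (x1 \<cdot> (S q \<cdot> h2)) * lam f (x2 \<cdot> S p))))"
      by (intro sw_cong') (auto simp: mult_assoc)
    also have "\<dots> = sw x (\<lambda>x1 x2. sw h (\<lambda>h1 h2. sw h1 (\<lambda>p q. g (x1 \<cdot> (S q \<cdot> h2)) * lam f (x2 \<cdot> S p))))"
      by (rule sw_swap)
    also have "\<dots> = sw x (\<lambda>x1 x2. sw h (\<lambda>p r. sw r (\<lambda>q h2. g (x1 \<cdot> (S q \<cdot> h2)) * lam f (x2 \<cdot> S p))))"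
      by (intro sw_cong' coassoc) (auto intro!: L)
    also have "\<dots> = sw x (\<lambda>x1 x2. g (x1 \<cdot> one) * lam f (x2 \<cdot> S h))"
      by (intro sw_cong' antipode_left_tail) (auto intro!: L)
    also have "\<dots> = sw x (\<lambda>x1 x2. 0 * 0)"
      by (intro sw_cong') (auto simp: Sh[OF lin_app[OF lin_lam[OF f] lop_mult_right]])
    also have "\<dots> = 0" by (simp only: sw_cmult) simp
    finally show ?thesis .
  qed
  \<comment> \<open>Expanding the tail \<open>r\<close> in the basis puts the sum into the form of
    fact 1, with x S(S(h2)) for \<open>x\<close> and the coordinate \<open>c k\<close> for
    \<open>g\<close>.\<close>
  have 2: "lam f x * g h = 0" if f: "lin f" and [simp]: "x \<in> H" for f x
  proof -
    note L = lin_intros lin_app[OF lin_lam[OF f]] lin_app[OF g] lin_app[OF lin_c]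
    have "lam f x * g h = lam f (x \<cdot> S one) * g h"
      by (simp add: antipode_one[OF lin_app[OF lin_lam[OF f] lop_mult_right]])
    also have "\<dots> = sw h (\<lambda>h1 r. sw r (\<lambda>h2 h3. lam f (x \<cdot> S (h1 \<cdot> S h2)) * g h3))"
      by (intro antipode_right_head[symmetric]) (auto intro!: L)
    also have "\<dots> = sw h (\<lambda>h1 r. sw r (\<lambda>h2 h3. lam f (x \<cdot> S (S h2) \<cdot> S h1) * g h3))"
      by (intro sw_cong') (auto simp: antipode_mult[OF lin_app[OF lin_lam[OF f] lop_mult_right]] mult_assoc)
    also have "\<dots> = sw h (\<lambda>h1 r. \<Sum>k<d. c k r * sw (e k) (\<lambda>h2 h3. lam f (x \<cdot> S (S h2) \<cdot> S h1) * g h3))"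
      by (intro sw_cong' lin_expand[symmetric]) (auto intro!: L)
    also have "\<dots> = (\<Sum>k<d. sw (e k) (\<lambda>h2 h3. g h3 * sw h (\<lambda>h1 r. lam f (x \<cdot> S (S h2) \<cdot> S h1) * c k r)))"
      by (simp only: sw_sum sw_cmult[symmetric] sw_swap[of h] ac_simps)
    also have "\<dots> = (\<Sum>k<d. sw (e k) (\<lambda>h2 h3. 0 * 0))"
      by (intro sum.cong refl sw_cong') (auto simp: 1 f lin_c)
    also have "\<dots> = 0" by (simp only: sw_cmult) simp
    finally show ?thesis .
  qed
  \<comment> \<open>\<open>lam_sum\<close>, taken for the counit at the unit, writes
    \<open>eps one\<close> as a sum of values of integrals.\<close>
  have "g h = eps one * g h" by (simp add: counit_one g)
  also have "\<dots> = (\<Sum>j<d. lam (\<lambda>v. sw v (\<lambda>v1 v2. c j v1 * eps v2)) (one \<cdot> S (e j)) * g h)"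
    by (subst lam_sum[OF counit_lin one_in, symmetric]) (rule sum_distrib_right)
  also have "\<dots> = (\<Sum>j<d. 0)"
    by (intro sum.cong refl 2) (auto intro!: lin_intros lin_app[OF lin_c])
  finally show ?thesis by simp
qed

end

context hopf_calc begin

definition quad :: "('h \<Rightarrow> 'h \<Rightarrow> 'h \<Rightarrow> 'h \<Rightarrow> 'r) \<Rightarrow> bool" where
  "quad F \<longleftrightarrow> (\<forall>b\<in>H. \<forall>k\<in>H. \<forall>l\<in>H. lin (\<lambda>a. F a b k l)) \<and> (\<forall>a\<in>H. tri (F a))"

lemma quadI: "\<lbrakk>\<And>b k l. \<lbrakk>b \<in> H; k \<in> H; l \<in> H\<rbrakk> \<Longrightarrow> lin (\<lambda>a. F a b k l); \<And>a k l. \<lbrakk>a \<in> H; k \<in> H; l \<in> H\<rbrakk> \<Longrightarrow> lin (\<lambda>b. F a b k l);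
   \<And>a b l. \<lbrakk>a \<in> H; b \<in> H; l \<in> H\<rbrakk> \<Longrightarrow> lin (\<lambda>k. F a b k l); \<And>a b k. \<lbrakk>a \<in> H; b \<in> H; k \<in> H\<rbrakk> \<Longrightarrow> lin (\<lambda>l. F a b k l)\<rbrakk>
  \<Longrightarrow> quad (\<lambda>a b k l. F a b k l)"
  by (simp add: quad_def tri_def bil_def)

lemma quadD:
  assumes "quad F"
  shows "\<And>t b k l. \<lbrakk>lop t; b \<in> H; k \<in> H; l \<in> H\<rbrakk> \<Longrightarrow> lin (\<lambda>x. F (t x) b k l)"
    "\<And>t a k l. \<lbrakk>lop t; a \<in> H; k \<in> H; l \<in> H\<rbrakk> \<Longrightarrow> lin (\<lambda>x. F a (t x) k l)"
    "\<And>t a b l. \<lbrakk>lop t; a \<in> H; b \<in> H; l \<in> H\<rbrakk> \<Longrightarrow> lin (\<lambda>x. F a b (t x) l)"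
    "\<And>t a b k. \<lbrakk>lop t; a \<in> H; b \<in> H; k \<in> H\<rbrakk> \<Longrightarrow> lin (\<lambda>x. F a b k (t x))"
proof -
  fix t assume t: "lop t"
  show "lin (\<lambda>x. F (t x) b k l)" if "b \<in> H" "k \<in> H" "l \<in> H" for b k l
    by (rule lin_app[of "\<lambda>a. F a b k l", OF _ t]) (use assms that in \<open>simp add: quad_def\<close>)
  fix a assume a: "a \<in> H"
  then have T: "tri (F a)" using assms by (simp add: quad_def)
  show "lin (\<lambda>x. F a (t x) k l)" if "k \<in> H" "l \<in> H" for k l
    using triD(1)[OF T t that] .
  show "lin (\<lambda>x. F a b (t x) l)" if "b \<in> H" "l \<in> H" for b l
    using triD(2)[OF T t that] .
  show "lin (\<lambda>x. F a b k (t x))" if "b \<in> H" "k \<in> H" for b k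
    using triD(3)[OF T t that] .
qed

subsection \<open>Sweedler powers\<close>

text \<open>The value of \<open>f\<close> at the n-th Sweedler power of \<open>x\<close>. Starting
  with the counit at 0 keeps the recursion uniform; the case n = 1 then rests on the counit
  law.\<close>

primrec spow :: "nat \<Rightarrow> ('h \<Rightarrow> 'r) \<Rightarrow> 'h \<Rightarrow> 'r" where
  "spow 0 f x = eps x * f one"
| "spow (Suc n) f x = sw x (\<lambda>a b. spow n (\<lambda>t. f (t \<cdot> b)) a)"

text \<open>The legs multiplied in the opposite order, x_(n) ... x_(1). This version arises because
  \<open>pi_op\<close> multiplies on the left.\<close>

primrec spow_op :: "nat \<Rightarrow> ('h \<Rightarrow> 'r) \<Rightarrow> 'h \<Rightarrow> 'r" where
  "spow_op 0 f x = eps x * f one"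
| "spow_op (Suc n) f x = sw x (\<lambda>a b. spow_op n (\<lambda>t. f (b \<cdot> t)) a)"

text \<open>Says that [n] = u \<epsilon>, not that n is the least such number; n = 0 always
  qualifies.\<close>

definition exponent :: "nat \<Rightarrow> bool" where
  "exponent n \<longleftrightarrow> (\<forall>f. lin f \<longrightarrow> (\<forall>x\<in>H. spow n f x = eps x * f one))"

lemma lin_spow_param: "\<lbrakk>bil F; x \<in> H\<rbrakk> \<Longrightarrow> lin (\<lambda>s. spow n (\<lambda>t. F s t) x)"
proof (induction n arbitrary: F x)
  case (Suc n)
  show ?case
    unfolding spow.simps by (intro lin_sw_const Suc.IH) (auto intro!: Suc.prems lin_intros bilD[OF Suc.prems(1)])
next
  case 0
  show ?case using bilD(1)[OF 0(1) lop_id one_in] by (simp add: lin_cmult)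
qed

lemma lin_spow_op_param: "\<lbrakk>bil F; x \<in> H\<rbrakk> \<Longrightarrow> lin (\<lambda>s. spow_op n (\<lambda>t. F s t) x)"
proof (induction n arbitrary: F x)
  case (Suc n)
  show ?case
    unfolding spow_op.simps by (intro lin_sw_const Suc.IH) (auto intro!: Suc.prems lin_intros bilD[OF Suc.prems(1)])
next
  case 0
  show ?case using bilD(1)[OF 0(1) lop_id one_in] by (simp add: lin_cmult)
qed

lemma lin_spow: "\<lbrakk>lin f; lop t\<rbrakk> \<Longrightarrow> lin (\<lambda>x. spow n f (t x))"
proof -
  have "lin f \<Longrightarrow> lin (spow n f)" for f
  proof (induction n arbitrary: f)
    case 0 then show ?case using lin_multc[OF counit_lin, of "f one"] by (simp cong: lin_cong)
  next
    case (Suc n)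
    show ?case
      unfolding spow.simps
      by (rule lin_sw_arg[OF lop_id]) (auto intro!: Suc.IH lin_app[OF Suc.prems] lin_intros)
  qed
  then show "\<lbrakk>lin f; lop t\<rbrakk> \<Longrightarrow> lin (\<lambda>x. spow n f (t x))" by (rule lin_app)
qed

lemma lin_spow_op: "\<lbrakk>lin f; lop t\<rbrakk> \<Longrightarrow> lin (\<lambda>x. spow_op n f (t x))"
proof -
  have "lin f \<Longrightarrow> lin (spow_op n f)" for f
  proof (induction n arbitrary: f)
    case 0 then show ?case using lin_multc[OF counit_lin, of "f one"] by (simp cong: lin_cong)
  next
    case (Suc n)
    show ?case
      unfolding spow_op.simps
      by (rule lin_sw_arg[OF lop_id]) (auto intro!: Suc.IH lin_app[OF Suc.prems] lin_intros)
  qed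
  then show "\<lbrakk>lin f; lop t\<rbrakk> \<Longrightarrow> lin (\<lambda>x. spow_op n f (t x))" by (rule lin_app)
qed

lemmas lin_intros2 = lin_intros quadI lin_spow_param lin_spow_op_param lin_spow lin_spow_op

lemma spow_cong:
  "\<lbrakk>x = y; y \<in> H; \<And>t. t \<in> H \<Longrightarrow> f t = g t\<rbrakk> \<Longrightarrow> spow n (\<lambda>t. f t) x = spow n (\<lambda>t. g t) y"
proof (induction n arbitrary: f g x y)
  case (Suc n)
  show ?case
    unfolding spow.simps by (intro sw_cong Suc.IH) (simp_all add: Suc.prems)
qed simp

lemma spow_op_cong:
  "\<lbrakk>x = y; y \<in> H; \<And>t. t \<in> H \<Longrightarrow> f t = g t\<rbrakk> \<Longrightarrow> spow_op n (\<lambda>t. f t) x = spow_op n (\<lambda>t. g t) y"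
proof (induction n arbitrary: f g x y)
  case (Suc n)
  show ?case
    unfolding spow_op.simps by (intro sw_cong Suc.IH) (simp_all add: Suc.prems)
qed simp

lemma spow_sw: "spow n (\<lambda>t. sw y (\<lambda>p q. F p q t)) x = sw y (\<lambda>p q. spow n (\<lambda>t. F p q t) x)"
  by (induction n arbitrary: F x) (simp_all add: sw_cmult sw_swap[of y])

lemma spow_op_sw: "spow_op n (\<lambda>t. sw y (\<lambda>p q. F p q t)) x = sw y (\<lambda>p q. spow_op n (\<lambda>t. F p q t) x)"
  by (induction n arbitrary: F x) (simp_all add: sw_cmult sw_swap[of y])

text \<open>The recursion splits off the last leg; associativity and coassociativity let the first
  leg be split off instead.\<close>

lemma spow_Suc2:
  "\<lbrakk>lin f; x \<in> H\<rbrakk> \<Longrightarrow> spow (Suc n) f x = sw x (\<lambda>a b. spow n (\<lambda>t. f (a \<cdot> t)) b)"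
proof (induction n arbitrary: f x)
  case 0
  note [simp] = 0(2)
  have "spow (Suc 0) f x = sw x (\<lambda>a b. eps a * f b)"
    unfolding spow.simps by (intro sw_cong') auto
  also have "\<dots> = f x" by (rule counit_left[OF 0])
  also have "\<dots> = sw x (\<lambda>a b. eps b * f a)" by (rule counit_right[OF 0, symmetric])
  also have "\<dots> = sw x (\<lambda>a b. spow 0 (\<lambda>t. f (a \<cdot> t)) b)"
    unfolding spow.simps by (intro sw_cong') auto
  finally show ?case .
next
  case (Suc n)
  note [simp] = Suc.prems(2)
  note L = lin_intros2 lin_app[OF Suc.prems(1)]
  have "spow (Suc (Suc n)) f x = sw x (\<lambda>a b. spow (Suc n) (\<lambda>t. f (t \<cdot> b)) a)"
    by simp
  also have "\<dots> = sw x (\<lambda>a b. sw a (\<lambda>p q. spow n (\<lambda>t. f (p \<cdot> t \<cdot> b)) q))"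
    by (intro sw_cong' Suc.IH) (auto intro!: L)
  also have "\<dots> = sw x (\<lambda>p r. sw r (\<lambda>q b. spow n (\<lambda>t. f (p \<cdot> t \<cdot> b)) q))"
    by (rule coassoc) (auto intro!: L)
  also have "\<dots> = sw x (\<lambda>p r. spow (Suc n) (\<lambda>t. f (p \<cdot> t)) r)"
    unfolding spow.simps by (intro sw_cong' spow_cong) (auto simp: mult_assoc)
  finally show ?case .
qed

end

section \<open>The inverse of the antipode\<close>

locale hopf_calc_bij = hopf_calc H d e c mul one S eps Dl
  for H :: "'h set" and d :: nat and e :: "nat \<Rightarrow> 'h" and c :: "nat \<Rightarrow> 'h \<Rightarrow> 'r::comm_ring"
    and mul :: "'h \<Rightarrow> 'h \<Rightarrow> 'h"  (infixl \<open>\<cdot>\<close> 70) and one :: 'h and S :: "'h \<Rightarrow> 'h"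
    and eps :: "'h \<Rightarrow> 'r" and Dl :: "nat \<Rightarrow> 'h \<Rightarrow> 'h" +
  fixes Si :: "'h \<Rightarrow> 'h"
  assumes lop_antipode_inv: "lop Si"
    and Si_S [simp]: "x \<in> H \<Longrightarrow> Si (S x) = x"
    and S_Si [simp]: "x \<in> H \<Longrightarrow> S (Si x) = x"
begin

lemma Si_in [simp]: "x \<in> H \<Longrightarrow> Si x \<in> H"
  using lop_antipode_inv lop_in by blast

lemma lop_Si: "lop t \<Longrightarrow> lop (\<lambda>x. Si (t x))"
  by (rule lop_comp[OF lop_antipode_inv])

lemmas lin_intros3 = lin_intros2 lop_Si

lemma Si_mult:
  assumes f: "lin f" and [simp]: "x \<in> H" "y \<in> H"
  shows "f (Si (x \<cdot> y)) = f (Si y \<cdot> Si x)"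
  using antipode_mult[OF lin_app[OF f lop_antipode_inv], of "Si y" "Si x"] by simp

lemma Si_one:
  assumes f: "lin f" shows "f (Si one) = f one"
  using antipode_one[OF lin_app[OF f lop_antipode_inv]] by simp

lemma Si_mult_eq: "\<lbrakk>x \<in> H; y \<in> H\<rbrakk> \<Longrightarrow> Si (x \<cdot> y) = Si y \<cdot> Si x"
  by (rule lin_separates) (auto simp: Si_mult)

lemma Si_one_eq [simp]: "Si one = one"
  by (rule lin_separates) (auto simp: Si_one)

lemma counit_Si: "x \<in> H \<Longrightarrow> eps (Si x) = eps x"
  using counit_antipode[of "Si x"] by simp

lemma Si_comult:
  assumes F: "bil F" and [simp]: "x \<in> H"
  shows "sw (Si x) (\<lambda>a b. F a b) = sw x (\<lambda>a b. F (Si b) (Si a))"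
proof -
  note L = lin_intros3 bilD[OF F]
  have "sw x (\<lambda>a b. F (Si b) (Si a)) = sw (S (Si x)) (\<lambda>a b. F (Si b) (Si a))"
    by simp
  also have "\<dots> = sw (Si x) (\<lambda>a b. F (Si (S a)) (Si (S b)))"
    by (rule antipode_comult[of "\<lambda>a b. F (Si b) (Si a)"]) (auto intro!: L)
  also have "\<dots> = sw (Si x) (\<lambda>a b. F a b)"
    by (intro sw_cong') auto
  finally show ?thesis ..
qed

text \<open>Apply \<open>Si\<close> to the antipode axiom. It reverses products, so it is an
  antipode for the opposite coproduct.\<close>

lemma Si_left:
  assumes f: "lin f" and [simp]: "x \<in> H"
  shows "sw x (\<lambda>a b. f (Si b \<cdot> a)) = eps x * f one"
proof -
  have "sw x (\<lambda>a b. f (Si b \<cdot> a)) = sw x (\<lambda>a b. f (Si (S a \<cdot> b)))"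
    by (intro sw_cong') (auto simp: Si_mult f)
  also have "\<dots> = eps x * f (Si one)"
    by (rule antipode_left) (auto intro!: lin_intros3 lin_app[OF f])
  finally show ?thesis by (simp add: Si_one f)
qed

lemma Si_right:
  assumes f: "lin f" and [simp]: "x \<in> H"
  shows "sw x (\<lambda>a b. f (b \<cdot> Si a)) = eps x * f one"
proof -
  have "sw x (\<lambda>a b. f (b \<cdot> Si a)) = sw x (\<lambda>a b. f (Si (a \<cdot> S b)))"
    by (intro sw_cong') (auto simp: Si_mult f)
  also have "\<dots> = eps x * f (Si one)"
    by (rule antipode_right) (auto intro!: lin_intros3 lin_app[OF f])
  finally show ?thesis by (simp add: Si_one f)
qed

lemmas Si_left_head = collapse_head[of "\<lambda>a b. Si b \<cdot> a", OF Si_left lop_mult_right[OF Si_in] lop_mull[OF lop_antipode_inv]]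
lemmas Si_right_head = collapse_head[of "\<lambda>a b. b \<cdot> Si a", OF Si_right lop_mulr[OF lop_antipode_inv] lop_mult_left[OF Si_in]]

text \<open>In Si(x_(2)^[n]) times the opposite n-th power of x_(1), neighbouring legs cancel pair
  after pair until \<epsilon>(x) remains; this is fact 1. If [n] = u \<epsilon>, the first factor
  disappears, and so the opposite power is trivial as well.\<close>

lemma exponent_op:
  assumes n: "exponent n" and f: "lin f" and x: "x \<in> H"
  shows "spow_op n f x = eps x * f one"
proof -
  have 1: "sw x (\<lambda>a b. spow_op n (\<lambda>s. spow n (\<lambda>t. f (Si t \<cdot> s)) b) a) = eps x * f one"
    if "lin f" "x \<in> H" for n f x
    using that
  proof (induction n arbitrary: f x)
    case 0
    note [simp] = 0(2)
    have "sw x (\<lambda>a b. spow_op 0 (\<lambda>s. spow 0 (\<lambda>t. f (Si t \<cdot> s)) b) a) = sw x (\<lambda>a b. eps a * (eps b * f (Si one)))"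
      by (intro sw_cong') auto
    also have "\<dots> = eps x * f (Si one)"
      by (intro counit_left) (auto intro!: lin_intros)
    finally show ?case by (simp add: Si_one 0)
  next
    case (Suc n)
    note [simp] = Suc.prems(2)
    note L = lin_intros3 lin_app[OF Suc.prems(1)]
    have "sw x (\<lambda>a b. spow_op (Suc n) (\<lambda>s. spow (Suc n) (\<lambda>t. f (Si t \<cdot> s)) b) a)
      = sw x (\<lambda>a b. sw a (\<lambda>a1 a2. spow_op n (\<lambda>s. sw b (\<lambda>b1 b2. spow n (\<lambda>t. f (Si (b1 \<cdot> t) \<cdot> (a2 \<cdot> s))) b2)) a1))"
      unfolding spow_op.simps by (intro sw_cong' spow_op_cong spow_Suc2) (auto intro!: L)
    also have "\<dots> = sw x (\<lambda>a b. sw a (\<lambda>a1 a2. spow_op n (\<lambda>s. sw b (\<lambda>b1 b2. spow n (\<lambda>t. f (Si t \<cdot> (Si b1 \<cdot> a2) \<cdot> s)) b2)) a1))"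
      by (intro sw_cong' spow_op_cong spow_cong)
       (auto simp: Si_mult[of "\<lambda>u. f (u \<cdot> _)", OF lin_app[OF Suc.prems(1) lop_mult_left]] mult_assoc)
    also have "\<dots> = sw x (\<lambda>a b. sw a (\<lambda>a1 a2. sw b (\<lambda>b1 b2. spow_op n (\<lambda>s. spow n (\<lambda>t. f (Si t \<cdot> (Si b1 \<cdot> a2) \<cdot> s)) b2) a1)))"
      by (simp only: spow_op_sw)
    also have "\<dots> = sw x (\<lambda>a1 r. sw r (\<lambda>a2 b. sw b (\<lambda>b1 b2. spow_op n (\<lambda>s. spow n (\<lambda>t. f (Si t \<cdot> (Si b1 \<cdot> a2) \<cdot> s)) b2) a1)))"
      by (rule coassoc) (auto intro!: L)
    also have "\<dots> = sw x (\<lambda>a1 b2. spow_op n (\<lambda>s. spow n (\<lambda>t. f (Si t \<cdot> one \<cdot> s)) b2) a1)"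
      by (intro sw_cong' Si_left_head) (auto intro!: L)
    also have "\<dots> = sw x (\<lambda>a1 b2. spow_op n (\<lambda>s. spow n (\<lambda>t. f (Si t \<cdot> s)) b2) a1)"
      by (intro sw_cong' spow_op_cong spow_cong) auto
    also have "\<dots> = eps x * f one" by (rule Suc.IH[OF Suc.prems])
    finally show ?case .
  qed
  note [simp] = x
  note L = lin_intros3 lin_app[OF f]
  have e: "spow n g y = eps y * g one" if "lin g" "y \<in> H" for g y
    using n that by (auto simp: exponent_def)
  have "spow_op n f x = sw x (\<lambda>a b. eps b * spow_op n f a)"
    by (rule counit_right[symmetric]) (auto intro!: L f)
  also have "\<dots> = sw x (\<lambda>a b. spow_op n (\<lambda>s. eps b * f (one \<cdot> s)) a)"
  proof (intro sw_cong')
    fix a b assume [simp]: "a \<in> H" "b \<in> H"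
    have "k * spow_op n g y = spow_op n (\<lambda>s. k * g s) y" for k g y
      by (induction n arbitrary: g y) (simp_all add: sw_cmult[symmetric] ac_simps)
    then show "eps b * spow_op n f a = spow_op n (\<lambda>s. eps b * f (one \<cdot> s)) a"
      by (auto intro!: spow_op_cong)
  qed simp
  also have "\<dots> = sw x (\<lambda>a b. spow_op n (\<lambda>s. eps b * f (Si one \<cdot> s)) a)"
    by (intro sw_cong' spow_op_cong) (auto simp: Si_one[OF lin_app[OF f lop_mult_left]])
  also have "\<dots> = sw x (\<lambda>a b. spow_op n (\<lambda>s. spow n (\<lambda>t. f (Si t \<cdot> s)) b) a)"
    by (intro sw_cong' spow_op_cong e[symmetric]) (auto intro!: L)
  also have "\<dots> = eps x * f one" by (rule 1[OF f x])
  finally show ?thesis .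
qed

end

subsection \<open>The factorisation for the Drinfeld double\<close>

context hopf_calc begin

definition sw4 :: "'h \<Rightarrow> ('h \<Rightarrow> 'h \<Rightarrow> 'h \<Rightarrow> 'h \<Rightarrow> 'r) \<Rightarrow> 'r" where
  "sw4 x F = sw x (\<lambda>a r. sw r (\<lambda>b r. sw r (\<lambda>p q. F a b p q)))"

lemma sw4_cong:
  assumes "x = y" "y \<in> H" "\<And>a b p q. \<lbrakk>a \<in> H; b \<in> H; p \<in> H; q \<in> H\<rbrakk> \<Longrightarrow> F a b p q = G a b p q"
  shows "sw4 x (\<lambda>a b p q. F a b p q) = sw4 y (\<lambda>a b p q. G a b p q)"
  unfolding sw4_def using assms by (auto intro!: sw_cong)

lemma lin_sw4_const: "\<lbrakk>y \<in> H; \<And>a b p q. \<lbrakk>a \<in> H; b \<in> H; p \<in> H; q \<in> H\<rbrakk> \<Longrightarrow> lin (\<lambda>x. F x a b p q)\<rbrakk>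
    \<Longrightarrow> lin (\<lambda>x. sw4 y (\<lambda>a b p q. F x a b p q))"
  unfolding sw4_def by (auto intro!: lin_sw_const)

lemma lin_sw4_arg: "\<lbrakk>lop t; quad (\<lambda>a b p q. F a b p q)\<rbrakk> \<Longrightarrow> lin (\<lambda>x. sw4 (t x) (\<lambda>a b p q. F a b p q))"
  unfolding sw4_def by (rule lin_sw_arg) (auto intro!: lin_intros quadD[of F])

lemma sw4_sw: "sw4 x (\<lambda>a b p q. sw y (\<lambda>u v. F a b p q u v)) = sw y (\<lambda>u v. sw4 x (\<lambda>a b p q. F a b p q u v))"
  unfolding sw4_def by (simp only: sw_swap[of _ y])

lemma sw4_mult:
  assumes F: "quad F" and [simp]: "x \<in> H" "y \<in> H"
  shows "sw4 (x \<cdot> y) (\<lambda>a b p q. F a b p q) = sw4 x (\<lambda>a b p q. sw4 y (\<lambda>a' b' p' q'. F (a \<cdot> a') (b \<cdot> b') (p \<cdot> p') (q \<cdot> q')))"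
proof -
  note L = lin_intros quadD[OF F]
  have "sw4 (x \<cdot> y) F = sw x (\<lambda>a r. sw y (\<lambda>a' r'. sw (r \<cdot> r') (\<lambda>b r. sw r (\<lambda>p q. F (a \<cdot> a') b p q))))"
    unfolding sw4_def by (rule comult_mult) (auto intro!: L)
  also have "\<dots> = sw x (\<lambda>a r. sw y (\<lambda>a' r'. sw r (\<lambda>b r. sw r' (\<lambda>b' r'. sw (r \<cdot> r') (\<lambda>p q. F (a \<cdot> a') (b \<cdot> b') p q)))))"
    by (intro sw_cong' comult_mult) (auto intro!: L)
  also have "\<dots> = sw x (\<lambda>a r. sw y (\<lambda>a' r'. sw r (\<lambda>b r. sw r' (\<lambda>b' r'. sw r (\<lambda>p q. sw r' (\<lambda>p' q'. F (a \<cdot> a') (b \<cdot> b') (p \<cdot> p') (q \<cdot> q')))))))"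
    by (intro sw_cong' comult_mult) (auto intro!: L)
  also have "\<dots> = sw x (\<lambda>a r. sw r (\<lambda>b r. sw y (\<lambda>a' r'. sw r (\<lambda>p q. sw r' (\<lambda>b' r'. sw r' (\<lambda>p' q'. F (a \<cdot> a') (b \<cdot> b') (p \<cdot> p') (q \<cdot> q')))))))"
    by (subst (2) sw_swap, subst (4) sw_swap, rule refl)
  also have "\<dots> = sw x (\<lambda>a r. sw r (\<lambda>b r. sw r (\<lambda>p q. sw y (\<lambda>a' r'. sw r' (\<lambda>b' r'. sw r' (\<lambda>p' q'. F (a \<cdot> a') (b \<cdot> b') (p \<cdot> p') (q \<cdot> q')))))))"
    by (subst (3) sw_swap, rule refl)
  finally show ?thesis by (simp only: sw4_def)
qed

lemma sw4_one:
  assumes F: "quad F"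
  shows "sw4 one (\<lambda>a b p q. F a b p q) = F one one one one"
proof -
  note L = lin_intros quadD[OF F]
  have "sw4 one F = sw one (\<lambda>b r. sw r (\<lambda>p q. F one b p q))"
    unfolding sw4_def by (rule comult_one) (auto intro!: L)
  also have "\<dots> = sw one (\<lambda>p q. F one one p q)" by (rule comult_one) (auto intro!: L)
  also have "\<dots> = F one one one one" by (rule comult_one) (auto intro!: L)
  finally show ?thesis .
qed

text \<open>Equality on the carrier only; outside it the forms are arbitrary functions.\<close>

definition eq4 :: "('h \<Rightarrow> 'h \<Rightarrow> 'h \<Rightarrow> 'h \<Rightarrow> 'r) \<Rightarrow> ('h \<Rightarrow> 'h \<Rightarrow> 'h \<Rightarrow> 'h \<Rightarrow> 'r) \<Rightarrow> bool" where
  "eq4 F G \<longleftrightarrow> (\<forall>v\<in>H. \<forall>h\<in>H. \<forall>x\<in>H. \<forall>z\<in>H. F v h x z = G v h x z)"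

lemma eq4_trans: "\<lbrakk>eq4 F G; eq4 G K\<rbrakk> \<Longrightarrow> eq4 F K"
  by (simp add: eq4_def)

lemma eq4_sym: "eq4 F G \<Longrightarrow> eq4 G F"
  by (simp add: eq4_def)

lemma eq4_refl: "eq4 F F"
  by (simp add: eq4_def)

end

context hopf_calc_bij begin

text \<open>The operator \<open>double_op\<close> encodes multiplication by the first tensor leg of the coproduct in the
  Drinfeld double; it is the product of two commuting operators that belong to the exponents of \<open>H\<close>.\<close>

definition double_op where
  "double_op \<Psi> v h x z = sw x (\<lambda>x1 x2. sw h (\<lambda>h1 r. sw r (\<lambda>h2 r. sw r (\<lambda>h3 h4. \<Psi> (x1 \<cdot> v) h4 (Si h3 \<cdot> x2 \<cdot> h1) (z \<cdot> h2)))))"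

text \<open>\<open>pi_op\<close> puts a leg of \<open>h\<close> and a leg of \<open>x\<close> in
  front of \<open>v\<close>. \<open>kappa_op\<close> lets the first leg of \<open>h\<close> act from
  the right on the triple \<open>v\<close>, \<open>x\<close>, \<open>z\<close>: through
  \<open>Si\<close> on \<open>v\<close>, from both sides on \<open>x\<close>, by multiplication on
  \<open>z\<close>. Their iterates therefore involve opposite and ordinary Sweedler powers
  respectively.\<close>

definition pi_op where
  "pi_op \<Psi> v h x z = sw x (\<lambda>x1 x2. sw h (\<lambda>h1 h2. \<Psi> (h1 \<cdot> x1 \<cdot> v) h2 x2 z))"

definition kappa_op where
  "kappa_op \<Psi> v h x z = sw h (\<lambda>a b. sw4 a (\<lambda>h1 h2 h3 h4. \<Psi> (Si h1 \<cdot> v) b (Si h4 \<cdot> x \<cdot> h2) (z \<cdot> h3)))"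

lemma quad_double:
  assumes "quad \<Psi>" shows "quad (double_op \<Psi>)"
  unfolding double_op_def by (auto intro!: lin_intros3 quadD[OF assms])

lemma quad_pi:
  assumes "quad \<Psi>" shows "quad (pi_op \<Psi>)"
  unfolding pi_op_def by (auto intro!: lin_intros3 quadD[OF assms])

lemma quad_kappa:
  assumes "quad \<Psi>" shows "quad (kappa_op \<Psi>)"
  unfolding kappa_op_def by (auto intro!: lin_intros3 quadD[OF assms] lin_sw4_const lin_sw4_arg)

lemma eq4_double: "eq4 F G \<Longrightarrow> eq4 (double_op F) (double_op G)"
  unfolding eq4_def double_op_def by (auto intro!: sw_cong)

lemma eq4_pi: "eq4 F G \<Longrightarrow> eq4 (pi_op F) (pi_op G)"
  unfolding eq4_def pi_op_def by (auto intro!: sw_cong)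

lemma eq4_kappa: "eq4 F G \<Longrightarrow> eq4 (kappa_op F) (kappa_op G)"
  unfolding eq4_def kappa_op_def by (auto intro!: sw_cong sw4_cong)

text \<open>The factor Si(h1) coming from \<open>kappa_op\<close> meets the leg of \<open>h\<close>
  that \<open>pi_op\<close> put in front of \<open>v\<close>, and the two cancel.\<close>

lemma pi_kappa:
  assumes \<Psi>: "quad \<Psi>" shows "eq4 (pi_op (kappa_op \<Psi>)) (double_op \<Psi>)"
  unfolding eq4_def
proof (intro ballI)
  fix v h x z assume [simp]: "v \<in> H" "h \<in> H" "x \<in> H" "z \<in> H"
  note L = lin_intros3 quadD[OF \<Psi>]
  have "pi_op (kappa_op \<Psi>) v h x z = sw x (\<lambda>x1 x2. sw h (\<lambda>k h'. sw h' (\<lambda>a b. sw a (\<lambda>h1 r. sw r (\<lambda>h2 r. sw r (\<lambda>h3 h4.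
      \<Psi> ((Si h1 \<cdot> k) \<cdot> (x1 \<cdot> v)) b (Si h4 \<cdot> x2 \<cdot> h2) (z \<cdot> h3)))))))"
    unfolding pi_op_def kappa_op_def sw4_def by (intro sw_cong') (auto simp: mult_assoc)
  also have "\<dots> = sw x (\<lambda>x1 x2. sw h (\<lambda>k h'. sw h' (\<lambda>h1 r. sw r (\<lambda>a b. sw a (\<lambda>h2 r. sw r (\<lambda>h3 h4.
      \<Psi> ((Si h1 \<cdot> k) \<cdot> (x1 \<cdot> v)) b (Si h4 \<cdot> x2 \<cdot> h2) (z \<cdot> h3)))))))"
    by (intro sw_cong' coassoc) (auto intro!: L)
  also have "\<dots> = sw x (\<lambda>x1 x2. sw h (\<lambda>k h'. sw h' (\<lambda>h1 r. sw r (\<lambda>h2 r. sw r (\<lambda>a b. sw a (\<lambda>h3 h4.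
      \<Psi> ((Si h1 \<cdot> k) \<cdot> (x1 \<cdot> v)) b (Si h4 \<cdot> x2 \<cdot> h2) (z \<cdot> h3)))))))"
    by (intro sw_cong' coassoc) (auto intro!: L)
  also have "\<dots> = sw x (\<lambda>x1 x2. sw h (\<lambda>k h'. sw h' (\<lambda>h1 r. sw r (\<lambda>h2 r. sw r (\<lambda>h3 r. sw r (\<lambda>h4 b.
      \<Psi> ((Si h1 \<cdot> k) \<cdot> (x1 \<cdot> v)) b (Si h4 \<cdot> x2 \<cdot> h2) (z \<cdot> h3)))))))"
    by (intro sw_cong' coassoc) (auto intro!: L)
  also have "\<dots> = sw x (\<lambda>x1 x2. sw h (\<lambda>h2 r. sw r (\<lambda>h3 r. sw r (\<lambda>h4 b.
      \<Psi> (one \<cdot> (x1 \<cdot> v)) b (Si h4 \<cdot> x2 \<cdot> h2) (z \<cdot> h3)))))"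
    by (intro sw_cong' Si_left_head) (auto intro!: L)
  also have "\<dots> = double_op \<Psi> v h x z"
    unfolding double_op_def by (intro sw_cong') auto
  finally show "pi_op (kappa_op \<Psi>) v h x z = double_op \<Psi> v h x z" .
qed

lemma comult_conj:
  assumes G: "bil G" and [simp]: "a \<in> H" "x \<in> H" "b \<in> H"
  shows "sw (Si a \<cdot> x \<cdot> b) (\<lambda>u v. G u v) = sw x (\<lambda>x1 x2. sw b (\<lambda>u w. sw a (\<lambda>s t. G (Si t \<cdot> x1 \<cdot> u) (Si s \<cdot> x2 \<cdot> w))))"
proof -
  note L = lin_intros3 bilD[OF G]
  have "sw (Si a \<cdot> x \<cdot> b) (\<lambda>u v. G u v) = sw (Si a \<cdot> x) (\<lambda>p q. sw b (\<lambda>u w. G (p \<cdot> u) (q \<cdot> w)))"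
    by (rule comult_mult) (auto intro!: L G)
  also have "\<dots> = sw (Si a) (\<lambda>t s. sw x (\<lambda>x1 x2. sw b (\<lambda>u w. G (t \<cdot> x1 \<cdot> u) (s \<cdot> x2 \<cdot> w))))"
    by (rule comult_mult) (auto intro!: L)
  also have "\<dots> = sw a (\<lambda>s t. sw x (\<lambda>x1 x2. sw b (\<lambda>u w. G (Si t \<cdot> x1 \<cdot> u) (Si s \<cdot> x2 \<cdot> w))))"
    by (rule Si_comult) (auto intro!: L)
  also have "\<dots> = sw x (\<lambda>x1 x2. sw b (\<lambda>u w. sw a (\<lambda>s t. G (Si t \<cdot> x1 \<cdot> u) (Si s \<cdot> x2 \<cdot> w))))"
    by (subst sw_swap, subst (2) sw_swap, rule refl)
  finally show ?thesis .
qed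

text \<open>In this order \<open>pi_op\<close> also splits the transformed \<open>x\<close>, so two
  pairs of legs have to cancel, by the other law of \<open>Si\<close>. Together with
  \<open>pi_kappa\<close> this shows that the two operators commute.\<close>

lemma kappa_pi:
  assumes \<Psi>: "quad \<Psi>" shows "eq4 (kappa_op (pi_op \<Psi>)) (double_op \<Psi>)"
  unfolding eq4_def
proof (intro ballI)
  fix v h x z assume [simp]: "v \<in> H" "h \<in> H" "x \<in> H" "z \<in> H"
  note L = lin_intros3 quadD[OF \<Psi>]
  let ?u = "\<lambda>k w h3 s t p q x1 x2. \<Psi> ((p \<cdot> Si t) \<cdot> (x1 \<cdot> (k \<cdot> v))) q (Si s \<cdot> x2 \<cdot> w) (z \<cdot> h3)"
  let ?t = "\<lambda>h1 u w h3 s t p q x1 x2. \<Psi> ((p \<cdot> Si t) \<cdot> (x1 \<cdot> ((u \<cdot> Si h1) \<cdot> v))) q (Si s \<cdot> x2 \<cdot> w) (z \<cdot> h3)"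
  have "kappa_op (pi_op \<Psi>) v h x z = sw h (\<lambda>a b. sw4 a (\<lambda>h1 h2 h3 h4. sw (Si h4 \<cdot> x \<cdot> h2) (\<lambda>y1 y2. sw b (\<lambda>p q.
      \<Psi> (p \<cdot> y1 \<cdot> (Si h1 \<cdot> v)) q y2 (z \<cdot> h3)))))"
    unfolding pi_op_def kappa_op_def by simp
  also have "\<dots> = sw h (\<lambda>a b. sw4 a (\<lambda>h1 h2 h3 h4. sw x (\<lambda>x1 x2. sw h2 (\<lambda>u w. sw h4 (\<lambda>s t. sw b (\<lambda>p q.
      \<Psi> (p \<cdot> (Si t \<cdot> x1 \<cdot> u) \<cdot> (Si h1 \<cdot> v)) q (Si s \<cdot> x2 \<cdot> w) (z \<cdot> h3)))))))"
    by (intro sw_cong' sw4_cong refl comult_conj) (auto intro!: L)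
  also have "\<dots> = sw h (\<lambda>a b. sw4 a (\<lambda>h1 h2 h3 h4. sw x (\<lambda>x1 x2. sw h2 (\<lambda>u w. sw h4 (\<lambda>s t. sw b (\<lambda>p q. ?t h1 u w h3 s t p q x1 x2))))))"
    by (intro sw_cong' sw4_cong) (auto simp: mult_assoc)
  also have "\<dots> = sw x (\<lambda>x1 x2. sw h (\<lambda>a b. sw4 a (\<lambda>h1 h2 h3 h4. sw h2 (\<lambda>u w. sw h4 (\<lambda>s t. sw b (\<lambda>p q. ?t h1 u w h3 s t p q x1 x2))))))"
    by (simp only: sw4_sw sw_swap[of _ x])
  also have "\<dots> = sw x (\<lambda>x1 x2. sw h (\<lambda>a b. sw a (\<lambda>h1 r. sw r (\<lambda>h2 r. sw h2 (\<lambda>u w. sw r (\<lambda>h3 h4. sw h4 (\<lambda>s t. sw b (\<lambda>p q. ?t h1 u w h3 s t p q x1 x2))))))))"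
    unfolding sw4_def by (subst (5) sw_swap, rule refl)
  also have "\<dots> = sw x (\<lambda>x1 x2. sw h (\<lambda>a b. sw a (\<lambda>h1 r. sw r (\<lambda>u r. sw r (\<lambda>w r. sw r (\<lambda>h3 h4. sw h4 (\<lambda>s t. sw b (\<lambda>p q. ?t h1 u w h3 s t p q x1 x2))))))))"
    by (intro sw_cong' coassoc) (auto intro!: L)
  also have "\<dots> = sw x (\<lambda>x1 x2. sw h (\<lambda>a b. sw a (\<lambda>w r. sw r (\<lambda>h3 h4. sw h4 (\<lambda>s t. sw b (\<lambda>p q. ?u one w h3 s t p q x1 x2))))))"
    by (intro sw_cong' Si_right_head) (auto intro!: L)
  also have "\<dots> = sw x (\<lambda>x1 x2. sw h (\<lambda>w r. sw r (\<lambda>a b. sw a (\<lambda>h3 h4. sw h4 (\<lambda>s t. sw b (\<lambda>p q. ?u one w h3 s t p q x1 x2))))))"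
    by (intro sw_cong' coassoc) (auto intro!: L)
  also have "\<dots> = sw x (\<lambda>x1 x2. sw h (\<lambda>w r. sw r (\<lambda>h3 r. sw r (\<lambda>a b. sw a (\<lambda>s t. sw b (\<lambda>p q. ?u one w h3 s t p q x1 x2))))))"
    by (intro sw_cong' coassoc) (auto intro!: L)
  also have "\<dots> = sw x (\<lambda>x1 x2. sw h (\<lambda>w r. sw r (\<lambda>h3 r. sw r (\<lambda>s r. sw r (\<lambda>t b. sw b (\<lambda>p q. ?u one w h3 s t p q x1 x2))))))"
    by (intro sw_cong' coassoc) (auto intro!: L)
  also have "\<dots> = sw x (\<lambda>x1 x2. sw h (\<lambda>w r. sw r (\<lambda>h3 r. sw r (\<lambda>s q. \<Psi> (one \<cdot> (x1 \<cdot> (one \<cdot> v))) q (Si s \<cdot> x2 \<cdot> w) (z \<cdot> h3)))))"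
    by (intro sw_cong' Si_right_head) (auto intro!: L)
  also have "\<dots> = double_op \<Psi> v h x z"
    unfolding double_op_def by (intro sw_cong') auto
  finally show "kappa_op (pi_op \<Psi>) v h x z = double_op \<Psi> v h x z" .
qed

text \<open>Each application multiplies \<open>v\<close> on the left by the next leg of the product
  h x, so the legs pile up in reverse order.\<close>

lemma pi_power:
  assumes \<Psi>: "quad \<Psi>"
  shows "eq4 ((pi_op ^^ n) \<Psi>) (\<lambda>v h x z. sw x (\<lambda>x1 x2. sw h (\<lambda>h1 h2. spow_op n (\<lambda>t. \<Psi> (t \<cdot> v) h2 x2 z) (h1 \<cdot> x1))))"
  using \<Psi>
proof (induction n arbitrary: \<Psi>)
  case 0
  note L = lin_intros3 quadD[OF 0]
  show ?case
    unfolding eq4_def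
  proof (intro ballI)
    fix v h x z assume [simp]: "v \<in> H" "h \<in> H" "x \<in> H" "z \<in> H"
    have "sw x (\<lambda>x1 x2. sw h (\<lambda>h1 h2. spow_op 0 (\<lambda>t. \<Psi> (t \<cdot> v) h2 x2 z) (h1 \<cdot> x1)))
      = sw x (\<lambda>x1 x2. sw h (\<lambda>h1 h2. eps h1 * (eps x1 * \<Psi> v h2 x2 z)))"
      by (intro sw_cong') (auto simp: counit_mult mult.assoc)
    also have "\<dots> = sw x (\<lambda>x1 x2. eps x1 * \<Psi> v h x2 z)"
      by (intro sw_cong' counit_left) (auto intro!: L)
    also have "\<dots> = \<Psi> v h x z"
      by (intro counit_left) (auto intro!: L)
    finally show "(pi_op ^^ 0) \<Psi> v h x z = sw x (\<lambda>x1 x2. sw h (\<lambda>h1 h2. spow_op 0 (\<lambda>t. \<Psi> (t \<cdot> v) h2 x2 z) (h1 \<cdot> x1)))"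
      by simp
  qed
next
  case (Suc n)
  note L = lin_intros3 quadD[OF Suc.prems]
  show ?case
    unfolding eq4_def
  proof (intro ballI)
    fix v h x z assume [simp]: "v \<in> H" "h \<in> H" "x \<in> H" "z \<in> H"
    have "(pi_op ^^ Suc n) \<Psi> v h x z = (pi_op ^^ n) (pi_op \<Psi>) v h x z"
      by (simp only: funpow_Suc_right o_apply)
    also have "\<dots> = sw x (\<lambda>x1 x2. sw h (\<lambda>h1 h2. spow_op n (\<lambda>t. pi_op \<Psi> (t \<cdot> v) h2 x2 z) (h1 \<cdot> x1)))"
      using Suc.IH[OF quad_pi[OF Suc.prems]] by (simp add: eq4_def)
    also have "\<dots> = sw x (\<lambda>x1 x2. sw h (\<lambda>h1 h2. spow_op n (\<lambda>t. sw x2 (\<lambda>y1 y2. sw h2 (\<lambda>k1 k2. \<Psi> (k1 \<cdot> y1 \<cdot> t \<cdot> v) k2 y2 z))) (h1 \<cdot> x1)))"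
      unfolding pi_op_def by (intro sw_cong' spow_op_cong) (auto simp: mult_assoc)
    also have "\<dots> = sw x (\<lambda>x1 x2. sw x2 (\<lambda>y1 y2. sw h (\<lambda>h1 h2. sw h2 (\<lambda>k1 k2. spow_op n (\<lambda>t. \<Psi> (k1 \<cdot> y1 \<cdot> t \<cdot> v) k2 y2 z) (h1 \<cdot> x1)))))"
      by (simp only: spow_op_sw) (subst (2) sw_swap, rule refl)
    also have "\<dots> = sw x (\<lambda>w y2. sw w (\<lambda>x1 y1. sw h (\<lambda>h1 h2. sw h2 (\<lambda>k1 k2. spow_op n (\<lambda>t. \<Psi> (k1 \<cdot> y1 \<cdot> t \<cdot> v) k2 y2 z) (h1 \<cdot> x1)))))"
      by (intro coassoc[symmetric]) (auto intro!: L)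
    also have "\<dots> = sw x (\<lambda>w y2. sw w (\<lambda>x1 y1. sw h (\<lambda>g k2. sw g (\<lambda>h1 k1. spow_op n (\<lambda>t. \<Psi> (k1 \<cdot> y1 \<cdot> t \<cdot> v) k2 y2 z) (h1 \<cdot> x1)))))"
      by (intro sw_cong' coassoc[symmetric]) (auto intro!: L)
    also have "\<dots> = sw x (\<lambda>w y2. sw h (\<lambda>g k2. sw g (\<lambda>h1 k1. sw w (\<lambda>x1 y1. spow_op n (\<lambda>t. \<Psi> (k1 \<cdot> y1 \<cdot> t \<cdot> v) k2 y2 z) (h1 \<cdot> x1)))))"
      by (subst (2) sw_swap, subst (3) sw_swap, rule refl)
    also have "\<dots> = sw x (\<lambda>w y2. sw h (\<lambda>g k2. spow_op (Suc n) (\<lambda>t. \<Psi> (t \<cdot> v) k2 y2 z) (g \<cdot> w)))"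
      unfolding spow_op.simps by (intro sw_cong' comult_mult[symmetric]) (auto intro!: L)
    finally show "(pi_op ^^ Suc n) \<Psi> v h x z = sw x (\<lambda>x1 x2. sw h (\<lambda>h1 h2. spow_op (Suc n) (\<lambda>t. \<Psi> (t \<cdot> v) h2 x2 z) (h1 \<cdot> x1)))" .
  qed
qed

text \<open>\<open>kappa_op\<close> comes from a right action of H, which is multiplicative by
  \<open>sw4_mult\<close> and because \<open>Si\<close> reverses products. Iterating it multiplies
  the acting legs, and this product is a Sweedler power.\<close>

lemma kappa_power:
  assumes \<Psi>: "quad \<Psi>"
  shows "eq4 ((kappa_op ^^ n) \<Psi>)
    (\<lambda>v h x z. sw h (\<lambda>a b. spow n (\<lambda>k. sw4 k (\<lambda>k1 k2 k3 k4. \<Psi> (Si k1 \<cdot> v) b (Si k4 \<cdot> x \<cdot> k2) (z \<cdot> k3))) a))"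
  using \<Psi>
proof (induction n arbitrary: \<Psi>)
  case 0
  note L = lin_intros3 quadD[OF 0]
  show ?case
    unfolding eq4_def
  proof (intro ballI)
    fix v h x z assume [simp]: "v \<in> H" "h \<in> H" "x \<in> H" "z \<in> H"
    have S1: "\<Psi> (Si one \<cdot> v) b (Si one \<cdot> x) z = \<Psi> v b x z" if [simp]: "b \<in> H" for b
    proof -
      have "\<Psi> (Si one \<cdot> v) b (Si one \<cdot> x) z = \<Psi> (one \<cdot> v) b (Si one \<cdot> x) z"
        by (rule Si_one[of "\<lambda>w. \<Psi> (w \<cdot> v) b (Si one \<cdot> x) z"]) (auto intro!: L)
      also have "\<dots> = \<Psi> (one \<cdot> v) b (one \<cdot> x) z"
        by (rule Si_one[of "\<lambda>w. \<Psi> (one \<cdot> v) b (w \<cdot> x) z"]) (auto intro!: L)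
      finally show ?thesis by simp
    qed
    have "sw h (\<lambda>a b. spow 0 (\<lambda>k. sw4 k (\<lambda>k1 k2 k3 k4. \<Psi> (Si k1 \<cdot> v) b (Si k4 \<cdot> x \<cdot> k2) (z \<cdot> k3))) a)
      = sw h (\<lambda>a b. eps a * \<Psi> (Si one \<cdot> v) b (Si one \<cdot> x \<cdot> one) (z \<cdot> one))"
      unfolding spow.simps by (intro sw_cong' arg_cong[where f="\<lambda>u. _ * u"] sw4_one) (auto intro!: L)
    also have "\<dots> = sw h (\<lambda>a b. eps a * \<Psi> v b x z)"
      by (intro sw_cong') (auto simp: S1)
    also have "\<dots> = \<Psi> v h x z"
      by (intro counit_left) (auto intro!: L)
    finally show "(kappa_op ^^ 0) \<Psi> v h x z = sw h (\<lambda>a b. spow 0 (\<lambda>k. sw4 k (\<lambda>k1 k2 k3 k4. \<Psi> (Si k1 \<cdot> v) b (Si k4 \<cdot> x \<cdot> k2) (z \<cdot> k3))) a)"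
      by simp
  qed
next
  case (Suc n)
  note L = lin_intros3 quadD[OF Suc.prems] lin_sw4_const lin_sw4_arg
  show ?case
    unfolding eq4_def
  proof (intro ballI)
    fix v h x z assume [simp]: "v \<in> H" "h \<in> H" "x \<in> H" "z \<in> H"
    have Sm: "\<Psi> (Si p1 \<cdot> (Si k1 \<cdot> v)) q (Si p4 \<cdot> (Si k4 \<cdot> x \<cdot> k2) \<cdot> p2) (z \<cdot> k3 \<cdot> p3)
      = \<Psi> (Si (k1 \<cdot> p1) \<cdot> v) q (Si (k4 \<cdot> p4) \<cdot> x \<cdot> (k2 \<cdot> p2)) (z \<cdot> (k3 \<cdot> p3))"
      if [simp]: "k1 \<in> H" "k2 \<in> H" "k3 \<in> H" "k4 \<in> H" "p1 \<in> H" "p2 \<in> H" "p3 \<in> H" "p4 \<in> H" "q \<in> H" for k1 k2 k3 k4 p1 p2 p3 p4 q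
      using Si_mult[of "\<lambda>w. \<Psi> (w \<cdot> v) q (Si (k4 \<cdot> p4) \<cdot> (x \<cdot> (k2 \<cdot> p2))) (z \<cdot> (k3 \<cdot> p3))" k1 p1]
        Si_mult[of "\<lambda>w. \<Psi> (Si p1 \<cdot> (Si k1 \<cdot> v)) q (w \<cdot> (x \<cdot> (k2 \<cdot> p2))) (z \<cdot> (k3 \<cdot> p3))" k4 p4]
      by (simp add: mult_assoc L)
    have "(kappa_op ^^ Suc n) \<Psi> v h x z = (kappa_op ^^ n) (kappa_op \<Psi>) v h x z"
      by (simp only: funpow_Suc_right o_apply)
    also have "\<dots> = sw h (\<lambda>a b. spow n (\<lambda>k. sw4 k (\<lambda>k1 k2 k3 k4. kappa_op \<Psi> (Si k1 \<cdot> v) b (Si k4 \<cdot> x \<cdot> k2) (z \<cdot> k3))) a)"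
      using Suc.IH[OF quad_kappa[OF Suc.prems]] by (simp add: eq4_def)
    also have "\<dots> = sw h (\<lambda>a b. spow n (\<lambda>k. sw4 k (\<lambda>k1 k2 k3 k4. sw b (\<lambda>p q. sw4 p (\<lambda>p1 p2 p3 p4.
        \<Psi> (Si (k1 \<cdot> p1) \<cdot> v) q (Si (k4 \<cdot> p4) \<cdot> x \<cdot> (k2 \<cdot> p2)) (z \<cdot> (k3 \<cdot> p3)))))) a)"
      unfolding kappa_op_def by (intro sw_cong' spow_cong sw4_cong refl) (auto simp: Sm)
    also have "\<dots> = sw h (\<lambda>a b. sw b (\<lambda>p q. spow n (\<lambda>k. sw4 k (\<lambda>k1 k2 k3 k4. sw4 p (\<lambda>p1 p2 p3 p4.
        \<Psi> (Si (k1 \<cdot> p1) \<cdot> v) q (Si (k4 \<cdot> p4) \<cdot> x \<cdot> (k2 \<cdot> p2)) (z \<cdot> (k3 \<cdot> p3))))) a))"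
      by (simp only: sw4_sw spow_sw)
    also have "\<dots> = sw h (\<lambda>a b. sw b (\<lambda>p q. spow n (\<lambda>k. sw4 (k \<cdot> p) (\<lambda>k1 k2 k3 k4. \<Psi> (Si k1 \<cdot> v) q (Si k4 \<cdot> x \<cdot> k2) (z \<cdot> k3))) a))"
      by (intro sw_cong' spow_cong sw4_mult[symmetric] refl) (auto intro!: L)
    also have "\<dots> = sw h (\<lambda>g q. sw g (\<lambda>a p. spow n (\<lambda>k. sw4 (k \<cdot> p) (\<lambda>k1 k2 k3 k4. \<Psi> (Si k1 \<cdot> v) q (Si k4 \<cdot> x \<cdot> k2) (z \<cdot> k3))) a))"
      by (rule coassoc[symmetric]) (auto intro!: L)
    also have "\<dots> = sw h (\<lambda>a b. spow (Suc n) (\<lambda>k. sw4 k (\<lambda>k1 k2 k3 k4. \<Psi> (Si k1 \<cdot> v) b (Si k4 \<cdot> x \<cdot> k2) (z \<cdot> k3))) a)"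
      by simp
    finally show "(kappa_op ^^ Suc n) \<Psi> v h x z = sw h (\<lambda>a b. spow (Suc n) (\<lambda>k. sw4 k (\<lambda>k1 k2 k3 k4. \<Psi> (Si k1 \<cdot> v) b (Si k4 \<cdot> x \<cdot> k2) (z \<cdot> k3))) a)" .
  qed
qed

lemma pi_power_exponent:
  assumes n: "exponent n" and \<Psi>: "quad \<Psi>"
  shows "eq4 ((pi_op ^^ n) \<Psi>) \<Psi>"
proof -
  note [trans] = eq4_trans
  note L = lin_intros3 quadD[OF \<Psi>]
  have "eq4 ((pi_op ^^ n) \<Psi>) (\<lambda>v h x z. sw x (\<lambda>x1 x2. sw h (\<lambda>h1 h2. spow_op n (\<lambda>t. \<Psi> (t \<cdot> v) h2 x2 z) (h1 \<cdot> x1))))"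
    by (rule pi_power[OF \<Psi>])
  \<comment> \<open>The formulas for n and for 0 differ only in the Sweedler power, which
    \<open>exponent_op\<close> makes trivial; for 0 the formula returns \<Psi>.\<close>
  also have "eq4 \<dots> (\<lambda>v h x z. sw x (\<lambda>x1 x2. sw h (\<lambda>h1 h2. spow_op 0 (\<lambda>t. \<Psi> (t \<cdot> v) h2 x2 z) (h1 \<cdot> x1))))"
    unfolding eq4_def spow_op.simps by (intro ballI sw_cong' exponent_op[OF n]) (auto intro!: L)
  also have "eq4 \<dots> \<Psi>"
    using eq4_sym[OF pi_power[OF \<Psi>, of 0]] by simp
  finally show ?thesis .
qed

lemma kappa_power_exponent:
  assumes n: "exponent n" and \<Psi>: "quad \<Psi>"
  shows "eq4 ((kappa_op ^^ n) \<Psi>) \<Psi>"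
proof -
  note [trans] = eq4_trans
  note L = lin_intros3 quadD[OF \<Psi>] lin_sw4_const lin_sw4_arg
  have e: "spow n g y = eps y * g one" if "lin g" "y \<in> H" for g y
    using n that by (auto simp: exponent_def)
  have "eq4 ((kappa_op ^^ n) \<Psi>) (\<lambda>v h x z. sw h (\<lambda>a b. spow n (\<lambda>k. sw4 k (\<lambda>k1 k2 k3 k4. \<Psi> (Si k1 \<cdot> v) b (Si k4 \<cdot> x \<cdot> k2) (z \<cdot> k3))) a))"
    by (rule kappa_power[OF \<Psi>])
  also have "eq4 \<dots> (\<lambda>v h x z. sw h (\<lambda>a b. spow 0 (\<lambda>k. sw4 k (\<lambda>k1 k2 k3 k4. \<Psi> (Si k1 \<cdot> v) b (Si k4 \<cdot> x \<cdot> k2) (z \<cdot> k3))) a))"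
    unfolding eq4_def spow.simps by (intro ballI sw_cong' e) (auto intro!: L)
  also have "eq4 \<dots> \<Psi>"
    using eq4_sym[OF kappa_power[OF \<Psi>, of 0]] by simp
  finally show ?thesis .
qed

text \<open>As the two factors commute up to \<open>eq4\<close>, the n-th power of their product is
  the product of their n-th powers, and each of these is trivial.\<close>

lemma double_power_exponent:
  assumes n: "exponent n" and \<Psi>: "quad \<Psi>"
  shows "eq4 ((double_op ^^ n) \<Psi>) \<Psi>"
proof -
  have pow_pi: "quad F \<Longrightarrow> quad ((pi_op ^^ m) F)" and pow_kappa: "quad F \<Longrightarrow> quad ((kappa_op ^^ m) F)" for m F
    by (induction m) (auto intro: quad_pi quad_kappa)
  have eq_pi: "eq4 F G \<Longrightarrow> eq4 ((pi_op ^^ m) F) ((pi_op ^^ m) G)"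
    and eq_kappa: "eq4 F G \<Longrightarrow> eq4 ((kappa_op ^^ m) F) ((kappa_op ^^ m) G)"
    and eq_double: "eq4 F G \<Longrightarrow> eq4 ((double_op ^^ m) F) ((double_op ^^ m) G)" for m F G
    by (induction m) (auto intro: eq4_pi eq4_kappa eq4_double)
  have comm: "eq4 ((kappa_op ^^ m) (pi_op F)) (pi_op ((kappa_op ^^ m) F))" if "quad F" for m F
    using that
  proof (induction m arbitrary: F)
    case (Suc m)
    have "eq4 (kappa_op (pi_op F)) (pi_op (kappa_op F))"
      using kappa_pi[OF Suc.prems] pi_kappa[OF Suc.prems] by (blast intro: eq4_trans eq4_sym)
    from eq_kappa[OF this, of m] Suc.IH[OF quad_kappa[OF Suc.prems]] show ?case
      by (simp only: funpow_Suc_right o_apply) (blast intro: eq4_trans)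
  qed (simp add: eq4_refl)
  have "eq4 ((double_op ^^ m) F) ((pi_op ^^ m) ((kappa_op ^^ m) F))" if "quad F" for m F
    using that
  proof (induction m arbitrary: F)
    case (Suc m)
    have 1: "eq4 ((double_op ^^ m) (double_op F)) ((double_op ^^ m) (pi_op (kappa_op F)))"
      by (rule eq_double[OF eq4_sym[OF pi_kappa[OF Suc.prems]]])
    have 2: "eq4 ((double_op ^^ m) (pi_op (kappa_op F))) ((pi_op ^^ m) ((kappa_op ^^ m) (pi_op (kappa_op F))))"
      by (rule Suc.IH[OF quad_pi[OF quad_kappa[OF Suc.prems]]])
    have 3: "eq4 ((pi_op ^^ m) ((kappa_op ^^ m) (pi_op (kappa_op F)))) ((pi_op ^^ m) (pi_op ((kappa_op ^^ m) (kappa_op F))))"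
      by (rule eq_pi[OF comm[OF quad_kappa[OF Suc.prems]]])
    from eq4_trans[OF eq4_trans[OF 1 2] 3] show ?case
      by (simp only: funpow_Suc_right o_apply)
  qed (simp add: eq4_refl)
  from this[OF \<Psi>, of n] pi_power_exponent[OF n pow_kappa[OF \<Psi>]] kappa_power_exponent[OF n \<Psi>] show ?thesis
    by (blast intro: eq4_trans)
qed

text \<open>\<open>double_op\<close> takes legs off the front of \<open>h\<close> and passes the
  last one on, so by coassociativity it commutes with splitting a further leg \<open>b\<close> off
  the end. In the double, \<open>b\<close> belongs to the factor of the coproduct that multiplies
  the third element.\<close>

lemma double_power_sw:
  assumes \<Phi>: "\<And>b. b \<in> H \<Longrightarrow> quad (\<Phi> b)"
      "\<And>t v h x z. \<lbrakk>lop t; v \<in> H; h \<in> H; x \<in> H; z \<in> H\<rbrakk> \<Longrightarrow> lin (\<lambda>b. \<Phi> (t b) v h x z)"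
    and "eq4 \<Psi> (\<lambda>v h x z. sw h (\<lambda>a b. \<Phi> b v a x z))"
  shows "eq4 ((double_op ^^ n) \<Psi>) (\<lambda>v h x z. sw h (\<lambda>a b. (double_op ^^ n) (\<Phi> b) v a x z))"
  using assms
proof (induction n arbitrary: \<Phi> \<Psi>)
  case (Suc n)
  note L = lin_intros3 Suc.prems(2)
    quadD(1)[OF Suc.prems(1)] quadD(2)[OF Suc.prems(1)] quadD(3)[OF Suc.prems(1)] quadD(4)[OF Suc.prems(1)]
  have "eq4 (double_op \<Psi>) (\<lambda>v h x z. sw h (\<lambda>a b. double_op (\<Phi> b) v a x z))"
    unfolding eq4_def
  proof (intro ballI)
    fix v h x z assume [simp]: "v \<in> H" "h \<in> H" "x \<in> H" "z \<in> H"
    let ?t = "\<lambda>x1 x2 h1 h2 h3 a b. \<Phi> b (x1 \<cdot> v) a (Si h3 \<cdot> x2 \<cdot> h1) (z \<cdot> h2)"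
    have "double_op \<Psi> v h x z = sw x (\<lambda>x1 x2. sw h (\<lambda>h1 r. sw r (\<lambda>h2 r. sw r (\<lambda>h3 h4. sw h4 (\<lambda>a b. ?t x1 x2 h1 h2 h3 a b)))))"
      unfolding double_op_def using Suc.prems(3) by (intro sw_cong') (auto simp: eq4_def)
    also have "\<dots> = sw x (\<lambda>x1 x2. sw h (\<lambda>h1 r. sw r (\<lambda>h2 r. sw r (\<lambda>r b. sw r (\<lambda>h3 a. ?t x1 x2 h1 h2 h3 a b)))))"
      by (intro sw_cong' coassoc[symmetric]) (auto intro!: L)
    also have "\<dots> = sw x (\<lambda>x1 x2. sw h (\<lambda>h1 r. sw r (\<lambda>r b. sw r (\<lambda>h2 r. sw r (\<lambda>h3 a. ?t x1 x2 h1 h2 h3 a b)))))"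
      by (intro sw_cong' coassoc[symmetric]) (auto intro!: L)
    also have "\<dots> = sw x (\<lambda>x1 x2. sw h (\<lambda>r b. sw r (\<lambda>h1 r. sw r (\<lambda>h2 r. sw r (\<lambda>h3 a. ?t x1 x2 h1 h2 h3 a b)))))"
      by (intro sw_cong' coassoc[symmetric]) (auto intro!: L)
    also have "\<dots> = sw h (\<lambda>a b. double_op (\<Phi> b) v a x z)"
      unfolding double_op_def by (rule sw_swap)
    finally show "double_op \<Psi> v h x z = sw h (\<lambda>a b. double_op (\<Phi> b) v a x z)" .
  qed
  then have "eq4 ((double_op ^^ n) (double_op \<Psi>)) (\<lambda>v h x z. sw h (\<lambda>a b. (double_op ^^ n) (double_op (\<Phi> b)) v a x z))"
    by (rule Suc.IH[rotated 2]) (auto intro!: quad_double Suc.prems(1), auto simp: double_op_def intro!: L)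
  then show ?case by (simp only: funpow_Suc_right o_apply)
qed simp

text \<open>The case of the elements 1 \<otimes> h of the double: all dual parts are counits, and a
  Sweedler power of \<open>h\<close> remains. This is where H appears as a Hopf subalgebra.\<close>

lemma double_power_counit:
  assumes "lin \<phi>"
  shows "eq4 ((double_op ^^ n) (\<lambda>v h x z. eps v * eps h * (eps x * \<phi> z))) (\<lambda>v h x z. eps v * (eps x * spow n (\<lambda>t. \<phi> (z \<cdot> t)) h))"
proof (induction n)
  case (Suc n)
  note L = lin_intros3 lin_app[OF assms]
  show ?case
    unfolding eq4_def
  proof (intro ballI)
    fix v h x z assume [simp]: "v \<in> H" "h \<in> H" "x \<in> H" "z \<in> H"
    let ?s = "\<lambda>z h. spow n (\<lambda>t. \<phi> (z \<cdot> t)) h"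
    have "(double_op ^^ Suc n) (\<lambda>v h x z. eps v * eps h * (eps x * \<phi> z)) v h x z
      = double_op (\<lambda>v h x z. eps v * (eps x * spow n (\<lambda>t. \<phi> (z \<cdot> t)) h)) v h x z"
      using eq4_double[OF Suc] by (simp add: eq4_def)
    also have "\<dots> = sw x (\<lambda>x1 x2. sw h (\<lambda>h1 r. eps h1 * sw r (\<lambda>h2 r. sw r (\<lambda>h3 h4. eps h3 * (eps x1 * (eps x2 * (eps v * ?s (z \<cdot> h2) h4)))))))"
      unfolding double_op_def sw_cmult[symmetric] by (intro sw_cong') (auto simp: counit_mult counit_Si ac_simps)
    also have "\<dots> = sw x (\<lambda>x1 x2. sw h (\<lambda>h2 r. sw r (\<lambda>h3 h4. eps h3 * (eps x1 * (eps x2 * (eps v * ?s (z \<cdot> h2) h4))))))"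
      by (intro sw_cong' counit_left) (auto intro!: L)
    also have "\<dots> = sw x (\<lambda>x1 x2. sw h (\<lambda>h2 h4. eps x1 * (eps x2 * (eps v * ?s (z \<cdot> h2) h4))))"
      by (intro sw_cong' counit_left) (auto intro!: L)
    also have "\<dots> = sw x (\<lambda>x1 x2. eps x1 * sw h (\<lambda>h2 h4. (eps x2 * (eps v * ?s (z \<cdot> h2) h4))))"
      by (simp only: sw_cmult)
    also have "\<dots> = sw h (\<lambda>h2 h4. (eps x * (eps v * ?s (z \<cdot> h2) h4)))"
      by (rule counit_left) (auto intro!: L)
    also have "\<dots> = eps v * (eps x * sw h (\<lambda>h2 h4. ?s (z \<cdot> h2) h4))"
      by (simp only: sw_cmult mult.left_commute)
    also have "sw h (\<lambda>h2 h4. ?s (z \<cdot> h2) h4) = sw h (\<lambda>a b. spow n (\<lambda>t. \<phi> (z \<cdot> (a \<cdot> t))) b)"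
      by (intro sw_cong' spow_cong) (auto simp: mult_assoc)
    also have "\<dots> = spow (Suc n) (\<lambda>t. \<phi> (z \<cdot> t)) h"
      by (rule spow_Suc2[symmetric]) (auto intro!: L)
    finally show "(double_op ^^ Suc n) (\<lambda>v h x z. eps v * eps h * (eps x * \<phi> z)) v h x z = eps v * (eps x * spow (Suc n) (\<lambda>t. \<phi> (z \<cdot> t)) h)" .
  qed
qed (simp add: eq4_def ac_simps)

end

subsection \<open>Twists\<close>

context hopf_calc begin

definition eq2 :: "('h \<Rightarrow> 'h \<Rightarrow> 'r) \<Rightarrow> ('h \<Rightarrow> 'h \<Rightarrow> 'r) \<Rightarrow> bool" where
  "eq2 F G \<longleftrightarrow> (\<forall>x\<in>H. \<forall>y\<in>H. F x y = G x y)"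

lemma eq2_trans: "\<lbrakk>eq2 F G; eq2 G K\<rbrakk> \<Longrightarrow> eq2 F K"
  by (simp add: eq2_def)

lemma eq2_sym: "eq2 F G \<Longrightarrow> eq2 G F"
  by (simp add: eq2_def)

text \<open>The transpose of x \<otimes> y \<mapsto> x_(1) \<otimes> x_(2) y, the canonical Galois
  map of H over the ground field.\<close>

definition beta where
  "beta B x y = sw x (\<lambda>a b. B a (b \<cdot> y))"

lemma eq2_beta: "eq2 F G \<Longrightarrow> eq2 (beta F) (beta G)"
  unfolding eq2_def beta_def by (auto intro!: sw_cong)

lemma beta_power_counit:
  assumes "lin \<phi>"
  shows "eq2 ((beta ^^ n) (\<lambda>x y. eps x * \<phi> y)) (\<lambda>x y. spow n (\<lambda>t. \<phi> (t \<cdot> y)) x)"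
proof (induction n)
  case (Suc n)
  have "eq2 (beta (\<lambda>x y. spow n (\<lambda>t. \<phi> (t \<cdot> y)) x)) (\<lambda>x y. spow (Suc n) (\<lambda>t. \<phi> (t \<cdot> y)) x)"
    unfolding eq2_def beta_def spow.simps by (intro ballI sw_cong' spow_cong) (auto simp: mult_assoc)
  with eq2_beta[OF Suc] show ?case by (auto intro: eq2_trans)
qed (simp add: eq2_def)

lemma beta_power:
  assumes B: "bil B"
  shows "eq2 ((beta ^^ n) B) (\<lambda>x y. sw x (\<lambda>a b. spow n (\<lambda>t. B a (t \<cdot> y)) b))"
proof (induction n)
  case 0
  show ?case
    unfolding eq2_def
  proof (intro ballI)
    fix x y assume [simp]: "x \<in> H" "y \<in> H"
    have "sw x (\<lambda>a b. spow 0 (\<lambda>t. B a (t \<cdot> y)) b) = sw x (\<lambda>a b. eps b * B a y)"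
      unfolding spow.simps by (intro sw_cong') auto
    also have "\<dots> = B x y" by (rule counit_right) (auto intro!: bilD[OF B] lop_id)
    finally show "(beta ^^ 0) B x y = sw x (\<lambda>a b. spow 0 (\<lambda>t. B a (t \<cdot> y)) b)" by simp
  qed
next
  case (Suc n)
  note L = lin_intros2 bilD[OF B]
  have "eq2 (beta (\<lambda>x y. sw x (\<lambda>a b. spow n (\<lambda>t. B a (t \<cdot> y)) b))) (\<lambda>x y. sw x (\<lambda>a b. spow (Suc n) (\<lambda>t. B a (t \<cdot> y)) b))"
    unfolding eq2_def
  proof (intro ballI)
    fix x y assume [simp]: "x \<in> H" "y \<in> H"
    have "beta (\<lambda>x y. sw x (\<lambda>a b. spow n (\<lambda>t. B a (t \<cdot> y)) b)) x y
      = sw x (\<lambda>p q. sw p (\<lambda>a b. spow n (\<lambda>t. B a (t \<cdot> q \<cdot> y)) b))"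
      unfolding beta_def by (intro sw_cong' spow_cong) (auto simp: mult_assoc)
    also have "\<dots> = sw x (\<lambda>a r. sw r (\<lambda>b q. spow n (\<lambda>t. B a (t \<cdot> q \<cdot> y)) b))"
      by (rule coassoc) (auto intro!: L)
    finally show "beta (\<lambda>x y. sw x (\<lambda>a b. spow n (\<lambda>t. B a (t \<cdot> y)) b)) x y = sw x (\<lambda>a b. spow (Suc n) (\<lambda>t. B a (t \<cdot> y)) b)"
      by simp
  qed
  with eq2_beta[OF Suc] show ?case by (auto intro: eq2_trans)
qed

lemma beta_power_exponent:
  assumes n: "exponent n" and B: "bil B"
  shows "eq2 ((beta ^^ n) B) B"
proof -
  note L = lin_intros2 bilD[OF B]
  have e: "spow n g y = eps y * g one" if "lin g" "y \<in> H" for g y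
    using n that by (auto simp: exponent_def)
  have "eq2 (\<lambda>x y. sw x (\<lambda>a b. spow n (\<lambda>t. B a (t \<cdot> y)) b)) (\<lambda>x y. sw x (\<lambda>a b. spow 0 (\<lambda>t. B a (t \<cdot> y)) b))"
    unfolding eq2_def spow.simps by (intro ballI sw_cong' e) (auto intro!: L)
  with beta_power[OF B, of n] eq2_sym[OF beta_power[OF B, of 0]] show ?thesis
    by (auto intro: eq2_trans)
qed

end

section \<open>The twist equation and its consequences\<close>

locale twist_calc = hopf_calc_bij H d e c mul one S eps Dl Si
  for H :: "'h set" and d :: nat and e :: "nat \<Rightarrow> 'h" and c :: "nat \<Rightarrow> 'h \<Rightarrow> 'r::comm_ring"
    and mul :: "'h \<Rightarrow> 'h \<Rightarrow> 'h"  (infixl \<open>\<cdot>\<close> 70) and one :: 'h and S :: "'h \<Rightarrow> 'h"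
    and eps :: "'h \<Rightarrow> 'r" and Dl :: "nat \<Rightarrow> 'h \<Rightarrow> 'h" and Si :: "'h \<Rightarrow> 'h" +
  fixes J J' :: "nat \<Rightarrow> 'h"
  assumes J_in: "\<forall>i<d. J i \<in> H" and J'_in: "\<forall>i<d. J' i \<in> H"
    and J_J': "bil F \<Longrightarrow> tsw J (\<lambda>a b. tsw J' (\<lambda>p q. F (a \<cdot> p) (b \<cdot> q))) = F one one"
    and J'_J: "bil F \<Longrightarrow> tsw J' (\<lambda>a b. tsw J (\<lambda>p q. F (a \<cdot> p) (b \<cdot> q))) = F one one"
    and cocycle: "tri T \<Longrightarrow> tsw J (\<lambda>a b. tsw J (\<lambda>p q. sw p (\<lambda>r s. T (a \<cdot> r) (b \<cdot> s) q)))
      = tsw J (\<lambda>a b. tsw J (\<lambda>p q. sw q (\<lambda>r s. T p (a \<cdot> r) (b \<cdot> s))))"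
begin

lemmas J_cong = tsw_cong[OF J_in] and J'_cong = tsw_cong[OF J'_in]
lemmas lin_J = lin_tsw[OF J_in] and lin_J' = lin_tsw[OF J'_in]
lemmas lin_intros4 = lin_J lin_J' lin_intros3

text \<open>(J \<otimes> 1)(\<Delta> \<otimes> id)(J) and (1 \<otimes> J)(id \<otimes> \<Delta>)(J),
  the two sides of the twist equation, paired with a trilinear form. The primed versions are their
  inverses, so their factors come in the opposite order.\<close>

definition cocA where
  "cocA T = tsw J (\<lambda>a b. tsw J (\<lambda>p q. sw p (\<lambda>r s. T (a \<cdot> r) (b \<cdot> s) q)))"
definition cocB where
  "cocB T = tsw J (\<lambda>a b. tsw J (\<lambda>p q. sw q (\<lambda>r s. T p (a \<cdot> r) (b \<cdot> s))))"
definition cocA' where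
  "cocA' T = tsw J' (\<lambda>p q. tsw J' (\<lambda>a b. sw p (\<lambda>r s. T (r \<cdot> a) (s \<cdot> b) q)))"
definition cocB' where
  "cocB' T = tsw J' (\<lambda>p q. tsw J' (\<lambda>a b. sw q (\<lambda>r s. T p (r \<cdot> a) (s \<cdot> b))))"

lemma cocA'_cocA:
  assumes T: "tri T"
  shows "cocA' (\<lambda>u v t. cocA (\<lambda>x y z. T (u \<cdot> x) (v \<cdot> y) (t \<cdot> z))) = T one one one"
proof -
  note L = lin_intros4 triD[OF T]
  let ?X = "\<lambda>a b r s q a2 b2 r2 s2 q2. T (r \<cdot> ((a \<cdot> a2) \<cdot> r2)) (s \<cdot> ((b \<cdot> b2) \<cdot> s2)) (q \<cdot> q2)"
  have "cocA' (\<lambda>u v t. cocA (\<lambda>x y z. T (u \<cdot> x) (v \<cdot> y) (t \<cdot> z)))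
     = tsw J' (\<lambda>p q. tsw J' (\<lambda>a b. sw p (\<lambda>r s. tsw J (\<lambda>a2 b2. tsw J (\<lambda>p2 q2. sw p2 (\<lambda>r2 s2. ?X a b r s q a2 b2 r2 s2 q2))))))"
    unfolding cocA_def cocA'_def by (intro J_cong J'_cong sw_cong') (auto simp: mult_assoc)
  also have "\<dots> = tsw J' (\<lambda>p q. sw p (\<lambda>r s. tsw J' (\<lambda>a b. tsw J (\<lambda>p2 q2. sw p2 (\<lambda>r2 s2. tsw J (\<lambda>a2 b2. ?X a b r s q a2 b2 r2 s2 q2))))))"
    by (simp only: sw_tsw) (subst (3) tsw_swap, rule refl)
  also have "\<dots> = tsw J' (\<lambda>p q. sw p (\<lambda>r s. tsw J (\<lambda>p2 q2. sw p2 (\<lambda>r2 s2. tsw J' (\<lambda>a b. tsw J (\<lambda>a2 b2. ?X a b r s q a2 b2 r2 s2 q2))))))"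
    by (simp only: sw_tsw) (subst (2) tsw_swap, rule refl)
  also have "\<dots> = tsw J' (\<lambda>p q. sw p (\<lambda>r s. tsw J (\<lambda>p2 q2. sw p2 (\<lambda>r2 s2. T (r \<cdot> (one \<cdot> r2)) (s \<cdot> (one \<cdot> s2)) (q \<cdot> q2)))))"
    by (intro J_cong J'_cong sw_cong' J'_J) (auto intro!: L)
  also have "\<dots> = tsw J' (\<lambda>p q. tsw J (\<lambda>p2 q2. sw p (\<lambda>r s. sw p2 (\<lambda>r2 s2. T (r \<cdot> r2) (s \<cdot> s2) (q \<cdot> q2)))))"
    unfolding sw_tsw by (intro J_cong J'_cong sw_cong') auto
  also have "\<dots> = tsw J' (\<lambda>p q. tsw J (\<lambda>p2 q2. sw (p \<cdot> p2) (\<lambda>r s. T r s (q \<cdot> q2))))"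
    by (intro J_cong J'_cong comult_mult[symmetric]) (auto intro!: L)
  also have "\<dots> = sw one (\<lambda>r s. T r s one)"
    by (rule J'_J) (auto intro!: L)
  also have "\<dots> = T one one one"
    by (rule comult_one) (auto intro!: L)
  finally show ?thesis .
qed

lemma cocB_cocB':
  assumes T: "tri T"
  shows "cocB (\<lambda>u v t. cocB' (\<lambda>x y z. T (u \<cdot> x) (v \<cdot> y) (t \<cdot> z))) = T one one one"
proof -
  note L = lin_intros4 triD[OF T]
  let ?X = "\<lambda>a b r s p a2 b2 r2 s2 p2. T (p \<cdot> p2) (a \<cdot> ((r \<cdot> r2) \<cdot> a2)) (b \<cdot> ((s \<cdot> s2) \<cdot> b2))"
  have "cocB (\<lambda>u v t. cocB' (\<lambda>x y z. T (u \<cdot> x) (v \<cdot> y) (t \<cdot> z)))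
     = tsw J (\<lambda>a b. tsw J (\<lambda>p q. sw q (\<lambda>r s. tsw J' (\<lambda>p2 q2. tsw J' (\<lambda>a2 b2. sw q2 (\<lambda>r2 s2. ?X a b r s p a2 b2 r2 s2 p2))))))"
    unfolding cocB_def cocB'_def by (intro J_cong J'_cong sw_cong') (auto simp: mult_assoc)
  also have "\<dots> = tsw J (\<lambda>a b. tsw J (\<lambda>p q. tsw J' (\<lambda>p2 q2. tsw J' (\<lambda>a2 b2. sw q (\<lambda>r s. sw q2 (\<lambda>r2 s2. ?X a b r s p a2 b2 r2 s2 p2))))))"
    by (simp only: sw_tsw)
  also have "\<dots> = tsw J (\<lambda>a b. tsw J (\<lambda>p q. tsw J' (\<lambda>p2 q2. tsw J' (\<lambda>a2 b2. sw (q \<cdot> q2) (\<lambda>r s. T (p \<cdot> p2) (a \<cdot> (r \<cdot> a2)) (b \<cdot> (s \<cdot> b2)))))))"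
    by (intro J_cong J'_cong comult_mult[symmetric]) (auto intro!: L)
  also have "\<dots> = tsw J (\<lambda>a b. tsw J' (\<lambda>a2 b2. tsw J (\<lambda>p q. tsw J' (\<lambda>p2 q2. sw (q \<cdot> q2) (\<lambda>r s. T (p \<cdot> p2) (a \<cdot> (r \<cdot> a2)) (b \<cdot> (s \<cdot> b2)))))))"
    by (subst (3) tsw_swap, subst (2) tsw_swap, rule refl)
  also have "\<dots> = tsw J (\<lambda>a b. tsw J' (\<lambda>a2 b2. sw one (\<lambda>r s. T one (a \<cdot> (r \<cdot> a2)) (b \<cdot> (s \<cdot> b2)))))"
    by (intro J_cong J'_cong J_J') (auto intro!: L)
  also have "\<dots> = tsw J (\<lambda>a b. tsw J' (\<lambda>a2 b2. T one (a \<cdot> (one \<cdot> a2)) (b \<cdot> (one \<cdot> b2))))"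
    by (intro J_cong J'_cong comult_one) (auto intro!: L)
  also have "\<dots> = tsw J (\<lambda>a b. tsw J' (\<lambda>a2 b2. T one (a \<cdot> a2) (b \<cdot> b2)))"
    by (intro J_cong J'_cong) auto
  also have "\<dots> = T one one one"
    by (rule J_J') (auto intro!: L)
  finally show ?thesis .
qed

lemma cocA'_cong: "(\<And>u v t. \<lbrakk>u \<in> H; v \<in> H; t \<in> H\<rbrakk> \<Longrightarrow> F u v t = G u v t) \<Longrightarrow> cocA' (\<lambda>u v t. F u v t) = cocA' (\<lambda>u v t. G u v t)"
  unfolding cocA'_def by (intro J'_cong sw_cong') auto

lemma cocB'_cong: "(\<And>u v t. \<lbrakk>u \<in> H; v \<in> H; t \<in> H\<rbrakk> \<Longrightarrow> F u v t = G u v t) \<Longrightarrow> cocB' (\<lambda>u v t. F u v t) = cocB' (\<lambda>u v t. G u v t)"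
  unfolding cocB'_def by (intro J'_cong sw_cong') auto

lemma lin_cocB': "(\<And>u v t. \<lbrakk>u \<in> H; v \<in> H; t \<in> H\<rbrakk> \<Longrightarrow> lin (\<lambda>x. F x u v t)) \<Longrightarrow> lin (\<lambda>x. cocB' (\<lambda>u v t. F x u v t))"
  unfolding cocB'_def by (auto intro!: lin_intros4)

text \<open>Uniqueness of inverses: A' = A' B B' = A' A B' = B', where A = B is the twist
  equation.\<close>

lemma cocycle_inv:
  assumes T: "tri T"
  shows "cocA' T = cocB' T"
proof -
  note L = lin_intros4 triD[OF T]
  let ?K = "\<lambda>u v t. cocB' (\<lambda>x y z. T (u \<cdot> x) (v \<cdot> y) (t \<cdot> z))"
  have K: "tri ?K" by (auto intro!: L lin_cocB')
  have "cocA' T = cocA' (\<lambda>u v t. cocB (\<lambda>x y z. ?K (u \<cdot> x) (v \<cdot> y) (t \<cdot> z)))"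
  proof (rule cocA'_cong)
    fix u v t assume [simp]: "u \<in> H" "v \<in> H" "t \<in> H"
    have "cocB (\<lambda>x y z. ?K (u \<cdot> x) (v \<cdot> y) (t \<cdot> z)) = cocB (\<lambda>a b k. cocB' (\<lambda>x y z. T (u \<cdot> (a \<cdot> x)) (v \<cdot> (b \<cdot> y)) (t \<cdot> (k \<cdot> z))))"
      unfolding cocB_def by (intro J_cong sw_cong' cocB'_cong) (auto simp: mult_assoc)
    also have "\<dots> = T (u \<cdot> one) (v \<cdot> one) (t \<cdot> one)"
      by (rule cocB_cocB'[of "\<lambda>x y z. T (u \<cdot> x) (v \<cdot> y) (t \<cdot> z)"]) (auto intro!: L)
    finally show "T u v t = cocB (\<lambda>x y z. ?K (u \<cdot> x) (v \<cdot> y) (t \<cdot> z))" by simp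
  qed
  also have "\<dots> = cocA' (\<lambda>u v t. cocA (\<lambda>x y z. ?K (u \<cdot> x) (v \<cdot> y) (t \<cdot> z)))"
    by (rule cocA'_cong, unfold cocA_def cocB_def, rule cocycle[symmetric]) (auto intro!: lin_intros4 triD[OF K])
  also have "\<dots> = ?K one one one"
    by (rule cocA'_cocA[OF K])
  also have "\<dots> = cocB' T"
    by (rule cocB'_cong) auto
  finally show ?thesis .
qed

text \<open>The twist equation with factors moved across: (J^-1 \<otimes> 1)(1 \<otimes> J) =
  (\<Delta> \<otimes> id)(J) (id \<otimes> \<Delta>)(J^-1). It is used to invert the element behind
  \<open>w_op\<close>.\<close>

lemma cocycle_mixed:
  assumes T: "tri T"
  shows "tsw J' (\<lambda>p q. tsw J (\<lambda>a b. T p (q \<cdot> a) b))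
    = tsw J (\<lambda>k l. tsw J' (\<lambda>p q. sw k (\<lambda>k1 k2. sw q (\<lambda>q1 q2. T (k1 \<cdot> p) (k2 \<cdot> q1) (l \<cdot> q2)))))"
proof -
  note L = lin_intros4 triD[OF T]
  \<comment> \<open>\<open>?T\<close> multiplies the inverted twist equation by (\<Delta> \<otimes>
    id)(J) from the left and by 1 \<otimes> J from the right; on each side one pair of factors then
    cancels.\<close>
  let ?T = "\<lambda>u v t. tsw J (\<lambda>k l. sw k (\<lambda>k1 k2. tsw J (\<lambda>a b. T (k1 \<cdot> u) (k2 \<cdot> (v \<cdot> a)) (l \<cdot> (t \<cdot> b)))))"
  have "cocA' ?T = tsw J' (\<lambda>p q. tsw J' (\<lambda>a b. sw p (\<lambda>r s. tsw J (\<lambda>k l. sw k (\<lambda>k1 k2. tsw J (\<lambda>a2 b2. T ((k1 \<cdot> r) \<cdot> a) ((k2 \<cdot> s) \<cdot> (b \<cdot> a2)) ((l \<cdot> q) \<cdot> b2)))))))"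
    unfolding cocA'_def by (intro J_cong J'_cong sw_cong') (auto simp: mult_assoc)
  also have "\<dots> = tsw J' (\<lambda>a b. tsw J (\<lambda>a2 b2. tsw J (\<lambda>k l. tsw J' (\<lambda>p q. sw k (\<lambda>k1 k2. sw p (\<lambda>r s. T ((k1 \<cdot> r) \<cdot> a) ((k2 \<cdot> s) \<cdot> (b \<cdot> a2)) ((l \<cdot> q) \<cdot> b2)))))))"
    by (subst tsw_swap, intro J'_cong, simp only: sw_tsw)
      (subst (2) tsw_swap, subst tsw_swap, subst (2) tsw_swap, subst sw_swap, rule refl)
  also have "\<dots> = tsw J' (\<lambda>a b. tsw J (\<lambda>a2 b2. tsw J (\<lambda>k l. tsw J' (\<lambda>p q. sw (k \<cdot> p) (\<lambda>r s. T (r \<cdot> a) (s \<cdot> (b \<cdot> a2)) ((l \<cdot> q) \<cdot> b2))))))"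
    by (intro J_cong J'_cong comult_mult[symmetric]) (auto intro!: L)
  also have "\<dots> = tsw J' (\<lambda>a b. tsw J (\<lambda>a2 b2. sw one (\<lambda>r s. T (r \<cdot> a) (s \<cdot> (b \<cdot> a2)) (one \<cdot> b2))))"
    by (intro J_cong J'_cong J_J') (auto intro!: L)
  also have "\<dots> = tsw J' (\<lambda>a b. tsw J (\<lambda>a2 b2. T (one \<cdot> a) (one \<cdot> (b \<cdot> a2)) (one \<cdot> b2)))"
    by (intro J_cong J'_cong comult_one) (auto intro!: L)
  also have "\<dots> = tsw J' (\<lambda>p q. tsw J (\<lambda>a b. T p (q \<cdot> a) b))"
    by (intro J_cong J'_cong) auto
  finally have 1: "cocA' ?T = tsw J' (\<lambda>p q. tsw J (\<lambda>a b. T p (q \<cdot> a) b))" .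
  have "cocB' ?T = tsw J' (\<lambda>p q. tsw J' (\<lambda>a b. sw q (\<lambda>r s. tsw J (\<lambda>k l. sw k (\<lambda>k1 k2. tsw J (\<lambda>a2 b2. T (k1 \<cdot> p) (k2 \<cdot> (r \<cdot> (a \<cdot> a2))) (l \<cdot> (s \<cdot> (b \<cdot> b2)))))))))"
    unfolding cocB'_def by (intro J_cong J'_cong sw_cong') (auto simp: mult_assoc)
  also have "\<dots> = tsw J' (\<lambda>p q. tsw J (\<lambda>k l. sw k (\<lambda>k1 k2. sw q (\<lambda>r s. tsw J' (\<lambda>a b. tsw J (\<lambda>a2 b2. T (k1 \<cdot> p) (k2 \<cdot> (r \<cdot> (a \<cdot> a2))) (l \<cdot> (s \<cdot> (b \<cdot> b2)))))))))"
    by (simp only: sw_tsw) (subst (2) tsw_swap, subst sw_swap, rule refl)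
  also have "\<dots> = tsw J' (\<lambda>p q. tsw J (\<lambda>k l. sw k (\<lambda>k1 k2. sw q (\<lambda>r s. T (k1 \<cdot> p) (k2 \<cdot> (r \<cdot> one)) (l \<cdot> (s \<cdot> one))))))"
    by (intro J_cong J'_cong sw_cong' J'_J) (auto intro!: L)
  also have "\<dots> = tsw J' (\<lambda>p q. tsw J (\<lambda>k l. sw k (\<lambda>k1 k2. sw q (\<lambda>r s. T (k1 \<cdot> p) (k2 \<cdot> r) (l \<cdot> s)))))"
    by (intro J_cong J'_cong sw_cong') auto
  also have "\<dots> = tsw J (\<lambda>k l. tsw J' (\<lambda>p q. sw k (\<lambda>k1 k2. sw q (\<lambda>q1 q2. T (k1 \<cdot> p) (k2 \<cdot> q1) (l \<cdot> q2)))))"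
    by (rule tsw_swap)
  finally have 2: "cocB' ?T = \<dots>" .
  have "tri ?T" by (auto intro!: L)
  from cocycle_inv[OF this] 1 2 show ?thesis by simp
qed

text \<open>A twist need not be normalised; its counit is a unit, and so is the constant that relates the two sides.\<close>

definition gam :: 'r where "gam = tsw J (\<lambda>a b. eps a * eps b)"
definition gam' :: 'r where "gam' = tsw J' (\<lambda>a b. eps a * eps b)"

text \<open>Apply \<epsilon> to the middle leg of the twist equation and cancel J: (id \<otimes>
  \<epsilon>)(J) \<otimes> 1 = 1 \<otimes> (\<epsilon> \<otimes> id)(J), so both are the same scalar
  times 1.\<close>

lemma twist_counit:
  assumes f: "lin f"
  shows "tsw J (\<lambda>a b. eps a * f b) = gam * f one" "tsw J (\<lambda>a b. eps b * f a) = gam * f one"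
proof -
  have 1: "tsw J (\<lambda>a b. eps b * G a one) = tsw J (\<lambda>a b. eps a * G one b)" if G: "bil G" for G
  proof -
    note L = lin_intros4 bilD[OF G]
    \<comment> \<open>Multiplication by J^-1 on the right, so that the copy of J not touched by the
      counit cancels.\<close>
    let ?G = "\<lambda>u t. tsw J' (\<lambda>m n. G (u \<cdot> m) (t \<cdot> n))"
    have "cocA (\<lambda>u v t. eps v * ?G u t) = tsw J (\<lambda>a b. tsw J (\<lambda>p q. sw p (\<lambda>r s. eps s * (eps b * ?G (a \<cdot> r) q))))"
      unfolding cocA_def by (intro J_cong sw_cong') (auto simp: counit_mult ac_simps)
    also have "\<dots> = tsw J (\<lambda>a b. tsw J (\<lambda>p q. eps b * ?G (a \<cdot> p) q))"
      by (intro J_cong counit_right) (auto intro!: L)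
    also have "\<dots> = tsw J (\<lambda>a b. tsw J (\<lambda>p q. tsw J' (\<lambda>m n. eps b * G (a \<cdot> (p \<cdot> m)) (q \<cdot> n))))"
      unfolding tsw_cmult[symmetric] by (intro J_cong J'_cong) (auto simp: mult_assoc)
    also have "\<dots> = tsw J (\<lambda>a b. eps b * G (a \<cdot> one) one)"
      by (intro J_cong J_J') (auto intro!: L)
    also have "\<dots> = tsw J (\<lambda>a b. eps b * G a one)"
      by (intro J_cong) auto
    finally have A: "cocA (\<lambda>u v t. eps v * ?G u t) = tsw J (\<lambda>a b. eps b * G a one)" .
    have "cocB (\<lambda>u v t. eps v * ?G u t) = tsw J (\<lambda>a b. tsw J (\<lambda>p q. sw q (\<lambda>r s. eps r * (eps a * ?G p (b \<cdot> s)))))"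
      unfolding cocB_def by (intro J_cong sw_cong') (auto simp: counit_mult ac_simps)
    also have "\<dots> = tsw J (\<lambda>a b. tsw J (\<lambda>p q. eps a * ?G p (b \<cdot> q)))"
      by (intro J_cong counit_left) (auto intro!: L)
    also have "\<dots> = tsw J (\<lambda>a b. tsw J (\<lambda>p q. tsw J' (\<lambda>m n. eps a * G (p \<cdot> m) (b \<cdot> (q \<cdot> n)))))"
      unfolding tsw_cmult[symmetric] by (intro J_cong J'_cong) (auto simp: mult_assoc)
    also have "\<dots> = tsw J (\<lambda>a b. eps a * G one (b \<cdot> one))"
      by (intro J_cong J_J') (auto intro!: L)
    also have "\<dots> = tsw J (\<lambda>a b. eps a * G one b)"
      by (intro J_cong) auto
    finally have B: "cocB (\<lambda>u v t. eps v * ?G u t) = tsw J (\<lambda>a b. eps a * G one b)" .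
    have "tri (\<lambda>u v t. eps v * ?G u t)" by (auto intro!: L)
    from cocycle[OF this] A B show ?thesis by (simp add: cocA_def cocB_def)
  qed
  note L = lin_intros4 lin_app[OF f]
  have "tsw J (\<lambda>a b. eps a * f b) = tsw J (\<lambda>a b. eps a * (eps one * f b))"
    by (intro J_cong) (auto simp: counit_one f)
  also have "\<dots> = tsw J (\<lambda>a b. eps b * (eps a * f one))"
    by (rule 1[of "\<lambda>u t. eps u * f t", symmetric]) (auto intro!: L)
  also have "\<dots> = gam * f one"
    unfolding gam_def tsw_multc[symmetric] by (simp only: ac_simps)
  finally show "tsw J (\<lambda>a b. eps a * f b) = gam * f one" .
  have "tsw J (\<lambda>a b. eps b * f a) = tsw J (\<lambda>a b. eps b * (f a * eps one))"
    by (intro J_cong) (auto simp: counit_one f mult.commute)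
  also have "\<dots> = tsw J (\<lambda>a b. eps a * (f one * eps b))"
    by (rule 1[of "\<lambda>u t. f u * eps t"]) (auto intro!: L)
  also have "\<dots> = gam * f one"
    unfolding gam_def tsw_multc[symmetric] by (simp only: ac_simps)
  finally show "tsw J (\<lambda>a b. eps b * f a) = gam * f one" .
qed

text \<open>Comes from applying \<epsilon> to both factors of J J^-1 = 1. The ring has no unit,
  hence the form with \<open>f x\<close>.\<close>

lemma gam_inverse:
  assumes f: "lin f" and [simp]: "x \<in> H"
  shows "gam * (gam' * f x) = f x"
proof -
  note L = lin_intros4 lin_app[OF f]
  have "eps one * eps one = tsw J (\<lambda>a b. tsw J' (\<lambda>p q. eps (a \<cdot> p) * eps (b \<cdot> q)))"
    by (rule J_J'[of "\<lambda>u v. eps u * eps v", symmetric]) (auto intro!: L)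
  also have "\<dots> = tsw J (\<lambda>a b. tsw J' (\<lambda>p q. eps a * eps b * (eps p * eps q)))"
    by (intro J_cong J'_cong) (auto simp: counit_mult ac_simps)
  also have "\<dots> = gam * gam'" unfolding gam_def gam'_def by (simp only: tsw_cmult tsw_multc)
  finally have "gam * (gam' * f x) = eps one * (eps one * f x)" by (simp only: mult.assoc[symmetric])
  then show ?thesis by (simp add: counit_one f)
qed

lemma twist_inv_counit:
  assumes f: "lin f"
  shows "tsw J' (\<lambda>a b. eps a * f b) = gam' * f one"
proof -
  note L = lin_intros4 lin_app[OF f]
  let ?s = "tsw J' (\<lambda>a b. eps a * f b)"
  have "eps one * f one = tsw J (\<lambda>a b. tsw J' (\<lambda>p q. eps (a \<cdot> p) * f (b \<cdot> q)))"
    by (rule J_J'[of "\<lambda>u v. eps u * f v", symmetric]) (auto intro!: L)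
  also have "\<dots> = tsw J' (\<lambda>p q. tsw J (\<lambda>a b. eps (a \<cdot> p) * f (b \<cdot> q)))"
    by (rule tsw_swap)
  also have "\<dots> = tsw J' (\<lambda>p q. tsw J (\<lambda>a b. eps a * (eps p * f (b \<cdot> q))))"
    by (intro J_cong J'_cong) (auto simp: counit_mult ac_simps)
  also have "\<dots> = tsw J' (\<lambda>p q. gam * (eps p * f (one \<cdot> q)))"
    by (intro J'_cong twist_counit) (auto intro!: L)
  also have "\<dots> = gam * tsw J' (\<lambda>p q. eps p * f (one \<cdot> q))"
    by (simp only: tsw_cmult)
  also have "tsw J' (\<lambda>p q. eps p * f (one \<cdot> q)) = ?s"
    by (intro J'_cong) auto
  finally have 1: "gam * ?s = f one" by (simp add: counit_one f)
  have "gam * (gam' * ?s) = tsw J' (\<lambda>a b. eps a * (gam * (gam' * f b)))"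
    unfolding tsw_cmult[symmetric] by (simp only: ac_simps)
  also have "\<dots> = ?s" by (intro J'_cong) (auto simp: gam_inverse f)
  finally have "?s = gam' * (gam * ?s)" by (simp only: ac_simps)
  then show ?thesis by (simp only: 1)
qed

lemma twist_inv_counit_right:
  assumes f: "lin f"
  shows "tsw J' (\<lambda>a b. eps b * f a) = gam' * f one"
proof -
  note L = lin_intros4 lin_app[OF f]
  let ?s = "tsw J' (\<lambda>a b. eps b * f a)"
  have "f one * eps one = tsw J (\<lambda>a b. tsw J' (\<lambda>p q. f (a \<cdot> p) * eps (b \<cdot> q)))"
    by (rule J_J'[of "\<lambda>u v. f u * eps v", symmetric]) (auto intro!: L)
  also have "\<dots> = tsw J' (\<lambda>p q. tsw J (\<lambda>a b. f (a \<cdot> p) * eps (b \<cdot> q)))"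
    by (rule tsw_swap)
  also have "\<dots> = tsw J' (\<lambda>p q. tsw J (\<lambda>a b. eps b * (eps q * f (a \<cdot> p))))"
    by (intro J_cong J'_cong) (auto simp: counit_mult ac_simps)
  also have "\<dots> = tsw J' (\<lambda>p q. gam * (eps q * f (one \<cdot> p)))"
    by (intro J'_cong twist_counit) (auto intro!: L)
  also have "\<dots> = gam * tsw J' (\<lambda>p q. eps q * f (one \<cdot> p))"
    by (simp only: tsw_cmult)
  also have "tsw J' (\<lambda>p q. eps q * f (one \<cdot> p)) = ?s"
    by (intro J'_cong) auto
  finally have 1: "gam * ?s = f one" by (simp add: counit_one f mult.commute)
  have "gam * (gam' * ?s) = tsw J' (\<lambda>a b. eps b * (gam * (gam' * f a)))"
    unfolding tsw_cmult[symmetric] by (simp only: ac_simps)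
  also have "\<dots> = ?s" by (intro J'_cong) (auto simp: gam_inverse f)
  finally have "?s = gam' * (gam * ?s)" by (simp only: ac_simps)
  then show ?thesis by (simp only: 1)
qed

end

section \<open>Conjugating the canonical map of the twist to that of H\<close>

context twist_calc begin

definition swJ where
  "swJ x F = tsw J (\<lambda>a b. sw x (\<lambda>p q. tsw J' (\<lambda>r s. F (a \<cdot> p \<cdot> r) (b \<cdot> q \<cdot> s))))"

primrec spowJ :: "nat \<Rightarrow> ('h \<Rightarrow> 'r) \<Rightarrow> 'h \<Rightarrow> 'r" where
  "spowJ 0 f x = eps x * f one"
| "spowJ (Suc n) f x = swJ x (\<lambda>a b. spowJ n (\<lambda>t. f (t \<cdot> b)) a)"

definition betaJ where
  "betaJ B x y = swJ x (\<lambda>a b. B a (b \<cdot> y))"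

lemma swJ_cong:
  assumes "x \<in> H" "\<And>a b. \<lbrakk>a \<in> H; b \<in> H\<rbrakk> \<Longrightarrow> F a b = G a b"
  shows "swJ x (\<lambda>a b. F a b) = swJ x (\<lambda>a b. G a b)"
  unfolding swJ_def using assms by (intro J_cong J'_cong sw_cong') auto

lemma spowJ_cong:
  "\<lbrakk>x \<in> H; \<And>t. t \<in> H \<Longrightarrow> f t = g t\<rbrakk> \<Longrightarrow> spowJ n (\<lambda>t. f t) x = spowJ n (\<lambda>t. g t) x"
proof (induction n arbitrary: f g x)
  case (Suc n)
  show ?case
    unfolding spowJ.simps by (intro swJ_cong Suc.IH) (simp_all add: Suc.prems)
qed simp

lemma counit_swJ:
  assumes f: "lin f" and [simp]: "x \<in> H"
  shows "swJ x (\<lambda>a b. eps a * f b) = f x"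
proof -
  note L = lin_intros4 lin_app[OF f]
  have "swJ x (\<lambda>a b. eps a * f b) = tsw J (\<lambda>a b. sw x (\<lambda>p q. tsw J' (\<lambda>r s. eps p * (eps r * (eps a * f (b \<cdot> q \<cdot> s))))))"
    unfolding swJ_def by (intro J_cong J'_cong sw_cong') (auto simp: counit_mult ac_simps)
  also have "\<dots> = tsw J (\<lambda>a b. sw x (\<lambda>p q. eps p * tsw J' (\<lambda>r s. eps r * (eps a * f (b \<cdot> q \<cdot> s)))))"
    by (simp only: tsw_cmult)
  also have "\<dots> = tsw J (\<lambda>a b. tsw J' (\<lambda>r s. eps r * (eps a * f (b \<cdot> x \<cdot> s))))"
    by (intro J_cong counit_left) (auto intro!: L)
  also have "\<dots> = tsw J (\<lambda>a b. gam' * (eps a * f (b \<cdot> x \<cdot> one)))"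
    by (intro J_cong twist_inv_counit) (auto intro!: L)
  also have "\<dots> = tsw J (\<lambda>a b. eps a * (gam' * f (b \<cdot> x)))"
    by (intro J_cong) (auto simp: ac_simps)
  also have "\<dots> = gam * (gam' * f (one \<cdot> x))"
    by (rule twist_counit) (auto intro!: L)
  also have "\<dots> = f x" using gam_inverse[OF f, of x] by simp
  finally show ?thesis .
qed

lemma bil_betaJ: "bil B \<Longrightarrow> bil (betaJ B)"
  unfolding betaJ_def swJ_def by (auto intro!: lin_intros4 bilD[of B])

lemma eq2_betaJ: "eq2 F G \<Longrightarrow> eq2 (betaJ F) (betaJ G)"
  unfolding eq2_def betaJ_def by (auto intro!: swJ_cong)

text \<open>Started at \<epsilon> \<otimes> \<phi>, the iterates follow the recursion of
  \<open>spowJ\<close> step by step, by associativity of the product.\<close>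

lemma betaJ_power_counit:
  assumes "lin \<phi>"
  shows "eq2 ((betaJ ^^ n) (\<lambda>x y. eps x * \<phi> y)) (\<lambda>x y. spowJ n (\<lambda>t. \<phi> (t \<cdot> y)) x)"
proof (induction n)
  case (Suc n)
  have "eq2 (betaJ (\<lambda>x y. spowJ n (\<lambda>t. \<phi> (t \<cdot> y)) x)) (\<lambda>x y. spowJ (Suc n) (\<lambda>t. \<phi> (t \<cdot> y)) x)"
    unfolding eq2_def betaJ_def spowJ.simps by (intro ballI swJ_cong spowJ_cong) (auto simp: mult_assoc)
  with eq2_betaJ[OF Suc] show ?case by (auto intro: eq2_trans)
qed (simp add: eq2_def)

text \<open>\<open>transfer_op\<close> is the transpose of an isomorphism between the cofree anti-Yetter-Drinfeld modules of
  \<open>H\<close> and of its twist; it conjugates the canonical maps \<open>beta\<close> and \<open>betaJ\<close>.\<close>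

definition w_op where
  "w_op B x y = tsw J' (\<lambda>p q. B (x \<cdot> (Si q \<cdot> p)) y)"
text \<open>With J = a \<otimes> b, the element b Si(a) is the classical one that conjugates the
  inverse antipode of H into that of the twist. \<open>w_op\<close> uses its inverse Si(q) p, with
  J^-1 = p \<otimes> q.\<close>

definition w_inv where
  "w_inv B x y = tsw J (\<lambda>a b. B (x \<cdot> (b \<cdot> Si a)) y)"
definition left_op where
  "left_op B x y = tsw J (\<lambda>a b. B (a \<cdot> x) (b \<cdot> y))"
definition left_inv where
  "left_inv B x y = tsw J' (\<lambda>a b. B (a \<cdot> x) (b \<cdot> y))"
text \<open>J acts here through a left action of H \<otimes> H on pairs: its first leg by diagonal
  left multiplication on x and y, its second on the right of x through \<open>Si\<close>.\<close>

definition adj_op where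
  "adj_op B x y = tsw J (\<lambda>k l. sw k (\<lambda>k1 k2. B (k1 \<cdot> x \<cdot> Si l) (k2 \<cdot> y)))"
definition adj_inv where
  "adj_inv B x y = tsw J' (\<lambda>k l. sw k (\<lambda>k1 k2. B (k1 \<cdot> x \<cdot> Si l) (k2 \<cdot> y)))"
definition transfer_op where
  "transfer_op B = adj_op (left_op (w_op B))"

lemma bil_w_op: "bil B \<Longrightarrow> bil (w_op B)"
  unfolding w_op_def by (auto intro!: lin_intros4 bilD[of B])
lemma bil_left_op: "bil B \<Longrightarrow> bil (left_op B)"
  unfolding left_op_def by (auto intro!: lin_intros4 bilD[of B])

lemma adj_inv_adj:
  assumes B: "bil B" shows "eq2 (adj_inv (adj_op B)) B"
  unfolding eq2_def
proof (intro ballI)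
  fix x y assume [simp]: "x \<in> H" "y \<in> H"
  note L = lin_intros4 bilD[OF B]
  have "adj_inv (adj_op B) x y = tsw J' (\<lambda>k l. sw k (\<lambda>k1 k2. tsw J (\<lambda>m n. sw m (\<lambda>m1 m2. B (m1 \<cdot> k1 \<cdot> x \<cdot> Si (n \<cdot> l)) (m2 \<cdot> k2 \<cdot> y)))))"
    unfolding adj_inv_def adj_op_def by (intro J_cong J'_cong sw_cong') (auto simp: Si_mult_eq mult_assoc)
  also have "\<dots> = tsw J (\<lambda>m n. tsw J' (\<lambda>k l. sw m (\<lambda>m1 m2. sw k (\<lambda>k1 k2. B (m1 \<cdot> k1 \<cdot> x \<cdot> Si (n \<cdot> l)) (m2 \<cdot> k2 \<cdot> y)))))"
    by (simp only: sw_tsw) (subst tsw_swap, subst sw_swap, rule refl)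
  also have "\<dots> = tsw J (\<lambda>m n. tsw J' (\<lambda>k l. sw (m \<cdot> k) (\<lambda>k1 k2. B (k1 \<cdot> x \<cdot> Si (n \<cdot> l)) (k2 \<cdot> y))))"
    by (intro J_cong J'_cong comult_mult[symmetric]) (auto intro!: L)
  also have "\<dots> = sw one (\<lambda>k1 k2. B (k1 \<cdot> x \<cdot> Si one) (k2 \<cdot> y))"
    by (rule J_J') (auto intro!: L)
  also have "\<dots> = B (one \<cdot> x \<cdot> Si one) (one \<cdot> y)"
    by (rule comult_one) (auto intro!: L)
  also have "\<dots> = B (one \<cdot> x \<cdot> one) (one \<cdot> y)"
    by (rule Si_one[of "\<lambda>t. B (one \<cdot> x \<cdot> t) (one \<cdot> y)"]) (auto intro!: L)
  finally show "adj_inv (adj_op B) x y = B x y" by simp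
qed

lemma left_inv_left:
  assumes B: "bil B" shows "eq2 (left_inv (left_op B)) B"
  unfolding eq2_def
proof (intro ballI)
  fix x y assume [simp]: "x \<in> H" "y \<in> H"
  note L = lin_intros4 bilD[OF B]
  have "left_inv (left_op B) x y = tsw J' (\<lambda>a b. tsw J (\<lambda>p q. B (p \<cdot> a \<cdot> x) (q \<cdot> b \<cdot> y)))"
    unfolding left_inv_def left_op_def by (intro J_cong J'_cong) (auto simp: mult_assoc)
  also have "\<dots> = tsw J (\<lambda>p q. tsw J' (\<lambda>a b. B (p \<cdot> a \<cdot> x) (q \<cdot> b \<cdot> y)))"
    by (rule tsw_swap)
  also have "\<dots> = B (one \<cdot> x) (one \<cdot> y)"
    by (rule J_J') (auto intro!: L)
  finally show "left_inv (left_op B) x y = B x y" by simp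
qed

text \<open>The product of the two elements is b Si(q a) p. \<open>cocycle_mixed\<close> rewrites it
  so that coproduct legs meet their inverse antipodes; only counits of J and J^-1 remain, and their
  product is 1.\<close>

lemma w_inv_w:
  assumes B: "bil B" shows "eq2 (w_inv (w_op B)) B"
  unfolding eq2_def
proof (intro ballI)
  fix x y assume [simp]: "x \<in> H" "y \<in> H"
  note L = lin_intros4 bilD[OF B]
  have "w_inv (w_op B) x y = tsw J (\<lambda>a b. tsw J' (\<lambda>p q. B (x \<cdot> b \<cdot> (Si (q \<cdot> a) \<cdot> p)) y))"
    unfolding w_inv_def w_op_def by (intro J_cong J'_cong) (auto simp: Si_mult_eq mult_assoc)
  also have "\<dots> = tsw J' (\<lambda>p q. tsw J (\<lambda>a b. B (x \<cdot> b \<cdot> (Si (q \<cdot> a) \<cdot> p)) y))"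
    by (rule tsw_swap)
  also have "\<dots> = tsw J (\<lambda>k l. tsw J' (\<lambda>p q. sw k (\<lambda>k1 k2. sw q (\<lambda>q1 q2. B (x \<cdot> (l \<cdot> q2) \<cdot> (Si (k2 \<cdot> q1) \<cdot> (k1 \<cdot> p))) y))))"
    by (rule cocycle_mixed) (auto intro!: L)
  also have "\<dots> = tsw J (\<lambda>k l. tsw J' (\<lambda>p q. sw k (\<lambda>k1 k2. sw q (\<lambda>q1 q2. B (x \<cdot> (l \<cdot> ((q2 \<cdot> Si q1) \<cdot> (Si k2 \<cdot> k1) \<cdot> p))) y))))"
    by (intro J_cong J'_cong sw_cong') (auto simp: Si_mult_eq mult_assoc)
  also have "\<dots> = tsw J (\<lambda>k l. tsw J' (\<lambda>p q. sw k (\<lambda>k1 k2. eps q * B (x \<cdot> (l \<cdot> (one \<cdot> (Si k2 \<cdot> k1) \<cdot> p))) y)))"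
    by (intro J_cong J'_cong sw_cong' Si_right) (auto intro!: L)
  also have "\<dots> = tsw J (\<lambda>k l. tsw J' (\<lambda>p q. eps k * (eps q * B (x \<cdot> (l \<cdot> (one \<cdot> one \<cdot> p))) y)))"
    by (intro J_cong J'_cong sw_cong' Si_left) (auto intro!: L)
  also have "\<dots> = tsw J (\<lambda>k l. eps k * tsw J' (\<lambda>p q. eps q * B (x \<cdot> (l \<cdot> (one \<cdot> one \<cdot> p))) y))"
    by (simp only: tsw_cmult)
  also have "\<dots> = tsw J (\<lambda>k l. eps k * (gam' * B (x \<cdot> (l \<cdot> (one \<cdot> one \<cdot> one))) y))"
    by (intro J_cong arg_cong[where f="\<lambda>u. _ * u"] twist_inv_counit_right) (auto intro!: L)
  also have "\<dots> = gam * (gam' * B (x \<cdot> (one \<cdot> (one \<cdot> one \<cdot> one))) y)"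
    by (rule twist_counit) (auto intro!: L)
  also have "\<dots> = B x y"
    using gam_inverse[OF bilD(1)[OF B lop_id], of y x] by simp
  finally show "w_inv (w_op B) x y = B x y" .
qed

text \<open>Each of the three factors of \<open>transfer_op\<close> has a left inverse, which gives
  injectivity.\<close>

lemma eq2_transfer_cancel:
  assumes B: "bil B" and C: "bil C" and e: "eq2 (transfer_op B) (transfer_op C)"
  shows "eq2 B C"
proof -
  have 1: "eq2 F G \<Longrightarrow> eq2 (adj_inv F) (adj_inv G)" for F G
    unfolding eq2_def adj_inv_def by (auto intro!: J'_cong sw_cong)
  have 2: "eq2 F G \<Longrightarrow> eq2 (left_inv F) (left_inv G)" for F G
    unfolding eq2_def left_inv_def by (auto intro!: J'_cong)
  have 3: "eq2 F G \<Longrightarrow> eq2 (w_inv F) (w_inv G)" for F G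
    unfolding eq2_def w_inv_def by (auto intro!: J_cong)
  have "eq2 (left_op (w_op B)) (left_op (w_op C))"
    using 1[OF e] adj_inv_adj[OF bil_left_op[OF bil_w_op[OF B]]] adj_inv_adj[OF bil_left_op[OF bil_w_op[OF C]]]
    unfolding transfer_op_def by (meson eq2_trans eq2_sym)
  from 2[OF this] have "eq2 (w_op B) (w_op C)"
    using left_inv_left[OF bil_w_op[OF B]] left_inv_left[OF bil_w_op[OF C]] by (meson eq2_trans eq2_sym)
  from 3[OF this] show ?thesis
    using w_inv_w[OF B] w_inv_w[OF C] by (meson eq2_trans eq2_sym)
qed

lemma eq2_transfer: "eq2 F G \<Longrightarrow> eq2 (transfer_op F) (transfer_op G)"
  unfolding eq2_def transfer_op_def adj_op_def left_op_def w_op_def by (auto intro!: J_cong J'_cong sw_cong)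

lemma transfer_form1:
  assumes B: "bil B" and [simp]: "x \<in> H" "y \<in> H"
  shows "transfer_op B x y = tsw J (\<lambda>a b. tsw J (\<lambda>k l. sw k (\<lambda>k1 k2. tsw J' (\<lambda>p q. B (a \<cdot> k1 \<cdot> x \<cdot> Si l \<cdot> (Si q \<cdot> p)) (b \<cdot> (k2 \<cdot> y))))))"
proof -
  have "transfer_op B x y = tsw J (\<lambda>k l. sw k (\<lambda>k1 k2. tsw J (\<lambda>a b. tsw J' (\<lambda>p q. B (a \<cdot> k1 \<cdot> x \<cdot> Si l \<cdot> (Si q \<cdot> p)) (b \<cdot> (k2 \<cdot> y))))))"
    unfolding transfer_op_def adj_op_def left_op_def w_op_def by (intro J_cong J'_cong sw_cong') (auto simp: mult_assoc)
  also have "\<dots> = tsw J (\<lambda>a b. tsw J (\<lambda>k l. sw k (\<lambda>k1 k2. tsw J' (\<lambda>p q. B (a \<cdot> k1 \<cdot> x \<cdot> Si l \<cdot> (Si q \<cdot> p)) (b \<cdot> (k2 \<cdot> y))))))"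
    by (simp only: sw_tsw) (rule tsw_swap)
  finally show ?thesis .
qed

text \<open>The two copies of J in \<open>transfer_op\<close> form the left side of the twist
  equation; here it has been replaced by the right side. The intertwining property is a computation
  from this form to \<open>transfer_form1\<close>.\<close>

lemma transfer_form2:
  assumes B: "bil B" and [simp]: "x \<in> H" "y \<in> H"
  shows "transfer_op B x y = tsw J (\<lambda>a b. tsw J (\<lambda>k l. sw l (\<lambda>l1 l2. tsw J' (\<lambda>p q. B (k \<cdot> x \<cdot> Si l2 \<cdot> (Si b \<cdot> (Si q \<cdot> p))) (a \<cdot> (l1 \<cdot> y))))))"
proof -
  note L = lin_intros4 bilD[OF B]
  have "transfer_op B x y = cocA (\<lambda>u v t. tsw J' (\<lambda>p q. B (u \<cdot> x \<cdot> (Si t \<cdot> (Si q \<cdot> p))) (v \<cdot> y)))"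
    unfolding transfer_form1[OF assms] cocA_def by (intro J_cong J'_cong sw_cong') (auto simp: mult_assoc)
  also have "\<dots> = cocB (\<lambda>u v t. tsw J' (\<lambda>p q. B (u \<cdot> x \<cdot> (Si t \<cdot> (Si q \<cdot> p))) (v \<cdot> y)))"
    unfolding cocA_def cocB_def by (rule cocycle) (auto intro!: L)
  also have "\<dots> = tsw J (\<lambda>a b. tsw J (\<lambda>k l. sw l (\<lambda>l1 l2. tsw J' (\<lambda>p q. B (k \<cdot> x \<cdot> Si l2 \<cdot> (Si b \<cdot> (Si q \<cdot> p))) (a \<cdot> (l1 \<cdot> y))))))"
    unfolding cocB_def by (intro J_cong J'_cong sw_cong') (auto simp: Si_mult_eq mult_assoc)
  finally show ?thesis .
qed

text \<open>For w = Si(q) p this reads \<Delta>(w) J^-1 = Si(s_(2)) w \<otimes> Si(s_(1)) r, where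
  J^-1 = r \<otimes> s. The inverted twist equation rearranges the two copies of J^-1, after which
  one pair of legs cancels.\<close>

lemma comult_w:
  assumes G: "bil G"
  shows "tsw J' (\<lambda>p q. sw (Si q \<cdot> p) (\<lambda>z1 z2. tsw J' (\<lambda>r s. G (z1 \<cdot> r) (z2 \<cdot> s))))
    = tsw J' (\<lambda>p q. tsw J' (\<lambda>r s. sw s (\<lambda>s1 s2. G (Si s2 \<cdot> (Si q \<cdot> p)) (Si s1 \<cdot> r))))"
proof -
  note L = lin_intros4 bilD[OF G]
  have "tsw J' (\<lambda>p q. sw (Si q \<cdot> p) (\<lambda>z1 z2. tsw J' (\<lambda>r s. G (z1 \<cdot> r) (z2 \<cdot> s))))
    = tsw J' (\<lambda>p q. sw (Si q) (\<lambda>u v. sw p (\<lambda>p1 p2. tsw J' (\<lambda>r s. G (u \<cdot> p1 \<cdot> r) (v \<cdot> p2 \<cdot> s)))))"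
    by (intro J'_cong comult_mult) (auto intro!: L)
  also have "\<dots> = tsw J' (\<lambda>p q. sw q (\<lambda>u v. sw p (\<lambda>p1 p2. tsw J' (\<lambda>r s. G (Si v \<cdot> p1 \<cdot> r) (Si u \<cdot> p2 \<cdot> s)))))"
    by (intro J'_cong Si_comult) (auto intro!: L)
  also have "\<dots> = tsw J' (\<lambda>p q. tsw J' (\<lambda>r s. sw p (\<lambda>p1 p2. sw q (\<lambda>u v. G (Si v \<cdot> p1 \<cdot> r) (Si u \<cdot> p2 \<cdot> s)))))"
    by (simp only: sw_tsw) (subst sw_swap, rule refl)
  also have "\<dots> = cocA' (\<lambda>a b t. sw t (\<lambda>u v. G (Si v \<cdot> a) (Si u \<cdot> b)))"
    unfolding cocA'_def by (intro J'_cong sw_cong') (auto simp: mult_assoc)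
  also have "\<dots> = cocB' (\<lambda>a b t. sw t (\<lambda>u v. G (Si v \<cdot> a) (Si u \<cdot> b)))"
    by (rule cocycle_inv) (auto intro!: L)
  also have "\<dots> = tsw J' (\<lambda>p q. tsw J' (\<lambda>r s. sw q (\<lambda>q1 q2. sw q2 (\<lambda>m n. sw s (\<lambda>s1 s2. G (Si (n \<cdot> s2) \<cdot> p) (Si (m \<cdot> s1) \<cdot> (q1 \<cdot> r)))))))"
    unfolding cocB'_def by (intro J'_cong sw_cong' comult_mult) (auto intro!: L)
  also have "\<dots> = tsw J' (\<lambda>p q. tsw J' (\<lambda>r s. sw q (\<lambda>q1 q2. sw q2 (\<lambda>m n. sw s (\<lambda>s1 s2. G (Si s2 \<cdot> (Si n \<cdot> p)) (Si s1 \<cdot> (Si m \<cdot> q1 \<cdot> r)))))))"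
    by (intro J'_cong sw_cong') (auto simp: Si_mult_eq mult_assoc)
  also have "\<dots> = tsw J' (\<lambda>p q. tsw J' (\<lambda>r s. sw s (\<lambda>s1 s2. G (Si s2 \<cdot> (Si q \<cdot> p)) (Si s1 \<cdot> (one \<cdot> r)))))"
    by (intro J'_cong Si_left_head) (auto intro!: L)
  also have "\<dots> = tsw J' (\<lambda>p q. tsw J' (\<lambda>r s. sw s (\<lambda>s1 s2. G (Si s2 \<cdot> (Si q \<cdot> p)) (Si s1 \<cdot> r))))"
    by (intro J'_cong sw_cong') auto
  finally show ?thesis .
qed

text \<open>With J = a \<otimes> b, the coproduct of Si(b) w, times J^-1, times 1 \<otimes> a,
  equals w \<otimes> 1. The copy of J absorbs the factors that \<open>comult_w\<close> leaves
  behind.\<close>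

lemma twisted_comult_w:
  assumes G: "bil G"
  shows "tsw J (\<lambda>a b. tsw J' (\<lambda>p q. sw (Si b \<cdot> (Si q \<cdot> p)) (\<lambda>z1 z2. tsw J' (\<lambda>r s. G (z1 \<cdot> r) (z2 \<cdot> s \<cdot> a)))))
    = tsw J' (\<lambda>p q. G (Si q \<cdot> p) one)"
proof -
  note L = lin_intros4 bilD[OF G]
  have "tsw J (\<lambda>a b. tsw J' (\<lambda>p q. sw (Si b \<cdot> (Si q \<cdot> p)) (\<lambda>z1 z2. tsw J' (\<lambda>r s. G (z1 \<cdot> r) (z2 \<cdot> s \<cdot> a)))))
    = tsw J (\<lambda>a b. tsw J' (\<lambda>p q. sw (Si b) (\<lambda>u v. sw (Si q \<cdot> p) (\<lambda>z1 z2. tsw J' (\<lambda>r s. G (u \<cdot> z1 \<cdot> r) (v \<cdot> z2 \<cdot> s \<cdot> a))))))"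
    by (intro J_cong J'_cong comult_mult) (auto intro!: L)
  also have "\<dots> = tsw J (\<lambda>a b. tsw J' (\<lambda>p q. sw b (\<lambda>u v. sw (Si q \<cdot> p) (\<lambda>z1 z2. tsw J' (\<lambda>r s. G (Si v \<cdot> z1 \<cdot> r) (Si u \<cdot> z2 \<cdot> s \<cdot> a))))))"
    by (intro J_cong J'_cong Si_comult) (auto intro!: L)
  also have "\<dots> = tsw J (\<lambda>a b. sw b (\<lambda>u v. tsw J' (\<lambda>p q. sw (Si q \<cdot> p) (\<lambda>z1 z2. tsw J' (\<lambda>r s. G (Si v \<cdot> (z1 \<cdot> r)) (Si u \<cdot> (z2 \<cdot> s \<cdot> a)))))))"
    unfolding sw_tsw[of "_ :: 'h" J'] by (intro J_cong J'_cong sw_cong') (auto simp: mult_assoc)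
  also have "\<dots> = tsw J (\<lambda>a b. sw b (\<lambda>u v. tsw J' (\<lambda>p q. tsw J' (\<lambda>r s. sw s (\<lambda>s1 s2. G (Si v \<cdot> (Si s2 \<cdot> (Si q \<cdot> p))) (Si u \<cdot> (Si s1 \<cdot> r \<cdot> a)))))))"
    by (intro J_cong sw_cong' comult_w) (auto intro!: L)
  also have "\<dots> = tsw J (\<lambda>a b. sw b (\<lambda>u v. tsw J' (\<lambda>p q. tsw J' (\<lambda>r s. sw s (\<lambda>s1 s2. G (Si (s2 \<cdot> v) \<cdot> (Si q \<cdot> p)) (Si (s1 \<cdot> u) \<cdot> (r \<cdot> a)))))))"
    by (intro J_cong J'_cong sw_cong') (auto simp: Si_mult_eq mult_assoc)
  also have "\<dots> = tsw J' (\<lambda>p q. tsw J' (\<lambda>r s. tsw J (\<lambda>a b. sw s (\<lambda>s1 s2. sw b (\<lambda>u v. G (Si (s2 \<cdot> v) \<cdot> (Si q \<cdot> p)) (Si (s1 \<cdot> u) \<cdot> (r \<cdot> a)))))))"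
    by (simp only: sw_tsw) (subst tsw_swap, subst (2) tsw_swap, subst sw_swap, rule refl)
  also have "\<dots> = tsw J' (\<lambda>p q. tsw J' (\<lambda>r s. tsw J (\<lambda>a b. sw (s \<cdot> b) (\<lambda>u v. G (Si v \<cdot> (Si q \<cdot> p)) (Si u \<cdot> (r \<cdot> a))))))"
    by (intro J_cong J'_cong comult_mult[symmetric]) (auto intro!: L)
  also have "\<dots> = tsw J' (\<lambda>p q. sw one (\<lambda>u v. G (Si v \<cdot> (Si q \<cdot> p)) (Si u \<cdot> one)))"
    by (intro J'_cong J'_J) (auto intro!: L)
  also have "\<dots> = tsw J' (\<lambda>p q. G (Si one \<cdot> (Si q \<cdot> p)) (Si one \<cdot> one))"
    by (intro J'_cong comult_one) (auto intro!: L)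
  also have "\<dots> = tsw J' (\<lambda>p q. G (one \<cdot> (Si q \<cdot> p)) (Si one \<cdot> one))"
    by (intro J'_cong Si_one[of "\<lambda>t. G (t \<cdot> (Si _ \<cdot> _)) (Si one \<cdot> one)"]) (auto intro!: L)
  also have "\<dots> = tsw J' (\<lambda>p q. G (one \<cdot> (Si q \<cdot> p)) (one \<cdot> one))"
    by (intro J'_cong Si_one[of "\<lambda>t. G (one \<cdot> (Si _ \<cdot> _)) (t \<cdot> one)"]) (auto intro!: L)
  also have "\<dots> = tsw J' (\<lambda>p q. G (Si q \<cdot> p) one)"
    by (intro J'_cong) auto
  finally show ?thesis .
qed

text \<open>In the second form, the part made of \<open>Si b\<close> and w is handled by
  \<open>twisted_comult_w\<close>. The coproduct of Si(l2) then cancels against \<open>l1\<close>,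
  and what remains is the first form applied to the legs of x.\<close>

lemma transfer_intertwines:
  assumes B: "bil B"
  shows "eq2 (transfer_op (betaJ B)) (beta (transfer_op B))"
  unfolding eq2_def
proof (intro ballI)
  fix x y assume [simp]: "x \<in> H" "y \<in> H"
  note L = lin_intros4 bilD[OF B]
  \<comment> \<open>The inner layer, for an arbitrary first argument \<open>X\<close>. The J^-1 of
    the twisted coproduct and the factors \<open>a\<close>, \<open>b\<close> are consumed by
    \<open>twisted_comult_w\<close>; the J of the twisted coproduct supplies the new pair.\<close>
  have 1: "tsw J (\<lambda>a b. tsw J' (\<lambda>p q. betaJ B (X \<cdot> (Si b \<cdot> (Si q \<cdot> p))) (a \<cdot> z)))
    = tsw J (\<lambda>a b. sw X (\<lambda>X1 X2. tsw J' (\<lambda>p q. B (a \<cdot> (X1 \<cdot> (Si q \<cdot> p))) (b \<cdot> (X2 \<cdot> (one \<cdot> z))))))"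
    (is "?l = ?r") if [simp]: "X \<in> H" "z \<in> H" for X z
  proof -
    have "?l = tsw J (\<lambda>a b. tsw J' (\<lambda>p q. tsw J (\<lambda>m n. sw X (\<lambda>X1 X2. sw (Si b \<cdot> (Si q \<cdot> p)) (\<lambda>z1 z2. tsw J' (\<lambda>r s.
       B (m \<cdot> (X1 \<cdot> z1) \<cdot> r) (n \<cdot> (X2 \<cdot> z2) \<cdot> s \<cdot> (a \<cdot> z))))))))"
      unfolding betaJ_def swJ_def by (intro J_cong J'_cong comult_mult) (auto intro!: L)
    also have "\<dots> = tsw J (\<lambda>a b. tsw J' (\<lambda>p q. tsw J (\<lambda>m n. sw X (\<lambda>X1 X2. sw (Si b \<cdot> (Si q \<cdot> p)) (\<lambda>z1 z2. tsw J' (\<lambda>r s.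
       B (m \<cdot> (X1 \<cdot> (z1 \<cdot> r))) (n \<cdot> (X2 \<cdot> (z2 \<cdot> s \<cdot> a \<cdot> z)))))))))"
      by (intro J_cong J'_cong sw_cong') (auto simp: mult_assoc)
    also have "\<dots> = tsw J (\<lambda>m n. sw X (\<lambda>X1 X2. tsw J (\<lambda>a b. tsw J' (\<lambda>p q. sw (Si b \<cdot> (Si q \<cdot> p)) (\<lambda>z1 z2. tsw J' (\<lambda>r s.
       B (m \<cdot> (X1 \<cdot> (z1 \<cdot> r))) (n \<cdot> (X2 \<cdot> (z2 \<cdot> s \<cdot> a \<cdot> z)))))))))"
      by (subst (2) tsw_swap, subst tsw_swap, simp only: sw_tsw)
    also have "\<dots> = ?r"
      by (intro J_cong sw_cong' twisted_comult_w) (auto intro!: L)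
    finally show ?thesis .
  qed
  have "transfer_op (betaJ B) x y = tsw J (\<lambda>a b. tsw J (\<lambda>k l. sw l (\<lambda>l1 l2. tsw J' (\<lambda>p q. betaJ B (k \<cdot> x \<cdot> Si l2 \<cdot> (Si b \<cdot> (Si q \<cdot> p))) (a \<cdot> (l1 \<cdot> y))))))"
    by (rule transfer_form2) (auto intro!: bil_betaJ B)
  also have "\<dots> = tsw J (\<lambda>k l. sw l (\<lambda>l1 l2. tsw J (\<lambda>a b. tsw J' (\<lambda>p q. betaJ B (k \<cdot> x \<cdot> Si l2 \<cdot> (Si b \<cdot> (Si q \<cdot> p))) (a \<cdot> (l1 \<cdot> y))))))"
    by (subst tsw_swap, simp only: sw_tsw)
  also have "\<dots> = tsw J (\<lambda>k l. sw l (\<lambda>l1 l2. tsw J (\<lambda>a b. sw (k \<cdot> x \<cdot> Si l2) (\<lambda>X1 X2. tsw J' (\<lambda>p q. B (a \<cdot> (X1 \<cdot> (Si q \<cdot> p))) (b \<cdot> (X2 \<cdot> (one \<cdot> (l1 \<cdot> y)))))))))"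
    by (intro J_cong sw_cong' 1) auto
  also have "\<dots> = tsw J (\<lambda>k l. sw l (\<lambda>l1 l2. tsw J (\<lambda>a b. sw (k \<cdot> x) (\<lambda>u v. sw (Si l2) (\<lambda>m n. tsw J' (\<lambda>p q. B (a \<cdot> (u \<cdot> m \<cdot> (Si q \<cdot> p))) (b \<cdot> (v \<cdot> n \<cdot> (one \<cdot> (l1 \<cdot> y))))))))))"
    by (intro J_cong sw_cong' comult_mult) (auto intro!: L)
  also have "\<dots> = tsw J (\<lambda>k l. sw l (\<lambda>l1 l2. tsw J (\<lambda>a b. sw (k \<cdot> x) (\<lambda>u v. sw l2 (\<lambda>n m. tsw J' (\<lambda>p q. B (a \<cdot> (u \<cdot> Si m \<cdot> (Si q \<cdot> p))) (b \<cdot> (v \<cdot> Si n \<cdot> (one \<cdot> (l1 \<cdot> y))))))))))"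
    by (intro J_cong sw_cong' Si_comult) (auto intro!: L)
  also have "\<dots> = tsw J (\<lambda>k l. sw l (\<lambda>l1 l2. tsw J (\<lambda>a b. sw (k \<cdot> x) (\<lambda>u v. sw l2 (\<lambda>n m. tsw J' (\<lambda>p q. B (a \<cdot> u \<cdot> Si m \<cdot> (Si q \<cdot> p)) (b \<cdot> (v \<cdot> ((Si n \<cdot> l1) \<cdot> y)))))))))"
    by (intro J_cong sw_cong' J'_cong) (auto simp: mult_assoc)
  also have "\<dots> = tsw J (\<lambda>a b. tsw J (\<lambda>k l. sw (k \<cdot> x) (\<lambda>u v. sw l (\<lambda>l1 l2. sw l2 (\<lambda>n m. tsw J' (\<lambda>p q. B (a \<cdot> u \<cdot> Si m \<cdot> (Si q \<cdot> p)) (b \<cdot> (v \<cdot> ((Si n \<cdot> l1) \<cdot> y)))))))))"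
    by (subst tsw_swap) (simp only: sw_tsw sw_swap[of "_ \<cdot> x"])
  also have "\<dots> = tsw J (\<lambda>a b. tsw J (\<lambda>k l. sw (k \<cdot> x) (\<lambda>u v. tsw J' (\<lambda>p q. B (a \<cdot> u \<cdot> Si l \<cdot> (Si q \<cdot> p)) (b \<cdot> (v \<cdot> (one \<cdot> y)))))))"
    by (intro J_cong sw_cong' Si_left_head) (auto intro!: L)
  also have "\<dots> = tsw J (\<lambda>a b. tsw J (\<lambda>k l. sw k (\<lambda>k1 k2. sw x (\<lambda>x1 x2. tsw J' (\<lambda>p q. B (a \<cdot> (k1 \<cdot> x1) \<cdot> Si l \<cdot> (Si q \<cdot> p)) (b \<cdot> (k2 \<cdot> x2 \<cdot> (one \<cdot> y))))))))"
    by (intro J_cong comult_mult) (auto intro!: L)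
  also have "\<dots> = sw x (\<lambda>x1 x2. tsw J (\<lambda>a b. tsw J (\<lambda>k l. sw k (\<lambda>k1 k2. tsw J' (\<lambda>p q. B (a \<cdot> (k1 \<cdot> x1) \<cdot> Si l \<cdot> (Si q \<cdot> p)) (b \<cdot> (k2 \<cdot> x2 \<cdot> (one \<cdot> y))))))))"
    by (simp only: sw_tsw[of x] sw_swap[of x])
  also have "\<dots> = sw x (\<lambda>x1 x2. tsw J (\<lambda>a b. tsw J (\<lambda>k l. sw k (\<lambda>k1 k2. tsw J' (\<lambda>p q. B (a \<cdot> k1 \<cdot> x1 \<cdot> Si l \<cdot> (Si q \<cdot> p)) (b \<cdot> (k2 \<cdot> (x2 \<cdot> y))))))))"
    by (intro sw_cong' J_cong J'_cong) (auto simp: mult_assoc)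
  also have "\<dots> = beta (transfer_op B) x y"
    unfolding beta_def by (intro sw_cong' transfer_form1[symmetric] B) auto
  finally show "transfer_op (betaJ B) x y = beta (transfer_op B) x y" .
qed

lemma bil_transfer: "bil B \<Longrightarrow> bil (transfer_op B)"
  unfolding transfer_op_def adj_op_def left_op_def w_op_def by (auto intro!: lin_intros4 bilD[of B])

lemma transfer_power:
  assumes B: "bil B"
  shows "eq2 (transfer_op ((betaJ ^^ n) B)) ((beta ^^ n) (transfer_op B))"
proof (induction n)
  case (Suc n)
  have "bil ((betaJ ^^ n) B)" by (induction n) (auto intro: B bil_betaJ)
  from transfer_intertwines[OF this] eq2_beta[OF Suc] show ?case by (auto intro: eq2_trans)
qed (simp add: eq2_def)

text \<open>The two copies of J contribute \<open>gam\<close> each and J^-1 contributes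
  \<open>gam'\<close>, so one factor \<open>gam\<close> survives.\<close>

lemma transfer_counit:
  assumes f: "lin f"
  shows "eq2 (transfer_op (\<lambda>x y. eps x * f y)) (\<lambda>x y. eps x * (gam * f y))"
  unfolding eq2_def
proof (intro ballI)
  fix x y assume [simp]: "x \<in> H" "y \<in> H"
  note L = lin_intros4 lin_app[OF f]
  have "transfer_op (\<lambda>x y. eps x * f y) x y = tsw J (\<lambda>a b. tsw J (\<lambda>k l. sw k (\<lambda>k1 k2. tsw J' (\<lambda>p q. eps (a \<cdot> k1 \<cdot> x \<cdot> Si l \<cdot> (Si q \<cdot> p)) * f (b \<cdot> (k2 \<cdot> y))))))"
    by (rule transfer_form1) (auto intro!: L)
  also have "\<dots> = tsw J (\<lambda>a b. tsw J (\<lambda>k l. sw k (\<lambda>k1 k2. tsw J' (\<lambda>p q. eps q * (eps p * (eps k1 * (eps l * (eps a * (eps x * f (b \<cdot> (k2 \<cdot> y))))))))))) "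
    by (intro J_cong sw_cong' J'_cong) (auto simp: counit_mult counit_Si ac_simps)
  also have "\<dots> = tsw J (\<lambda>a b. tsw J (\<lambda>k l. sw k (\<lambda>k1 k2. gam' * (eps one * (eps k1 * (eps l * (eps a * (eps x * f (b \<cdot> (k2 \<cdot> y)))))))))) "
    by (intro J_cong sw_cong' twist_inv_counit_right) (auto intro!: L)
  also have "\<dots> = tsw J (\<lambda>a b. tsw J (\<lambda>k l. sw k (\<lambda>k1 k2. eps k1 * (eps l * (eps a * (eps x * (gam' * (eps one * f (b \<cdot> (k2 \<cdot> y))))))))))"
    by (simp only: ac_simps)
  also have "\<dots> = tsw J (\<lambda>a b. tsw J (\<lambda>k l. sw k (\<lambda>k1 k2. eps k1 * (eps l * (eps a * (eps x * (gam' * f (b \<cdot> (k2 \<cdot> y)))))))))"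
    by (intro J_cong sw_cong') (auto simp: counit_one f)
  also have "\<dots> = tsw J (\<lambda>a b. tsw J (\<lambda>k l. eps l * (eps a * (eps x * (gam' * f (b \<cdot> (k \<cdot> y)))))))"
    by (intro J_cong counit_left) (auto intro!: L)
  also have "\<dots> = tsw J (\<lambda>a b. gam * (eps a * (eps x * (gam' * f (b \<cdot> (one \<cdot> y))))))"
    by (intro J_cong twist_counit) (auto intro!: L)
  also have "\<dots> = tsw J (\<lambda>a b. eps a * (gam * (eps x * (gam' * f (b \<cdot> y)))))"
    by (intro J_cong) (auto simp: ac_simps)
  also have "\<dots> = gam * (gam * (eps x * (gam' * f (one \<cdot> y))))"
    by (rule twist_counit) (auto intro!: L)
  also have "\<dots> = eps x * (gam * (gam * (gam' * f y)))"
    by (simp add: ac_simps)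
  also have "\<dots> = eps x * (gam * f y)"
    by (simp add: gam_inverse f)
  finally show "transfer_op (\<lambda>x y. eps x * f y) x y = eps x * (gam * f y)" .
qed

text \<open>Both conditions say that powers of an operator fix certain forms, and
  \<open>transfer_op\<close> carries one operator to the other. From the twist to H it suffices to
  follow the forms \<epsilon> \<otimes> f; in the other direction, injectivity of
  \<open>transfer_op\<close> brings the equation back.\<close>

lemma exponent_twist:
  "(\<forall>f. lin f \<longrightarrow> (\<forall>x\<in>H. spowJ n f x = eps x * f one)) \<longleftrightarrow> exponent n"
proof
  assume e: "\<forall>f. lin f \<longrightarrow> (\<forall>x\<in>H. spowJ n f x = eps x * f one)"
  show "exponent n"
    unfolding exponent_def
  proof (intro allI impI ballI)
    fix f x assume f: "lin f" and [simp]: "x \<in> H"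
    note L = lin_intros4 lin_app[OF f]
    \<comment> \<open>Scaled by \<open>gam'\<close> so that the transfer of the resulting form is
      exactly \<epsilon> \<otimes> f.\<close>
    let ?g = "\<lambda>y. gam' * f y"
    have g: "lin ?g" by (rule lin_cmult[OF f])
    let ?B = "\<lambda>x y. eps x * ?g y"
    have B: "bil ?B" by (auto intro!: L f)
    have "eq2 ((betaJ ^^ n) ?B) ?B"
      using betaJ_power_counit[OF g, of n]
      by (rule eq2_trans) (simp add: eq2_def e lin_cmult lin_app[OF f lop_mult_left])
    from eq2_transfer[OF this] transfer_power[OF B, of n] have "eq2 ((beta ^^ n) (transfer_op ?B)) (transfer_op ?B)"
      by (meson eq2_trans eq2_sym)
    moreover have t: "eq2 (transfer_op ?B) (\<lambda>x y. eps x * f y)"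
      using transfer_counit[OF g] by (rule eq2_trans) (simp add: eq2_def gam_inverse f)
    moreover have "eq2 F G \<Longrightarrow> eq2 ((beta ^^ n) F) ((beta ^^ n) G)" for F G
      by (induction n) (auto intro: eq2_beta)
    ultimately have "eq2 ((beta ^^ n) (\<lambda>x y. eps x * f y)) (\<lambda>x y. eps x * f y)"
      by (meson eq2_trans eq2_sym)
    with beta_power_counit[OF f, of n] have "spow n (\<lambda>t. f (t \<cdot> one)) x = eps x * f one"
      by (auto simp: eq2_def)
    moreover have "spow n (\<lambda>t. f (t \<cdot> one)) x = spow n f x"
      by (intro spow_cong) auto
    ultimately show "spow n f x = eps x * f one" by simp
  qed
next
  assume e: "exponent n"
  show "\<forall>f. lin f \<longrightarrow> (\<forall>x\<in>H. spowJ n f x = eps x * f one)"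
  proof (intro allI impI ballI)
    fix f x assume f: "lin f" and [simp]: "x \<in> H"
    note L = lin_intros4 lin_app[OF f]
    let ?B = "\<lambda>x y. eps x * f y"
    have B: "bil ?B" by (auto intro!: L f)
    have Bn: "bil ((betaJ ^^ n) ?B)" by (induction n) (auto intro: bil_betaJ B)
    have "eq2 (transfer_op ((betaJ ^^ n) ?B)) (transfer_op ?B)"
      using transfer_power[OF B] beta_power_exponent[OF e bil_transfer[OF B]] by (rule eq2_trans)
    from eq2_transfer_cancel[OF Bn B this] betaJ_power_counit[OF f, of n]
    have "spowJ n (\<lambda>t. f (t \<cdot> one)) x = eps x * f one"
      by (auto simp: eq2_def)
    moreover have "spowJ n (\<lambda>t. f (t \<cdot> one)) x = spowJ n f x"
      by (intro spowJ_cong) auto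
    ultimately show "spowJ n f x = eps x * f one" by simp
  qed
qed

end

section \<open>From Hopf algebras to the Sweedler calculus\<close>

lemma module_scalars: "cring K \<Longrightarrow> module K (scalars K)"
proof -
  assume "cring K"
  then interpret cring K .
  have "abelian_group (scalars K)"
    by (rule abelian_groupI) (auto simp: scalars_def a_ac intro: l_neg)
  then show ?thesis
    by (intro moduleI) (auto simp: scalars_def l_distr r_distr m_assoc is_cring)
qed

lemma scalars_simps [simp]:
  "carrier (scalars K) = carrier K" "\<zero>\<^bsub>scalars K\<^esub> = \<zero>\<^bsub>K\<^esub>" "a \<oplus>\<^bsub>scalars K\<^esub> b = a \<oplus>\<^bsub>K\<^esub> b" "a \<odot>\<^bsub>scalars K\<^esub> b = a \<otimes>\<^bsub>K\<^esub> b"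
  by (simp_all add: scalars_def)

lemma module_hom_sum:
  assumes M: "module K M" and N: "module K N" and "finite I" and "\<And>i. i \<in> I \<Longrightarrow> f i \<in> module_hom K M N"
  shows "(\<lambda>x. \<Oplus>\<^bsub>N\<^esub>i\<in>I. f i x) \<in> module_hom K M N"
  using assms(3,4)
proof (induction I)
  case empty
  interpret N: module K N by fact
  show ?case by (rule module_homI) simp_all
next
  case (insert i I)
  interpret N: module K N by fact
  have h: "f i \<in> module_hom K M N" "(\<lambda>x. \<Oplus>\<^bsub>N\<^esub>i\<in>I. f i x) \<in> module_hom K M N"
    using insert by auto
  show ?case
  proof (rule iffD1[OF module_hom_cong[OF _ M] module_hom_plus[OF N h]])
    fix x assume "x \<in> carrier M"
    then show "f i x \<oplus>\<^bsub>N\<^esub> (\<Oplus>\<^bsub>N\<^esub>i\<in>I. f i x) = (\<Oplus>\<^bsub>N\<^esub>i\<in>insert i I. f i x)"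
      using insert.prems by (intro N.M.finsum_insert[OF insert.hyps, symmetric]) (auto intro: module_hom_in)
  qed
qed

lemma emb_hom: "cring K \<Longrightarrow> emb K \<in> module_hom K (scalars K) (uring_module K)"
  by (rule module_homI) (auto simp: emb_ops emb_one)

section \<open>Bases, coordinates and components of tensors\<close>

definition frame :: "('a, 'k) ring_scheme \<Rightarrow> ('a, 'v, 'm) module_scheme \<Rightarrow> nat \<Rightarrow> (nat \<Rightarrow> 'v) \<Rightarrow> (nat \<Rightarrow> 'v \<Rightarrow> 'a) \<Rightarrow> bool" where
  "frame K V d e k \<longleftrightarrow> (\<forall>i<d. e i \<in> carrier V) \<and> (\<forall>i<d. k i \<in> module_hom K V (scalars K)) \<and>
     (\<forall>x\<in>carrier V. x = (\<Oplus>\<^bsub>V\<^esub>i\<in>{..<d}. k i x \<odot>\<^bsub>V\<^esub> e i)) \<and>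
     (\<forall>i<d. \<forall>j<d. k i (e j) = (if i = j then \<one>\<^bsub>K\<^esub> else \<zero>\<^bsub>K\<^esub>))"

lemma frame_exists:
  assumes V: "vectorspace K V" and fd: "vectorspace.fin_dim K V"
  shows "\<exists>d e k. frame K V d e k"
proof -
  interpret vectorspace K V by fact
  obtain \<beta> where \<beta>: "finite \<beta>" "basis \<beta>" using finite_basis_exists[OF fd] by auto
  then have \<beta>V: "\<beta> \<subseteq> carrier V" by (simp add: basis_def)
  have ex1: "\<exists>!a. a \<in> \<beta> \<rightarrow>\<^sub>E carrier K \<and> lincomb a \<beta> = v" if "v \<in> carrier V" for v
    using basis_criterion[OF \<beta>(1) \<beta>V] \<beta>(2) that by blast
  \<comment> \<open>Coefficient functions are taken extensional on the basis, which makes them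
    unique as functions.\<close>
  define co where "co v = (THE a. a \<in> \<beta> \<rightarrow>\<^sub>E carrier K \<and> lincomb a \<beta> = v)" for v
  have co: "co v \<in> \<beta> \<rightarrow>\<^sub>E carrier K \<and> lincomb (co v) \<beta> = v" if "v \<in> carrier V" for v
    unfolding co_def by (rule theI'[OF ex1[OF that]])
  have co_eq: "co v b = a b" if "v \<in> carrier V" "a \<in> \<beta> \<rightarrow> carrier K" "lincomb a \<beta> = v" "b \<in> \<beta>" for v a b
  proof -
    have "lincomb (restrict a \<beta>) \<beta> = lincomb a \<beta>"
      unfolding lincomb_def by (intro M.finsum_cong' refl) (use that(2) \<beta>V in auto)
    then have r: "restrict a \<beta> \<in> \<beta> \<rightarrow>\<^sub>E carrier K \<and> lincomb (restrict a \<beta>) \<beta> = v" using that(2,3) by auto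
    have "co v = restrict a \<beta>" unfolding co_def by (rule the1_equality, rule ex1[OF that(1)], rule r)
    then show ?thesis using that(4) by simp
  qed
  have coK: "co v b \<in> carrier K" if "v \<in> carrier V" "b \<in> \<beta>" for v b using co[OF that(1)] that(2) by auto
  have co_Pi: "co v \<in> \<beta> \<rightarrow> carrier K" if "v \<in> carrier V" for v using co[OF that] by auto
  obtain e where e: "bij_betw e {..<card \<beta>} \<beta>" using bij_betw_from_nat_into_finite[OF \<beta>(1)] by blast
  have e_in: "e i \<in> \<beta>" if "i < card \<beta>" for i using e that by (auto simp: bij_betw_def)
  have e_inj: "inj_on e {..<card \<beta>}" and e_im: "e ` {..<card \<beta>} = \<beta>" using e by (auto simp: bij_betw_def)
  have "frame K V (card \<beta>) e (\<lambda>i v. co v (e i))"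
    unfolding frame_def
  proof (intro conjI allI impI ballI)
    fix i assume i: "i < card \<beta>"
    note b = e_in[OF i]
    show "e i \<in> carrier V" using b \<beta>V by auto
    show "(\<lambda>v. co v (e i)) \<in> module_hom K V (scalars K)"
    proof (rule module_homI)
      fix v w assume vw: "v \<in> carrier V" "w \<in> carrier V"
      show "co v (e i) \<in> carrier (scalars K)" using coK vw b by simp
      have "lincomb (\<lambda>b. co v b \<oplus>\<^bsub>K\<^esub> co w b) \<beta> = v \<oplus>\<^bsub>V\<^esub> w"
        using lincomb_sum[OF \<beta>(1) \<beta>V co_Pi[OF vw(1)] co_Pi[OF vw(2)]] co vw by simp
      then have "co (v \<oplus>\<^bsub>V\<^esub> w) (e i) = co v (e i) \<oplus>\<^bsub>K\<^esub> co w (e i)"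
        using vw coK b by (intro co_eq) auto
      then show "co (v \<oplus>\<^bsub>V\<^esub> w) (e i) = co v (e i) \<oplus>\<^bsub>scalars K\<^esub> co w (e i)" by simp
    next
      fix a v assume av: "a \<in> carrier K" "v \<in> carrier V"
      have "lincomb (\<lambda>b. a \<otimes>\<^bsub>K\<^esub> co v b) \<beta> = a \<odot>\<^bsub>V\<^esub> v"
        using lincomb_smult[OF \<beta>V co_Pi[OF av(2)] av(1)] co av by simp
      then have "co (a \<odot>\<^bsub>V\<^esub> v) (e i) = a \<otimes>\<^bsub>K\<^esub> co v (e i)"
        using av coK b by (intro co_eq) auto
      then show "co (a \<odot>\<^bsub>V\<^esub> v) (e i) = a \<odot>\<^bsub>scalars K\<^esub> co v (e i)" by simp
    qed
    fix j assume j: "j < card \<beta>"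
    have ej: "e j \<in> carrier V" using e_in[OF j] \<beta>V by auto
    have "lincomb (\<lambda>b. if b = e j then \<one>\<^bsub>K\<^esub> else \<zero>\<^bsub>K\<^esub>) \<beta> = (\<Oplus>\<^bsub>V\<^esub>b\<in>{e j}. b)"
      unfolding lincomb_def
      by (rule M.add.finprod_mono_neutral_cong_right) (use \<beta> \<beta>V e_in[OF j] ej in auto)
    also have "\<dots> = e j" using ej by (simp add: M.finsum_insert[of "{}"])
    finally have "co (e j) (e i) = (if e i = e j then \<one>\<^bsub>K\<^esub> else \<zero>\<^bsub>K\<^esub>)"
      using ej b by (intro co_eq) auto
    then show "co (e j) (e i) = (if i = j then \<one>\<^bsub>K\<^esub> else \<zero>\<^bsub>K\<^esub>)"
      using inj_onD[OF e_inj, of i j] i j by auto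
  next
    fix x assume x: "x \<in> carrier V"
    have "x = (\<Oplus>\<^bsub>V\<^esub>b\<in>e ` {..<card \<beta>}. co x b \<odot>\<^bsub>V\<^esub> b)"
      using co[OF x] by (simp add: lincomb_def e_im)
    also have "\<dots> = (\<Oplus>\<^bsub>V\<^esub>i\<in>{..<card \<beta>}. co x (e i) \<odot>\<^bsub>V\<^esub> e i)"
      by (rule M.finsum_reindex[OF _ e_inj]) (use coK[OF x] e_im \<beta>V in auto)
    finally show "x = (\<Oplus>\<^bsub>V\<^esub>i\<in>{..<card \<beta>}. co x (e i) \<odot>\<^bsub>V\<^esub> e i)" .
  qed
  then show ?thesis by blast
qed

text \<open>An injective map sends a basis to an independent set of the same size, hence to a basis.
  It upgrades injectivity of the antipode to bijectivity.\<close>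

lemma injective_endomorphism_surj:
  assumes V: "vectorspace K V" and fd: "vectorspace.fin_dim K V" and T: "T \<in> module_hom K V V" and inj: "inj_on T (carrier V)"
  shows "T ` carrier V = carrier V"
proof -
  interpret vectorspace K V by fact
  interpret T: linear_map K V V T
    by (intro linear_map.intro V mod_hom.intro mod_hom_axioms.intro module_axioms T)
  obtain \<beta> where \<beta>: "finite \<beta>" "basis \<beta>" using finite_basis_exists[OF fd] by auto
  then have \<beta>V: "\<beta> \<subseteq> carrier V" and li: "lin_indpt \<beta>" by (auto simp: basis_def)
  have T\<beta>: "T ` \<beta> \<subseteq> carrier V" using \<beta>V by auto
  have "lin_indpt (T ` \<beta>)"
  proof
    assume "lin_dep (T ` \<beta>)"
    then obtain a b where a: "a \<in> T ` \<beta> \<rightarrow> carrier K" "lincomb a (T ` \<beta>) = \<zero>\<^bsub>V\<^esub>" "b \<in> \<beta>" "a (T b) \<noteq> \<zero>\<^bsub>K\<^esub>"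
      using finite_lin_dep[of "T ` \<beta>"] \<beta>(1) T\<beta> by blast
    have aT: "a \<circ> T \<in> \<beta> \<rightarrow> carrier K" using a(1) by auto
    have "T (lincomb (a \<circ> T) \<beta>) = T \<zero>\<^bsub>V\<^esub>"
      using T.lincomb_linear_image[OF inj \<beta>V a(1) \<beta>(1)] a(2) T.f0_is_0 by simp
    then have "lincomb (a \<circ> T) \<beta> = \<zero>\<^bsub>V\<^esub>"
      using inj_onD[OF inj] lincomb_closed[OF \<beta>V aT] by simp
    then have "lin_dep \<beta>"
      unfolding lin_dep_def using \<beta>(1) aT a(3,4) by (intro exI[of _ \<beta>] exI[of _ "a \<circ> T"] exI[of _ b]) simp
    with li show False by simp
  qed
  moreover have "card (T ` \<beta>) = dim"
    using card_image[OF inj_on_subset[OF inj \<beta>V]] dim_basis[OF \<beta>] by simp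
  ultimately have gen: "gen_set (T ` \<beta>)"
    using dim_li_is_basis[OF fd _ T\<beta>] \<beta>(1) by (simp add: basis_def)
  have "x \<in> T ` carrier V" if "x \<in> carrier V" for x
  proof -
    have "x \<in> span (T ` \<beta>)" using gen that by simp
    then obtain a where a: "a \<in> T ` \<beta> \<rightarrow> carrier K" "lincomb a (T ` \<beta>) = x"
      using finite_in_span[OF _ T\<beta>] \<beta>(1) by blast
    have "x = T (lincomb (a \<circ> T) \<beta>)" using T.lincomb_linear_image[OF inj \<beta>V a(1) \<beta>(1)] a(2) by simp
    moreover have "lincomb (a \<circ> T) \<beta> \<in> carrier V" by (rule lincomb_closed[OF \<beta>V]) (use a(1) in auto)
    ultimately show ?thesis by blast
  qed
  then show ?thesis using T.f_im by blast
qed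

locale framed = V: module K V for K :: "('a, 'k) ring_scheme" and V :: "('a, 'v, 'm) module_scheme" +
  fixes d :: nat and e :: "nat \<Rightarrow> 'v" and k :: "nat \<Rightarrow> 'v \<Rightarrow> 'a"
  assumes frame: "frame K V d e k"
begin

abbreviation "R \<equiv> uring_module K"
abbreviation "co \<equiv> \<lambda>i x. emb K (k i x)"

lemma R_module: "module K R" by (rule module_uring[OF V.R.is_cring])

lemma e_carrier: "i < d \<Longrightarrow> e i \<in> carrier V" and k_hom: "i < d \<Longrightarrow> k i \<in> module_hom K V (scalars K)"
  and expand: "x \<in> carrier V \<Longrightarrow> x = (\<Oplus>\<^bsub>V\<^esub>i\<in>{..<d}. k i x \<odot>\<^bsub>V\<^esub> e i)"
  and k_e: "\<lbrakk>i < d; j < d\<rbrakk> \<Longrightarrow> k i (e j) = (if i = j then \<one>\<^bsub>K\<^esub> else \<zero>\<^bsub>K\<^esub>)"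
  using frame by (auto simp: frame_def)

lemma k_in: "\<lbrakk>i < d; x \<in> carrier V\<rbrakk> \<Longrightarrow> k i x \<in> carrier K"
  using module_hom_in[OF k_hom] by auto

lemma co_hom: "i < d \<Longrightarrow> co i \<in> module_hom K V R"
  by (rule module_hom_comp[OF k_hom emb_hom[OF V.R.is_cring]])

lemma hom_expand:
  assumes W: "module K W" and f: "f \<in> module_hom K V W" and x: "x \<in> carrier V"
  shows "f x = (\<Oplus>\<^bsub>W\<^esub>i\<in>{..<d}. k i x \<odot>\<^bsub>W\<^esub> f (e i))"
proof -
  interpret W: module K W by fact
  have "f x = f (\<Oplus>\<^bsub>V\<^esub>i\<in>{..<d}. k i x \<odot>\<^bsub>V\<^esub> e i)" using expand[OF x] by simp
  also have "\<dots> = (\<Oplus>\<^bsub>W\<^esub>i\<in>{..<d}. f (k i x \<odot>\<^bsub>V\<^esub> e i))"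
    by (rule module_hom_finsum[OF V.module_axioms W f]) (use k_in[OF _ x] e_carrier in auto)
  also have "\<dots> = (\<Oplus>\<^bsub>W\<^esub>i\<in>{..<d}. k i x \<odot>\<^bsub>W\<^esub> f (e i))"
    by (intro W.M.finsum_cong' refl)
      (use k_in[OF _ x] e_carrier module_hom_smult[OF f] module_hom_in[OF f] in auto)
  finally show ?thesis .
qed

lemma hom_expand_uring:
  assumes f: "f \<in> module_hom K V R" and x: "x \<in> carrier V"
  shows "f x = (\<Sum>i<d. co i x * f (e i))"
proof -
  interpret R: module K R by (rule R_module)
  have "f x = (\<Oplus>\<^bsub>R\<^esub>i\<in>{..<d}. k i x \<odot>\<^bsub>R\<^esub> f (e i))" by (rule hom_expand[OF R_module f x])
  also have "\<dots> = (\<Sum>i<d. k i x \<odot>\<^bsub>R\<^esub> f (e i))"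
    by (rule finsum_uring[OF V.R.is_cring]) (use k_in[OF _ x] module_hom_in[OF f e_carrier] in \<open>auto simp del: uring_module_simps\<close>)
  finally show ?thesis by simp
qed

sublocale lin_frame "carrier V" d e co
proof
  fix x y assume xy: "x \<in> carrier V" "y \<in> carrier V" and eq: "\<forall>i<d. co i x = co i y"
  have "k i x = k i y" if "i < d" for i
    using emb_inject[OF V.R.is_cring k_in[OF that xy(1)] k_in[OF that xy(2)]] eq that by simp
  then have "(\<Oplus>\<^bsub>V\<^esub>i\<in>{..<d}. k i x \<odot>\<^bsub>V\<^esub> e i) = (\<Oplus>\<^bsub>V\<^esub>i\<in>{..<d}. k i y \<odot>\<^bsub>V\<^esub> e i)"
    by (intro V.M.finsum_cong' refl) (use k_in xy e_carrier in auto)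
  then show "x = y" by (rule trans[OF expand[OF xy(1)] trans[OF _ expand[OF xy(2), symmetric]]])
next
  show "e i \<in> carrier V" if "i < d" for i by (rule e_carrier[OF that])
  show "co j x = (\<Sum>i<d. co i x * co j (e i))" if "x \<in> carrier V" "j < d" for x j
    by (rule hom_expand_uring[OF co_hom[OF that(2)] that(1)])
qed

lemma hom_lin: "f \<in> module_hom K V R \<Longrightarrow> lin f"
  unfolding lin_def by (auto intro: hom_expand_uring)

lemma lin_hom:
  assumes f: "lin f" shows "f \<in> module_hom K V R"
proof (rule module_homI)
  note c = module_homD[OF co_hom]
  show "f x \<in> carrier R" if x: "x \<in> carrier V" for x
    unfolding linD[OF f x] using c(1)[OF _ x] by (simp add: sum_distrib_left mult.assoc[symmetric])
  show "f (x \<oplus>\<^bsub>V\<^esub> y) = f x \<oplus>\<^bsub>R\<^esub> f y" if xy: "x \<in> carrier V" "y \<in> carrier V" for x y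
    using linD[OF f xy(1)] linD[OF f xy(2)] linD[OF f V.M.a_closed[OF xy]] c(2)[OF _ xy]
    by (simp add: sum.distrib[symmetric] distrib_right[symmetric])
  show "f (a \<odot>\<^bsub>V\<^esub> x) = a \<odot>\<^bsub>R\<^esub> f x" if ax: "a \<in> carrier K" "x \<in> carrier V" for a x
    using linD[OF f ax(2)] linD[OF f V.smult_closed[OF ax]] c(3)[OF _ ax]
    by (simp add: sum_distrib_left mult.assoc)
qed

text \<open>The notion used in the calculus is ordinary linearity into the image of
  \<open>K\<close>, so facts about homomorphisms and about the calculus can be mixed.\<close>

lemma lin_iff: "lin f \<longleftrightarrow> f \<in> module_hom K V R"
  using hom_lin lin_hom by blast

lemma lopI: "t \<in> module_hom K V V \<Longrightarrow> lop t"
  unfolding lop_def by (auto simp: lin_iff module_hom_in intro: module_hom_comp)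

lemma bil_bi2: "bil F \<longleftrightarrow> bi2 K V R F"
  by (auto simp: bil_def bi2_def lin_iff)

lemma bil_mlin: "bil F \<Longrightarrow> mlin K 2 V R (\<lambda>xs. F (xs ! 0) (xs ! 1))"
  by (rule bi2_mlin) (simp add: bil_bi2)

lemma tri_mlin:
  assumes T: "tri T" shows "mlin K 3 V R (\<lambda>xs. T (xs ! 0) (xs ! 1) (xs ! 2))"
  by (rule mlin_3I; fold lin_iff) (rule triD[OF T lop_id]; assumption)+

text \<open>The coefficient in front of \<open>e i\<close> when the second tensor factor is expanded
  in the basis.\<close>

definition comp :: "('v list \<Rightarrow> 'a) set \<Rightarrow> nat \<Rightarrow> 'v" where
  "comp X i = lift K V (\<lambda>xs. k i (xs ! 1) \<odot>\<^bsub>V\<^esub> xs ! 0) X"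

lemma bi2_comp: "i < d \<Longrightarrow> bi2 K V V (\<lambda>a b. k i b \<odot>\<^bsub>V\<^esub> a)"
proof -
  assume i: "i < d"
  show ?thesis
    unfolding bi2_def
    by (auto intro!: module_homI module_hom_scale[OF V.module_axioms module_hom_ident] k_in[OF i]
        simp: module_hom_add[OF k_hom[OF i]] module_hom_smult[OF k_hom[OF i]] V.smult_l_distr V.smult_assoc1 k_in[OF i])
qed

lemma comp_hom: "i < d \<Longrightarrow> (\<lambda>X. comp X i) \<in> module_hom K (tensor_space K 2 V) V"
  unfolding comp_def by (rule lift_tensor_hom[OF V.module_axioms V.module_axioms bi2_mlin[OF bi2_comp]])

lemma comp_in: "\<lbrakk>i < d; X \<in> carrier (tensor_space K 2 V)\<rbrakk> \<Longrightarrow> comp X i \<in> carrier V"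
  using module_hom_in[OF comp_hom] .

lemma comp_tensor: "\<lbrakk>i < d; a \<in> carrier V; b \<in> carrier V\<rbrakk> \<Longrightarrow> comp (tensor K V [a, b]) i = k i b \<odot>\<^bsub>V\<^esub> a"
  unfolding comp_def
  by (subst lift_tensor[OF V.module_axioms V.module_axioms bi2_mlin[OF bi2_comp]]) (auto simp: vectors_2)

lemma tensor2_expand:
  assumes X: "X \<in> carrier (tensor_space K 2 V)"
  shows "X = (\<Oplus>\<^bsub>tensor_space K 2 V\<^esub>i\<in>{..<d}. tensor K V [comp X i, e i])"
proof -
  interpret T: module K "tensor_space K 2 V" by (rule module_tensor_space[OF V.module_axioms])
  have h: "(\<lambda>X. tensor K V [comp X i, e i]) \<in> module_hom K (tensor_space K 2 V) (tensor_space K 2 V)" if i: "i < d" for i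
  proof -
    have v: "[\<zero>\<^bsub>V\<^esub>, e i] \<in> vectors 2 V" using e_carrier[OF i] by (auto simp: vectors_2)
    show ?thesis
      using module_hom_comp[OF comp_hom[OF i] mlinD(2)[OF mlin_tensor[OF V.module_axioms] v, of 0]] by simp
  qed
  have s: "(\<lambda>X. \<Oplus>\<^bsub>tensor_space K 2 V\<^esub>i\<in>{..<d}. tensor K V [comp X i, e i]) \<in> module_hom K (tensor_space K 2 V) (tensor_space K 2 V)"
    by (rule module_hom_sum[OF T.module_axioms T.module_axioms]) (simp_all add: h)
  show ?thesis
  proof (rule tensor_hom_eqI[OF V.module_axioms T.module_axioms module_hom_ident s _ X])
    fix xs assume xs: "xs \<in> vectors 2 V"
    then obtain a b where ab: "a \<in> carrier V" "b \<in> carrier V" "xs = [a, b]" by (auto simp: vectors_2)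
    note m = mlinD(2)[OF mlin_tensor[OF V.module_axioms] xs]
    have m0: "(\<lambda>a. tensor K V [a, e i]) \<in> module_hom K V (tensor_space K 2 V)" if "i < d" for i
      using mlinD(2)[OF mlin_tensor[OF V.module_axioms], of "[a, e i]" 2 0] that ab e_carrier by (auto simp: vectors_2)
    have m1: "(\<lambda>b. tensor K V [a, b]) \<in> module_hom K V (tensor_space K 2 V)"
      using m[of 1] ab by simp
    have "tensor K V xs = (\<Oplus>\<^bsub>tensor_space K 2 V\<^esub>i\<in>{..<d}. k i b \<odot>\<^bsub>tensor_space K 2 V\<^esub> tensor K V [a, e i])"
      using hom_expand[OF T.module_axioms m1 ab(2)] by (simp add: ab)
    also have "\<dots> = (\<Oplus>\<^bsub>tensor_space K 2 V\<^esub>i\<in>{..<d}. tensor K V [comp (tensor K V xs) i, e i])"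
      by (intro T.M.finsum_cong' refl)
        (use ab in \<open>auto simp: comp_tensor module_hom_smult[OF m0] k_in intro!: tensor_in[OF V.module_axioms] simp: vectors_2 e_carrier\<close>)
    finally show "tensor K V xs = (\<Oplus>\<^bsub>tensor_space K 2 V\<^esub>i\<in>{..<d}. tensor K V [comp (tensor K V xs) i, e i])" .
  qed
qed

lemma comp_eqI:
  assumes X: "X \<in> carrier (tensor_space K 2 V)" and Y: "Y \<in> carrier (tensor_space K 2 V)"
    and c: "\<And>i. i < d \<Longrightarrow> comp X i = comp Y i"
  shows "X = Y"
proof -
  interpret T: module K "tensor_space K 2 V" by (rule module_tensor_space[OF V.module_axioms])
  have "(\<Oplus>\<^bsub>tensor_space K 2 V\<^esub>i\<in>{..<d}. tensor K V [comp X i, e i]) = (\<Oplus>\<^bsub>tensor_space K 2 V\<^esub>i\<in>{..<d}. tensor K V [comp Y i, e i])"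
    by (intro T.M.finsum_cong' refl)
      (use Y in \<open>auto simp: c vectors_2 e_carrier comp_in intro!: tensor_in[OF V.module_axioms]\<close>)
  then show ?thesis using tensor2_expand[OF X] tensor2_expand[OF Y] by simp
qed

lemma hom_sum_uring:
  assumes "\<And>i. i \<in> I \<Longrightarrow> f i \<in> module_hom K M R"
  shows "(\<lambda>x. \<Sum>i\<in>I. f i x) \<in> module_hom K M R"
proof (rule module_homI)
  note h = module_homD[OF assms]
  show "(\<Sum>i\<in>I. f i x) \<in> carrier R" if "x \<in> carrier M" for x
    using h(1)[OF _ that] by (simp add: sum_distrib_left)
  show "(\<Sum>i\<in>I. f i (x \<oplus>\<^bsub>M\<^esub> y)) = (\<Sum>i\<in>I. f i x) \<oplus>\<^bsub>R\<^esub> (\<Sum>i\<in>I. f i y)" if "x \<in> carrier M" "y \<in> carrier M" for x y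
    using h(2)[OF _ that] by (simp add: sum.distrib)
  show "(\<Sum>i\<in>I. f i (a \<odot>\<^bsub>M\<^esub> x)) = a \<odot>\<^bsub>R\<^esub> (\<Sum>i\<in>I. f i x)" if "a \<in> carrier K" "x \<in> carrier M" for a x
    using h(3)[OF _ that] by (simp add: sum_distrib_left)
qed

text \<open>The bridge from tensors to the calculus. Both sides are linear in \<open>X\<close>, so
  pure tensors suffice, and there it is the expansion of the second factor in the basis.\<close>

lemma lift_bil:
  assumes F: "bil F" and X: "X \<in> carrier (tensor_space K 2 V)"
  shows "lift K R (\<lambda>xs. F (xs ! 0) (xs ! 1)) X = tsw (comp X) F"
  unfolding tsw_def
proof (rule tensor_hom_eqI[OF V.module_axioms R_module _ _ _ X])
  show "lift K R (\<lambda>xs. F (xs ! 0) (xs ! 1)) \<in> module_hom K (tensor_space K 2 V) R"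
    by (rule lift_tensor_hom[OF V.module_axioms R_module bil_mlin[OF F]])
  have h: "(\<lambda>a. F a b) \<in> module_hom K V R" if "b \<in> carrier V" for b
    using bilD(1)[OF F lop_id that] by (simp add: lin_iff)
  show "(\<lambda>X. \<Sum>i<d. F (comp X i) (e i)) \<in> module_hom K (tensor_space K 2 V) R"
  proof (rule hom_sum_uring)
    fix i assume "i \<in> {..<d}"
    then have i: "i < d" by simp
    show "(\<lambda>X. F (comp X i) (e i)) \<in> module_hom K (tensor_space K 2 V) R"
      by (rule module_hom_comp[OF comp_hom[OF i] h[OF e_carrier[OF i]]])
  qed
  fix xs assume xs: "xs \<in> vectors 2 V"
  then obtain a b where ab: "a \<in> carrier V" "b \<in> carrier V" "xs = [a, b]" by (auto simp: vectors_2)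
  have "lift K R (\<lambda>xs. F (xs ! 0) (xs ! 1)) (tensor K V xs) = F a b"
    using lift_tensor[OF V.module_axioms R_module bil_mlin[OF F] xs] ab by simp
  also have "\<dots> = (\<Sum>i<d. co i b * F a (e i))"
    by (rule linD[OF bilD(2)[OF F lop_id ab(1)] ab(2)])
  also have "\<dots> = (\<Sum>i<d. F (comp (tensor K V xs) i) (e i))"
  proof (rule sum.cong[OF refl])
    fix i assume "i \<in> {..<d}"
    then have i: "i < d" by simp
    show "co i b * F a (e i) = F (comp (tensor K V xs) i) (e i)"
      using module_hom_smult[OF h[OF e_carrier[OF i]] k_in[OF i ab(2)] ab(1)] by (simp add: ab(3) comp_tensor[OF i ab(1,2)])
  qed
  finally show "lift K R (\<lambda>xs. F (xs ! 0) (xs ! 1)) (tensor K V xs) = (\<Sum>i<d. F (comp (tensor K V xs) i) (e i))" .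
qed

lemma lin_lift:
  assumes f: "lin f" and \<phi>: "mlin K n V V \<phi>" and X: "X \<in> carrier (tensor_space K n V)"
  shows "f (lift K V \<phi> X) = lift K R (\<lambda>xs. f (\<phi> xs)) X"
  by (rule lift_tensor_comp[OF V.module_axioms V.module_axioms R_module lin_hom[OF f] \<phi> X])

end

subsection \<open>Sweedler powers as iterated multiplication\<close>

lemma foldr_mlin:
  assumes A: "module K A" and m: "bi2 K A A (\<otimes>\<^bsub>A\<^esub>)"
  shows "Y \<in> carrier A \<Longrightarrow> mlin K n A A (\<lambda>xs. foldr (\<otimes>\<^bsub>A\<^esub>) xs Y)"
    and "xs \<in> vectors n A \<Longrightarrow> (\<lambda>Y. foldr (\<otimes>\<^bsub>A\<^esub>) xs Y) \<in> module_hom K A A"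
proof -
  have m2: "\<And>b. b \<in> carrier A \<Longrightarrow> (\<lambda>a. a \<otimes>\<^bsub>A\<^esub> b) \<in> module_hom K A A" "\<And>a. a \<in> carrier A \<Longrightarrow> (\<lambda>b. a \<otimes>\<^bsub>A\<^esub> b) \<in> module_hom K A A"
    using m by (auto simp: bi2_def)
  have h: "(\<lambda>Y. foldr (\<otimes>\<^bsub>A\<^esub>) xs Y) \<in> module_hom K A A" if "set xs \<subseteq> carrier A" for xs
    using that
  proof (induction xs)
    case (Cons x xs)
    then show ?case using module_hom_comp[OF Cons.IH m2(2)[of x]] by (simp add: o_def)
  qed (auto simp: module_hom_def)
  show "xs \<in> vectors n A \<Longrightarrow> (\<lambda>Y. foldr (\<otimes>\<^bsub>A\<^esub>) xs Y) \<in> module_hom K A A"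
    by (rule h) (simp add: vectors_def)
  assume Y: "Y \<in> carrier A"
  have "(\<lambda>v. foldr (\<otimes>\<^bsub>A\<^esub>) (xs[i := v]) Y) \<in> module_hom K A A" if "set xs \<subseteq> carrier A" "i < length xs" for xs i
    using that
  proof (induction xs arbitrary: i)
    case (Cons x xs)
    show ?case
    proof (cases i)
      case 0
      then show ?thesis using m2(1)[OF module_hom_in[OF h Y], of xs] Cons.prems by (simp add: o_def)
    next
      case (Suc j)
      then show ?thesis using module_hom_comp[OF Cons.IH[of j] m2(2)[of x]] Cons.prems by (simp add: o_def)
    qed
  qed simp
  then show "mlin K n A A (\<lambda>xs. foldr (\<otimes>\<^bsub>A\<^esub>) xs Y)"
    unfolding mlin_def using module_hom_in[OF h Y] by (auto simp: vectors_def)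
qed

text \<open>The recursion for Sweedler powers is derived from linearity of product and coproduct, so
  that it applies alike to H, to its twists and to the double.\<close>

locale sweedler_struct =
  fixes K :: "('a, 'k) ring_scheme" and A :: "('a, 'v, 'm) hopf_scheme"
  assumes A: "module K A" and mult: "bi2 K A A (\<otimes>\<^bsub>A\<^esub>)"
    and comult: "comult A \<in> module_hom K A (tensor_space K 2 A)"
begin

text \<open>X_(1) (X_(2) ( ... (X_(n) Y))), bracketed to the right. The third element absorbs one
  leg after another, which yields a recursion; Y = 1 is the Sweedler power.\<close>

definition act_pow :: "nat \<Rightarrow> 'v \<Rightarrow> 'v \<Rightarrow> 'v" where
  "act_pow n X Y = lift K A (\<lambda>xs. foldr (\<otimes>\<^bsub>A\<^esub>) xs Y) (comult_n K A n X)"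

lemma comult_n_hom: "comult_n K A (Suc n) \<in> module_hom K A (tensor_space K (Suc n) A)"
proof (induction n)
  case 0
  have "comult_n K A (Suc 0) = (\<lambda>h. tensor K A [h])" by (auto simp: fun_eq_iff)
  then show ?case using tensor1_hom[OF A] by simp
next
  case (Suc n)
  interpret T2: module K "tensor_space K 2 A" by (rule module_tensor_space[OF A])
  have "comult_n K A (Suc (Suc n)) = (\<lambda>h. tensor_left K A (Suc n) (comult_n K A (Suc n)) (comult A h))"
    by (auto simp: fun_eq_iff)
  then show ?case
    using module_hom_comp[OF comult tensor_left_hom[OF A Suc T2.M.zero_closed]] by simp
qed

lemma sweedler_power_act: "sweedler_power K A n X = act_pow n X \<one>\<^bsub>A\<^esub>"
  by (simp add: sweedler_power_def mult_n_def act_pow_def)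

lemma act_pow_1:
  assumes X: "X \<in> carrier A" and Y: "Y \<in> carrier A"
  shows "act_pow (Suc 0) X Y = X \<otimes>\<^bsub>A\<^esub> Y"
  unfolding act_pow_def comult_n.simps
  by (subst lift_tensor[OF A A foldr_mlin(1)[OF A mult Y, of "Suc 0"]]) (use X in \<open>auto simp: vectors_1\<close>)

lemma act_pow_hom:
  "Y \<in> carrier A \<Longrightarrow> (\<lambda>X. act_pow (Suc n) X Y) \<in> module_hom K A A"
  "X \<in> carrier A \<Longrightarrow> (\<lambda>Y. act_pow (Suc n) X Y) \<in> module_hom K A A"
proof -
  show "Y \<in> carrier A \<Longrightarrow> (\<lambda>X. act_pow (Suc n) X Y) \<in> module_hom K A A"
    unfolding act_pow_def by (rule module_hom_comp[OF comult_n_hom lift_tensor_hom[OF A A foldr_mlin(1)[OF A mult]]])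
  show "X \<in> carrier A \<Longrightarrow> (\<lambda>Y. act_pow (Suc n) X Y) \<in> module_hom K A A"
    unfolding act_pow_def
    by (rule lift_tensor_param[OF A A A foldr_mlin[OF A mult] module_hom_in[OF comult_n_hom]])
qed

lemma act_pow_bi2:
  assumes Y: "Y \<in> carrier A"
  shows "bi2 K A A (\<lambda>a b. act_pow (Suc n) a (b \<otimes>\<^bsub>A\<^esub> Y))"
proof -
  have m2: "\<And>b. b \<in> carrier A \<Longrightarrow> (\<lambda>a. a \<otimes>\<^bsub>A\<^esub> b) \<in> module_hom K A A"
    using mult by (auto simp: bi2_def)
  show ?thesis
    unfolding bi2_def
    using act_pow_hom(1)[OF module_hom_in[OF m2[OF Y]]] module_hom_comp[OF m2[OF Y] act_pow_hom(2)] by blast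
qed

text \<open>\<open>comult_n\<close> always splits the first leg further, so the last leg stands
  alone and can be absorbed into \<open>Y\<close>.\<close>

lemma act_pow_Suc:
  assumes X: "X \<in> carrier A" and Y: "Y \<in> carrier A"
  shows "act_pow (Suc (Suc n)) X Y = lift K A (\<lambda>xs. act_pow (Suc n) (xs ! 0) (xs ! 1 \<otimes>\<^bsub>A\<^esub> Y)) (comult A X)"
proof -
  have f: "mlin K (Suc n + 1) A A (\<lambda>xs. foldr (\<otimes>\<^bsub>A\<^esub>) xs Y)" by (rule foldr_mlin(1)[OF A mult Y])
  have "act_pow (Suc (Suc n)) X Y
    = lift K A (\<lambda>xs. lift K A (\<lambda>ys. foldr (\<otimes>\<^bsub>A\<^esub>) (ys @ [xs ! 1]) Y) (comult_n K A (Suc n) (xs ! 0))) (comult A X)"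
    unfolding act_pow_def comult_n.simps
    by (rule lift_tensor_left[OF A comult_n_hom module_hom_in[OF comult X] A f])
  also have "\<dots> = lift K A (\<lambda>xs. act_pow (Suc n) (xs ! 0) (xs ! 1 \<otimes>\<^bsub>A\<^esub> Y)) (comult A X)"
    by (simp add: act_pow_def)
  finally show ?thesis .
qed

lemma sweedler_power_hom:
  assumes "\<one>\<^bsub>A\<^esub> \<in> carrier A" "n \<ge> 1"
  shows "sweedler_power K A n \<in> module_hom K A A"
proof -
  obtain m where n: "n = Suc m" using assms(2) by (cases n) auto
  have "sweedler_power K A n = (\<lambda>X. act_pow (Suc m) X \<one>\<^bsub>A\<^esub>)" by (auto simp: sweedler_power_act n)
  then show ?thesis using act_pow_hom(1)[OF assms(1)] by simp
qed

end

subsection \<open>Finite-dimensional Hopf algebras\<close>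

text \<open>Some antipode is fixed as a parameter, since \<open>antipode\<close> is a definite
  description whose uniqueness is proved only inside this locale.\<close>

locale fd_hopf = hopf_algebra K H + framed K H d e k
  for K :: "('a, 'k) ring_scheme" and H :: "('a, 'h, 'm) hopf_scheme" and d e k +
  fixes S
  assumes fin: "vectorspace.fin_dim K H" and S: "is_antipode K H S"
begin

interpretation Hr: ring H by (rule ring)

lemma mult_hom:
  "y \<in> carrier H \<Longrightarrow> (\<lambda>x. x \<otimes>\<^bsub>H\<^esub> y) \<in> module_hom K H H"
  "y \<in> carrier H \<Longrightarrow> (\<lambda>x. y \<otimes>\<^bsub>H\<^esub> x) \<in> module_hom K H H"
  by (auto intro!: module_homI simp: Hr.l_distr Hr.r_distr smult_mult_left smult_mult_right)

lemma mult_bi2: "bi2 K H H (\<otimes>\<^bsub>H\<^esub>)"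
  using mult_hom by (simp add: bi2_def)

definition Dl :: "nat \<Rightarrow> 'h \<Rightarrow> 'h" where "Dl i x = comp (comult H x) i"

lemma lop_Dl: "i < d \<Longrightarrow> lop (Dl i)"
  unfolding Dl_def by (rule lopI[OF module_hom_comp[OF comult_linear comp_hom]])

lemma comult_in: "x \<in> carrier H \<Longrightarrow> comult H x \<in> carrier (tensor_space K 2 H)"
  by (rule module_hom_in[OF comult_linear])

lemma lift_comult: "\<lbrakk>bil F; x \<in> carrier H\<rbrakk> \<Longrightarrow> lift K R (\<lambda>xs. F (xs ! 0) (xs ! 1)) (comult H x) = (\<Sum>i<d. F (Dl i x) (e i))"
  using lift_bil[OF _ comult_in] by (simp add: tsw_def Dl_def)

lemma bil_comult:
  assumes T: "tri T"
  shows "bil (\<lambda>a b. \<Sum>i<d. T (Dl i a) (e i) b)" "bil (\<lambda>a b. \<Sum>i<d. T a (Dl i b) (e i))"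
  by (auto intro!: bilI lin_sum triD[OF T] lop_Dl lop_id intro: lop_in[OF lop_Dl])

lemma two_plus_one: "(2::nat) + 1 = 3" "(1::nat) + 2 = 3"
  by simp_all

text \<open>Stated for arbitrary tensors and not only for coproducts, because the twist equation
  applies \<Delta> to a leg of J.\<close>

lemma lift_left_comult:
  assumes T: "tri T" and X: "X \<in> carrier (tensor_space K 2 H)"
  shows "lift K R (\<lambda>xs. T (xs ! 0) (xs ! 1) (xs ! 2)) (tensor_left K H 2 (comult H) X) = tsw (comp X) (\<lambda>a b. \<Sum>i<d. T (Dl i a) (e i) b)"
proof -
  note V = V.module_axioms
  have m: "mlin K (2 + 1) H R (\<lambda>xs. T (xs ! 0) (xs ! 1) (xs ! 2))"
    unfolding two_plus_one by (rule tri_mlin[OF T])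
  have "lift K R (\<lambda>xs. T (xs ! 0) (xs ! 1) (xs ! 2)) (tensor_left K H 2 (comult H) X)
    = lift K R (\<lambda>xs. lift K R (\<lambda>ys. T ((ys @ [xs ! 1]) ! 0) ((ys @ [xs ! 1]) ! 1) ((ys @ [xs ! 1]) ! 2)) (comult H (xs ! 0))) X"
    by (rule lift_tensor_left[OF V comult_linear X R_module m])
  also have "\<dots> = lift K R (\<lambda>xs. (\<lambda>a b. \<Sum>i<d. T (Dl i a) (e i) b) (xs ! 0) (xs ! 1)) X"
  proof (rule lift_tensor_cong[OF V R_module bil_mlin[OF bil_comult(1)[OF T]] _ X, symmetric])
    fix xs assume "xs \<in> vectors 2 H"
    then obtain a b where ab: "a \<in> carrier H" "b \<in> carrier H" "xs = [a, b]" by (auto simp: vectors_2)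
    have F: "bil (\<lambda>p q. T p q b)" by (auto intro!: bilI triD[OF T] lop_id ab)
    have "lift K R (\<lambda>ys. T ((ys @ [b]) ! 0) ((ys @ [b]) ! 1) ((ys @ [b]) ! 2)) (comult H a) = lift K R (\<lambda>ys. T (ys ! 0) (ys ! 1) b) (comult H a)"
      by (rule lift_tensor_cong[OF V R_module bil_mlin[OF F] _ comult_in[OF ab(1)], symmetric]) (auto simp: vectors_2)
    also have "\<dots> = (\<Sum>i<d. T (Dl i a) (e i) b)" by (rule lift_comult[OF F ab(1)])
    finally show "(\<Sum>i<d. T (Dl i (xs ! 0)) (e i) (xs ! 1)) =
       lift K R (\<lambda>ys. T ((ys @ [xs ! 1]) ! 0) ((ys @ [xs ! 1]) ! 1) ((ys @ [xs ! 1]) ! 2)) (comult H (xs ! 0))"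
      by (simp add: ab)
  qed
  also have "\<dots> = tsw (comp X) (\<lambda>a b. \<Sum>i<d. T (Dl i a) (e i) b)"
    by (rule lift_bil[OF bil_comult(1)[OF T] X])
  finally show ?thesis .
qed

lemma lift_right_comult:
  assumes T: "tri T" and X: "X \<in> carrier (tensor_space K 2 H)"
  shows "lift K R (\<lambda>xs. T (xs ! 0) (xs ! 1) (xs ! 2)) (tensor_right K H 2 (comult H) X) = tsw (comp X) (\<lambda>a b. \<Sum>i<d. T a (Dl i b) (e i))"
proof -
  note V = V.module_axioms
  have m: "mlin K (1 + 2) H R (\<lambda>xs. T (xs ! 0) (xs ! 1) (xs ! 2))"
    unfolding two_plus_one by (rule tri_mlin[OF T])
  have "lift K R (\<lambda>xs. T (xs ! 0) (xs ! 1) (xs ! 2)) (tensor_right K H 2 (comult H) X)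
    = lift K R (\<lambda>xs. lift K R (\<lambda>ys. T ((xs ! 0 # ys) ! 0) ((xs ! 0 # ys) ! 1) ((xs ! 0 # ys) ! 2)) (comult H (xs ! 1))) X"
    by (rule lift_tensor_right[OF V comult_linear X R_module m])
  also have "\<dots> = lift K R (\<lambda>xs. (\<lambda>a b. \<Sum>i<d. T a (Dl i b) (e i)) (xs ! 0) (xs ! 1)) X"
  proof (rule lift_tensor_cong[OF V R_module bil_mlin[OF bil_comult(2)[OF T]] _ X, symmetric])
    fix xs assume "xs \<in> vectors 2 H"
    then obtain a b where ab: "a \<in> carrier H" "b \<in> carrier H" "xs = [a, b]" by (auto simp: vectors_2)
    have F: "bil (\<lambda>p q. T a p q)" by (auto intro!: bilI triD[OF T] lop_id ab)
    have "lift K R (\<lambda>ys. T ((a # ys) ! 0) ((a # ys) ! 1) ((a # ys) ! 2)) (comult H b) = lift K R (\<lambda>ys. T a (ys ! 0) (ys ! 1)) (comult H b)"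
      by (rule lift_tensor_cong[OF V R_module bil_mlin[OF F] _ comult_in[OF ab(2)], symmetric]) (auto simp: vectors_2)
    also have "\<dots> = (\<Sum>i<d. T a (Dl i b) (e i))" by (rule lift_comult[OF F ab(2)])
    finally show "(\<Sum>i<d. T (xs ! 0) (Dl i (xs ! 1)) (e i)) =
       lift K R (\<lambda>ys. T ((xs ! 0 # ys) ! 0) ((xs ! 0 # ys) ! 1) ((xs ! 0 # ys) ! 2)) (comult H (xs ! 1))"
      by (simp add: ab)
  qed
  also have "\<dots> = tsw (comp X) (\<lambda>a b. \<Sum>i<d. T a (Dl i b) (e i))"
    by (rule lift_bil[OF bil_comult(2)[OF T] X])
  finally show ?thesis .
qed

lemma comp_mult:
  assumes F: "bil F" and X: "X \<in> carrier (tensor_space K 2 H)" and Y: "Y \<in> carrier (tensor_space K 2 H)"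
  shows "tsw (comp (X \<otimes>\<^bsub>tensor_power K 2 H\<^esub> Y)) F = tsw (comp X) (\<lambda>a b. tsw (comp Y) (\<lambda>p q. F (a \<otimes>\<^bsub>H\<^esub> p) (b \<otimes>\<^bsub>H\<^esub> q)))"
proof -
  note V = V.module_axioms
  note XY = tensor_power_mult_in[OF V mult_bi2 X Y]
  have F1: "bil (\<lambda>p q. F (a \<otimes>\<^bsub>H\<^esub> p) (b \<otimes>\<^bsub>H\<^esub> q))" if "a \<in> carrier H" "b \<in> carrier H" for a b
    by (auto intro!: bilI bilD[OF F] lopI mult_hom that)
  have Y': "\<forall>i<d. comp Y i \<in> carrier H" using comp_in[OF _ Y] by auto
  have F2: "bil (\<lambda>a b. tsw (comp Y) (\<lambda>p q. F (a \<otimes>\<^bsub>H\<^esub> p) (b \<otimes>\<^bsub>H\<^esub> q)))"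
    by (auto intro!: bilI lin_tsw[OF Y'] bilD[OF F] lopI mult_hom)
  have "tsw (comp (X \<otimes>\<^bsub>tensor_power K 2 H\<^esub> Y)) F = lift K R (\<lambda>xs. F (xs ! 0) (xs ! 1)) (X \<otimes>\<^bsub>tensor_power K 2 H\<^esub> Y)"
    by (rule lift_bil[OF F XY, symmetric])
  also have "\<dots> = lift K R (\<lambda>xs. lift K R (\<lambda>ys. F (map2 (\<otimes>\<^bsub>H\<^esub>) xs ys ! 0) (map2 (\<otimes>\<^bsub>H\<^esub>) xs ys ! 1)) Y) X"
    by (rule lift_tensor_mult[OF V mult_bi2 X Y R_module bil_mlin[OF F]])
  also have "\<dots> = lift K R (\<lambda>xs. (\<lambda>a b. tsw (comp Y) (\<lambda>p q. F (a \<otimes>\<^bsub>H\<^esub> p) (b \<otimes>\<^bsub>H\<^esub> q))) (xs ! 0) (xs ! 1)) X"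
  proof (rule lift_tensor_cong[OF V R_module bil_mlin[OF F2] _ X, symmetric])
    fix xs assume "xs \<in> vectors 2 H"
    then obtain a b where ab: "a \<in> carrier H" "b \<in> carrier H" "xs = [a, b]" by (auto simp: vectors_2)
    have "tsw (comp Y) (\<lambda>p q. F (a \<otimes>\<^bsub>H\<^esub> p) (b \<otimes>\<^bsub>H\<^esub> q)) = lift K R (\<lambda>ys. F (a \<otimes>\<^bsub>H\<^esub> ys ! 0) (b \<otimes>\<^bsub>H\<^esub> ys ! 1)) Y"
      by (rule lift_bil[OF F1[OF ab(1,2)] Y, symmetric])
    also have "\<dots> = lift K R (\<lambda>ys. F (map2 (\<otimes>\<^bsub>H\<^esub>) xs ys ! 0) (map2 (\<otimes>\<^bsub>H\<^esub>) xs ys ! 1)) Y"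
      by (rule lift_tensor_cong[OF V R_module bil_mlin[OF F1[OF ab(1,2)]] _ Y]) (auto simp: vectors_2 ab)
    finally show "tsw (comp Y) (\<lambda>p q. F (xs ! 0 \<otimes>\<^bsub>H\<^esub> p) (xs ! 1 \<otimes>\<^bsub>H\<^esub> q)) = lift K R (\<lambda>ys. F (map2 (\<otimes>\<^bsub>H\<^esub>) xs ys ! 0) (map2 (\<otimes>\<^bsub>H\<^esub>) xs ys ! 1)) Y"
      by (simp add: ab)
  qed
  also have "\<dots> = tsw (comp X) (\<lambda>a b. tsw (comp Y) (\<lambda>p q. F (a \<otimes>\<^bsub>H\<^esub> p) (b \<otimes>\<^bsub>H\<^esub> q)))"
    by (rule lift_bil[OF F2 X])
  finally show ?thesis .
qed

lemma comp_pure: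
  assumes F: "bil F" and ab: "a \<in> carrier H" "b \<in> carrier H"
  shows "tsw (comp (tensor K H [a, b])) F = F a b"
proof -
  have v: "[a, b] \<in> vectors 2 H" using ab by (auto simp: vectors_2)
  show ?thesis
    using lift_bil[OF F tensor_in[OF V.module_axioms v]] lift_tensor[OF V.module_axioms R_module bil_mlin[OF F] v] by simp
qed

lemma tensor_power_one: "\<one>\<^bsub>tensor_power K 2 H\<^esub> = tensor K H [\<one>\<^bsub>H\<^esub>, \<one>\<^bsub>H\<^esub>]"
  by (simp add: tensor_power_def numeral_2_eq_2)

abbreviation "ep \<equiv> \<lambda>x. emb K (counit H x)"

lemma ep_hom: "ep \<in> module_hom K H R"
  by (rule module_hom_comp[OF counit_linear emb_hom[OF V.R.is_cring]])

lemma counit_in: "x \<in> carrier H \<Longrightarrow> counit H x \<in> carrier K"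
  using module_hom_in[OF counit_linear] by auto

lemma S_hom: "S \<in> module_hom K H H"
  using S by (simp add: is_antipode_def)

lemma lin_smult: "\<lbrakk>lin f; a \<in> carrier K; x \<in> carrier H\<rbrakk> \<Longrightarrow> f (a \<odot>\<^bsub>H\<^esub> x) = emb K a * f x"
  using module_hom_smult[OF lin_hom] by simp

lemma lin_lift_bi2:
  assumes f: "lin f" and \<phi>: "bi2 K H H \<phi>" and X: "X \<in> carrier (tensor_space K 2 H)"
  shows "f (lift K H (\<lambda>xs. \<phi> (xs ! 0) (xs ! 1)) X) = tsw (comp X) (\<lambda>a b. f (\<phi> a b))"
proof -
  have "bil (\<lambda>a b. f (\<phi> a b))"
    unfolding bil_bi2 bi2_def using \<phi> module_hom_comp[OF _ lin_hom[OF f]] by (auto simp: bi2_def)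
  then show ?thesis using lin_lift[OF f bi2_mlin[OF \<phi>] X] lift_bil[OF _ X] by simp
qed

lemma bi2_counit: "bi2 K H H (\<lambda>a b. counit H a \<odot>\<^bsub>H\<^esub> b)" "bi2 K H H (\<lambda>a b. counit H b \<odot>\<^bsub>H\<^esub> a)"
  unfolding bi2_def
  by (auto intro!: module_homI module_hom_scale[OF V.module_axioms module_hom_ident] counit_in
      simp: module_hom_add[OF counit_linear] module_hom_smult[OF counit_linear] V.smult_l_distr V.smult_assoc1 counit_in)

lemma bi2_antipode: "bi2 K H H (\<lambda>a b. S a \<otimes>\<^bsub>H\<^esub> b)" "bi2 K H H (\<lambda>a b. a \<otimes>\<^bsub>H\<^esub> S b)"
  unfolding bi2_def
  by (auto intro: module_hom_comp[OF S_hom mult_hom(1)] module_hom_comp[OF S_hom mult_hom(2)] mult_hom module_hom_in[OF S_hom])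

sublocale hopf_calc "carrier H" d e co "(\<otimes>\<^bsub>H\<^esub>)" "\<one>\<^bsub>H\<^esub>" S ep Dl
proof
  fix F :: "'h \<Rightarrow> 'h \<Rightarrow> ('a, 'k) uring" and T :: "'h \<Rightarrow> 'h \<Rightarrow> 'h \<Rightarrow> ('a, 'k) uring" and f :: "'h \<Rightarrow> ('a, 'k) uring" and x y
  assume F: "bil F" and x: "x \<in> carrier H" and y: "y \<in> carrier H"
  have "(\<Sum>i<d. F (Dl i (x \<otimes>\<^bsub>H\<^esub> y)) (e i)) = tsw (comp (comult H (x \<otimes>\<^bsub>H\<^esub> y))) F"
    by (simp add: tsw_def Dl_def)
  also have "comult H (x \<otimes>\<^bsub>H\<^esub> y) = comult H x \<otimes>\<^bsub>tensor_power K 2 H\<^esub> comult H y"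
    using comult_ring_hom x y by (simp add: ring_hom_def)
  also have "tsw (comp \<dots>) F = (\<Sum>i<d. \<Sum>j<d. F (Dl i x \<otimes>\<^bsub>H\<^esub> Dl j y) (e i \<otimes>\<^bsub>H\<^esub> e j))"
    by (subst comp_mult[OF F comult_in[OF x] comult_in[OF y]]) (simp add: tsw_def Dl_def)
  finally show "(\<Sum>i<d. F (Dl i (x \<otimes>\<^bsub>H\<^esub> y)) (e i)) = (\<Sum>i<d. \<Sum>j<d. F (Dl i x \<otimes>\<^bsub>H\<^esub> Dl j y) (e i \<otimes>\<^bsub>H\<^esub> e j))" .
next
  fix F :: "'h \<Rightarrow> 'h \<Rightarrow> ('a, 'k) uring"
  assume F: "bil F"
  have "comult H \<one>\<^bsub>H\<^esub> = tensor K H [\<one>\<^bsub>H\<^esub>, \<one>\<^bsub>H\<^esub>]"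
    using comult_ring_hom by (simp add: ring_hom_def tensor_power_one)
  then show "(\<Sum>i<d. F (Dl i \<one>\<^bsub>H\<^esub>) (e i)) = F \<one>\<^bsub>H\<^esub> \<one>\<^bsub>H\<^esub>"
    using comp_pure[OF F Hr.one_closed Hr.one_closed] by (simp add: tsw_def Dl_def)
next
  fix T :: "'h \<Rightarrow> 'h \<Rightarrow> 'h \<Rightarrow> ('a, 'k) uring" and x assume T: "tri T" and x: "x \<in> carrier H"
  show "(\<Sum>j<d. \<Sum>i<d. T (Dl i (Dl j x)) (e i) (e j)) = (\<Sum>j<d. \<Sum>i<d. T (Dl j x) (Dl i (e j)) (e i))"
    using lift_left_comult[OF T comult_in[OF x]] lift_right_comult[OF T comult_in[OF x]] coassoc[OF x]
    by (simp add: tsw_def Dl_def)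
next
  fix f :: "'h \<Rightarrow> ('a, 'k) uring" and x assume f: "lin f" and x: "x \<in> carrier H"
  note D = comp_in[OF _ comult_in[OF x]]
  show "(\<Sum>i<d. ep (Dl i x) * f (e i)) = f x"
    using lin_lift_bi2[OF f bi2_counit(1) comult_in[OF x]] counit_left[OF x]
    by (simp add: tsw_def Dl_def lin_smult[OF f] counit_in D)
  show "(\<Sum>i<d. f (Dl i x) * ep (e i)) = f x"
    using lin_lift_bi2[OF f bi2_counit(2) comult_in[OF x]] counit_right[OF x]
    by (simp add: tsw_def Dl_def lin_smult[OF f] counit_in D mult.commute)
  have Sx: "lift K H (\<lambda>xs. S (xs ! 0) \<otimes>\<^bsub>H\<^esub> xs ! 1) (comult H x) = counit H x \<odot>\<^bsub>H\<^esub> \<one>\<^bsub>H\<^esub>"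
      "lift K H (\<lambda>xs. xs ! 0 \<otimes>\<^bsub>H\<^esub> S (xs ! 1)) (comult H x) = counit H x \<odot>\<^bsub>H\<^esub> \<one>\<^bsub>H\<^esub>"
    using S x by (auto simp: is_antipode_def)
  show "(\<Sum>i<d. f (S (Dl i x) \<otimes>\<^bsub>H\<^esub> e i)) = ep x * f \<one>\<^bsub>H\<^esub>"
    using lin_lift_bi2[OF f bi2_antipode(1) comult_in[OF x]] Sx(1)
    by (simp add: tsw_def Dl_def lin_smult[OF f] counit_in x)
  show "(\<Sum>i<d. f (Dl i x \<otimes>\<^bsub>H\<^esub> S (e i))) = ep x * f \<one>\<^bsub>H\<^esub>"
    using lin_lift_bi2[OF f bi2_antipode(2) comult_in[OF x]] Sx(2)
    by (simp add: tsw_def Dl_def lin_smult[OF f] counit_in x)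
  have "ep \<one>\<^bsub>H\<^esub> = emb K \<one>\<^bsub>K\<^esub>" using counit_ring_hom by (simp add: ring_hom_def)
  then show "ep \<one>\<^bsub>H\<^esub> * f x = f x" using lin_smult[OF f _ x, of "\<one>\<^bsub>K\<^esub>"] x by simp
next
  fix x y assume "x \<in> carrier H" "y \<in> carrier H"
  then show "ep (x \<otimes>\<^bsub>H\<^esub> y) = ep x * ep y"
    using counit_ring_hom by (simp add: ring_hom_def emb_ops V.R.is_cring counit_in)
qed (auto simp: Hr.m_assoc lop_Dl intro!: lopI mult_hom S_hom hom_lin ep_hom)

end

subsection \<open>The exponents of a Hopf algebra and of its twists\<close>

context fd_hopf
begin

text \<open>The calculus has no subtraction on H, so its statement about the kernel of S is applied
  to the difference of two elements with the same image.\<close>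

lemma antipode_inj: "inj_on S (carrier H)"
proof (rule inj_onI)
  fix x y assume xy: "x \<in> carrier H" "y \<in> carrier H" and eq: "S x = S y"
  have d: "x \<ominus>\<^bsub>H\<^esub> y \<in> carrier H" using xy by simp
  have sub: "f (x \<ominus>\<^bsub>H\<^esub> y) = f x - f y" if f: "lin f" for f
  proof -
    have "f ((x \<ominus>\<^bsub>H\<^esub> y) \<oplus>\<^bsub>H\<^esub> y) = f (x \<ominus>\<^bsub>H\<^esub> y) + f y"
      using module_hom_add[OF lin_hom[OF f] d xy(2)] by simp
    moreover have "(x \<ominus>\<^bsub>H\<^esub> y) \<oplus>\<^bsub>H\<^esub> y = x"
      using xy by (simp add: a_minus_def V.M.a_assoc V.M.l_neg)
    ultimately show ?thesis by simp
  qed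
  have "g (x \<ominus>\<^bsub>H\<^esub> y) = 0" if g: "lin g" for g
  proof (rule antipode_injective[OF d _ g])
    fix g assume g: "lin g"
    have "lin (\<lambda>t. g (S t))" by (rule lin_app[OF g lop_antipode])
    from sub[OF this] show "g (S (x \<ominus>\<^bsub>H\<^esub> y)) = 0" by (simp add: eq)
  qed
  then have "f x - f y = 0" if "lin f" for f using sub[OF that] that by metis
  then have "f x = f y" if "lin f" for f using that by (simp only: right_minus_eq)
  then show "x = y" by (rule lin_separates[OF xy])
qed

lemma antipode_surj: "S ` carrier H = carrier H"
  by (rule injective_endomorphism_surj[OF vectorspace fin S_hom antipode_inj])

abbreviation "Si \<equiv> inv_into (carrier H) S"

lemma Si_antipode: "x \<in> carrier H \<Longrightarrow> Si (S x) = x"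
  by (rule inv_into_f_f[OF antipode_inj])

lemma antipode_Si: "x \<in> carrier H \<Longrightarrow> S (Si x) = x"
  by (rule f_inv_into_f) (simp add: antipode_surj)

lemma Si_in_carrier: "x \<in> carrier H \<Longrightarrow> Si x \<in> carrier H"
  by (rule inv_into_into) (simp add: antipode_surj)

lemma Si_hom: "Si \<in> module_hom K H H"
  by (rule module_homI; (rule inv_into_f_eq[OF antipode_inj])?)
    (simp_all add: Si_in_carrier antipode_Si module_hom_add[OF S_hom] module_hom_smult[OF S_hom])

sublocale hopf_calc_bij "carrier H" d e co "(\<otimes>\<^bsub>H\<^esub>)" "\<one>\<^bsub>H\<^esub>" S ep Dl Si
  by unfold_locales (rule lopI[OF Si_hom] Si_antipode antipode_Si; assumption?)+

text \<open>Uniqueness of convolution inverses: S' = S * id * S' = S. The locale is interpreted a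
  second time, with S', to have the axioms for both maps.\<close>

lemma antipode_unique:
  assumes "is_antipode K H S'" and [simp]: "x \<in> carrier H"
  shows "S' x = S x"
proof -
  interpret T: fd_hopf K H d e k S'
    by (intro fd_hopf.intro hopf_algebra_axioms framed_axioms fd_hopf_axioms.intro fin assms(1))
  show ?thesis
  proof (rule lin_separates)
    fix f assume f: "lin f"
    note L = lin_intros lin_app[OF f] T.lop_S
    have "f (S' x) = f (\<one>\<^bsub>H\<^esub> \<otimes>\<^bsub>H\<^esub> S' x)" by simp
    also have "\<dots> = sw x (\<lambda>a r. sw r (\<lambda>b t. f (S a \<otimes>\<^bsub>H\<^esub> b \<otimes>\<^bsub>H\<^esub> S' t)))"
      by (rule antipode_left_head[symmetric]) (auto intro!: L)
    also have "\<dots> = sw x (\<lambda>a r. sw r (\<lambda>b t. f (S a \<otimes>\<^bsub>H\<^esub> (b \<otimes>\<^bsub>H\<^esub> S' t))))"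
      by (intro sw_cong') (auto simp: mult_assoc)
    also have "\<dots> = f (S x \<otimes>\<^bsub>H\<^esub> \<one>\<^bsub>H\<^esub>)"
      by (rule T.antipode_right_tail) (auto intro!: L)
    finally show "f (S' x) = f (S x)" by simp
  qed auto
qed

text \<open>The definition singles out the extensional antipode, and that is any antipode cut down
  to the carrier.\<close>

lemma antipode_restrict: "antipode K H = restrict S (carrier H)"
  unfolding antipode_def
proof (rule the_equality)
  have "is_antipode K H (restrict S (carrier H))"
    unfolding is_antipode_def
  proof (intro conjI ballI)
    show "restrict S (carrier H) \<in> module_hom K H H"
      by (rule iffD2[OF module_hom_cong[OF _ V.module_axioms] S_hom]) simp
    fix h assume h: "h \<in> carrier H"
    have "lift K H (\<lambda>xs. S (xs ! 0) \<otimes>\<^bsub>H\<^esub> xs ! 1) (comult H h) = lift K H (\<lambda>xs. restrict S (carrier H) (xs ! 0) \<otimes>\<^bsub>H\<^esub> xs ! 1) (comult H h)"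
      by (rule lift_tensor_cong[OF V.module_axioms V.module_axioms bi2_mlin[OF bi2_antipode(1)] _ comult_in[OF h]]) (auto simp: vectors_2)
    then show "lift K H (\<lambda>xs. restrict S (carrier H) (xs ! 0) \<otimes>\<^bsub>H\<^esub> xs ! 1) (comult H h) = counit H h \<odot>\<^bsub>H\<^esub> \<one>\<^bsub>H\<^esub>"
      using S h by (simp add: is_antipode_def)
    have "lift K H (\<lambda>xs. xs ! 0 \<otimes>\<^bsub>H\<^esub> S (xs ! 1)) (comult H h) = lift K H (\<lambda>xs. xs ! 0 \<otimes>\<^bsub>H\<^esub> restrict S (carrier H) (xs ! 1)) (comult H h)"
      by (rule lift_tensor_cong[OF V.module_axioms V.module_axioms bi2_mlin[OF bi2_antipode(2)] _ comult_in[OF h]]) (auto simp: vectors_2)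
    then show "lift K H (\<lambda>xs. xs ! 0 \<otimes>\<^bsub>H\<^esub> restrict S (carrier H) (xs ! 1)) (comult H h) = counit H h \<odot>\<^bsub>H\<^esub> \<one>\<^bsub>H\<^esub>"
      using S h by (simp add: is_antipode_def)
  qed
  then show "is_antipode K H (restrict S (carrier H)) \<and> restrict S (carrier H) \<in> extensional (carrier H)" by simp
  fix S' assume "is_antipode K H S' \<and> S' \<in> extensional (carrier H)"
  then show "S' = restrict S (carrier H)"
    using antipode_unique by (intro extensionalityI[of _ "carrier H"]) auto
qed

lemma inv_antipode: "inv_into (carrier H) (antipode K H) = Si"
  by (rule ext) (simp add: antipode_restrict inv_into_def cong: conj_cong)

sublocale sweedler_struct K H
  by unfold_locales (auto intro: mult_bi2 comult_linear)

text \<open>The comparison begins at n = 1 although \<open>spow\<close> starts from the counit at 0,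
  so the base case is the counit law.\<close>

lemma lin_act_pow:
  assumes f: "lin f" and "x \<in> carrier H" "y \<in> carrier H"
  shows "f (act_pow (Suc n) x y) = spow (Suc n) (\<lambda>t. f (t \<otimes>\<^bsub>H\<^esub> y)) x"
  using assms(2,3)
proof (induction n arbitrary: x y)
  case 0
  note [simp] = 0
  have "spow (Suc 0) (\<lambda>t. f (t \<otimes>\<^bsub>H\<^esub> y)) x = sw x (\<lambda>a b. ep a * f (b \<otimes>\<^bsub>H\<^esub> y))"
    unfolding spow.simps by (intro sw_cong') auto
  also have "\<dots> = f (x \<otimes>\<^bsub>H\<^esub> y)" by (rule counit_left) (auto intro!: lin_app[OF f] lin_intros)
  finally show ?case by (simp add: act_pow_1)
next
  case (Suc n)
  have "f (act_pow (Suc (Suc n)) x y) = tsw (comp (comult H x)) (\<lambda>a b. f (act_pow (Suc n) a (b \<otimes>\<^bsub>H\<^esub> y)))"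
    unfolding act_pow_Suc[OF Suc.prems] by (rule lin_lift_bi2[OF f act_pow_bi2[OF Suc.prems(2)] comult_in[OF Suc.prems(1)]])
  also have "\<dots> = sw x (\<lambda>a b. f (act_pow (Suc n) a (b \<otimes>\<^bsub>H\<^esub> y)))"
    by (simp add: sw_def Dl_def tsw_def)
  also have "\<dots> = sw x (\<lambda>a b. spow (Suc n) (\<lambda>t. f (t \<otimes>\<^bsub>H\<^esub> (b \<otimes>\<^bsub>H\<^esub> y))) a)"
    by (intro sw_cong' Suc.IH) (auto simp: Suc.prems)
  also have "\<dots> = sw x (\<lambda>a b. spow (Suc n) (\<lambda>t. f (t \<otimes>\<^bsub>H\<^esub> b \<otimes>\<^bsub>H\<^esub> y)) a)"
    by (intro sw_cong' spow_cong) (auto simp: Suc.prems mult_assoc)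
  finally show ?case by simp
qed

lemma lin_counit_one: "\<lbrakk>lin f; x \<in> carrier H\<rbrakk> \<Longrightarrow> f (counit H x \<odot>\<^bsub>H\<^esub> \<one>\<^bsub>H\<^esub>) = ep x * f \<one>\<^bsub>H\<^esub>"
  by (simp add: lin_smult counit_in)

lemma exponent_iff:
  assumes "n \<ge> 1"
  shows "(\<forall>h\<in>carrier H. sweedler_power K H n h = counit H h \<odot>\<^bsub>H\<^esub> \<one>\<^bsub>H\<^esub>) \<longleftrightarrow> exponent n"
proof -
  obtain m where m: "n = Suc m" using assms by (cases n) auto
  have p: "f (sweedler_power K H n x) = spow n f x" if f: "lin f" and x: "x \<in> carrier H" for f x
  proof -
    have "f (sweedler_power K H n x) = spow n (\<lambda>t. f (t \<otimes>\<^bsub>H\<^esub> \<one>\<^bsub>H\<^esub>)) x"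
      unfolding m sweedler_power_act by (rule lin_act_pow[OF f x one_in])
    also have "\<dots> = spow n f x" by (intro spow_cong) (auto simp: x)
    finally show ?thesis .
  qed
  have i: "sweedler_power K H n x \<in> carrier H" "counit H x \<odot>\<^bsub>H\<^esub> \<one>\<^bsub>H\<^esub> \<in> carrier H" if x: "x \<in> carrier H" for x
    using module_hom_in[OF sweedler_power_hom[OF one_in assms] x] counit_in[OF x] by auto
  show ?thesis
  proof
    assume "\<forall>h\<in>carrier H. sweedler_power K H n h = counit H h \<odot>\<^bsub>H\<^esub> \<one>\<^bsub>H\<^esub>"
    then show "exponent n" unfolding exponent_def using p lin_counit_one by metis
  next
    assume "exponent n"
    then show "\<forall>h\<in>carrier H. sweedler_power K H n h = counit H h \<odot>\<^bsub>H\<^esub> \<one>\<^bsub>H\<^esub>"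
      using i p lin_counit_one by (auto intro!: lin_separates simp: exponent_def)
  qed
qed

end

text \<open>Tensor spaces, \<open>lift\<close> and homomorphisms read only these fields. Records
  that agree on them have literally equal tensor constructions, so nothing has to be
  transported.\<close>

definition same_space :: "('a, 'v, 'm) module_scheme \<Rightarrow> ('a, 'v, 'n) module_scheme \<Rightarrow> bool" where
  "same_space V V' \<longleftrightarrow> carrier V' = carrier V \<and> \<zero>\<^bsub>V'\<^esub> = \<zero>\<^bsub>V\<^esub> \<and> add V' = add V \<and> smult V' = smult V"

lemma same_space_module:
  assumes s: "same_space V V'" and V: "module K V" shows "module K V'"
proof -
  interpret V: module K V by fact
  have "abelian_group V'"
    by (rule abelian_groupI) (use s V.M.l_neg in \<open>auto simp: same_space_def V.M.a_ac intro!: bexI[of _ "\<ominus>\<^bsub>V\<^esub> _"]\<close>)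
  then show ?thesis
    using s by (intro moduleI) (auto simp: same_space_def V.R.is_cring V.smult_l_distr V.smult_r_distr V.smult_assoc1)
qed

lemma same_space_lift: "same_space V V' \<Longrightarrow> lift K V' = lift K V"
  by (intro ext) (simp add: same_space_def lift_def finsum_def finprod_def)

lemma same_space_tensor_space: "same_space V V' \<Longrightarrow> tensor_space K n V' = tensor_space K n V"
  by (simp add: same_space_def tensor_space_def multilinear_submodule_def multilinear_relations_def vectors_def)

lemma same_space_hom: "same_space V V' \<Longrightarrow> module_hom K V' = module_hom K V" "same_space W W' \<Longrightarrow> module_hom K V W' = module_hom K V W"
  by (simp_all add: same_space_def module_hom_def fun_eq_iff)

context fd_hopf
begin

text \<open>The forms \<open>co i b * f a\<close> read off the value of \<open>f\<close> at each
  component, and functionals separate points.\<close>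

lemma tensor2_separates:
  assumes X: "X \<in> carrier (tensor_space K 2 H)" and Y: "Y \<in> carrier (tensor_space K 2 H)"
    and eq: "\<And>F. bil F \<Longrightarrow> tsw (comp X) F = tsw (comp Y) F"
  shows "X = Y"
proof -
  note V = V.module_axioms
  have c: "comp X i = comp Y i" if i: "i < d" for i
  proof (rule lin_separates[OF comp_in[OF i X] comp_in[OF i Y]])
    fix f assume f: "lin f"
    have "bil (\<lambda>a b. co i b * f a)"
      using i by (auto intro!: bilI lin_cmult lin_multc f lin_c)
    from eq[OF this] have "tsw (comp X) (\<lambda>a b. f (k i b \<odot>\<^bsub>H\<^esub> a)) = tsw (comp Y) (\<lambda>a b. f (k i b \<odot>\<^bsub>H\<^esub> a))"
      using i comp_in X Y by (simp add: tsw_def lin_smult[OF f] k_in e_carrier)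
    then show "f (comp X i) = f (comp Y i)"
      using lin_lift_bi2[OF f bi2_comp[OF i] X] lin_lift_bi2[OF f bi2_comp[OF i] Y]
      by (simp only: comp_def[symmetric])
  qed
  show "X = Y" by (rule comp_eqI[OF X Y c])
qed

text \<open>Gives \<open>Units\<close> and \<open>inv\<close> in the definition of a twist their
  usual meaning. The laws are checked after pairing with bilinear forms.\<close>

lemma monoid_tensor_power: "monoid (tensor_power K 2 H)"
proof -
  note i = tensor_power_mult_in[OF V.module_axioms mult_bi2]
  have one: "tensor K H [\<one>\<^bsub>H\<^esub>, \<one>\<^bsub>H\<^esub>] \<in> carrier (tensor_space K 2 H)"
    by (intro tensor_in V.module_axioms) (auto simp: vectors_2)
  have C: "\<forall>i<d. comp X i \<in> carrier H" if "X \<in> carrier (tensor_space K 2 H)" for X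
    using that comp_in by auto
  have b: "bil (\<lambda>a b. tsw (comp Z) (\<lambda>p q. F (a \<otimes>\<^bsub>H\<^esub> p) (b \<otimes>\<^bsub>H\<^esub> q)))"
    if F: "bil F" and Z: "Z \<in> carrier (tensor_space K 2 H)" for F Z
    by (auto intro!: lin_intros lin_tsw[OF C[OF Z]] bilD[OF F])
  have b': "bil (\<lambda>p q. F (a \<otimes>\<^bsub>H\<^esub> p) (b \<otimes>\<^bsub>H\<^esub> q))" if F: "bil F" and "a \<in> carrier H" "b \<in> carrier H" for F a b
    using that by (auto intro!: lin_intros bilD[OF F])
  show ?thesis
  proof (rule monoidI)
    fix X Y Z assume X: "X \<in> carrier (tensor_power K 2 H)" and Y: "Y \<in> carrier (tensor_power K 2 H)" and Z: "Z \<in> carrier (tensor_power K 2 H)"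
    note X = X[unfolded tensor_power_carrier] and Y = Y[unfolded tensor_power_carrier] and Z = Z[unfolded tensor_power_carrier]
    show "X \<otimes>\<^bsub>tensor_power K 2 H\<^esub> Y \<otimes>\<^bsub>tensor_power K 2 H\<^esub> Z = X \<otimes>\<^bsub>tensor_power K 2 H\<^esub> (Y \<otimes>\<^bsub>tensor_power K 2 H\<^esub> Z)"
    proof (rule tensor2_separates[OF i[OF i[OF X Y] Z] i[OF X i[OF Y Z]]])
      fix F assume F: "bil F"
      have "tsw (comp (X \<otimes>\<^bsub>tensor_power K 2 H\<^esub> Y \<otimes>\<^bsub>tensor_power K 2 H\<^esub> Z)) F = tsw (comp X) (\<lambda>a b. tsw (comp Y) (\<lambda>p q. tsw (comp Z) (\<lambda>r s. F (a \<otimes>\<^bsub>H\<^esub> p \<otimes>\<^bsub>H\<^esub> r) (b \<otimes>\<^bsub>H\<^esub> q \<otimes>\<^bsub>H\<^esub> s))))"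
        by (simp only: comp_mult[OF F i[OF X Y] Z] comp_mult[OF b[OF F Z] X Y])
      also have "\<dots> = tsw (comp X) (\<lambda>a b. tsw (comp Y) (\<lambda>p q. tsw (comp Z) (\<lambda>r s. F (a \<otimes>\<^bsub>H\<^esub> (p \<otimes>\<^bsub>H\<^esub> r)) (b \<otimes>\<^bsub>H\<^esub> (q \<otimes>\<^bsub>H\<^esub> s)))))"
        by (intro tsw_cong C X Y Z) (auto simp: mult_assoc)
      also have "\<dots> = tsw (comp X) (\<lambda>a b. tsw (comp (Y \<otimes>\<^bsub>tensor_power K 2 H\<^esub> Z)) (\<lambda>p q. F (a \<otimes>\<^bsub>H\<^esub> p) (b \<otimes>\<^bsub>H\<^esub> q)))"
        by (intro tsw_cong C X comp_mult[symmetric] b'[OF F] Y Z)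
      also have "\<dots> = tsw (comp (X \<otimes>\<^bsub>tensor_power K 2 H\<^esub> (Y \<otimes>\<^bsub>tensor_power K 2 H\<^esub> Z))) F"
        by (rule comp_mult[OF F X i[OF Y Z], symmetric])
      finally show "tsw (comp (X \<otimes>\<^bsub>tensor_power K 2 H\<^esub> Y \<otimes>\<^bsub>tensor_power K 2 H\<^esub> Z)) F = tsw (comp (X \<otimes>\<^bsub>tensor_power K 2 H\<^esub> (Y \<otimes>\<^bsub>tensor_power K 2 H\<^esub> Z))) F" .
    qed
  next
    fix X assume "X \<in> carrier (tensor_power K 2 H)"
    then have X: "X \<in> carrier (tensor_space K 2 H)" by simp
    show "\<one>\<^bsub>tensor_power K 2 H\<^esub> \<otimes>\<^bsub>tensor_power K 2 H\<^esub> X = X"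
      unfolding tensor_power_one
    proof (rule tensor2_separates[OF i[OF one X] X])
      fix F assume F: "bil F"
      show "tsw (comp (tensor K H [\<one>\<^bsub>H\<^esub>, \<one>\<^bsub>H\<^esub>] \<otimes>\<^bsub>tensor_power K 2 H\<^esub> X)) F = tsw (comp X) F"
        unfolding comp_mult[OF F one X] comp_pure[OF b[OF F X] one_in one_in] by (intro tsw_cong C X) auto
    qed
    show "X \<otimes>\<^bsub>tensor_power K 2 H\<^esub> \<one>\<^bsub>tensor_power K 2 H\<^esub> = X"
      unfolding tensor_power_one
    proof (rule tensor2_separates[OF i[OF X one] X])
      fix F assume F: "bil F"
      have "tsw (comp X) (\<lambda>a b. tsw (comp (tensor K H [\<one>\<^bsub>H\<^esub>, \<one>\<^bsub>H\<^esub>])) (\<lambda>p q. F (a \<otimes>\<^bsub>H\<^esub> p) (b \<otimes>\<^bsub>H\<^esub> q)))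
        = tsw (comp X) (\<lambda>a b. F (a \<otimes>\<^bsub>H\<^esub> \<one>\<^bsub>H\<^esub>) (b \<otimes>\<^bsub>H\<^esub> \<one>\<^bsub>H\<^esub>))"
        by (intro tsw_cong C X comp_pure b'[OF F]) auto
      also have "\<dots> = tsw (comp X) F" by (intro tsw_cong C X) auto
      finally show "tsw (comp (X \<otimes>\<^bsub>tensor_power K 2 H\<^esub> tensor K H [\<one>\<^bsub>H\<^esub>, \<one>\<^bsub>H\<^esub>])) F = tsw (comp X) F"
        unfolding comp_mult[OF F X one] .
    qed
  qed (auto simp: i tensor_power_one one)
qed

lemma lift3_mult:
  assumes T: "tri T" and X: "X \<in> carrier (tensor_space K 3 H)" and Y: "Y \<in> carrier (tensor_space K 3 H)"
  shows "lift K R (\<lambda>xs. T (xs ! 0) (xs ! 1) (xs ! 2)) (X \<otimes>\<^bsub>tensor_power K 3 H\<^esub> Y)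
    = lift K R (\<lambda>xs. lift K R (\<lambda>ys. T (xs ! 0 \<otimes>\<^bsub>H\<^esub> ys ! 0) (xs ! 1 \<otimes>\<^bsub>H\<^esub> ys ! 1) (xs ! 2 \<otimes>\<^bsub>H\<^esub> ys ! 2)) Y) X"
proof -
  note V = V.module_axioms
  have "lift K R (\<lambda>xs. T (xs ! 0) (xs ! 1) (xs ! 2)) (X \<otimes>\<^bsub>tensor_power K 3 H\<^esub> Y)
    = lift K R (\<lambda>xs. lift K R (\<lambda>ys. T (map2 (\<otimes>\<^bsub>H\<^esub>) xs ys ! 0) (map2 (\<otimes>\<^bsub>H\<^esub>) xs ys ! 1) (map2 (\<otimes>\<^bsub>H\<^esub>) xs ys ! 2)) Y) X"
    by (rule lift_tensor_mult[OF V mult_bi2 X Y R_module tri_mlin[OF T]])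
  also have "\<dots> = lift K R (\<lambda>xs. lift K R (\<lambda>ys. T (xs ! 0 \<otimes>\<^bsub>H\<^esub> ys ! 0) (xs ! 1 \<otimes>\<^bsub>H\<^esub> ys ! 1) (xs ! 2 \<otimes>\<^bsub>H\<^esub> ys ! 2)) Y) X"
  proof (rule lift_tensor_cong[OF V R_module mlin_mult[OF V mult_bi2 X Y R_module tri_mlin[OF T]] _ X])
    fix xs assume "xs \<in> vectors 3 H"
    then obtain a b c where ab: "a \<in> carrier H" "b \<in> carrier H" "c \<in> carrier H" "xs = [a, b, c]" by (auto simp: vectors_3)
    have T': "tri (\<lambda>u v w. T (a \<otimes>\<^bsub>H\<^esub> u) (b \<otimes>\<^bsub>H\<^esub> v) (c \<otimes>\<^bsub>H\<^esub> w))"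
      using ab by (auto intro!: lin_intros triD[OF T])
    have "lift K R (\<lambda>ys. T (map2 (\<otimes>\<^bsub>H\<^esub>) xs ys ! 0) (map2 (\<otimes>\<^bsub>H\<^esub>) xs ys ! 1) (map2 (\<otimes>\<^bsub>H\<^esub>) xs ys ! 2)) Y
      = lift K R (\<lambda>ys. T (a \<otimes>\<^bsub>H\<^esub> ys ! 0) (b \<otimes>\<^bsub>H\<^esub> ys ! 1) (c \<otimes>\<^bsub>H\<^esub> ys ! 2)) Y"
      by (rule lift_tensor_cong[OF V R_module tri_mlin[OF T'] _ Y, symmetric]) (auto simp: vectors_3 ab)
    then show "lift K R (\<lambda>ys. T (map2 (\<otimes>\<^bsub>H\<^esub>) xs ys ! 0) (map2 (\<otimes>\<^bsub>H\<^esub>) xs ys ! 1) (map2 (\<otimes>\<^bsub>H\<^esub>) xs ys ! 2)) Y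
      = lift K R (\<lambda>ys. T (xs ! 0 \<otimes>\<^bsub>H\<^esub> ys ! 0) (xs ! 1 \<otimes>\<^bsub>H\<^esub> ys ! 1) (xs ! 2 \<otimes>\<^bsub>H\<^esub> ys ! 2)) Y"
      by (simp add: ab)
  qed
  finally show ?thesis .
qed

lemma lift3_append:
  assumes T: "tri T" and X: "X \<in> carrier (tensor_space K 2 H)"
  shows "lift K R (\<lambda>xs. T (xs ! 0) (xs ! 1) (xs ! 2)) (tensor_append K H 2 1 X (tensor K H [\<one>\<^bsub>H\<^esub>])) = tsw (comp X) (\<lambda>a b. T a b \<one>\<^bsub>H\<^esub>)" (is ?th1)
    and "lift K R (\<lambda>xs. T (xs ! 0) (xs ! 1) (xs ! 2)) (tensor_append K H 1 2 (tensor K H [\<one>\<^bsub>H\<^esub>]) X) = tsw (comp X) (\<lambda>a b. T \<one>\<^bsub>H\<^esub> a b)" (is ?th2)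
proof -
  note V = V.module_axioms
  let ?T = "\<lambda>xs. T (xs ! 0) (xs ! 1) (xs ! 2)"
  have v1: "[\<one>\<^bsub>H\<^esub>] \<in> vectors 1 H" by (simp add: vectors_def)
  note t1 = tensor_in[OF V v1]
  have m: "mlin K (2 + 1) H R ?T" "mlin K (1 + 2) H R ?T"
    unfolding two_plus_one by (rule tri_mlin[OF T])+
  have b: "bil (\<lambda>a b. T a b \<one>\<^bsub>H\<^esub>)" "bil (\<lambda>a b. T \<one>\<^bsub>H\<^esub> a b)"
    by (auto intro!: lin_intros triD[OF T])
  have "lift K R ?T (tensor_append K H 2 1 X (tensor K H [\<one>\<^bsub>H\<^esub>])) = lift K R (\<lambda>xs. lift K R (\<lambda>ys. ?T (xs @ ys)) (tensor K H [\<one>\<^bsub>H\<^esub>])) X"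
    by (rule lift_tensor_append[OF V X t1 R_module m(1)])
  also have "\<dots> = lift K R (\<lambda>xs. T (xs ! 0) (xs ! 1) \<one>\<^bsub>H\<^esub>) X"
  proof (rule lift_tensor_cong[OF V R_module mlin_append(2)[OF V R_module m(1) t1] _ X])
    fix xs assume xs: "xs \<in> vectors 2 H"
    show "lift K R (\<lambda>ys. ?T (xs @ ys)) (tensor K H [\<one>\<^bsub>H\<^esub>]) = T (xs ! 0) (xs ! 1) \<one>\<^bsub>H\<^esub>"
      using lift_tensor[OF V R_module mlin_append(1)[OF V R_module m(1) xs] v1] xs by (auto simp: vectors_2)
  qed
  also have "\<dots> = tsw (comp X) (\<lambda>a b. T a b \<one>\<^bsub>H\<^esub>)" by (rule lift_bil[OF b(1) X])
  finally show ?th1 .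
  have "lift K R ?T (tensor_append K H 1 2 (tensor K H [\<one>\<^bsub>H\<^esub>]) X) = lift K R (\<lambda>xs. lift K R (\<lambda>ys. ?T (xs @ ys)) X) (tensor K H [\<one>\<^bsub>H\<^esub>])"
    by (rule lift_tensor_append[OF V t1 X R_module m(2)])
  also have "\<dots> = lift K R (\<lambda>ys. ?T ([\<one>\<^bsub>H\<^esub>] @ ys)) X"
    by (rule lift_tensor[OF V R_module mlin_append(2)[OF V R_module m(2) X] v1])
  also have "\<dots> = lift K R (\<lambda>ys. T \<one>\<^bsub>H\<^esub> (ys ! 0) (ys ! 1)) X"
    by (rule lift_tensor_cong[OF V R_module bil_mlin[OF b(2)] _ X, symmetric]) (auto simp: vectors_2)
  also have "\<dots> = tsw (comp X) (\<lambda>a b. T \<one>\<^bsub>H\<^esub> a b)" by (rule lift_bil[OF b(2) X])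
  finally show ?th2 .
qed

lemma exp0_left_twist:
  assumes J: "left_twist K H J"
  shows "exp0 K (left_twisted K H J) = exp0 K H"
proof -
  note V = V.module_axioms
  interpret M: monoid "tensor_power K 2 H" by (rule monoid_tensor_power)
  define J' where "J' = inv\<^bsub>tensor_power K 2 H\<^esub> J"
  have JU: "J \<in> Units (tensor_power K 2 H)" using J by (simp add: left_twist_def)
  have Jin: "J \<in> carrier (tensor_space K 2 H)" and J'in: "J' \<in> carrier (tensor_space K 2 H)"
    using M.Units_closed[OF JU] M.Units_inv_closed[OF JU] by (auto simp: J'_def)
  have JJ': "J \<otimes>\<^bsub>tensor_power K 2 H\<^esub> J' = tensor K H [\<one>\<^bsub>H\<^esub>, \<one>\<^bsub>H\<^esub>]" "J' \<otimes>\<^bsub>tensor_power K 2 H\<^esub> J = tensor K H [\<one>\<^bsub>H\<^esub>, \<one>\<^bsub>H\<^esub>]"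
    using M.Units_r_inv[OF JU] M.Units_l_inv[OF JU] by (simp_all add: J'_def tensor_power_one)
  have c: "\<forall>i<d. comp J i \<in> carrier H" "\<forall>i<d. comp J' i \<in> carrier H" using comp_in Jin J'in by auto
  have T3: "\<one>\<^bsub>H\<^esub> \<in> carrier H" "[\<one>\<^bsub>H\<^esub>] \<in> vectors 1 H" by (simp_all add: vectors_def)
  note one1 = tensor_in[OF V T3(2)]
  have ap: "tensor_append K H 2 1 J (tensor K H [\<one>\<^bsub>H\<^esub>]) \<in> carrier (tensor_space K 3 H)"
     "tensor_append K H 1 2 (tensor K H [\<one>\<^bsub>H\<^esub>]) J \<in> carrier (tensor_space K 3 H)"
     "tensor_left K H 2 (comult H) J \<in> carrier (tensor_space K 3 H)" "tensor_right K H 2 (comult H) J \<in> carrier (tensor_space K 3 H)"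
    using tensor_append_in[OF V Jin one1] tensor_append_in[OF V one1 Jin] tensor_left_in[OF V comult_linear Jin] tensor_right_in[OF V comult_linear Jin]
    unfolding two_plus_one by auto
  have sum_sw: "(\<Sum>i<d. F (Dl i a) (e i)) = sw a F" for F a by (simp add: sw_def tsw_def)
  \<comment> \<open>J and J^-1 enter by their components. Pairing the twist equation in the third
    tensor power with a trilinear form turns both of its sides into nested sums.\<close>
  interpret tw: twist_calc "carrier H" d e co "(\<otimes>\<^bsub>H\<^esub>)" "\<one>\<^bsub>H\<^esub>" S ep Dl Si "comp J" "comp J'"
  proof
    fix F :: "'h \<Rightarrow> 'h \<Rightarrow> ('a, 'k) uring" assume F: "bil F"
    show "tsw (comp J) (\<lambda>a b. tsw (comp J') (\<lambda>p q. F (a \<otimes>\<^bsub>H\<^esub> p) (b \<otimes>\<^bsub>H\<^esub> q))) = F \<one>\<^bsub>H\<^esub> \<one>\<^bsub>H\<^esub>"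
      using comp_mult[OF F Jin J'in] comp_pure[OF F one_in one_in] by (simp add: JJ')
    show "tsw (comp J') (\<lambda>a b. tsw (comp J) (\<lambda>p q. F (a \<otimes>\<^bsub>H\<^esub> p) (b \<otimes>\<^bsub>H\<^esub> q))) = F \<one>\<^bsub>H\<^esub> \<one>\<^bsub>H\<^esub>"
      using comp_mult[OF F J'in Jin] comp_pure[OF F one_in one_in] by (simp add: JJ')
  next
    fix T :: "'h \<Rightarrow> 'h \<Rightarrow> 'h \<Rightarrow> ('a, 'k) uring" assume T: "tri T"
    note L = lin_intros lin_tsw[OF c(1)] triD[OF T]
    let ?l = "lift K R (\<lambda>xs. T (xs ! 0) (xs ! 1) (xs ! 2))"
    have T': "tri (\<lambda>u v w. T (a \<otimes>\<^bsub>H\<^esub> u) (b \<otimes>\<^bsub>H\<^esub> v) (c \<otimes>\<^bsub>H\<^esub> w))" if "a \<in> carrier H" "b \<in> carrier H" "c \<in> carrier H" for a b c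
      using that by (auto intro!: L)
    let ?A = "\<lambda>a b c. tsw (comp J) (\<lambda>p q. sw p (\<lambda>r s. T (a \<otimes>\<^bsub>H\<^esub> r) (b \<otimes>\<^bsub>H\<^esub> s) (c \<otimes>\<^bsub>H\<^esub> q)))"
    let ?B = "\<lambda>a b c. tsw (comp J) (\<lambda>p q. sw q (\<lambda>r s. T (a \<otimes>\<^bsub>H\<^esub> p) (b \<otimes>\<^bsub>H\<^esub> r) (c \<otimes>\<^bsub>H\<^esub> s)))"
    have A: "tri ?A" and B: "tri ?B" by (auto intro!: L)
    have "?l (tensor_append K H 2 1 J (tensor K H [\<one>\<^bsub>H\<^esub>]) \<otimes>\<^bsub>tensor_power K 3 H\<^esub> tensor_left K H 2 (comult H) J)
      = lift K R (\<lambda>xs. ?A (xs ! 0) (xs ! 1) (xs ! 2)) (tensor_append K H 2 1 J (tensor K H [\<one>\<^bsub>H\<^esub>]))"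
      unfolding lift3_mult[OF T ap(1,3)]
    proof (rule lift_tensor_cong[OF V R_module tri_mlin[OF A] _ ap(1), symmetric])
      fix xs assume "xs \<in> vectors 3 H"
      then have "xs ! 0 \<in> carrier H" "xs ! 1 \<in> carrier H" "xs ! 2 \<in> carrier H" by (auto simp: vectors_3)
      from lift_left_comult[OF T'[OF this] Jin]
      show "?A (xs ! 0) (xs ! 1) (xs ! 2) = lift K R (\<lambda>ys. T (xs ! 0 \<otimes>\<^bsub>H\<^esub> ys ! 0) (xs ! 1 \<otimes>\<^bsub>H\<^esub> ys ! 1) (xs ! 2 \<otimes>\<^bsub>H\<^esub> ys ! 2)) (tensor_left K H 2 (comult H) J)"
        by (simp only: sw_def tsw_def)
    qed
    also have "\<dots> = tsw (comp J) (\<lambda>a b. ?A a b \<one>\<^bsub>H\<^esub>)" by (rule lift3_append(1)[OF A Jin])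
    also have "\<dots> = tsw (comp J) (\<lambda>a b. tsw (comp J) (\<lambda>p q. sw p (\<lambda>r s. T (a \<otimes>\<^bsub>H\<^esub> r) (b \<otimes>\<^bsub>H\<^esub> s) q)))"
      by (intro tsw_cong c(1) sw_cong') auto
    finally have 1: "?l (tensor_append K H 2 1 J (tensor K H [\<one>\<^bsub>H\<^esub>]) \<otimes>\<^bsub>tensor_power K 3 H\<^esub> tensor_left K H 2 (comult H) J) = \<dots>" .
    have "?l (tensor_append K H 1 2 (tensor K H [\<one>\<^bsub>H\<^esub>]) J \<otimes>\<^bsub>tensor_power K 3 H\<^esub> tensor_right K H 2 (comult H) J)
      = lift K R (\<lambda>xs. ?B (xs ! 0) (xs ! 1) (xs ! 2)) (tensor_append K H 1 2 (tensor K H [\<one>\<^bsub>H\<^esub>]) J)"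
      unfolding lift3_mult[OF T ap(2,4)]
    proof (rule lift_tensor_cong[OF V R_module tri_mlin[OF B] _ ap(2), symmetric])
      fix xs assume "xs \<in> vectors 3 H"
      then have "xs ! 0 \<in> carrier H" "xs ! 1 \<in> carrier H" "xs ! 2 \<in> carrier H" by (auto simp: vectors_3)
      from lift_right_comult[OF T'[OF this] Jin]
      show "?B (xs ! 0) (xs ! 1) (xs ! 2) = lift K R (\<lambda>ys. T (xs ! 0 \<otimes>\<^bsub>H\<^esub> ys ! 0) (xs ! 1 \<otimes>\<^bsub>H\<^esub> ys ! 1) (xs ! 2 \<otimes>\<^bsub>H\<^esub> ys ! 2)) (tensor_right K H 2 (comult H) J)"
        by (simp only: sw_def tsw_def)
    qed
    also have "\<dots> = tsw (comp J) (\<lambda>a b. ?B \<one>\<^bsub>H\<^esub> a b)" by (rule lift3_append(2)[OF B Jin])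
    also have "\<dots> = tsw (comp J) (\<lambda>a b. tsw (comp J) (\<lambda>p q. sw q (\<lambda>r s. T p (a \<otimes>\<^bsub>H\<^esub> r) (b \<otimes>\<^bsub>H\<^esub> s))))"
      by (intro tsw_cong c(1) sw_cong') auto
    finally show "tsw (comp J) (\<lambda>a b. tsw (comp J) (\<lambda>p q. sw p (\<lambda>r s. T (a \<otimes>\<^bsub>H\<^esub> r) (b \<otimes>\<^bsub>H\<^esub> s) q)))
      = tsw (comp J) (\<lambda>a b. tsw (comp J) (\<lambda>p q. sw q (\<lambda>r s. T p (a \<otimes>\<^bsub>H\<^esub> r) (b \<otimes>\<^bsub>H\<^esub> s))))"
      using 1 J by (simp only: left_twist_def)
  qed (use c in auto)
  let ?HJ = "left_twisted K H J"
  have s: "same_space H ?HJ" by (simp add: same_space_def left_twisted_def)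
  have HJ [simp]: "mult ?HJ = mult H" "one ?HJ = one H" "carrier ?HJ = carrier H" "counit ?HJ = counit H" "smult ?HJ = smult H"
    by (simp_all add: left_twisted_def)
  have cJ: "comult ?HJ h = J \<otimes>\<^bsub>tensor_power K 2 H\<^esub> comult H h \<otimes>\<^bsub>tensor_power K 2 H\<^esub> J'" for h
    by (simp add: left_twisted_def J'_def)
  note i = tensor_power_mult_in[OF V mult_bi2]
  have cJ_in: "comult ?HJ h \<in> carrier (tensor_space K 2 H)" if "h \<in> carrier H" for h
    unfolding cJ by (rule i[OF i[OF Jin comult_in[OF that]] J'in])
  have swJ: "tsw (comp (comult ?HJ h)) F = tw.swJ h F" if F: "bil F" and h: "h \<in> carrier H" for F h
  proof -
    have b: "bil (\<lambda>a b. tsw (comp J') (\<lambda>p q. F (a \<otimes>\<^bsub>H\<^esub> p) (b \<otimes>\<^bsub>H\<^esub> q)))"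
      by (auto intro!: lin_intros lin_tsw[OF c(2)] bilD[OF F])
    show ?thesis
      unfolding cJ comp_mult[OF F i[OF Jin comult_in[OF h]] J'in] comp_mult[OF b Jin comult_in[OF h]] tw.swJ_def
      by (simp add: sw_def Dl_def tsw_def)
  qed
  \<comment> \<open>Linearity of the twisted coproduct is checked after pairing with bilinear forms,
    where it becomes linearity of \<open>swJ\<close>.\<close>
  have cJ_hom: "comult ?HJ \<in> module_hom K H (tensor_space K 2 H)"
  proof (rule module_homI)
    note sep = tensor2_separates[OF cJ_in]
    interpret T2: module K "tensor_space K 2 H" by (rule module_tensor_space[OF V])
    show "comult ?HJ h \<in> carrier (tensor_space K 2 H)" if "h \<in> carrier H" for h by (rule cJ_in[OF that])
    have l: "tsw (comp X) F = lift K R (\<lambda>xs. F (xs ! 0) (xs ! 1)) X" if "bil F" "X \<in> carrier (tensor_space K 2 H)" for F X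
      using lift_bil[OF that] by simp
    have lh: "(\<lambda>h. tw.swJ h F) \<in> module_hom K H R" if F: "bil F" for F
      unfolding lin_iff[symmetric] tw.swJ_def
      by (auto intro!: lin_intros lin_tsw[OF c(1)] lin_tsw[OF c(2)] bilD[OF F])
    note lt = lift_tensor_hom[OF V R_module bil_mlin]
    show "comult ?HJ (x \<oplus>\<^bsub>H\<^esub> y) = comult ?HJ x \<oplus>\<^bsub>tensor_space K 2 H\<^esub> comult ?HJ y" if xy: "x \<in> carrier H" "y \<in> carrier H" for x y
    proof (rule sep)
      fix F assume F: "bil F"
      show "tsw (comp (comult ?HJ (x \<oplus>\<^bsub>H\<^esub> y))) F = tsw (comp (comult ?HJ x \<oplus>\<^bsub>tensor_space K 2 H\<^esub> comult ?HJ y)) F"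
        using swJ[OF F] l[OF F] module_hom_add[OF lt[OF F] cJ_in[OF xy(1)] cJ_in[OF xy(2)]] module_hom_add[OF lh[OF F] xy] xy cJ_in
        by simp
    qed (use xy cJ_in in auto)
    show "comult ?HJ (a \<odot>\<^bsub>H\<^esub> x) = a \<odot>\<^bsub>tensor_space K 2 H\<^esub> comult ?HJ x" if ax: "a \<in> carrier K" "x \<in> carrier H" for a x
    proof (rule sep)
      fix F assume F: "bil F"
      show "tsw (comp (comult ?HJ (a \<odot>\<^bsub>H\<^esub> x))) F = tsw (comp (a \<odot>\<^bsub>tensor_space K 2 H\<^esub> comult ?HJ x)) F"
        using swJ[OF F] l[OF F] module_hom_smult[OF lt[OF F] ax(1) cJ_in[OF ax(2)]] module_hom_smult[OF lh[OF F] ax] ax cJ_in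
        by simp
    qed (use ax cJ_in in auto)
  qed
  interpret P: sweedler_struct K ?HJ
  proof (intro sweedler_struct.intro)
    show "module K ?HJ" by (rule same_space_module[OF s V])
    show "bi2 K ?HJ ?HJ (\<otimes>\<^bsub>?HJ\<^esub>)" using mult_bi2 by (simp add: bi2_def same_space_hom[OF s] same_space_hom(1)[OF s])
    show "comult ?HJ \<in> module_hom K ?HJ (tensor_space K 2 ?HJ)"
      using cJ_hom by (simp add: same_space_hom[OF s] same_space_tensor_space[OF s])
  qed
  \<comment> \<open>The same induction as for H; the base case is now the counit law of the twisted
    coproduct.\<close>
  have act: "f (P.act_pow (Suc n) x y) = tw.spowJ (Suc n) (\<lambda>t. f (t \<otimes>\<^bsub>H\<^esub> y)) x"
    if f: "lin f" and "x \<in> carrier H" "y \<in> carrier H" for f n x y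
    using that(2,3)
  proof (induction n arbitrary: x y)
    case 0
    note [simp] = 0
    have "tw.spowJ (Suc 0) (\<lambda>t. f (t \<otimes>\<^bsub>H\<^esub> y)) x = tw.swJ x (\<lambda>a b. ep a * f (b \<otimes>\<^bsub>H\<^esub> y))"
      unfolding tw.spowJ.simps by (intro tw.swJ_cong) auto
    also have "\<dots> = f (x \<otimes>\<^bsub>H\<^esub> y)"
      by (rule tw.counit_swJ) (auto intro!: lin_intros lin_app[OF f])
    finally show ?case using P.act_pow_1[of x y] by simp
  next
    case (Suc n)
    have bi: "bi2 K H H (\<lambda>a b. P.act_pow (Suc n) a (b \<otimes>\<^bsub>H\<^esub> y))"
      using P.act_pow_bi2[of y n] Suc.prems(2) by (simp add: bi2_def same_space_hom[OF s] same_space_hom(1)[OF s])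
    have lf: "lift K ?HJ = lift K H" by (rule same_space_lift[OF s])
    have bil: "bil (\<lambda>a b. f (P.act_pow (Suc n) a (b \<otimes>\<^bsub>H\<^esub> y)))"
      unfolding bil_bi2 bi2_def using bi module_hom_comp[OF _ lin_hom[OF f]] by (auto simp: bi2_def)
    have "f (P.act_pow (Suc (Suc n)) x y) = tsw (comp (comult ?HJ x)) (\<lambda>a b. f (P.act_pow (Suc n) a (b \<otimes>\<^bsub>H\<^esub> y)))"
      using P.act_pow_Suc[of x y n] Suc.prems lin_lift_bi2[OF f bi cJ_in[OF Suc.prems(1)]] by (simp add: lf)
    also have "\<dots> = tw.swJ x (\<lambda>a b. f (P.act_pow (Suc n) a (b \<otimes>\<^bsub>H\<^esub> y)))"
      by (rule swJ[OF bil Suc.prems(1)])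
    also have "\<dots> = tw.swJ x (\<lambda>a b. tw.spowJ (Suc n) (\<lambda>t. f (t \<otimes>\<^bsub>H\<^esub> (b \<otimes>\<^bsub>H\<^esub> y))) a)"
      by (intro tw.swJ_cong Suc.IH) (auto simp: Suc.prems)
    also have "\<dots> = tw.swJ x (\<lambda>a b. tw.spowJ (Suc n) (\<lambda>t. f (t \<otimes>\<^bsub>H\<^esub> b \<otimes>\<^bsub>H\<^esub> y)) a)"
      by (intro tw.swJ_cong tw.spowJ_cong) (auto simp: Suc.prems mult_assoc)
    finally show ?case by simp
  qed
  have "(\<forall>h\<in>carrier H. sweedler_power K ?HJ n h = counit H h \<odot>\<^bsub>H\<^esub> \<one>\<^bsub>H\<^esub>) \<longleftrightarrow>
    (\<forall>h\<in>carrier H. sweedler_power K H n h = counit H h \<odot>\<^bsub>H\<^esub> \<one>\<^bsub>H\<^esub>)" if n: "n \<ge> 1" for n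
  proof -
    obtain m where m: "n = Suc m" using n by (cases n) auto
    have p: "f (sweedler_power K ?HJ n x) = tw.spowJ n f x" if f: "lin f" and x: "x \<in> carrier H" for f x
    proof -
      have "f (sweedler_power K ?HJ n x) = tw.spowJ n (\<lambda>t. f (t \<otimes>\<^bsub>H\<^esub> \<one>\<^bsub>H\<^esub>)) x"
        unfolding m P.sweedler_power_act using act[OF f x one_in] by simp
      also have "\<dots> = tw.spowJ n f x" by (intro tw.spowJ_cong) (auto simp: x)
      finally show ?thesis .
    qed
    have i: "sweedler_power K ?HJ n x \<in> carrier H" "counit H x \<odot>\<^bsub>H\<^esub> \<one>\<^bsub>H\<^esub> \<in> carrier H" if x: "x \<in> carrier H" for x
      using module_hom_in[OF P.sweedler_power_hom[OF _ n], of x] x counit_in[OF x] by auto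
    have "(\<forall>h\<in>carrier H. sweedler_power K ?HJ n h = counit H h \<odot>\<^bsub>H\<^esub> \<one>\<^bsub>H\<^esub>) \<longleftrightarrow>
       (\<forall>f. lin f \<longrightarrow> (\<forall>x\<in>carrier H. tw.spowJ n f x = ep x * f \<one>\<^bsub>H\<^esub>))" (is "?l \<longleftrightarrow> ?r")
    proof
      assume l: ?l
      show ?r
      proof (intro allI impI ballI)
        fix f x assume f: "lin f" and x: "x \<in> carrier H"
        show "tw.spowJ n f x = ep x * f \<one>\<^bsub>H\<^esub>"
          using p[OF f x] lin_counit_one[OF f x] l x by simp
      qed
    next
      assume r: ?r
      show ?l
      proof
        fix x assume x: "x \<in> carrier H"
        show "sweedler_power K ?HJ n x = counit H x \<odot>\<^bsub>H\<^esub> \<one>\<^bsub>H\<^esub>"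
        proof (rule lin_separates[OF i[OF x]])
          fix f assume f: "lin f"
          show "f (sweedler_power K ?HJ n x) = f (counit H x \<odot>\<^bsub>H\<^esub> \<one>\<^bsub>H\<^esub>)"
            using p[OF f x] lin_counit_one[OF f x] r f x by simp
        qed
      qed
    qed
    also have "\<dots> \<longleftrightarrow> exponent n" by (rule tw.exponent_twist)
    also have "\<dots> \<longleftrightarrow> (\<forall>h\<in>carrier H. sweedler_power K H n h = counit H h \<odot>\<^bsub>H\<^esub> \<one>\<^bsub>H\<^esub>)"
      by (rule exponent_iff[OF n, symmetric])
    finally show ?thesis .
  qed
  note iff = this
  have "{n. n \<ge> 1 \<and> (\<forall>h\<in>carrier H. sweedler_power K ?HJ n h = counit H h \<odot>\<^bsub>H\<^esub> \<one>\<^bsub>H\<^esub>)} =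
    {n. n \<ge> 1 \<and> (\<forall>h\<in>carrier H. sweedler_power K H n h = counit H h \<odot>\<^bsub>H\<^esub> \<one>\<^bsub>H\<^esub>)}"
    by (rule Collect_cong, rule conj_cong[OF refl], rule iff)
  then show ?thesis unfolding exp0_def HJ by (rule arg_cong)
qed

lemma exp0_right_twist:
  assumes J: "right_twist K H J"
  shows "exp0 K (right_twisted K H J) = exp0 K H"
proof -
  interpret M: monoid "tensor_power K 2 H" by (rule monoid_tensor_power)
  \<comment> \<open>The inverse of the inverse of J is J, so twisting on the right by J is twisting
    on the left by J^-1.\<close>
  have "right_twisted K H J = left_twisted K H (inv\<^bsub>tensor_power K 2 H\<^esub> J)"
    using J by (simp add: right_twisted_def left_twisted_def right_twist_def)
  then show ?thesis using exp0_left_twist J by (simp add: right_twist_def)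
qed

end

subsection \<open>The tensor product of two spaces\<close>

definition bim :: "('a, 'k) ring_scheme \<Rightarrow> ('a, 'v, 'm) module_scheme \<Rightarrow> ('a, 'w, 'n) module_scheme \<Rightarrow> ('a, 'u, 'l) module_scheme \<Rightarrow> ('v \<Rightarrow> 'w \<Rightarrow> 'u) \<Rightarrow> bool" where
  "bim K V W U f \<longleftrightarrow> (\<forall>w\<in>carrier W. (\<lambda>v. f v w) \<in> module_hom K V U) \<and> (\<forall>v\<in>carrier V. (\<lambda>w. f v w) \<in> module_hom K W U)"

lemma bimI:
  "\<lbrakk>\<And>w. w \<in> carrier W \<Longrightarrow> (\<lambda>v. f v w) \<in> module_hom K V U; \<And>v. v \<in> carrier V \<Longrightarrow> (\<lambda>w. f v w) \<in> module_hom K W U\<rbrakk> \<Longrightarrow> bim K V W U f"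
  by (simp add: bim_def)

lemma bimD:
  assumes "bim K V W U f"
  shows "w \<in> carrier W \<Longrightarrow> (\<lambda>v. f v w) \<in> module_hom K V U" "v \<in> carrier V \<Longrightarrow> (\<lambda>w. f v w) \<in> module_hom K W U"
    "\<lbrakk>v \<in> carrier V; w \<in> carrier W\<rbrakk> \<Longrightarrow> f v w \<in> carrier U"
  using assms by (auto simp: bim_def intro: module_hom_in)

locale pair_pres = V: module K V + W: module K W
  for K :: "('a, 'k) ring_scheme" and V :: "('a, 'v, 'm) module_scheme" and W :: "('a, 'w, 'n) module_scheme"
begin

sublocale presentation K "carrier V \<times> carrier W" "bilinear_relations K V W"
proof
  interpret F: module K "free_module K (carrier V \<times> carrier W)" by (rule module_free_module[OF V.R.is_cring])
  note g = free_gen_in[OF V.R.is_cring]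
  show "bilinear_relations K V W \<subseteq> carrier (free_module K (carrier V \<times> carrier W))"
    unfolding bilinear_relations_def Let_def
    by (auto intro!: F.M.minus_closed F.M.a_closed F.smult_closed g)
qed

lemma tensor_product_eq: "tensor_product K V W = Q"
  by (simp add: tensor_product_def bilinear_submodule_def)

lemma pair_tensor_eq: "pair_tensor K V W v w = cls (v, w)"
  by (simp only: pair_tensor_def bilinear_submodule_def cls_def)

lemma bim_good:
  assumes U: "module K U" and \<phi>: "bim K V W U \<phi>"
  shows "good U (\<lambda>(v, w). \<phi> v w)"
proof -
  have \<phi>in: "(\<lambda>(v, w). \<phi> v w) \<in> carrier V \<times> carrier W \<rightarrow> carrier U" using bimD(3)[OF \<phi>] by auto
  have "lin_ext K U (\<lambda>(v, w). \<phi> v w) \<rho> = \<zero>\<^bsub>U\<^esub>" if \<rho>: "\<rho> \<in> bilinear_relations K V W" for \<rho>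
    using \<rho> unfolding bilinear_relations_def Let_def
  proof (elim UnE CollectE exE conjE)
    fix v v' w assume \<rho>: "\<rho> = free_gen K (v \<oplus>\<^bsub>V\<^esub> v', w) \<ominus>\<^bsub>F\<^esub> (free_gen K (v, w) \<oplus>\<^bsub>F\<^esub> free_gen K (v', w))"
      and c: "v \<in> carrier V" "v' \<in> carrier V" "w \<in> carrier W"
    show ?thesis
      unfolding \<rho> by (rule good_relation[OF U \<phi>in]) (use c module_hom_add[OF bimD(1)[OF \<phi> c(3)] c(1,2)] in auto)
  next
    fix v w w' assume \<rho>: "\<rho> = free_gen K (v, w \<oplus>\<^bsub>W\<^esub> w') \<ominus>\<^bsub>F\<^esub> (free_gen K (v, w) \<oplus>\<^bsub>F\<^esub> free_gen K (v, w'))"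
      and c: "v \<in> carrier V" "w \<in> carrier W" "w' \<in> carrier W"
    show ?thesis
      unfolding \<rho> by (rule good_relation[OF U \<phi>in]) (use c module_hom_add[OF bimD(2)[OF \<phi> c(1)] c(2,3)] in auto)
  next
    fix a v w assume \<rho>: "\<rho> = free_gen K (a \<odot>\<^bsub>V\<^esub> v, w) \<ominus>\<^bsub>F\<^esub> a \<odot>\<^bsub>F\<^esub> free_gen K (v, w)"
      and c: "a \<in> carrier K" "v \<in> carrier V" "w \<in> carrier W"
    show ?thesis
      unfolding \<rho> by (rule good_relation[OF U \<phi>in]) (use c module_hom_smult[OF bimD(1)[OF \<phi> c(3)] c(1,2)] in auto)
  next
    fix a v w assume \<rho>: "\<rho> = free_gen K (v, a \<odot>\<^bsub>W\<^esub> w) \<ominus>\<^bsub>F\<^esub> a \<odot>\<^bsub>F\<^esub> free_gen K (v, w)"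
      and c: "a \<in> carrier K" "v \<in> carrier V" "w \<in> carrier W"
    show ?thesis
      unfolding \<rho> by (rule good_relation[OF U \<phi>in]) (use c module_hom_smult[OF bimD(2)[OF \<phi> c(2)] c(1,3)] in auto)
  qed
  with \<phi>in show ?thesis by (simp add: good_def)
qed

lemma pair_tensor_bim: "bim K V W (tensor_product K V W) (pair_tensor K V W)"
  unfolding tensor_product_eq pair_tensor_eq
proof (rule bimI; rule module_homI)
  fix v v' w assume c: "v \<in> carrier V" "v' \<in> carrier V" "w \<in> carrier W"
  show "cls (v, w) \<in> carrier Q" using c by (simp add: cls_in)
  have "free_gen K (v \<oplus>\<^bsub>V\<^esub> v', w) \<ominus>\<^bsub>F\<^esub> (free_gen K (v, w) \<oplus>\<^bsub>F\<^esub> free_gen K (v', w)) \<in> bilinear_relations K V W"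
    unfolding bilinear_relations_def Let_def using c by blast
  then show "cls (v \<oplus>\<^bsub>V\<^esub> v', w) = cls (v, w) \<oplus>\<^bsub>Q\<^esub> cls (v', w)"
    by (intro cls_rel(1)) (use c in auto)
next
  fix a v w assume c: "a \<in> carrier K" "v \<in> carrier V" "w \<in> carrier W"
  have "free_gen K (a \<odot>\<^bsub>V\<^esub> v, w) \<ominus>\<^bsub>F\<^esub> a \<odot>\<^bsub>F\<^esub> free_gen K (v, w) \<in> bilinear_relations K V W"
    unfolding bilinear_relations_def Let_def using c by blast
  then show "cls (a \<odot>\<^bsub>V\<^esub> v, w) = a \<odot>\<^bsub>Q\<^esub> cls (v, w)"
    by (intro cls_rel(2)) (use c in auto)
next
  fix v w w' assume c: "v \<in> carrier V" "w \<in> carrier W" "w' \<in> carrier W"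
  show "cls (v, w) \<in> carrier Q" using c by (simp add: cls_in)
  have "free_gen K (v, w \<oplus>\<^bsub>W\<^esub> w') \<ominus>\<^bsub>F\<^esub> (free_gen K (v, w) \<oplus>\<^bsub>F\<^esub> free_gen K (v, w')) \<in> bilinear_relations K V W"
    unfolding bilinear_relations_def Let_def using c by blast
  then show "cls (v, w \<oplus>\<^bsub>W\<^esub> w') = cls (v, w) \<oplus>\<^bsub>Q\<^esub> cls (v, w')"
    by (intro cls_rel(1)) (use c in auto)
next
  fix v a w assume c: "v \<in> carrier V" "a \<in> carrier K" "w \<in> carrier W"
  have "free_gen K (v, a \<odot>\<^bsub>W\<^esub> w) \<ominus>\<^bsub>F\<^esub> a \<odot>\<^bsub>F\<^esub> free_gen K (v, w) \<in> bilinear_relations K V W"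
    unfolding bilinear_relations_def Let_def using c by blast
  then show "cls (v, a \<odot>\<^bsub>W\<^esub> w) = a \<odot>\<^bsub>Q\<^esub> cls (v, w)"
    by (intro cls_rel(2)) (use c in auto)
qed

lemma module_tensor_product: "module K (tensor_product K V W)"
  unfolding tensor_product_eq by (rule module_quot)

lemma
  assumes U: "module K U" and \<phi>: "bim K V W U \<phi>"
  shows lift_pair_hom: "lift K U (\<lambda>(v, w). \<phi> v w) \<in> module_hom K (tensor_product K V W) U"
    and lift_pair: "\<lbrakk>v \<in> carrier V; w \<in> carrier W\<rbrakk> \<Longrightarrow> lift K U (\<lambda>(v, w). \<phi> v w) (pair_tensor K V W v w) = \<phi> v w"
  unfolding tensor_product_eq pair_tensor_eq
  using good_hom[OF U bim_good[OF U \<phi>]] good_cls[OF U bim_good[OF U \<phi>]] by auto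

lemma pair_hom_eqI:
  assumes U: "module K U"
    and f: "f \<in> module_hom K (tensor_product K V W) U" and g: "g \<in> module_hom K (tensor_product K V W) U"
    and eq: "\<And>v w. \<lbrakk>v \<in> carrier V; w \<in> carrier W\<rbrakk> \<Longrightarrow> f (pair_tensor K V W v w) = g (pair_tensor K V W v w)"
    and T: "T \<in> carrier (tensor_product K V W)"
  shows "f T = g T"
  by (rule hom_eqI[OF U f[unfolded tensor_product_eq] g[unfolded tensor_product_eq] _ T[unfolded tensor_product_eq]])
    (use eq in \<open>auto simp: pair_tensor_eq\<close>)

lemma lift_pair_param:
  assumes Z: "module K Z" and U: "module K U" and \<phi>: "\<And>z. z \<in> carrier Z \<Longrightarrow> bim K V W U (\<phi> z)"
    and h: "\<And>v w. \<lbrakk>v \<in> carrier V; w \<in> carrier W\<rbrakk> \<Longrightarrow> (\<lambda>z. \<phi> z v w) \<in> module_hom K Z U"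
    and T: "T \<in> carrier (tensor_product K V W)"
  shows "(\<lambda>z. lift K U (\<lambda>(v, w). \<phi> z v w) T) \<in> module_hom K Z U"
  by (rule lift_param[OF Z U bim_good[OF U \<phi>] _ T[unfolded tensor_product_eq]]) (use h in auto)

end

subsection \<open>The dual Hopf algebra\<close>

context fd_hopf
begin

abbreviation "A \<equiv> dual_hopf K H"

lemma dual_simps:
  "carrier A = module_hom K H (scalars K) \<inter> extensional (carrier H)"
  "f \<otimes>\<^bsub>A\<^esub> g = (\<lambda>h\<in>carrier H. lift K (scalars K) (\<lambda>xs. f (xs ! 0) \<otimes>\<^bsub>K\<^esub> g (xs ! 1)) (comult H h))"
  "\<one>\<^bsub>A\<^esub> = (\<lambda>h\<in>carrier H. counit H h)" "\<zero>\<^bsub>A\<^esub> = (\<lambda>h\<in>carrier H. \<zero>\<^bsub>K\<^esub>)"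
  "f \<oplus>\<^bsub>A\<^esub> g = (\<lambda>h\<in>carrier H. f h \<oplus>\<^bsub>K\<^esub> g h)" "a \<odot>\<^bsub>A\<^esub> f = (\<lambda>h\<in>carrier H. a \<otimes>\<^bsub>K\<^esub> f h)"
  "counit A f = f \<one>\<^bsub>H\<^esub>"
  by (simp_all add: dual_hopf_def dual_algebra_def module.defs hopf.defs)

lemma dual_apply:
  assumes "x \<in> carrier H"
  shows "(f \<oplus>\<^bsub>A\<^esub> g) x = f x \<oplus>\<^bsub>K\<^esub> g x" "(a \<odot>\<^bsub>A\<^esub> f) x = a \<otimes>\<^bsub>K\<^esub> f x"
  using assms by (simp_all add: dual_simps)

lemma same_space_dual: "same_space (dual_algebra K H) A"
  by (simp add: same_space_def dual_hopf_def dual_algebra_def module.defs hopf.defs)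

lemma dual_hom: "f \<in> carrier A \<Longrightarrow> f \<in> module_hom K H (scalars K)"
  by (simp add: dual_simps)

lemma dual_in: "\<lbrakk>f \<in> carrier A; x \<in> carrier H\<rbrakk> \<Longrightarrow> f x \<in> carrier K"
  using module_hom_in[OF dual_hom] by auto

lemma dual_lin: "f \<in> carrier A \<Longrightarrow> lin (\<lambda>x. emb K (f x))"
  unfolding lin_iff by (rule module_hom_comp[OF dual_hom emb_hom[OF V.R.is_cring]])

lemma dual_restrict: "f \<in> module_hom K H (scalars K) \<Longrightarrow> restrict f (carrier H) \<in> carrier A"
  using module_hom_cong[OF _ V.module_axioms, of "restrict f (carrier H)" f "scalars K"] by (simp add: dual_simps(1))

lemma dual_eqI: "\<lbrakk>f \<in> carrier A; g \<in> carrier A; \<And>x. x \<in> carrier H \<Longrightarrow> f x = g x\<rbrakk> \<Longrightarrow> f = g"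
  by (auto simp: dual_simps(1) intro: extensionalityI)

lemma scalars_module: "module K (scalars K)"
  by (rule module_scalars[OF V.R.is_cring])

lemma dual_closed:
  "\<lbrakk>f \<in> carrier A; g \<in> carrier A\<rbrakk> \<Longrightarrow> f \<oplus>\<^bsub>A\<^esub> g \<in> carrier A"
  "\<lbrakk>a \<in> carrier K; f \<in> carrier A\<rbrakk> \<Longrightarrow> a \<odot>\<^bsub>A\<^esub> f \<in> carrier A" "\<zero>\<^bsub>A\<^esub> \<in> carrier A"
proof -
  show "f \<oplus>\<^bsub>A\<^esub> g \<in> carrier A" if "f \<in> carrier A" "g \<in> carrier A"
    using module_hom_plus[OF scalars_module dual_hom[OF that(1)] dual_hom[OF that(2)]]
    unfolding dual_simps(5) by (intro dual_restrict) simp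
  show "a \<odot>\<^bsub>A\<^esub> f \<in> carrier A" if "a \<in> carrier K" "f \<in> carrier A"
    using module_hom_scale[OF scalars_module dual_hom[OF that(2)] that(1)]
    unfolding dual_simps(6) by (intro dual_restrict) simp
  show "\<zero>\<^bsub>A\<^esub> \<in> carrier A"
    unfolding dual_simps(4) by (intro dual_restrict module_homI) simp_all
qed

lemma dual_module: "module K A"
proof -
  have z: "\<zero>\<^bsub>A\<^esub> x = \<zero>\<^bsub>K\<^esub>" if "x \<in> carrier H" for x by (simp add: dual_simps(4) that)
  note s = dual_apply z dual_in
  have "abelian_group A"
  proof (rule abelian_groupI)
    fix f assume f: "f \<in> carrier A"
    show "\<exists>g\<in>carrier A. g \<oplus>\<^bsub>A\<^esub> f = \<zero>\<^bsub>A\<^esub>"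
    proof (rule bexI[of _ "(\<ominus>\<^bsub>K\<^esub> \<one>\<^bsub>K\<^esub>) \<odot>\<^bsub>A\<^esub> f"])
      show "(\<ominus>\<^bsub>K\<^esub> \<one>\<^bsub>K\<^esub>) \<odot>\<^bsub>A\<^esub> f \<oplus>\<^bsub>A\<^esub> f = \<zero>\<^bsub>A\<^esub>"
        by (rule dual_eqI) (simp_all add: dual_closed f s V.R.l_minus V.R.l_neg)
    qed (simp add: dual_closed f)
  next
    show "f \<oplus>\<^bsub>A\<^esub> g = g \<oplus>\<^bsub>A\<^esub> f" if "f \<in> carrier A" "g \<in> carrier A" for f g
      by (rule dual_eqI) (simp_all add: dual_closed that s V.R.a_comm)
    show "f \<oplus>\<^bsub>A\<^esub> g \<oplus>\<^bsub>A\<^esub> h = f \<oplus>\<^bsub>A\<^esub> (g \<oplus>\<^bsub>A\<^esub> h)" if "f \<in> carrier A" "g \<in> carrier A" "h \<in> carrier A" for f g h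
      by (rule dual_eqI) (simp_all add: dual_closed that s V.R.a_assoc)
    show "\<zero>\<^bsub>A\<^esub> \<oplus>\<^bsub>A\<^esub> f = f" if "f \<in> carrier A" for f
      by (rule dual_eqI) (simp_all add: dual_closed that s)
  qed (simp_all add: dual_closed)
  then show ?thesis
  proof (rule moduleI[OF V.R.is_cring])
    show "(a \<oplus>\<^bsub>K\<^esub> b) \<odot>\<^bsub>A\<^esub> f = a \<odot>\<^bsub>A\<^esub> f \<oplus>\<^bsub>A\<^esub> b \<odot>\<^bsub>A\<^esub> f" "(a \<otimes>\<^bsub>K\<^esub> b) \<odot>\<^bsub>A\<^esub> f = a \<odot>\<^bsub>A\<^esub> (b \<odot>\<^bsub>A\<^esub> f)"
      if "a \<in> carrier K" "b \<in> carrier K" "f \<in> carrier A" for a b f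
      by (rule dual_eqI; simp add: dual_closed that s V.R.l_distr V.R.m_assoc)+
    show "a \<odot>\<^bsub>A\<^esub> (f \<oplus>\<^bsub>A\<^esub> g) = a \<odot>\<^bsub>A\<^esub> f \<oplus>\<^bsub>A\<^esub> a \<odot>\<^bsub>A\<^esub> g"
      if "a \<in> carrier K" "f \<in> carrier A" "g \<in> carrier A" for a f g
      by (rule dual_eqI; simp add: dual_closed that s V.R.r_distr)
    show "\<one>\<^bsub>K\<^esub> \<odot>\<^bsub>A\<^esub> f = f" if "f \<in> carrier A" for f
      by (rule dual_eqI; simp add: dual_closed that s)
  qed (simp_all add: dual_closed)
qed

sublocale Am: module K A by (rule dual_module)

lemma dual_ev: "x \<in> carrier H \<Longrightarrow> (\<lambda>f. f x) \<in> module_hom K A (scalars K)"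
  by (rule module_homI) (auto simp: dual_in dual_simps(5,6))

lemma dual_homI:
  assumes "module K M" and F: "\<And>m. m \<in> carrier M \<Longrightarrow> F m \<in> carrier A"
    and h: "\<And>x. x \<in> carrier H \<Longrightarrow> (\<lambda>m. F m x) \<in> module_hom K M (scalars K)"
  shows "F \<in> module_hom K M A"
proof -
  interpret M: module K M by fact
  show ?thesis
  proof (rule module_homI)
    show "F (x \<oplus>\<^bsub>M\<^esub> y) = F x \<oplus>\<^bsub>A\<^esub> F y" if "x \<in> carrier M" "y \<in> carrier M" for x y
      by (rule dual_eqI) (use that module_hom_add[OF h that] F in \<open>auto simp: dual_apply\<close>)
    show "F (a \<odot>\<^bsub>M\<^esub> x) = a \<odot>\<^bsub>A\<^esub> F x" if "a \<in> carrier K" "x \<in> carrier M" for a x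
      by (rule dual_eqI) (use that module_hom_smult[OF h that] F in \<open>auto simp: dual_apply\<close>)
  qed (rule F)
qed

definition E where "E i = restrict (k i) (carrier H)"

lemma E_in: "i < d \<Longrightarrow> E i \<in> carrier A"
  unfolding E_def by (rule dual_restrict[OF k_hom])

text \<open>The dual basis: the coordinates of a functional are its values on the basis of
  H.\<close>

lemma dual_frame: "frame K A d E (\<lambda>i f. f (e i))"
  unfolding frame_def
proof (intro conjI allI impI ballI)
  fix f assume f: "f \<in> carrier A"
  have s: "(\<Oplus>\<^bsub>A\<^esub>i\<in>{..<d}. f (e i) \<odot>\<^bsub>A\<^esub> E i) \<in> carrier A"
    by (rule Am.M.finsum_closed) (auto simp: E_in dual_in f e_carrier)
  show "f = (\<Oplus>\<^bsub>A\<^esub>i\<in>{..<d}. f (e i) \<odot>\<^bsub>A\<^esub> E i)"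
  proof (rule dual_eqI[OF f s])
    fix x assume x: "x \<in> carrier H"
    interpret s: module K "scalars K" by (rule scalars_module)
    have "(\<Oplus>\<^bsub>A\<^esub>i\<in>{..<d}. f (e i) \<odot>\<^bsub>A\<^esub> E i) x = (\<Oplus>\<^bsub>scalars K\<^esub>i\<in>{..<d}. (f (e i) \<odot>\<^bsub>A\<^esub> E i) x)"
      by (rule module_hom_finsum[OF dual_module scalars_module dual_ev[OF x]]) (auto simp: E_in dual_in f e_carrier)
    also have "\<dots> = (\<Oplus>\<^bsub>scalars K\<^esub>i\<in>{..<d}. k i x \<odot>\<^bsub>scalars K\<^esub> f (e i))"
      by (intro s.M.finsum_cong' refl) (auto simp: dual_simps(6) E_def x k_in dual_in f e_carrier V.R.m_comm)
    also have "\<dots> = f x" by (rule hom_expand[OF scalars_module dual_hom[OF f] x, symmetric])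
    finally show "f x = (\<Oplus>\<^bsub>A\<^esub>i\<in>{..<d}. f (e i) \<odot>\<^bsub>A\<^esub> E i) x" by simp
  qed
qed (auto simp: E_in dual_ev e_carrier, auto simp: E_def k_e e_carrier)

sublocale Af: framed K A d E "\<lambda>i f. f (e i)"
  by (intro framed.intro framed_axioms.intro dual_module dual_frame)

lemma dual_mult_bi2:
  assumes f: "f \<in> carrier A" and g: "g \<in> carrier A"
  shows "bi2 K H (scalars K) (\<lambda>a b. f a \<otimes>\<^bsub>K\<^esub> g b)"
proof -
  have "(\<lambda>a. f a \<otimes>\<^bsub>K\<^esub> g b) \<in> module_hom K H (scalars K)" if "b \<in> carrier H" for b
    using module_hom_scale[OF scalars_module dual_hom[OF f] dual_in[OF g that]]
    by (rule iffD1[OF module_hom_cong[OF _ V.module_axioms], rotated]) (simp add: V.R.m_comm dual_in f g that)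
  moreover have "(\<lambda>b. f a \<otimes>\<^bsub>K\<^esub> g b) \<in> module_hom K H (scalars K)" if "a \<in> carrier H" for a
    using module_hom_scale[OF scalars_module dual_hom[OF g] dual_in[OF f that]] by simp
  ultimately show ?thesis by (simp add: bi2_def)
qed

lemma dual_mult_in:
  assumes "f \<in> carrier A" "g \<in> carrier A" shows "f \<otimes>\<^bsub>A\<^esub> g \<in> carrier A"
  unfolding dual_simps(2)
  by (rule dual_restrict[OF module_hom_comp[OF comult_linear lift_tensor_hom[OF V.module_axioms scalars_module bi2_mlin[OF dual_mult_bi2[OF assms]]]]])

lemma dual_mult_hom:
  "g \<in> carrier A \<Longrightarrow> (\<lambda>f. f \<otimes>\<^bsub>A\<^esub> g) \<in> module_hom K A A"
  "f \<in> carrier A \<Longrightarrow> (\<lambda>g. f \<otimes>\<^bsub>A\<^esub> g) \<in> module_hom K A A"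
proof -
  note P = lift_tensor_param[OF V.module_axioms dual_module scalars_module bi2_mlin[OF dual_mult_bi2] _ comult_in]
  have s: "(\<lambda>f. f x \<otimes>\<^bsub>K\<^esub> a) \<in> module_hom K A (scalars K)" "(\<lambda>f. a \<otimes>\<^bsub>K\<^esub> f x) \<in> module_hom K A (scalars K)" if "x \<in> carrier H" "a \<in> carrier K" for a x
  proof -
    show 1: "(\<lambda>f. a \<otimes>\<^bsub>K\<^esub> f x) \<in> module_hom K A (scalars K)"
      using module_hom_scale[OF scalars_module dual_ev[OF that(1)] that(2)] by simp
    show "(\<lambda>f. f x \<otimes>\<^bsub>K\<^esub> a) \<in> module_hom K A (scalars K)"
      by (rule iffD1[OF module_hom_cong[OF _ dual_module] 1]) (simp add: V.R.m_comm dual_in that)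
  qed
  show "(\<lambda>f. f \<otimes>\<^bsub>A\<^esub> g) \<in> module_hom K A A" if g: "g \<in> carrier A"
  proof (rule dual_homI[OF dual_module dual_mult_in[OF _ g]])
    fix x assume x: "x \<in> carrier H"
    have "(\<lambda>f. lift K (scalars K) (\<lambda>xs. f (xs ! 0) \<otimes>\<^bsub>K\<^esub> g (xs ! 1)) (comult H x)) \<in> module_hom K A (scalars K)"
      by (rule P) (auto simp: g x vectors_2 intro!: s dual_in)
    then show "(\<lambda>f. (f \<otimes>\<^bsub>A\<^esub> g) x) \<in> module_hom K A (scalars K)" by (simp add: dual_simps(2) x)
  qed
  show "(\<lambda>g. f \<otimes>\<^bsub>A\<^esub> g) \<in> module_hom K A A" if f: "f \<in> carrier A"
  proof (rule dual_homI[OF dual_module dual_mult_in[OF f]])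
    fix x assume x: "x \<in> carrier H"
    have "(\<lambda>g. lift K (scalars K) (\<lambda>xs. f (xs ! 0) \<otimes>\<^bsub>K\<^esub> g (xs ! 1)) (comult H x)) \<in> module_hom K A (scalars K)"
      by (rule P) (auto simp: f x vectors_2 intro!: s dual_in)
    then show "(\<lambda>g. (f \<otimes>\<^bsub>A\<^esub> g) x) \<in> module_hom K A (scalars K)" by (simp add: dual_simps(2) x)
  qed
qed

lemma emb_dual_mult:
  assumes f: "f \<in> carrier A" and g: "g \<in> carrier A" and x: "x \<in> carrier H"
  shows "emb K ((f \<otimes>\<^bsub>A\<^esub> g) x) = sw x (\<lambda>a b. emb K (f a) * emb K (g b))"
proof -
  have F: "bil (\<lambda>a b. emb K (f a) * emb K (g b))"
    by (intro bilI lin_cmult lin_multc lin_app[OF dual_lin[OF f]] lin_app[OF dual_lin[OF g]] lop_id)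
  have "emb K ((f \<otimes>\<^bsub>A\<^esub> g) x) = lift K R (\<lambda>xs. emb K (f (xs ! 0) \<otimes>\<^bsub>K\<^esub> g (xs ! 1))) (comult H x)"
    using lift_tensor_comp[OF V.module_axioms scalars_module R_module emb_hom[OF V.R.is_cring] bi2_mlin[OF dual_mult_bi2[OF f g]] comult_in[OF x]]
    by (simp add: dual_simps(2) x)
  also have "\<dots> = lift K R (\<lambda>xs. emb K (f (xs ! 0)) * emb K (g (xs ! 1))) (comult H x)"
    by (rule lift_tensor_cong[OF V.module_axioms R_module bil_mlin[OF F] _ comult_in[OF x], symmetric])
      (auto simp: vectors_2 emb_ops V.R.is_cring dual_in f g)
  also have "\<dots> = sw x (\<lambda>a b. emb K (f a) * emb K (g b))"
    using lift_comult[OF F x] by (simp add: sw_def tsw_def)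
  finally show ?thesis .
qed

text \<open>Supplies the components of the coproduct of \<open>f\<close>: f(x y) is the sum of the
  products of f(x e i) and \<open>E i\<close> at y.\<close>

definition shift where "shift f y = (\<lambda>x\<in>carrier H. f (x \<otimes>\<^bsub>H\<^esub> y))"

lemma shift_in: "\<lbrakk>f \<in> carrier A; y \<in> carrier H\<rbrakk> \<Longrightarrow> shift f y \<in> carrier A"
  unfolding shift_def by (rule dual_restrict[OF module_hom_comp[OF mult_hom(1) dual_hom]])

lemma shift_hom: "y \<in> carrier H \<Longrightarrow> (\<lambda>f. shift f y) \<in> module_hom K A A"
  by (rule dual_homI[OF dual_module shift_in]) (simp_all add: shift_def dual_ev)

text \<open>The coproduct is a definite description. Any tensor with the required values must have
  the components \<open>shift f (e i)\<close>, which gives uniqueness; the tensor built from these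
  components has the required values, by the basis expansion of y in f(x y).\<close>

lemma dual_comult:
  assumes f: "f \<in> carrier A"
  shows "comult A f \<in> carrier (tensor_space K 2 A)" "\<And>i. i < d \<Longrightarrow> Af.comp (comult A f) i = shift f (e i)"
proof -
  interpret T2: module K "tensor_space K 2 A" by (rule module_tensor_space[OF dual_module])
  interpret s: module K "scalars K" by (rule scalars_module)
  let ?ev = "\<lambda>x y. lift K (scalars K) (\<lambda>fs. (fs ! 0) x \<otimes>\<^bsub>K\<^esub> (fs ! 1) y)"
  have b: "bi2 K A (scalars K) (\<lambda>f g. f x \<otimes>\<^bsub>K\<^esub> g y)" if xy: "x \<in> carrier H" "y \<in> carrier H" for x y
  proof -
    have "(\<lambda>g. f x \<otimes>\<^bsub>K\<^esub> g y) \<in> module_hom K A (scalars K)" if "f \<in> carrier A" for f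
      using module_hom_scale[OF scalars_module dual_ev[OF xy(2)] dual_in[OF that xy(1)]] by simp
    moreover have "(\<lambda>f. f x \<otimes>\<^bsub>K\<^esub> g y) \<in> module_hom K A (scalars K)" if "g \<in> carrier A" for g
      by (rule iffD1[OF module_hom_cong[OF _ dual_module] module_hom_scale[OF scalars_module dual_ev[OF xy(1)] dual_in[OF that xy(2)]]])
        (simp add: V.R.m_comm dual_in that xy)
    ultimately show ?thesis by (simp add: bi2_def)
  qed
  let ?P = "\<lambda>t. t \<in> carrier (tensor_space K 2 A) \<and> (\<forall>x\<in>carrier H. \<forall>y\<in>carrier H. ?ev x y t = f (x \<otimes>\<^bsub>H\<^esub> y))"
  have comp: "Af.comp t i = shift f (e i)" if t: "?P t" and i: "i < d" for t i
  proof (rule dual_eqI[OF Af.comp_in[OF i] shift_in[OF f e_carrier[OF i]]])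
    show t': "t \<in> carrier (tensor_space K 2 A)" using t by simp
    fix x assume x: "x \<in> carrier H"
    have "Af.comp t i x = lift K (scalars K) (\<lambda>fs. ((fs ! 1) (e i) \<odot>\<^bsub>A\<^esub> fs ! 0) x) t"
      unfolding Af.comp_def by (rule lift_tensor_comp[OF dual_module dual_module scalars_module dual_ev[OF x] bi2_mlin[OF Af.bi2_comp[OF i]] t'])
    also have "\<dots> = ?ev x (e i) t"
      by (rule lift_tensor_cong[OF dual_module scalars_module bi2_mlin[OF b[OF x e_carrier[OF i]]] _ t', symmetric])
        (auto simp: vectors_2 dual_simps(6) x V.R.m_comm dual_in e_carrier i)
    also have "\<dots> = shift f (e i) x" using t x i by (simp add: shift_def e_carrier)
    finally show "Af.comp t i x = shift f (e i) x" .
  qed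
  define T where "T = (\<Oplus>\<^bsub>tensor_space K 2 A\<^esub>i\<in>{..<d}. tensor K A [shift f (e i), E i])"
  have v: "[shift f (e i), E i] \<in> vectors 2 A" if "i < d" for i
    using that by (simp add: vectors_2 shift_in f e_carrier E_in)
  have Tc: "T \<in> carrier (tensor_space K 2 A)"
    unfolding T_def by (rule T2.M.finsum_closed) (auto intro: tensor_in[OF dual_module v])
  have "?ev x y T = f (x \<otimes>\<^bsub>H\<^esub> y)" if xy: "x \<in> carrier H" "y \<in> carrier H" for x y
  proof -
    note m = bi2_mlin[OF b[OF xy]]
    have "?ev x y T = (\<Oplus>\<^bsub>scalars K\<^esub>i\<in>{..<d}. ?ev x y (tensor K A [shift f (e i), E i]))"
      unfolding T_def
      by (rule module_hom_finsum[OF T2.module_axioms scalars_module lift_tensor_hom[OF dual_module scalars_module m]])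
        (auto intro: tensor_in[OF dual_module v])
    also have "\<dots> = (\<Oplus>\<^bsub>scalars K\<^esub>i\<in>{..<d}. k i y \<odot>\<^bsub>scalars K\<^esub> f (x \<otimes>\<^bsub>H\<^esub> e i))"
      by (intro s.M.finsum_cong' refl)
        (use lift_tensor[OF dual_module scalars_module m v] in \<open>auto simp: shift_def E_def xy k_in dual_in f e_carrier V.R.m_comm\<close>)
    also have "\<dots> = f (x \<otimes>\<^bsub>H\<^esub> y)"
      by (rule hom_expand[OF scalars_module module_hom_comp[OF mult_hom(2)[OF xy(1)] dual_hom[OF f]] xy(2), symmetric])
    finally show ?thesis .
  qed
  then have PT: "?P T" using Tc by simp
  have "comult A f = (THE t. t \<in> carrier (tensor_space K 2 (dual_algebra K H)) \<and> (\<forall>x\<in>carrier H. \<forall>y\<in>carrier H. ?ev x y t = f (x \<otimes>\<^bsub>H\<^esub> y)))"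
    by (simp add: dual_hopf_def module.defs hopf.defs)
  also have "\<dots> = (THE t. ?P t)" by (simp only: same_space_tensor_space[OF same_space_dual])
  also have "\<dots> = T"
  proof (rule the_equality)
    show "?P T" by (rule PT)
    fix t assume t: "?P t"
    show "t = T" by (rule Af.comp_eqI) (use t PT comp in auto)
  qed
  finally have "?P (comult A f)" using PT by simp
  then show "comult A f \<in> carrier (tensor_space K 2 A)" "\<And>i. i < d \<Longrightarrow> Af.comp (comult A f) i = shift f (e i)"
    using comp by auto
qed

lemma dual_comult_hom: "comult A \<in> module_hom K A (tensor_space K 2 A)"
proof (rule module_homI)
  interpret T2: module K "tensor_space K 2 A" by (rule module_tensor_space[OF dual_module])
  show "comult A f \<in> carrier (tensor_space K 2 A)" if "f \<in> carrier A" for f by (rule dual_comult[OF that])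
  show "comult A (f \<oplus>\<^bsub>A\<^esub> g) = comult A f \<oplus>\<^bsub>tensor_space K 2 A\<^esub> comult A g" if fg: "f \<in> carrier A" "g \<in> carrier A" for f g
    by (rule Af.comp_eqI)
      (simp_all add: fg dual_comult module_hom_add[OF Af.comp_hom] module_hom_add[OF shift_hom] e_carrier)
  show "comult A (a \<odot>\<^bsub>A\<^esub> f) = a \<odot>\<^bsub>tensor_space K 2 A\<^esub> comult A f" if af: "a \<in> carrier K" "f \<in> carrier A" for a f
    by (rule Af.comp_eqI)
      (simp_all add: af dual_comult module_hom_smult[OF Af.comp_hom] module_hom_smult[OF shift_hom] e_carrier)
qed

end

subsection \<open>The Drinfeld double\<close>

lemma bi2_pre:
  assumes F: "bi2 K W U F" and s: "s \<in> module_hom K V W" and t: "t \<in> module_hom K V W"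
  shows "bi2 K V U (\<lambda>a b. F (s a) (t b))"
  using F module_hom_comp[OF s] module_hom_comp[OF t] module_hom_in[OF s] module_hom_in[OF t]
  unfolding bi2_def by fastforce

lemma bi2_post: "\<lbrakk>bi2 K V W F; g \<in> module_hom K W U\<rbrakk> \<Longrightarrow> bi2 K V U (\<lambda>a b. g (F a b))"
  unfolding bi2_def by (auto intro: module_hom_comp)

lemma tensor_bi2:
  assumes V: "module K V" shows "bi2 K V (tensor_space K 2 V) (\<lambda>a b. tensor K V [a, b])"
proof -
  have "(\<lambda>a. tensor K V [a, b]) \<in> module_hom K V (tensor_space K 2 V)" "(\<lambda>a. tensor K V [b, a]) \<in> module_hom K V (tensor_space K 2 V)"
    if "b \<in> carrier V" for b
    using mlinD(2)[OF mlin_tensor[OF V], of "[b, b]" 2 0] mlinD(2)[OF mlin_tensor[OF V], of "[b, b]" 2 1] that by (auto simp: vectors_2)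
  then show ?thesis by (simp add: bi2_def)
qed

lemma uring_hom_mult:
  assumes "f \<in> module_hom K M (uring_module K)"
  shows "(\<lambda>x. f x * r) \<in> module_hom K M (uring_module K)" "(\<lambda>x. r * f x) \<in> module_hom K M (uring_module K)"
  using module_homD[OF assms] by (auto intro!: module_homI simp: distrib_left distrib_right mult.assoc[symmetric] mult.commute[of r] simp del: mult.assoc)

context hopf_calc_bij
begin

lemma double_op_sum:
  "double_op (\<lambda>v h x z. \<Sum>i\<in>I. G i v h x z) = (\<lambda>v h x z. \<Sum>i\<in>I. double_op (G i) v h x z)"
  by (intro ext) (simp only: double_op_def sw_sum)

lemma double_power_sum:
  "(double_op ^^ n) (\<lambda>v h x z. \<Sum>i\<in>I. G i v h x z) = (\<lambda>v h x z. \<Sum>i\<in>I. (double_op ^^ n) (G i) v h x z)"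
  by (induction n) (simp_all add: double_op_sum)

lemma eq4_double_power: "eq4 F G \<Longrightarrow> eq4 ((double_op ^^ n) F) ((double_op ^^ n) G)"
  by (induction n) (simp_all add: eq4_double)

end

context fd_hopf
begin

abbreviation "D \<equiv> tensor_product K A H"
abbreviation "DD \<equiv> drinfeld_double K H"
abbreviation "pt \<equiv> pair_tensor K A H"

sublocale Dp: pair_pres K A H
  by (intro pair_pres.intro dual_module V.module_axioms)

lemma D_module: "module K D" by (rule Dp.module_tensor_product)

lemma pt_hom:
  "h \<in> carrier H \<Longrightarrow> (\<lambda>f. pt f h) \<in> module_hom K A D" "f \<in> carrier A \<Longrightarrow> pt f \<in> module_hom K H D"
  and pt_in: "\<lbrakk>f \<in> carrier A; h \<in> carrier H\<rbrakk> \<Longrightarrow> pt f h \<in> carrier D"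
  using bimD[OF Dp.pair_tensor_bim] by auto

text \<open>The translate of \<open>g\<close> by the outer legs of \<open>h\<close> in the product
  of the double, one of them through the inverse antipode.\<close>

definition dual_conj where "dual_conj g c a = (\<lambda>x\<in>carrier H. g (Si c \<otimes>\<^bsub>H\<^esub> x \<otimes>\<^bsub>H\<^esub> a))"

lemma dual_conj_in:
  "\<lbrakk>g \<in> carrier A; c \<in> carrier H; a \<in> carrier H\<rbrakk> \<Longrightarrow> dual_conj g c a \<in> carrier A"
  unfolding dual_conj_def
  by (intro dual_restrict module_hom_comp[OF module_hom_comp[OF mult_hom(2) mult_hom(1)] dual_hom] Si_in_carrier)

lemma dual_conj_hom:
  "\<lbrakk>c \<in> carrier H; a \<in> carrier H\<rbrakk> \<Longrightarrow> (\<lambda>g. dual_conj g c a) \<in> module_hom K A A"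
  "\<lbrakk>g \<in> carrier A; a \<in> carrier H\<rbrakk> \<Longrightarrow> (\<lambda>c. dual_conj g c a) \<in> module_hom K H A"
  "\<lbrakk>g \<in> carrier A; c \<in> carrier H\<rbrakk> \<Longrightarrow> (\<lambda>a. dual_conj g c a) \<in> module_hom K H A"
proof -
  show "(\<lambda>g. dual_conj g c a) \<in> module_hom K A A" if "c \<in> carrier H" "a \<in> carrier H"
    by (rule dual_homI[OF dual_module]) (simp_all add: that dual_conj_in, simp add: dual_conj_def that dual_ev Si_in_carrier)
  show "(\<lambda>c. dual_conj g c a) \<in> module_hom K H A" if "g \<in> carrier A" "a \<in> carrier H"
    by (rule dual_homI[OF V.module_axioms])
      (simp_all add: that dual_conj_in,
       simp add: dual_conj_def that module_hom_comp[OF Si_hom module_hom_comp[OF mult_hom(1) module_hom_comp[OF mult_hom(1) dual_hom]]])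
  show "(\<lambda>a. dual_conj g c a) \<in> module_hom K H A" if "g \<in> carrier A" "c \<in> carrier H"
    by (rule dual_homI[OF V.module_axioms])
      (simp_all add: that dual_conj_in,
       simp add: dual_conj_def that module_hom_comp[OF mult_hom(2) dual_hom] Si_in_carrier)
qed

lemma comult_2_hom: "comult_n K H 2 \<in> module_hom K H (tensor_space K 2 H)"
  using comult_n_hom[of 1] by (simp only: Suc_1)

lemma comult_3_hom: "comult_n K H 3 \<in> module_hom K H (tensor_space K 3 H)"
proof -
  have "(3::nat) = Suc 2" by simp
  then show ?thesis using comult_n_hom[of 2] by (simp only:)
qed

text \<open>The product of the pure tensors f \<otimes> h and g \<otimes> y. Giving it a name
  separates the innermost of the three nested \<open>lift\<close>s in the product of the
  double.\<close>

definition pure_mult where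
  "pure_mult f h g y = lift K D (\<lambda>hs. pt (f \<otimes>\<^bsub>A\<^esub> dual_conj g (hs ! 2) (hs ! 0)) (hs ! 1 \<otimes>\<^bsub>H\<^esub> y)) (comult_n K H 3 h)"

lemma pure_mult_mlin:
  assumes "f \<in> carrier A" "g \<in> carrier A" "y \<in> carrier H"
  shows "mlin K 3 H D (\<lambda>hs. pt (f \<otimes>\<^bsub>A\<^esub> dual_conj g (hs ! 2) (hs ! 0)) (hs ! 1 \<otimes>\<^bsub>H\<^esub> y))"
proof (rule mlin_3I)
  note m = dual_mult_hom(2)[OF assms(1)]
  show "(\<lambda>a. pt (f \<otimes>\<^bsub>A\<^esub> dual_conj g c a) (b \<otimes>\<^bsub>H\<^esub> y)) \<in> module_hom K H D" if "b \<in> carrier H" "c \<in> carrier H" for b c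
    by (rule module_hom_comp[OF dual_conj_hom(3) module_hom_comp[OF m pt_hom(1)]]) (simp_all add: assms that)
  show "(\<lambda>c. pt (f \<otimes>\<^bsub>A\<^esub> dual_conj g c a) (b \<otimes>\<^bsub>H\<^esub> y)) \<in> module_hom K H D" if "a \<in> carrier H" "b \<in> carrier H" for a b
    by (rule module_hom_comp[OF dual_conj_hom(2) module_hom_comp[OF m pt_hom(1)]]) (simp_all add: assms that)
  show "(\<lambda>b. pt (f \<otimes>\<^bsub>A\<^esub> dual_conj g c a) (b \<otimes>\<^bsub>H\<^esub> y)) \<in> module_hom K H D" if "a \<in> carrier H" "c \<in> carrier H" for a c
    by (rule module_hom_comp[OF mult_hom(1) pt_hom(2)]) (simp_all add: assms that dual_mult_in dual_conj_in)
qed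

lemma pure_mult_bim:
  "\<lbrakk>f \<in> carrier A; h \<in> carrier H\<rbrakk> \<Longrightarrow> bim K A H D (pure_mult f h)"
  "\<lbrakk>g \<in> carrier A; y \<in> carrier H\<rbrakk> \<Longrightarrow> bim K A H D (\<lambda>f h. pure_mult f h g y)"
proof -
  note V = V.module_axioms
  note c = module_hom_in[OF comult_3_hom]
  show "bim K A H D (pure_mult f h)" if f: "f \<in> carrier A" and h: "h \<in> carrier H"
  proof (rule bimI)
    show "(\<lambda>g. pure_mult f h g y) \<in> module_hom K A D" if y: "y \<in> carrier H" for y
      unfolding pure_mult_def
    proof (rule lift_tensor_param[OF V dual_module D_module pure_mult_mlin[OF f _ y] _ c[OF h]])
      fix xs assume "xs \<in> vectors 3 H"
      then show "(\<lambda>g. pt (f \<otimes>\<^bsub>A\<^esub> dual_conj g (xs ! 2) (xs ! 0)) (xs ! 1 \<otimes>\<^bsub>H\<^esub> y)) \<in> module_hom K A D"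
        by (intro module_hom_comp[OF dual_conj_hom(1) module_hom_comp[OF dual_mult_hom(2)[OF f] pt_hom(1)]])
          (auto simp: vectors_3 y)
    qed
    show "(\<lambda>y. pure_mult f h g y) \<in> module_hom K H D" if g: "g \<in> carrier A" for g
      unfolding pure_mult_def
    proof (rule lift_tensor_param[OF V V D_module pure_mult_mlin[OF f g] _ c[OF h]])
      fix xs assume "xs \<in> vectors 3 H"
      then show "(\<lambda>y. pt (f \<otimes>\<^bsub>A\<^esub> dual_conj g (xs ! 2) (xs ! 0)) (xs ! 1 \<otimes>\<^bsub>H\<^esub> y)) \<in> module_hom K H D"
        by (intro module_hom_comp[OF mult_hom(2) pt_hom(2)]) (auto simp: vectors_3 f g dual_mult_in dual_conj_in)
    qed
  qed
  show "bim K A H D (\<lambda>f h. pure_mult f h g y)" if g: "g \<in> carrier A" and y: "y \<in> carrier H"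
  proof (rule bimI)
    show "(\<lambda>f. pure_mult f h g y) \<in> module_hom K A D" if h: "h \<in> carrier H" for h
      unfolding pure_mult_def
    proof (rule lift_tensor_param[OF V dual_module D_module pure_mult_mlin[OF _ g y] _ c[OF h]])
      fix xs assume "xs \<in> vectors 3 H"
      then show "(\<lambda>f. pt (f \<otimes>\<^bsub>A\<^esub> dual_conj g (xs ! 2) (xs ! 0)) (xs ! 1 \<otimes>\<^bsub>H\<^esub> y)) \<in> module_hom K A D"
        by (intro module_hom_comp[OF dual_mult_hom(1) pt_hom(1)]) (auto simp: vectors_3 g y dual_conj_in)
    qed
    show "(\<lambda>h. pure_mult f h g y) \<in> module_hom K H D" if f: "f \<in> carrier A" for f
      unfolding pure_mult_def
      by (rule module_hom_comp[OF comult_3_hom lift_tensor_hom[OF V D_module pure_mult_mlin[OF f g y]]])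
  qed
qed

abbreviation "lmult f h Y \<equiv> lift K D (\<lambda>(g, y). pure_mult f h g y) Y"

lemma lmult_bim: "Y \<in> carrier D \<Longrightarrow> bim K A H D (\<lambda>f h. lmult f h Y)"
  by (rule bimI; rule Dp.lift_pair_param[OF _ D_module pure_mult_bim(1)])
    (auto simp: dual_module V.module_axioms intro: bimD(1)[OF pure_mult_bim(2)] bimD(2)[OF pure_mult_bim(2)])

text \<open>The second leg \<open>b\<close> of the dual coproduct comes first, because the double
  uses the co-opposite dual.\<close>

abbreviation "pure_comult a b h \<equiv> lift K (tensor_space K 2 D) (\<lambda>hs. tensor K D [pt b (hs ! 0), pt a (hs ! 1)]) (comult H h)"

lemma pure_comult_bi2: "\<lbrakk>a \<in> carrier A; b \<in> carrier A\<rbrakk> \<Longrightarrow> bi2 K H (tensor_space K 2 D) (\<lambda>u v. tensor K D [pt b u, pt a v])"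
  by (rule bi2_pre[OF tensor_bi2[OF D_module] pt_hom(2) pt_hom(2)])

lemma pure_comult_hom:
  "h \<in> carrier H \<Longrightarrow> bi2 K A (tensor_space K 2 D) (\<lambda>a b. pure_comult a b h)"
  "\<lbrakk>a \<in> carrier A; b \<in> carrier A\<rbrakk> \<Longrightarrow> (\<lambda>h. pure_comult a b h) \<in> module_hom K H (tensor_space K 2 D)"
proof -
  note T = module_tensor_space[OF D_module]
  have t: "(\<lambda>X. tensor K D [X, Y]) \<in> module_hom K D (tensor_space K 2 D)" "(\<lambda>X. tensor K D [Y, X]) \<in> module_hom K D (tensor_space K 2 D)"
    if "Y \<in> carrier D" for Y
    using tensor_bi2[OF D_module] that by (auto simp: bi2_def)
  show "bi2 K A (tensor_space K 2 D) (\<lambda>a b. pure_comult a b h)" if h: "h \<in> carrier H"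
    unfolding bi2_def
  proof (intro conjI ballI)
    fix b assume b: "b \<in> carrier A"
    show "(\<lambda>a. pure_comult a b h) \<in> module_hom K A (tensor_space K 2 D)"
      by (rule lift_tensor_param[OF V.module_axioms dual_module T bi2_mlin[OF pure_comult_bi2[OF _ b]] _ comult_in[OF h]])
        (auto simp: vectors_2 b pt_in intro!: module_hom_comp[OF pt_hom(1) t(2)])
    show "(\<lambda>a. pure_comult b a h) \<in> module_hom K A (tensor_space K 2 D)"
      by (rule lift_tensor_param[OF V.module_axioms dual_module T bi2_mlin[OF pure_comult_bi2[OF b]] _ comult_in[OF h]])
        (auto simp: vectors_2 b pt_in intro!: module_hom_comp[OF pt_hom(1) t(1)])
  qed
  show "(\<lambda>h. pure_comult a b h) \<in> module_hom K H (tensor_space K 2 D)" if "a \<in> carrier A" "b \<in> carrier A"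
    by (rule module_hom_comp[OF comult_linear lift_tensor_hom[OF V.module_axioms T bi2_mlin[OF pure_comult_bi2[OF that]]]])
qed

abbreviation "dcomult f h \<equiv> lift K (tensor_space K 2 D) (\<lambda>fs. pure_comult (fs ! 0) (fs ! 1) h) (comult A f)"

lemma dcomult_bim: "bim K A H (tensor_space K 2 D) dcomult"
proof (rule bimI)
  note T = module_tensor_space[OF D_module]
  show "(\<lambda>f. dcomult f h) \<in> module_hom K A (tensor_space K 2 D)" if "h \<in> carrier H" for h
    by (rule module_hom_comp[OF dual_comult_hom lift_tensor_hom[OF dual_module T bi2_mlin[OF pure_comult_hom(1)[OF that]]]])
  show "(\<lambda>h. dcomult f h) \<in> module_hom K H (tensor_space K 2 D)" if "f \<in> carrier A" for f
    by (rule lift_tensor_param[OF dual_module V.module_axioms T bi2_mlin[OF pure_comult_hom(1)] _ dual_comult(1)[OF that]])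
      (auto simp: vectors_2 intro!: pure_comult_hom(2)[unfolded One_nat_def])
qed

lemma double_simps:
  "carrier DD = carrier D" "X \<otimes>\<^bsub>DD\<^esub> Y = lift K D (\<lambda>(f, h). lmult f h Y) X"
  "\<one>\<^bsub>DD\<^esub> = pt \<one>\<^bsub>A\<^esub> \<one>\<^bsub>H\<^esub>"
  "comult DD = lift K (tensor_space K 2 D) (\<lambda>(f, h). dcomult f h)"
  "counit DD = lift K (scalars K) (\<lambda>(f, h). f \<one>\<^bsub>H\<^esub> \<otimes>\<^bsub>K\<^esub> counit H h)"
  by (simp_all add: drinfeld_double_def Let_def inv_antipode pure_mult_def dual_conj_def dual_simps(7))

lemma same_space_double: "same_space D DD"
  by (simp add: same_space_def drinfeld_double_def Let_def)

lemma double_mult_bi2: "bi2 K D D (\<otimes>\<^bsub>DD\<^esub>)"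
  unfolding bi2_def double_simps
  by (intro conjI ballI Dp.lift_pair_hom[OF D_module lmult_bim]
     Dp.lift_pair_param[OF D_module D_module lmult_bim Dp.lift_pair_hom[OF D_module pure_mult_bim(1)]])

sublocale DD: sweedler_struct K DD
proof (intro sweedler_struct.intro)
  note s = same_space_double
  show "module K DD" by (rule same_space_module[OF s D_module])
  show "bi2 K DD DD (\<otimes>\<^bsub>DD\<^esub>)" using double_mult_bi2 by (simp add: bi2_def same_space_hom[OF s] same_space_hom(1)[OF s] double_simps(1))
  show "comult DD \<in> module_hom K DD (tensor_space K 2 DD)"
    using Dp.lift_pair_hom[OF module_tensor_space[OF D_module] dcomult_bim]
    by (simp add: same_space_hom[OF s] same_space_tensor_space[OF s] double_simps(4))
qed

lemma double_mult_pure: "\<lbrakk>f \<in> carrier A; h \<in> carrier H; Y \<in> carrier D\<rbrakk> \<Longrightarrow> pt f h \<otimes>\<^bsub>DD\<^esub> Y = lmult f h Y"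
  unfolding double_simps by (rule Dp.lift_pair[OF D_module lmult_bim])

lemma double_mult_in: "\<lbrakk>X \<in> carrier D; Y \<in> carrier D\<rbrakk> \<Longrightarrow> X \<otimes>\<^bsub>DD\<^esub> Y \<in> carrier D"
  using double_mult_bi2 by (auto simp: bi2_def intro: module_hom_in)

text \<open>In coordinates, the coproduct of f \<otimes> h is the sum of (E i \<otimes> h_(1))
  \<otimes> (shift f (e i) \<otimes> h_(2)). The dual basis vector lands in the first factor because
  of the co-opposite coproduct.\<close>

lemma lift_double_comult:
  assumes B: "bi2 K D R B" and f: "f \<in> carrier A" and h: "h \<in> carrier H"
  shows "lift K R (\<lambda>Xs. B (Xs ! 0) (Xs ! 1)) (comult DD (pt f h)) = (\<Sum>i<d. sw h (\<lambda>a b. B (pt (E i) a) (pt (shift f (e i)) b)))"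
proof -
  note T = module_tensor_space[OF D_module]
  let ?g = "lift K R (\<lambda>Xs. B (Xs ! 0) (Xs ! 1))"
  have g: "?g \<in> module_hom K (tensor_space K 2 D) R" by (rule lift_tensor_hom[OF D_module R_module bi2_mlin[OF B]])
  have "comult DD (pt f h) = dcomult f h"
    unfolding double_simps(4) by (rule Dp.lift_pair[OF T dcomult_bim f h])
  then have "?g (comult DD (pt f h)) = lift K R (\<lambda>fs. ?g (pure_comult (fs ! 0) (fs ! 1) h)) (comult A f)"
    using lift_tensor_comp[OF dual_module T R_module g bi2_mlin[OF pure_comult_hom(1)[OF h]] dual_comult(1)[OF f]] by simp
  also have "\<dots> = Af.tsw (Af.comp (comult A f)) (\<lambda>a b. ?g (pure_comult a b h))"
    by (rule Af.lift_bil[OF _ dual_comult(1)[OF f]]) (unfold Af.bil_bi2, rule bi2_post[OF pure_comult_hom(1)[OF h] g])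
  also have "\<dots> = (\<Sum>i<d. ?g (pure_comult (shift f (e i)) (E i) h))"
    by (simp add: Af.tsw_def dual_comult(2)[OF f])
  also have "\<dots> = (\<Sum>i<d. sw h (\<lambda>a b. B (pt (E i) a) (pt (shift f (e i)) b)))"
  proof (rule sum.cong[OF refl])
    fix i assume "i \<in> {..<d}"
    then have i: "i < d" by simp
    have s: "shift f (e i) \<in> carrier A" using i by (simp add: shift_in f)
    have F: "bil (\<lambda>a b. B (pt (E i) a) (pt (shift f (e i)) b))"
      unfolding bil_bi2 by (rule bi2_pre[OF B pt_hom(2)[OF E_in[OF i]] pt_hom(2)[OF s]])
    have "?g (pure_comult (shift f (e i)) (E i) h) = lift K R (\<lambda>hs. ?g (tensor K D [pt (E i) (hs ! 0), pt (shift f (e i)) (hs ! 1)])) (comult H h)"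
      by (rule lift_tensor_comp[OF V.module_axioms T R_module g bi2_mlin[OF pure_comult_bi2[OF s E_in[OF i]]] comult_in[OF h]])
    also have "\<dots> = lift K R (\<lambda>hs. B (pt (E i) (hs ! 0)) (pt (shift f (e i)) (hs ! 1))) (comult H h)"
      by (rule lift_tensor_cong[OF V.module_axioms R_module bil_mlin[OF F] _ comult_in[OF h], symmetric])
        (use lift_tensor[OF D_module R_module bi2_mlin[OF B]] in \<open>auto simp: vectors_2 pt_in s E_in[OF i]\<close>)
    also have "\<dots> = sw h (\<lambda>a b. B (pt (E i) a) (pt (shift f (e i)) b))"
      using lift_comult[OF F h] by (simp add: sw_def tsw_def)
    finally show "?g (pure_comult (shift f (e i)) (E i) h) = sw h (\<lambda>a b. B (pt (E i) a) (pt (shift f (e i)) b))" .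
  qed
  finally show ?thesis .
qed

lemma lift_comult_2:
  assumes F: "bil F" and a: "a \<in> carrier H"
  shows "lift K R (\<lambda>xs. F (xs ! 0) (xs ! 1)) (comult_n K H 2 a) = sw a F"
proof -
  note V = V.module_axioms
  have m: "mlin K (1 + 1) H R (\<lambda>xs. F (xs ! 0) (xs ! 1))" using bil_mlin[OF F] by (simp only: one_add_one)
  have f: "comult_n K H (Suc 0) \<in> module_hom K H (tensor_space K 1 H)" using comult_n_hom[of 0] by simp
  have "comult_n K H 2 a = tensor_left K H 1 (comult_n K H (Suc 0)) (comult H a)"
    by (simp add: numeral_2_eq_2)
  then have "lift K R (\<lambda>xs. F (xs ! 0) (xs ! 1)) (comult_n K H 2 a)
    = lift K R (\<lambda>xs. lift K R (\<lambda>ys. F ((ys @ [xs ! 1]) ! 0) ((ys @ [xs ! 1]) ! 1)) (tensor K H [xs ! 0])) (comult H a)"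
    using lift_tensor_left[OF V f comult_in[OF a] R_module m] by simp
  also have "\<dots> = lift K R (\<lambda>xs. F (xs ! 0) (xs ! 1)) (comult H a)"
  proof (rule lift_tensor_cong[OF V R_module bil_mlin[OF F] _ comult_in[OF a], symmetric])
    fix xs assume "xs \<in> vectors 2 H"
    then obtain p q where pq: "p \<in> carrier H" "q \<in> carrier H" "xs = [p, q]" by (auto simp: vectors_2)
    have v: "[q] \<in> vectors 1 H" "[p] \<in> vectors 1 H" using pq by (simp_all add: vectors_def)
    have "mlin K 1 H R (\<lambda>ys. F ((ys @ [q]) ! 0) ((ys @ [q]) ! 1))"
      unfolding mlin_def using bilD(1)[OF F lop_id pq(2)] module_hom_in
      by (auto simp: vectors_1 lin_iff simp del: uring_module_simps)
    from lift_tensor[OF V R_module this v(2)]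
    show "F (xs ! 0) (xs ! 1) = lift K R (\<lambda>ys. F ((ys @ [xs ! 1]) ! 0) ((ys @ [xs ! 1]) ! 1)) (tensor K H [xs ! 0])"
      by (simp add: pq)
  qed
  also have "\<dots> = sw a F" using lift_comult[OF F a] by (simp add: sw_def tsw_def)
  finally show ?thesis .
qed

lemma lift_comult_3:
  assumes T: "tri T" and h: "h \<in> carrier H"
  shows "lift K R (\<lambda>xs. T (xs ! 0) (xs ! 1) (xs ! 2)) (comult_n K H 3 h) = sw h (\<lambda>a b. sw a (\<lambda>p q. T p q b))"
proof -
  note V = V.module_axioms
  note L = lin_intros triD[OF T]
  have m: "mlin K (2 + 1) H R (\<lambda>xs. T (xs ! 0) (xs ! 1) (xs ! 2))"
    unfolding two_plus_one by (rule tri_mlin[OF T])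
  have G: "bil (\<lambda>a b. sw a (\<lambda>p q. T p q b))" by (auto intro!: L)
  have "comult_n K H 3 h = tensor_left K H 2 (comult_n K H 2) (comult H h)"
    by (simp only: numeral_3_eq_3 comult_n.simps(3)) (simp only: Suc_1[symmetric] One_nat_def)
  then have "lift K R (\<lambda>xs. T (xs ! 0) (xs ! 1) (xs ! 2)) (comult_n K H 3 h)
    = lift K R (\<lambda>xs. lift K R (\<lambda>ys. T ((ys @ [xs ! 1]) ! 0) ((ys @ [xs ! 1]) ! 1) ((ys @ [xs ! 1]) ! 2)) (comult_n K H 2 (xs ! 0))) (comult H h)"
    using lift_tensor_left[OF V comult_2_hom comult_in[OF h] R_module m] by (simp only:)
  also have "\<dots> = lift K R (\<lambda>xs. sw (xs ! 0) (\<lambda>p q. T p q (xs ! 1))) (comult H h)"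
  proof (rule lift_tensor_cong[OF V R_module bil_mlin[OF G] _ comult_in[OF h], symmetric])
    fix xs assume "xs \<in> vectors 2 H"
    then obtain a b where ab: "a \<in> carrier H" "b \<in> carrier H" "xs = [a, b]" by (auto simp: vectors_2)
    have F: "bil (\<lambda>p q. T p q b)" using ab by (auto intro!: L)
    have "lift K R (\<lambda>ys. T ((ys @ [b]) ! 0) ((ys @ [b]) ! 1) ((ys @ [b]) ! 2)) (comult_n K H 2 a) = lift K R (\<lambda>ys. T (ys ! 0) (ys ! 1) b) (comult_n K H 2 a)"
      by (rule lift_tensor_cong[OF V R_module bil_mlin[OF F] _ module_hom_in[OF comult_2_hom ab(1)], symmetric]) (auto simp: vectors_2)
    also have "\<dots> = sw a (\<lambda>p q. T p q b)" by (rule lift_comult_2[OF F ab(1)])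
    finally show "sw (xs ! 0) (\<lambda>p q. T p q (xs ! 1)) =
       lift K R (\<lambda>ys. T ((ys @ [xs ! 1]) ! 0) ((ys @ [xs ! 1]) ! 1) ((ys @ [xs ! 1]) ! 2)) (comult_n K H 2 (xs ! 0))"
      by (simp add: ab)
  qed
  also have "\<dots> = sw h (\<lambda>a b. sw a (\<lambda>p q. T p q b))" using lift_comult[OF G h] by (simp add: sw_def tsw_def)
  finally show ?thesis .
qed

end

section \<open>Sweedler powers of the double as powers of \<open>double_op\<close>\<close>

context fd_hopf
begin

text \<open>A linear functional on the double: the dual part is evaluated at \<open>x\<close> and
  the part in H by \<phi>. The extra left factor \<open>z\<close> collects the legs of
  \<open>h\<close> that come from the factors already multiplied off.\<close>

definition ev where
  "ev Y \<phi> x z = lift K R (\<lambda>(g, y). emb K (g x) * \<phi> (z \<otimes>\<^bsub>H\<^esub> y)) Y"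

lemma ev_bim:
  assumes \<phi>: "lin \<phi>" and x: "x \<in> carrier H" and z: "z \<in> carrier H"
  shows "bim K A H R (\<lambda>g y. emb K (g x) * \<phi> (z \<otimes>\<^bsub>H\<^esub> y))"
  by (rule bimI)
    (intro uring_hom_mult module_hom_comp[OF dual_ev[OF x] emb_hom[OF V.R.is_cring]] module_hom_comp[OF mult_hom(2)[OF z] lin_hom[OF \<phi>]])+

lemma ev_hom: "\<lbrakk>lin \<phi>; x \<in> carrier H; z \<in> carrier H\<rbrakk> \<Longrightarrow> (\<lambda>Y. ev Y \<phi> x z) \<in> module_hom K D R"
  unfolding ev_def by (rule Dp.lift_pair_hom[OF R_module ev_bim])

lemma ev_pure:
  "\<lbrakk>lin \<phi>; x \<in> carrier H; z \<in> carrier H; g \<in> carrier A; y \<in> carrier H\<rbrakk> \<Longrightarrow> ev (pt g y) \<phi> x z = emb K (g x) * \<phi> (z \<otimes>\<^bsub>H\<^esub> y)"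
  unfolding ev_def by (rule Dp.lift_pair[OF R_module ev_bim])

lemma ev_lin:
  assumes \<phi>: "lin \<phi>" and Y: "Y \<in> carrier D" and t: "lop t"
  shows "z \<in> carrier H \<Longrightarrow> lin (\<lambda>x. ev Y \<phi> (t x) z)" "x \<in> carrier H \<Longrightarrow> lin (\<lambda>z. ev Y \<phi> x (t z))"
proof -
  show "lin (\<lambda>x. ev Y \<phi> (t x) z)" if z: "z \<in> carrier H"
  proof (rule lin_app[OF _ t], unfold lin_iff ev_def, rule Dp.lift_pair_param[OF V.module_axioms R_module ev_bim[OF \<phi> _ z] _ Y])
    show "(\<lambda>x. emb K (g x) * \<phi> (z \<otimes>\<^bsub>H\<^esub> y)) \<in> module_hom K H R" if "g \<in> carrier A" for g y
      by (rule uring_hom_mult[OF dual_lin[OF that, unfolded lin_iff]])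
  qed
  show "lin (\<lambda>z. ev Y \<phi> x (t z))" if x: "x \<in> carrier H"
  proof (rule lin_app[OF _ t], unfold lin_iff ev_def, rule Dp.lift_pair_param[OF V.module_axioms R_module ev_bim[OF \<phi> x] _ Y])
    show "(\<lambda>z. emb K (g x) * \<phi> (z \<otimes>\<^bsub>H\<^esub> y)) \<in> module_hom K H R" if "y \<in> carrier H" for g y
      by (intro uring_hom_mult module_hom_comp[OF mult_hom(1)[OF that] lin_hom[OF \<phi>]])
  qed
qed

definition adj_ev where
  "adj_ev Y \<phi> b x z = sw b (\<lambda>a c. sw a (\<lambda>p q. ev Y \<phi> (Si c \<otimes>\<^bsub>H\<^esub> x \<otimes>\<^bsub>H\<^esub> p) (z \<otimes>\<^bsub>H\<^esub> q)))"

lemma adj_ev_lin: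
  assumes \<phi>: "lin \<phi>" and Y: "Y \<in> carrier D" and t: "lop t"
  shows "\<lbrakk>x \<in> carrier H; z \<in> carrier H\<rbrakk> \<Longrightarrow> lin (\<lambda>b. adj_ev Y \<phi> (t b) x z)"
    "\<lbrakk>b \<in> carrier H; z \<in> carrier H\<rbrakk> \<Longrightarrow> lin (\<lambda>x. adj_ev Y \<phi> b (t x) z)"
    "\<lbrakk>b \<in> carrier H; x \<in> carrier H\<rbrakk> \<Longrightarrow> lin (\<lambda>z. adj_ev Y \<phi> b x (t z))"
  unfolding adj_ev_def using t by (auto intro!: lin_intros3 ev_lin[OF \<phi> Y])

text \<open>Left multiplication by f \<otimes> h, transposed. Convolution in the dual splits
  \<open>x\<close> into a leg for \<open>f\<close> and a leg for the rest; the product formula of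
  the double turns that rest into \<open>adj_ev\<close>.\<close>

lemma ev_lmult:
  assumes \<phi>: "lin \<phi>" and f: "f \<in> carrier A" and [simp]: "h \<in> carrier H" and Y: "Y \<in> carrier D"
    and [simp]: "x \<in> carrier H" "z \<in> carrier H"
  shows "ev (lmult f h Y) \<phi> x z = sw x (\<lambda>x1 x2. emb K (f x1) * adj_ev Y \<phi> h x2 z)"
proof (rule Dp.pair_hom_eqI[OF R_module _ _ _ Y])
  show "(\<lambda>Y. ev (lmult f h Y) \<phi> x z) \<in> module_hom K D R"
    by (rule module_hom_comp[OF Dp.lift_pair_hom[OF D_module pure_mult_bim(1)] ev_hom[OF \<phi>]]) (simp_all add: f)
  have "(\<lambda>Y. \<Sum>i<d. emb K (f (Dl i x)) * (\<Sum>j<d. \<Sum>l<d. ev Y \<phi> (Si (e j) \<otimes>\<^bsub>H\<^esub> e i \<otimes>\<^bsub>H\<^esub> Dl l (Dl j h)) (z \<otimes>\<^bsub>H\<^esub> e l))) \<in> module_hom K D R"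
    by (intro hom_sum_uring uring_hom_mult ev_hom \<phi>) (auto intro!: lop_in[OF lop_Dl])
  then show "(\<lambda>Y. sw x (\<lambda>x1 x2. emb K (f x1) * adj_ev Y \<phi> h x2 z)) \<in> module_hom K D R"
    by (simp only: adj_ev_def sw_def tsw_def)
next
  fix g y assume g: "g \<in> carrier A" and y [simp]: "y \<in> carrier H"
  note L = lin_intros3 lin_app[OF \<phi>] lin_app[OF dual_lin[OF f]] lin_app[OF dual_lin[OF g]]
  let ?T = "\<lambda>a q c. sw x (\<lambda>x1 x2. emb K (f x1) * emb K (g (Si c \<otimes>\<^bsub>H\<^esub> x2 \<otimes>\<^bsub>H\<^esub> a))) * \<phi> (z \<otimes>\<^bsub>H\<^esub> (q \<otimes>\<^bsub>H\<^esub> y))"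
  have T: "tri ?T" by (auto intro!: L)
  have "ev (lmult f h (pt g y)) \<phi> x z = ev (pure_mult f h g y) \<phi> x z"
    by (simp add: Dp.lift_pair[OF D_module pure_mult_bim(1)] f g)
  also have "\<dots> = lift K R (\<lambda>hs. ev (pt (f \<otimes>\<^bsub>A\<^esub> dual_conj g (hs ! 2) (hs ! 0)) (hs ! 1 \<otimes>\<^bsub>H\<^esub> y)) \<phi> x z) (comult_n K H 3 h)"
    unfolding pure_mult_def
    by (rule lift_tensor_comp[OF V.module_axioms D_module R_module ev_hom[OF \<phi>] pure_mult_mlin[OF f g y] module_hom_in[OF comult_3_hom]]) simp_all
  also have "\<dots> = lift K R (\<lambda>hs. ?T (hs ! 0) (hs ! 1) (hs ! 2)) (comult_n K H 3 h)"
  proof (rule lift_tensor_cong[OF V.module_axioms R_module tri_mlin[OF T] _ module_hom_in[OF comult_3_hom], symmetric])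
    fix hs assume "hs \<in> vectors 3 H"
    then obtain a q c where v: "a \<in> carrier H" "q \<in> carrier H" "c \<in> carrier H" "hs = [a, q, c]" by (auto simp: vectors_3)
    have "emb K ((f \<otimes>\<^bsub>A\<^esub> dual_conj g c a) x) = sw x (\<lambda>x1 x2. emb K (f x1) * emb K (dual_conj g c a x2))"
      by (rule emb_dual_mult) (simp_all add: f g v dual_conj_in)
    also have "\<dots> = sw x (\<lambda>x1 x2. emb K (f x1) * emb K (g (Si c \<otimes>\<^bsub>H\<^esub> x2 \<otimes>\<^bsub>H\<^esub> a)))"
      by (intro sw_cong') (simp_all add: dual_conj_def)
    finally show "?T (hs ! 0) (hs ! 1) (hs ! 2) = ev (pt (f \<otimes>\<^bsub>A\<^esub> dual_conj g (hs ! 2) (hs ! 0)) (hs ! 1 \<otimes>\<^bsub>H\<^esub> y)) \<phi> x z"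
      by (simp add: v ev_pure \<phi> f g dual_mult_in dual_conj_in)
  qed simp
  also have "\<dots> = sw h (\<lambda>a c. sw a (\<lambda>p q. ?T p q c))" by (rule lift_comult_3[OF T]) simp
  also have "\<dots> = sw h (\<lambda>a c. sw a (\<lambda>p q. sw x (\<lambda>x1 x2. emb K (f x1) * (emb K (g (Si c \<otimes>\<^bsub>H\<^esub> x2 \<otimes>\<^bsub>H\<^esub> p)) * \<phi> (z \<otimes>\<^bsub>H\<^esub> (q \<otimes>\<^bsub>H\<^esub> y))))))"
    by (simp only: sw_multc[symmetric] mult.assoc)
  also have "\<dots> = sw x (\<lambda>x1 x2. sw h (\<lambda>a c. sw a (\<lambda>p q. emb K (f x1) * (emb K (g (Si c \<otimes>\<^bsub>H\<^esub> x2 \<otimes>\<^bsub>H\<^esub> p)) * \<phi> (z \<otimes>\<^bsub>H\<^esub> (q \<otimes>\<^bsub>H\<^esub> y))))))"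
    by (simp only: sw_swap[of _ x])
  also have "\<dots> = sw x (\<lambda>x1 x2. sw h (\<lambda>a c. sw a (\<lambda>p q. emb K (f x1) * ev (pt g y) \<phi> (Si c \<otimes>\<^bsub>H\<^esub> x2 \<otimes>\<^bsub>H\<^esub> p) (z \<otimes>\<^bsub>H\<^esub> q))))"
    by (intro sw_cong') (simp_all add: ev_pure \<phi> g mult_assoc)
  also have "\<dots> = sw x (\<lambda>x1 x2. emb K (f x1) * adj_ev (pt g y) \<phi> h x2 z)"
    by (simp only: sw_cmult adj_ev_def)
  finally show "ev (lmult f h (pt g y)) \<phi> x z = sw x (\<lambda>x1 x2. emb K (f x1) * adj_ev (pt g y) \<phi> h x2 z)" .
qed

text \<open>The form on which \<open>double_op\<close> is iterated: \<open>v\<close> is the point at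
  which \<open>f\<close> is evaluated, and the counit discards what is left of
  \<open>h\<close>.\<close>

definition ev_start where
  "ev_start f Y \<phi> v h x z = emb K (f v) * (ep h * ev Y \<phi> x z)"

lemma quad_ev_start:
  assumes \<phi>: "lin \<phi>" and f: "f \<in> carrier A" and Y: "Y \<in> carrier D"
  shows "quad (ev_start f Y \<phi>)"
  unfolding ev_start_def by (auto intro!: lin_intros3 ev_lin[OF \<phi> Y] lin_app[OF dual_lin[OF f]])

lemma double_op_ev_start:
  assumes \<phi>: "lin \<phi>" and f: "f \<in> carrier A" and Y: "Y \<in> carrier D"
    and [simp]: "v \<in> carrier H" "h \<in> carrier H" "x \<in> carrier H" "z \<in> carrier H"
  shows "double_op (ev_start f Y \<phi>) v h x z = sw x (\<lambda>x1 x2. emb K (f (x1 \<otimes>\<^bsub>H\<^esub> v)) * adj_ev Y \<phi> h x2 z)"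
proof -
  note L = lin_intros3 ev_lin[OF \<phi> Y]
  have "double_op (ev_start f Y \<phi>) v h x z = sw x (\<lambda>x1 x2. emb K (f (x1 \<otimes>\<^bsub>H\<^esub> v)) * sw h (\<lambda>h1 r. sw r (\<lambda>h2 r. sw r (\<lambda>h3 h4.
      ep h4 * ev Y \<phi> (Si h3 \<otimes>\<^bsub>H\<^esub> x2 \<otimes>\<^bsub>H\<^esub> h1) (z \<otimes>\<^bsub>H\<^esub> h2)))))"
    unfolding double_op_def ev_start_def by (simp only: sw_cmult)
  also have "\<dots> = sw x (\<lambda>x1 x2. emb K (f (x1 \<otimes>\<^bsub>H\<^esub> v)) * sw h (\<lambda>h1 r. sw r (\<lambda>h2 h3. ev Y \<phi> (Si h3 \<otimes>\<^bsub>H\<^esub> x2 \<otimes>\<^bsub>H\<^esub> h1) (z \<otimes>\<^bsub>H\<^esub> h2))))"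
    by (intro sw_cong' arg_cong2[of _ _ _ _ "(*)"] refl counit_right) (auto intro!: L)
  also have "\<dots> = sw x (\<lambda>x1 x2. emb K (f (x1 \<otimes>\<^bsub>H\<^esub> v)) * adj_ev Y \<phi> h x2 z)"
    unfolding adj_ev_def by (intro sw_cong' arg_cong2[of _ _ _ _ "(*)"] refl coassoc[symmetric]) (auto intro!: L)
  finally show ?thesis .
qed

text \<open>The two halves of the coproduct of \<open>f\<close> recombine. This is why a single
  argument \<open>v\<close> can record all the legs that are fed to \<open>f\<close>.\<close>

lemma sum_dual_shift:
  assumes f: "f \<in> carrier A" and v: "v \<in> carrier H" and x: "x \<in> carrier H"
  shows "(\<Sum>i<d. emb K (E i v) * emb K (shift f (e i) x)) = emb K (f (x \<otimes>\<^bsub>H\<^esub> v))"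
  using linD[OF lin_app[OF dual_lin[OF f] lop_mulr[OF lop_id x]] v] by (simp add: E_def shift_def v x)

text \<open>Induction on the number of factors. The last factor of the coproduct is absorbed into
  \<open>Y\<close>, at the cost of one \<open>double_op\<close>; the sum over the dual basis
  recombines \<open>f\<close>, and \<open>double_power_sw\<close> moves the remaining powers past
  the coproduct of \<open>h\<close>.\<close>

lemma ev_act_pow:
  assumes \<phi>: "lin \<phi>" and "f \<in> carrier A" "h \<in> carrier H" "Y \<in> carrier D" "x \<in> carrier H" "z \<in> carrier H"
  shows "ev (DD.act_pow (Suc n) (pt f h) Y) \<phi> x z = (double_op ^^ Suc n) (ev_start f Y \<phi>) \<one>\<^bsub>H\<^esub> h x z"
  using assms(2-)
proof (induction n arbitrary: f h Y x z)
  case 0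
  note h = "0.prems"
  have "ev (DD.act_pow (Suc 0) (pt f h) Y) \<phi> x z = ev (lmult f h Y) \<phi> x z"
    using DD.act_pow_1[of "pt f h" Y] by (simp add: h double_simps(1) pt_in double_mult_pure)
  also have "\<dots> = sw x (\<lambda>x1 x2. emb K (f x1) * adj_ev Y \<phi> h x2 z)" by (rule ev_lmult[OF \<phi> h])
  also have "\<dots> = sw x (\<lambda>x1 x2. emb K (f (x1 \<otimes>\<^bsub>H\<^esub> \<one>\<^bsub>H\<^esub>)) * adj_ev Y \<phi> h x2 z)" by (intro sw_cong') (simp_all add: h)
  also have "\<dots> = double_op (ev_start f Y \<phi>) \<one>\<^bsub>H\<^esub> h x z"
    by (rule double_op_ev_start[OF \<phi> h(1,3) one_in h(2,4,5), symmetric])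
  finally show ?case by simp
next
  case (Suc n)
  note f = Suc.prems(1) and [simp] = Suc.prems(2,4,5) and Y = Suc.prems(3)
  let ?op = "double_op ^^ Suc n"
  let ?B = "\<lambda>a b. DD.act_pow (Suc n) a (b \<otimes>\<^bsub>DD\<^esub> Y)"
  have B: "bi2 K D D ?B"
    using DD.act_pow_bi2[of Y n] Y by (simp add: bi2_def same_space_hom[OF same_space_double] same_space_hom(1)[OF same_space_double] double_simps(1))
  have B': "bi2 K D R (\<lambda>a b. ev (?B a b) \<phi> x z)" by (rule bi2_post[OF B ev_hom[OF \<phi>]]) simp_all
  have s: "shift f (e i) \<in> carrier A" if "i < d" for i using that by (simp add: shift_in f)
  have Yi: "lmult (shift f (e i)) b Y \<in> carrier D" if "i < d" "b \<in> carrier H" for i b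
    using double_mult_in[OF pt_in[OF s[OF that(1)] that(2)] Y] double_mult_pure[OF s[OF that(1)] that(2) Y] by simp
  \<comment> \<open>The starting form after the last factor has been absorbed into \<open>Y\<close>,
    with its leg \<open>b\<close> of \<open>h\<close> kept as a parameter and the sum over the dual
    basis already carried out.\<close>
  define \<Phi> where "\<Phi> b v h x z = ep h * sw x (\<lambda>x1 x2. emb K (f (x1 \<otimes>\<^bsub>H\<^esub> v)) * adj_ev Y \<phi> b x2 z)" for b v h x z
  have cd: "comult DD (pt f h) \<in> carrier (tensor_space K 2 D)"
    using module_hom_in[OF DD.comult] by (simp add: double_simps(1) pt_in f same_space_tensor_space[OF same_space_double])
  have "ev (DD.act_pow (Suc (Suc n)) (pt f h) Y) \<phi> x z = ev (lift K D (\<lambda>xs. ?B (xs ! 0) (xs ! 1)) (comult DD (pt f h))) \<phi> x z"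
    using DD.act_pow_Suc[of "pt f h" Y n] Y by (simp add: double_simps(1) pt_in f same_space_lift[OF same_space_double])
  also have "\<dots> = lift K R (\<lambda>xs. ev (?B (xs ! 0) (xs ! 1)) \<phi> x z) (comult DD (pt f h))"
    by (rule lift_tensor_comp[OF D_module D_module R_module ev_hom[OF \<phi>] bi2_mlin[OF B] cd]) simp_all
  also have "\<dots> = (\<Sum>i<d. sw h (\<lambda>a b. ev (?B (pt (E i) a) (pt (shift f (e i)) b)) \<phi> x z))"
    by (rule lift_double_comult[OF B' f]) simp
  also have "\<dots> = (\<Sum>i<d. sw h (\<lambda>a b. ?op (ev_start (E i) (lmult (shift f (e i)) b Y) \<phi>) \<one>\<^bsub>H\<^esub> a x z))"
  proof (intro sum.cong refl sw_cong')
    fix i a b assume "i \<in> {..<d}" and ab: "a \<in> carrier H" "b \<in> carrier H"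
    then have i: "i < d" by simp
    show "ev (?B (pt (E i) a) (pt (shift f (e i)) b)) \<phi> x z = ?op (ev_start (E i) (lmult (shift f (e i)) b Y) \<phi>) \<one>\<^bsub>H\<^esub> a x z"
      unfolding double_mult_pure[OF s[OF i] ab(2) Y]
      by (rule Suc.IH[OF E_in[OF i] ab(1) Yi[OF i ab(2)]]) simp_all
  qed simp
  also have "\<dots> = sw h (\<lambda>a b. ?op (\<lambda>v h x z. \<Sum>i<d. ev_start (E i) (lmult (shift f (e i)) b Y) \<phi> v h x z) \<one>\<^bsub>H\<^esub> a x z)"
    unfolding double_power_sum sw_sum ..
  also have "\<dots> = sw h (\<lambda>a b. ?op (\<Phi> b) \<one>\<^bsub>H\<^esub> a x z)"
  proof (intro sw_cong')
    fix a b assume ab: "a \<in> carrier H" "b \<in> carrier H"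
    have "eq4 (\<lambda>v h x z. \<Sum>i<d. ev_start (E i) (lmult (shift f (e i)) b Y) \<phi> v h x z) (\<Phi> b)"
      unfolding eq4_def
    proof (intro ballI)
      fix v h' x' z' assume c [simp]: "v \<in> carrier H" "h' \<in> carrier H" "x' \<in> carrier H" "z' \<in> carrier H"
      have "(\<Sum>i<d. ev_start (E i) (lmult (shift f (e i)) b Y) \<phi> v h' x' z')
        = (\<Sum>i<d. emb K (E i v) * (ep h' * sw x' (\<lambda>x1 x2. emb K (shift f (e i) x1) * adj_ev Y \<phi> b x2 z')))"
        unfolding ev_start_def by (intro sum.cong refl) (simp add: ev_lmult[OF \<phi> s ab(2) Y c(3,4)])
      also have "\<dots> = (\<Sum>i<d. ep h' * sw x' (\<lambda>x1 x2. (emb K (E i v) * emb K (shift f (e i) x1)) * adj_ev Y \<phi> b x2 z'))"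
        unfolding mult.assoc sw_cmult by (simp only: mult.left_commute)
      also have "\<dots> = ep h' * sw x' (\<lambda>x1 x2. (\<Sum>i<d. emb K (E i v) * emb K (shift f (e i) x1)) * adj_ev Y \<phi> b x2 z')"
        by (simp only: sum_distrib_left[symmetric] sum_distrib_right sw_sum)
      also have "\<dots> = \<Phi> b v h' x' z'"
        unfolding \<Phi>_def by (intro sw_cong' arg_cong2[of _ _ _ _ "(*)"] refl sum_dual_shift f) simp_all
      finally show "(\<Sum>i<d. ev_start (E i) (lmult (shift f (e i)) b Y) \<phi> v h' x' z') = \<Phi> b v h' x' z'" .
    qed
    from eq4_double_power[OF this, of "Suc n"] ab
    show "?op (\<lambda>v h x z. \<Sum>i<d. ev_start (E i) (lmult (shift f (e i)) b Y) \<phi> v h x z) \<one>\<^bsub>H\<^esub> a x z = ?op (\<Phi> b) \<one>\<^bsub>H\<^esub> a x z"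
      by (simp only: eq4_def) (simp del: funpow.simps)
  qed simp
  also have "\<dots> = ?op (double_op (ev_start f Y \<phi>)) \<one>\<^bsub>H\<^esub> h x z"
  proof -
    note L = lin_intros3 adj_ev_lin[OF \<phi> Y] lin_app[OF dual_lin[OF f]]
    have "eq4 (?op (double_op (ev_start f Y \<phi>))) (\<lambda>v h x z. sw h (\<lambda>a b. ?op (\<Phi> b) v a x z))"
    proof (rule double_power_sw)
      show "quad (\<Phi> b)" if "b \<in> carrier H" for b
        unfolding \<Phi>_def using that by (auto intro!: L)
      show "lin (\<lambda>b. \<Phi> (t b) v h x z)" if "lop t" "v \<in> carrier H" "h \<in> carrier H" "x \<in> carrier H" "z \<in> carrier H" for t v h x z
        unfolding \<Phi>_def using that by (auto intro!: L)
      show "eq4 (double_op (ev_start f Y \<phi>)) (\<lambda>v h x z. sw h (\<lambda>a b. \<Phi> b v a x z))"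
        unfolding eq4_def
      proof (intro ballI)
        fix v h x z assume c: "v \<in> carrier H" "h \<in> carrier H" "x \<in> carrier H" "z \<in> carrier H"
        have "sw h (\<lambda>a b. \<Phi> b v a x z) = sw x (\<lambda>x1 x2. emb K (f (x1 \<otimes>\<^bsub>H\<^esub> v)) * adj_ev Y \<phi> h x2 z)"
          unfolding \<Phi>_def by (rule counit_left) (use c in \<open>auto intro!: L\<close>)
        then show "double_op (ev_start f Y \<phi>) v h x z = sw h (\<lambda>a b. \<Phi> b v a x z)"
          by (simp only: double_op_ev_start[OF \<phi> f Y c])
      qed
    qed
    then show ?thesis by (simp add: eq4_def del: funpow.simps)
  qed
  also have "\<dots> = (double_op ^^ Suc (Suc n)) (ev_start f Y \<phi>) \<one>\<^bsub>H\<^esub> h x z"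
    by (simp only: funpow_Suc_right o_apply)
  finally show ?case .
qed

text \<open>An element is recovered from its components C i in H along the dual basis. Evaluating at
  x = e i and z = 1 gives the value of \<phi> at C i, and functionals separate points of H.\<close>

lemma double_separates:
  assumes X: "X \<in> carrier D" and Y: "Y \<in> carrier D"
    and eq: "\<And>\<phi> x z. \<lbrakk>lin \<phi>; x \<in> carrier H; z \<in> carrier H\<rbrakk> \<Longrightarrow> ev X \<phi> x z = ev Y \<phi> x z"
  shows "X = Y"
proof -
  interpret D: module K D by (rule D_module)
  have b: "bim K A H H (\<lambda>g y. g (e i) \<odot>\<^bsub>H\<^esub> y)" if i: "i < d" for i
  proof (rule bimI)
    show "(\<lambda>g. g (e i) \<odot>\<^bsub>H\<^esub> y) \<in> module_hom K A H" if "y \<in> carrier H" for y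
      by (rule module_homI) (use that i in \<open>simp_all add: dual_apply dual_in V.smult_l_distr V.smult_assoc1\<close>)
    show "(\<lambda>y. g (e i) \<odot>\<^bsub>H\<^esub> y) \<in> module_hom K H H" if "g \<in> carrier A" for g
      by (rule module_hom_scale[OF V.module_axioms module_hom_ident]) (use that i in \<open>simp add: dual_in\<close>)
  qed
  let ?C = "\<lambda>i. lift K H (\<lambda>(g, y). g (e i) \<odot>\<^bsub>H\<^esub> y)"
  note C_hom = Dp.lift_pair_hom[OF V.module_axioms b]
  have C: "?C i X = ?C i Y" if i: "i < d" for i
  proof (rule lin_separates)
    show "?C i X \<in> carrier H" "?C i Y \<in> carrier H" using module_hom_in[OF C_hom[OF i]] X Y by auto
    fix \<phi> assume \<phi>: "lin \<phi>"
    have "\<phi> (?C i X) = ev X \<phi> (e i) \<one>\<^bsub>H\<^esub>" if X: "X \<in> carrier D" for X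
      by (rule Dp.pair_hom_eqI[OF R_module module_hom_comp[OF C_hom[OF i] lin_hom[OF \<phi>]] ev_hom[OF \<phi>] _ X])
        (simp_all add: i ev_pure[OF \<phi>] Dp.lift_pair[OF V.module_axioms b[OF i]] lin_smult[OF \<phi>] dual_in)
    then show "\<phi> (?C i X) = \<phi> (?C i Y)" using X Y eq[OF \<phi>] i by simp
  qed
  have "X = (\<Oplus>\<^bsub>D\<^esub>i\<in>{..<d}. pt (E i) (?C i X))" if X: "X \<in> carrier D" for X
  proof (rule Dp.pair_hom_eqI[OF D_module module_hom_ident _ _ X])
    show "(\<lambda>X. \<Oplus>\<^bsub>D\<^esub>i\<in>{..<d}. pt (E i) (?C i X)) \<in> module_hom K D D"
      by (rule module_hom_sum[OF D_module D_module]) (auto intro!: module_hom_comp[OF C_hom pt_hom(2)] E_in)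
    fix g y assume g: "g \<in> carrier A" and y: "y \<in> carrier H"
    have "pt g y = (\<Oplus>\<^bsub>D\<^esub>i\<in>{..<d}. g (e i) \<odot>\<^bsub>D\<^esub> pt (E i) y)"
      by (rule Af.hom_expand[OF D_module pt_hom(1)[OF y] g])
    also have "\<dots> = (\<Oplus>\<^bsub>D\<^esub>i\<in>{..<d}. pt (E i) (?C i (pt g y)))"
    proof (intro D.M.finsum_cong' refl)
      fix i assume "i \<in> {..<d}"
      then have i: "i < d" by simp
      show "g (e i) \<odot>\<^bsub>D\<^esub> pt (E i) y = pt (E i) (?C i (pt g y))"
        using module_hom_smult[OF pt_hom(2)[OF E_in[OF i]] dual_in[OF g e_carrier[OF i]] y]
        by (simp add: Dp.lift_pair[OF V.module_axioms b[OF i] g y])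
    qed (auto intro!: pt_in E_in module_hom_in[OF C_hom] g y)
    finally show "pt g y = (\<Oplus>\<^bsub>D\<^esub>i\<in>{..<d}. pt (E i) (?C i (pt g y)))" .
  qed
  note ex = this
  have "(\<Oplus>\<^bsub>D\<^esub>i\<in>{..<d}. pt (E i) (?C i X)) = (\<Oplus>\<^bsub>D\<^esub>i\<in>{..<d}. pt (E i) (?C i Y))"
    by (intro D.M.finsum_cong' refl) (auto simp: C intro!: pt_in E_in module_hom_in[OF C_hom] Y)
  then show ?thesis using ex[OF X] ex[OF Y] by simp
qed

lemma dual_one_in: "\<one>\<^bsub>A\<^esub> \<in> carrier A"
  unfolding dual_simps(3) using dual_restrict[OF counit_linear] by simp

lemma ev_one: "\<lbrakk>lin \<phi>; x \<in> carrier H; z \<in> carrier H\<rbrakk> \<Longrightarrow> ev \<one>\<^bsub>DD\<^esub> \<phi> x z = ep x * \<phi> z"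
  by (simp add: double_simps(3) ev_pure dual_one_in) (simp add: dual_simps(3))

lemma double_counit:
  "counit DD \<in> module_hom K D (scalars K)"
  "\<lbrakk>f \<in> carrier A; h \<in> carrier H\<rbrakk> \<Longrightarrow> counit DD (pt f h) = f \<one>\<^bsub>H\<^esub> \<otimes>\<^bsub>K\<^esub> counit H h"
proof -
  have b: "bim K A H (scalars K) (\<lambda>f h. f \<one>\<^bsub>H\<^esub> \<otimes>\<^bsub>K\<^esub> counit H h)"
  proof (rule bimI)
    show "(\<lambda>f. f \<one>\<^bsub>H\<^esub> \<otimes>\<^bsub>K\<^esub> counit H h) \<in> module_hom K A (scalars K)" if "h \<in> carrier H" for h
      by (rule iffD1[OF module_hom_cong[OF _ dual_module] module_hom_scale[OF scalars_module dual_ev[OF one_in] counit_in[OF that]]])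
        (simp add: V.R.m_comm dual_in counit_in that)
    show "(\<lambda>h. f \<one>\<^bsub>H\<^esub> \<otimes>\<^bsub>K\<^esub> counit H h) \<in> module_hom K H (scalars K)" if "f \<in> carrier A" for f
      using module_hom_scale[OF scalars_module counit_linear dual_in[OF that one_in]] by simp
  qed
  show "counit DD \<in> module_hom K D (scalars K)"
    unfolding double_simps(5) by (rule Dp.lift_pair_hom[OF scalars_module b])
  show "\<lbrakk>f \<in> carrier A; h \<in> carrier H\<rbrakk> \<Longrightarrow> counit DD (pt f h) = f \<one>\<^bsub>H\<^esub> \<otimes>\<^bsub>K\<^esub> counit H h"
    unfolding double_simps(5) by (rule Dp.lift_pair[OF scalars_module b])
qed

text \<open>Evaluated on pure tensors, the condition on the double says that the n-th power of
  \<open>double_op\<close> fixes \<open>ev_start\<close> at v = 1. This holds when [n] = u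
  \<epsilon> on H, and conversely it can be tested on the copy of H inside the double.\<close>

lemma double_exponent_iff:
  assumes "n \<ge> 1"
  shows "(\<forall>X\<in>carrier DD. sweedler_power K DD n X = counit DD X \<odot>\<^bsub>DD\<^esub> \<one>\<^bsub>DD\<^esub>) \<longleftrightarrow> exponent n"
proof -
  obtain m where m: "n = Suc m" using assms by (cases n) auto
  interpret D: module K D by (rule D_module)
  have sm: "smult DD = smult D" using same_space_double by (simp add: same_space_def)
  have one: "\<one>\<^bsub>DD\<^esub> \<in> carrier D" unfolding double_simps(3) by (rule pt_in[OF dual_one_in one_in])
  have p: "ev (sweedler_power K DD n (pt f h)) \<phi> x z = (double_op ^^ n) (ev_start f \<one>\<^bsub>DD\<^esub> \<phi>) \<one>\<^bsub>H\<^esub> h x z"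
    if "lin \<phi>" "f \<in> carrier A" "h \<in> carrier H" "x \<in> carrier H" "z \<in> carrier H" for \<phi> f h x z
    unfolding m DD.sweedler_power_act by (rule ev_act_pow[OF that(1-3) one that(4,5)])
  have c: "ev (counit DD (pt f h) \<odot>\<^bsub>DD\<^esub> \<one>\<^bsub>DD\<^esub>) \<phi> x z = ev_start f \<one>\<^bsub>DD\<^esub> \<phi> \<one>\<^bsub>H\<^esub> h x z"
    if \<phi>: "lin \<phi>" and f: "f \<in> carrier A" and h: "h \<in> carrier H" and xz: "x \<in> carrier H" "z \<in> carrier H" for \<phi> f h x z
    using module_hom_smult[OF ev_hom[OF \<phi> xz] _ one, of "counit DD (pt f h)"]
    by (simp add: sm double_counit f h dual_in counit_in ev_start_def emb_ops V.R.is_cring mult.assoc)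
  have hp: "sweedler_power K DD n \<in> module_hom K D D"
    using DD.sweedler_power_hom[OF _ assms] one by (simp add: double_simps(1) same_space_hom[OF same_space_double] same_space_hom(1)[OF same_space_double])
  have hc: "(\<lambda>X. counit DD X \<odot>\<^bsub>DD\<^esub> \<one>\<^bsub>DD\<^esub>) \<in> module_hom K D D"
  proof (rule module_hom_comp[OF double_counit(1)])
    show "(\<lambda>a. a \<odot>\<^bsub>DD\<^esub> \<one>\<^bsub>DD\<^esub>) \<in> module_hom K (scalars K) D"
      by (rule module_homI) (simp_all add: sm one D.smult_l_distr D.smult_assoc1)
  qed
  show ?thesis
  proof
    assume n: "exponent n"
    have "sweedler_power K DD n X = counit DD X \<odot>\<^bsub>DD\<^esub> \<one>\<^bsub>DD\<^esub>" if X: "X \<in> carrier D" for X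
    proof (rule Dp.pair_hom_eqI[OF D_module hp hc _ X])
      fix f h assume f: "f \<in> carrier A" and h: "h \<in> carrier H"
      show "sweedler_power K DD n (pt f h) = counit DD (pt f h) \<odot>\<^bsub>DD\<^esub> \<one>\<^bsub>DD\<^esub>"
      proof (rule double_separates)
        fix \<phi> x z assume \<phi>: "lin \<phi>" and xz: "x \<in> carrier H" "z \<in> carrier H"
        show "ev (sweedler_power K DD n (pt f h)) \<phi> x z = ev (counit DD (pt f h) \<odot>\<^bsub>DD\<^esub> \<one>\<^bsub>DD\<^esub>) \<phi> x z"
          using double_power_exponent[OF n quad_ev_start[OF \<phi> f one]] h xz
          by (simp add: p[OF \<phi> f h xz] c[OF \<phi> f h xz] eq4_def)
      qed (rule module_hom_in[OF hp] module_hom_in[OF hc]; rule pt_in[OF f h])+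
    qed
    then show "\<forall>X\<in>carrier DD. sweedler_power K DD n X = counit DD X \<odot>\<^bsub>DD\<^esub> \<one>\<^bsub>DD\<^esub>" by (simp add: double_simps(1))
  next
    assume n: "\<forall>X\<in>carrier DD. sweedler_power K DD n X = counit DD X \<odot>\<^bsub>DD\<^esub> \<one>\<^bsub>DD\<^esub>"
    show "exponent n"
      unfolding exponent_def
    proof (intro allI impI ballI)
      fix \<phi> h assume \<phi>: "lin \<phi>" and h [simp]: "h \<in> carrier H"
      \<comment> \<open>The elements 1 \<otimes> h, evaluated at x = z = 1, suffice: there
        \<open>double_power_counit\<close> turns the power of \<open>double_op\<close> into a
        Sweedler power of h.\<close>
      have "sweedler_power K DD n (pt \<one>\<^bsub>A\<^esub> h) = counit DD (pt \<one>\<^bsub>A\<^esub> h) \<odot>\<^bsub>DD\<^esub> \<one>\<^bsub>DD\<^esub>"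
        using n pt_in[OF dual_one_in h] by (simp add: double_simps(1))
      then have 1: "(double_op ^^ n) (ev_start \<one>\<^bsub>A\<^esub> \<one>\<^bsub>DD\<^esub> \<phi>) \<one>\<^bsub>H\<^esub> h \<one>\<^bsub>H\<^esub> \<one>\<^bsub>H\<^esub> = ev_start \<one>\<^bsub>A\<^esub> \<one>\<^bsub>DD\<^esub> \<phi> \<one>\<^bsub>H\<^esub> h \<one>\<^bsub>H\<^esub> \<one>\<^bsub>H\<^esub>"
        using p[OF \<phi> dual_one_in h one_in one_in] c[OF \<phi> dual_one_in h one_in one_in] by simp
      have e: "eq4 (ev_start \<one>\<^bsub>A\<^esub> \<one>\<^bsub>DD\<^esub> \<phi>) (\<lambda>v h x z. ep v * ep h * (ep x * \<phi> z))"
        by (simp add: eq4_def ev_start_def ev_one[OF \<phi>] dual_simps(3) mult.assoc)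
      have eps_one: "ep \<one>\<^bsub>H\<^esub> * (ep \<one>\<^bsub>H\<^esub> * spow n (\<lambda>t. \<phi> (\<one>\<^bsub>H\<^esub> \<otimes>\<^bsub>H\<^esub> t)) h) = spow n \<phi> h"
      proof -
        have l: "lin (spow n \<phi>)" by (auto intro!: lin_intros2 simp: \<phi>)
        have "spow n (\<lambda>t. \<phi> (\<one>\<^bsub>H\<^esub> \<otimes>\<^bsub>H\<^esub> t)) h = spow n \<phi> h" by (intro spow_cong) simp_all
        then show ?thesis by (simp add: counit_one[OF l])
      qed
      have "spow n \<phi> h = (double_op ^^ n) (\<lambda>v h x z. ep v * ep h * (ep x * \<phi> z)) \<one>\<^bsub>H\<^esub> h \<one>\<^bsub>H\<^esub> \<one>\<^bsub>H\<^esub>"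
        using double_power_counit[OF \<phi>, of n] eps_one by (simp add: eq4_def)
      also have "\<dots> = ep \<one>\<^bsub>H\<^esub> * ep h * (ep \<one>\<^bsub>H\<^esub> * \<phi> \<one>\<^bsub>H\<^esub>)"
        using eq4_double_power[OF e, of n] e 1 by (simp add: eq4_def)
      also have "\<dots> = ep h * (ep \<one>\<^bsub>H\<^esub> * (ep \<one>\<^bsub>H\<^esub> * \<phi> \<one>\<^bsub>H\<^esub>))" by (simp only: ac_simps)
      also have "\<dots> = ep h * \<phi> \<one>\<^bsub>H\<^esub>" by (simp add: counit_one[OF \<phi>])
      finally show "spow n \<phi> h = ep h * \<phi> \<one>\<^bsub>H\<^esub>" .
    qed
  qed
qed

lemma exp0_double: "exp0 K DD = exp0 K H"
proof -
  have "{n. n \<ge> 1 \<and> (\<forall>X\<in>carrier DD. sweedler_power K DD n X = counit DD X \<odot>\<^bsub>DD\<^esub> \<one>\<^bsub>DD\<^esub>)} =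
    {n. n \<ge> 1 \<and> (\<forall>h\<in>carrier H. sweedler_power K H n h = counit H h \<odot>\<^bsub>H\<^esub> \<one>\<^bsub>H\<^esub>)}"
    by (rule Collect_cong, rule conj_cong[OF refl], rule trans[OF double_exponent_iff exponent_iff[symmetric]])
  then show ?thesis unfolding exp0_def by (rule arg_cong)
qed

end

theorem proposition2p5:
  fixes K :: "('a, 'k) ring_scheme" and H :: "('a, 'h, 'm) hopf_scheme"
  assumes "hopf_algebra K H" and "vectorspace.fin_dim K H"
  shows "(\<forall>J. left_twist K H J \<longrightarrow> exp0 K (left_twisted K H J) = exp0 K H) \<and>
    (\<forall>J. right_twist K H J \<longrightarrow> exp0 K (right_twisted K H J) = exp0 K H) \<and>
    exp0 K (drinfeld_double K H) = exp0 K H"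
proof -
  interpret hopf_algebra K H by fact
  obtain d e k where "frame K H d e k" using frame_exists[OF vectorspace assms(2)] by auto
  moreover obtain S where "is_antipode K H S" using antipode_exists by auto
  moreover have "module K H" using vectorspace by (simp add: vectorspace_def)
  ultimately interpret fd_hopf K H d e k S
    by (intro fd_hopf.intro framed.intro framed_axioms.intro fd_hopf_axioms.intro hopf_algebra_axioms assms(2))
  show ?thesis using exp0_left_twist exp0_right_twist exp0_double by blast
qed

end
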